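(* Let $\mathfrak g=\mathfrak l\oplus\mathfrak m$ be a reductive decomposition of a Lie algebra $(\mathfrak g,[\,,\,])$ and let $\mathcal G=(\mathfrak g,[\,,\,],\varpi,\varphi)$ be a Lie quasi-bialgebra canonically compatible with this reductive decomposition, with canonical double $\mathfrak d=\mathfrak g\oplus\mathfrak g^*$. Let $U$ be the $\mathrm{Ad}^*_L$-invariant open subset of $\mathfrak l^*$ containing $0$ defined by $$U=\{p\in\mathfrak l^*:\ \mathrm{Sp}_{\mathfrak l\oplus\mathfrak l^*}(\mathrm{ad}^{\mathfrak l\oplus\mathfrak l^*}_p)\cap \mathrm i\pi(\mathbb Z\setminus\{0\})=\emptyset\ \text{ and }\ 0\notin\mathrm{Sp}_{\mathfrak g}(\mathrm p_{\mathfrak g}\,\mathrm{Ad}^{\mathfrak d}_{e^{-sp}}\,i_{\mathfrak g})\}.$$ For $p\in U$, $\alpha\in\mathfrak l^*$ and $\xi\in\mathfrak l^\perp\subset\mathfrak g^*$ set $$l^{\mathrm{can}}_p(s\alpha+\xi)=r^{AM}_p\alpha-(\mathrm p_{\mathfrak g}\mathrm{Ad}^{\mathfrak d}_{e^{-sp}}i_{\mathfrak g})^{-1}\,\mathrm p_{\mathfrak g}\mathrm{Ad}^{\mathfrak d}_{e^{-sp}}\xi ,$$ where $r^{AM}_p=F(\mathrm{ad}_p^{\mathfrak l\oplus\mathfrak l^*})|_{\mathfrak l^*}:\mathfrak l^*\to\mathfrak l$ with $F(z)=\coth z-\frac1z$. Then $l^{\mathrm{can}}$ is a dynamical $\ell$-matrix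 on $U$ associated with $\mathcal G$, it satisfies $l^{\mathrm{can}}_0=0$, and it is compatible with the reductive decomposition, i.e. $l^{\mathrm{can}}_p\mathfrak m^\perp\subset\mathfrak l$ and $l^{\mathrm{can}}_p\mathfrak l^\perp\subset\mathfrak m$ for all $p\in U$.
   Context: Conventions: vector spaces are finite-dimensional over $\mathbb K=\mathbb R$ or $\mathbb C$; $f^*$ is the transpose of a linear map $f$; $\mathcal A(\mathfrak g^*,\mathfrak g)$ is the set of linear maps $t:\mathfrak g^*\to\mathfrak g$ with $t^*=-t$; $\mathrm{ad}^*_x$ is the transpose of $\mathrm{ad}_x$ ($\langle\mathrm{ad}^*_x\xi,y\rangle=\langle\xi,[x,y]\rangle$), and $\mathrm{Ad}^*_g$ the transpose of $\mathrm{Ad}_g$; for a subspace $A$, $A^\perp$ is its annihilator; $\sum_{\mathrm{cyc}(\xi,\eta,\zeta)}$ is the sum over cyclic permutations; $\mathrm{Sp}_E(f)\subset\mathbb C$ is the spectrum of $f$ on $E$. Lie quasi-bialgebra: a quadruple $\mathcal G=(\mathfrak g,[\,,\,],\varpi,\varphi)$ with $(\mathfrak g,[\,,\,])$ a Lie algebra, $\varpi:\mathfrak g\to\mathcal A(\mathfrak g^*,\mathfrak g)$ a linear map with $\varpi_{[x,y]}=\mathrm{ad}_x\varpi_y+\varpi_y\mathrm{ad}^*_x-\mathrm{ad}_y\varpi_x-\varpi_x\mathrm{ad}^*_y$ (a $1$-cocycle), $\varphi\in\wedge^3\mathfrak g$, such that $\mathfrak d=\mathfrak g\oplus\mathfrak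 g^*$ with bracket $[x,y]_{\mathfrak d}=[x,y]$, $[x,\xi]_{\mathfrak d}=\varpi_x\xi-\mathrm{ad}^*_x\xi$, $[\xi,\eta]_{\mathfrak d}=\langle\eta,\varpi_\bullet\xi\rangle+\langle\xi\otimes\eta\otimes1,\varphi\rangle$ ($x,y\in\mathfrak g$, $\xi,\eta\in\mathfrak g^*$) is a Lie algebra, the canonical double. Here $\langle\eta,\varpi_\bullet\xi\rangle\in\mathfrak g^*$ is $x\mapsto\langle\eta,\varpi_x\xi\rangle$ and $\langle\xi\otimes\eta\otimes1,\varphi\rangle\in\mathfrak g$ is the contraction on the first two slots. $\mathrm p_{\mathfrak g}$ is the projection of $\mathfrak d$ onto $\mathfrak g$ along $\mathfrak g^*$, $i_{\mathfrak g}:\mathfrak g\to\mathfrak d$ the inclusion, and $\mathrm{Ad}^{\mathfrak d}_{e^{X}}=\exp(\mathrm{ad}^{\mathfrak d}_X)$. Reductive decomposition: $\mathfrak g=\mathfrak l\oplus\mathfrak m$ as vector spaces, $\mathfrak l$ a subalgebra, $[\mathfrak l,\mathfrak m]\subset\mathfrak m$. $\mathrm p_{\mathfrak l}:\mathfrak g\to\mathfrak l$ is the projection along $\mathfrak m$, $s=\mathrm p_{\mathfrak l}^*:\mathfrak l^*\to\mathfrak g^*$ (with image $\mathfrak m^\perp$), $i:\mathfrak l\to\mathfrak g$ is the inclusion; $L$ is the connected Lie subgroup with Lie algebra $\mathfrak l$ of a Lie group with Lie algebra $\mathfrak g$. $\mathcal G$ is canonically compatible with $\mathfrak g=\mathfrak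 l\oplus\mathfrak m$ if: $\varpi_z=0$ for all $z\in\mathfrak l$; $\langle\xi,\varpi_x\eta\rangle=0$ for all $x\in\mathfrak g$, $\xi,\eta\in\mathfrak m^\perp$; $\varphi\in\mathrm{Alt}(\mathfrak l\otimes\mathfrak l\otimes\mathfrak l\oplus\mathfrak l\otimes\mathfrak m\otimes\mathfrak m\oplus\mathfrak m\otimes\mathfrak m\otimes\mathfrak m)$; and $\varphi\equiv0\bmod\mathfrak l$ (i.e. $\varphi$ vanishes on $\mathfrak l^\perp\times\mathfrak l^\perp\times\mathfrak l^\perp$). Then $(\mathfrak l,[\,,\,]_{\mathfrak l},0,\mathrm p_{\mathfrak l}^{(3)}\varphi)$ (with $\mathrm p_{\mathfrak l}^{(3)}=\mathrm p_{\mathfrak l}^{\otimes3}$) is a Lie quasi-bialgebra; $\mathfrak l\oplus\mathfrak l^*$ denotes its canonical double and $\mathrm{ad}^{\mathfrak l\oplus\mathfrak l^*}$ its adjoint action. $F$ is odd, analytic near $0$, with poles exactly at $\mathrm i\pi(\mathbb Z\setminus\{0\})$; $F(\mathrm{ad}_p^{\mathfrak l\oplus\mathfrak l^*})$ is defined by holomorphic functional calculus and maps $\mathfrak l^*$ into $\mathfrak l$. Dynamical $\ell$-matrix on an $\mathrm{Ad}^*_L$-invariant open $U\subset\mathfrak l^*$ associated with $\mathcal G$: a smooth map $l:U\to\mathcal A(\mathfrak g^*,\mathfrak g)$ such that for all $p\in U$, $\xi,\eta,\zeta\in\mathfrak g^*$, $z\in\mathfrak l$: $$\sum_{\mathrm{cyc}(\xi,\eta,\zeta)}\big(\langle\zeta,d_pl(i^*\xi)\eta\rangle-\langle\zeta,[l_p\xi,l_p\eta]\rangle-\langle\zeta,\varpi_{l_p\xi}\eta\rangle\big)=\langle\xi\otimes\eta\otimes\zeta,\varphi\rangle,$$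 $$d_pl(\mathrm{ad}^*_zp)+\varpi_{iz}+\mathrm{ad}_{iz}l_p+l_p\mathrm{ad}^*_{iz}=0 .$$ *)

theory Defs
  imports
    "HOL-Complex_Analysis.Complex_Analysis"
    "HOL-Library.Function_Algebras"
    "Jordan_Normal_Form.Spectral_Radius"
    "Jordan_Normal_Form.Gauss_Jordan_Elimination"
begin

section \<open>The ground field\<close>

text \<open>
  The class of the fields \<open>\<real>\<close> and \<open>\<complex>\<close>: a real normed field with an isometric embedding of
  real algebras into \<open>\<complex>\<close>. The embedding is what gives a meaning to the complex spectrum of an
  operator over \<open>\<real>\<close>. The lemma \<open>range_to_complex\<close> shows that nothing else is covered.
\<close>

class rc_field = real_normed_field +
  fixes to_complex :: "'a \<Rightarrow> complex"
  assumes to_complex_add: "to_complex (x + y) = to_complex x + to_complex y"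
    and to_complex_mult: "to_complex (x * y) = to_complex x * to_complex y"
    and to_complex_scaleR: "to_complex (r *\<^sub>R x) = r *\<^sub>R to_complex x"
    and norm_to_complex: "norm (to_complex x) = norm x"

instantiation real :: rc_field
begin
definition to_complex_real :: "real \<Rightarrow> complex" where "to_complex_real = complex_of_real"
instance by standard (auto simp: to_complex_real_def scaleR_conv_of_real)
end

instantiation complex :: rc_field
begin
definition to_complex_complex :: "complex \<Rightarrow> complex" where "to_complex_complex = (\<lambda>z. z)"
instance by standard (auto simp: to_complex_complex_def)
end

lemma to_complex_1: "to_complex (1 :: 'k::rc_field) = 1"
proof -
  have "to_complex (1 :: 'k) * to_complex (1 :: 'k) = to_complex (1 :: 'k)"
    by (metis mult_1 to_complex_mult)
  moreover have "to_complex (1 :: 'k) \<noteq> 0"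
    by (metis norm_one norm_to_complex norm_zero zero_neq_one)
  ultimately show ?thesis by simp
qed

lemma to_complex_of_real: "to_complex (of_real r :: 'k::rc_field) = complex_of_real r"
  by (simp add: of_real_def to_complex_scaleR to_complex_1)

lemma range_to_complex:
  "range (to_complex :: 'k::rc_field \<Rightarrow> complex) = \<real> \<or>
   range (to_complex :: 'k::rc_field \<Rightarrow> complex) = UNIV"
proof (cases "range (to_complex :: 'k \<Rightarrow> complex) \<subseteq> \<real>")
  case True
  have "complex_of_real r \<in> range (to_complex :: 'k \<Rightarrow> complex)" for r
    by (metis rangeI to_complex_of_real)
  then have "\<real> \<subseteq> range (to_complex :: 'k \<Rightarrow> complex)"
    by (auto simp: Reals_def)
  with True show ?thesis by blast
next
  case False
  then obtain x :: 'k where x: "Im (to_complex x) \<noteq> 0"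
    unfolding complex_is_Real_iff image_subset_iff by blast
  have "z \<in> range (to_complex :: 'k \<Rightarrow> complex)" for z
  proof -
    define b where "b = Im z / Im (to_complex x)"
    define a where "a = Re z - b * Re (to_complex x)"
    have "to_complex (of_real a + of_real b * x :: 'k)
        = complex_of_real a + complex_of_real b * to_complex x"
      by (simp add: to_complex_add to_complex_mult to_complex_of_real)
    also have "\<dots> = z"
      using x by (simp add: complex_eq_iff a_def b_def)
    finally show ?thesis by (metis rangeI)
  qed
  then show ?thesis by blast
qed

section \<open>Linear algebra on subspaces\<close>

text \<open>
  Vector spaces are subspaces \<open>V\<close> of a type with a scalar multiplication \<open>s\<close>, as in the library
  locale \<open>vector_space\<close>. Linear forms on \<open>V\<close> are functions that vanish outside \<open>V\<close>,
  so that each form on \<open>V\<close> has exactly one representative.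
\<close>

definition fin_dim :: "('k::rc_field \<Rightarrow> 'v::ab_group_add \<Rightarrow> 'v) \<Rightarrow> bool" where
  "fin_dim s \<longleftrightarrow> Vector_Spaces.vector_space s \<and> (\<exists>B. finite B \<and> Modules.module.span s B = UNIV)"

definition lin_on :: "('k \<Rightarrow> 'v::ab_group_add \<Rightarrow> 'v) \<Rightarrow> ('k \<Rightarrow> 'w::ab_group_add \<Rightarrow> 'w)
    \<Rightarrow> 'v set \<Rightarrow> ('v \<Rightarrow> 'w) \<Rightarrow> bool" where
  "lin_on s t V f \<longleftrightarrow>
     (\<forall>x\<in>V. \<forall>y\<in>V. f (x + y) = f x + f y) \<and> (\<forall>c. \<forall>x\<in>V. f (s c x) = t c (f x))"

definition restr :: "'v set \<Rightarrow> ('v \<Rightarrow> 'k::zero) \<Rightarrow> 'v \<Rightarrow> 'k" where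
  "restr V f = (\<lambda>x. if x \<in> V then f x else 0)"

definition dual :: "('k::rc_field \<Rightarrow> 'v::ab_group_add \<Rightarrow> 'v) \<Rightarrow> 'v set \<Rightarrow> ('v \<Rightarrow> 'k) set" where
  "dual s V = {\<xi>. lin_on s (*) V \<xi> \<and> (\<forall>x. x \<notin> V \<longrightarrow> \<xi> x = 0)}"

definition fscale :: "'k::rc_field \<Rightarrow> ('v \<Rightarrow> 'k) \<Rightarrow> 'v \<Rightarrow> 'k" where
  "fscale c \<xi> = (\<lambda>x. c * \<xi> x)"

definition dscale :: "('k::rc_field \<Rightarrow> 'v \<Rightarrow> 'v) \<Rightarrow> 'k \<Rightarrow> 'v \<times> ('v \<Rightarrow> 'k) \<Rightarrow> 'v \<times> ('v \<Rightarrow> 'k)" where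
  "dscale s c u = (s c (fst u), fscale c (snd u))"

definition annih :: "('k::rc_field \<Rightarrow> 'v::ab_group_add \<Rightarrow> 'v) \<Rightarrow> 'v set \<Rightarrow> ('v \<Rightarrow> 'k) set" where
  "annih s A = {\<xi> \<in> dual s UNIV. \<forall>x\<in>A. \<xi> x = 0}"

definition skew_maps :: "('k::rc_field \<Rightarrow> 'v::ab_group_add \<Rightarrow> 'v) \<Rightarrow> 'v set
    \<Rightarrow> (('v \<Rightarrow> 'k) \<Rightarrow> 'v) set" where
  "skew_maps s V = {t. lin_on fscale s (dual s V) t \<and> t ` dual s V \<subseteq> V \<and>
     (\<forall>\<xi>\<in>dual s V. \<forall>\<eta>\<in>dual s V. \<eta> (t \<xi>) = - \<xi> (t \<eta>))}"

text \<open>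
  Elements of \<open>V \<otimes> V \<otimes> V\<close> are given by their values
  \<open>\<phi> \<xi> \<eta> \<zeta> = \<langle>\<xi> \<otimes> \<eta> \<otimes> \<zeta>, \<phi>\<rangle>\<close> on triples of linear forms on \<open>V\<close>; the values on other arguments
  are irrelevant. \<open>alt3 a b c\<close> is the antisymmetrization of \<open>a \<otimes> b \<otimes> c\<close>, and
  \<open>Alt_space s V T\<close> is the span of these for \<open>(a, b, c) \<in> T\<close> (scalars can be absorbed into \<open>a\<close>
  for the sets \<open>T\<close> used below).
\<close>

definition alt3 :: "'v \<Rightarrow> 'v \<Rightarrow> 'v \<Rightarrow> ('v \<Rightarrow> 'k::rc_field) \<Rightarrow> ('v \<Rightarrow> 'k) \<Rightarrow> ('v \<Rightarrow> 'k) \<Rightarrow> 'k" where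
  "alt3 a b c \<xi> \<eta> \<zeta> =
     \<xi> a * \<eta> b * \<zeta> c + \<xi> b * \<eta> c * \<zeta> a + \<xi> c * \<eta> a * \<zeta> b
     - \<xi> b * \<eta> a * \<zeta> c - \<xi> a * \<eta> c * \<zeta> b - \<xi> c * \<eta> b * \<zeta> a"

definition Alt_space :: "('k::rc_field \<Rightarrow> 'v::ab_group_add \<Rightarrow> 'v) \<Rightarrow> 'v set \<Rightarrow> ('v \<times> 'v \<times> 'v) set
    \<Rightarrow> (('v \<Rightarrow> 'k) \<Rightarrow> ('v \<Rightarrow> 'k) \<Rightarrow> ('v \<Rightarrow> 'k) \<Rightarrow> 'k) set" where
  "Alt_space s V T = {\<phi>. \<exists>(N::nat) a b c. (\<forall>j<N. (a j, b j, c j) \<in> T) \<and>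
     (\<forall>\<xi>\<in>dual s V. \<forall>\<eta>\<in>dual s V. \<forall>\<zeta>\<in>dual s V.
        \<phi> \<xi> \<eta> \<zeta> = (\<Sum>j<N. alt3 (a j) (b j) (c j) \<xi> \<eta> \<zeta>))}"

definition wedge3 :: "('k::rc_field \<Rightarrow> 'v::ab_group_add \<Rightarrow> 'v) \<Rightarrow> 'v set
    \<Rightarrow> (('v \<Rightarrow> 'k) \<Rightarrow> ('v \<Rightarrow> 'k) \<Rightarrow> ('v \<Rightarrow> 'k) \<Rightarrow> 'k) set" where
  "wedge3 s V = Alt_space s V (V \<times> V \<times> V)"

text \<open>The vector \<open>\<langle>\<xi> \<otimes> \<eta> \<otimes> 1, \<phi>\<rangle>\<close> of \<open>V\<close>.\<close>

definition contr :: "('k::rc_field \<Rightarrow> 'v::ab_group_add \<Rightarrow> 'v) \<Rightarrow> 'v set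
    \<Rightarrow> (('v \<Rightarrow> 'k) \<Rightarrow> ('v \<Rightarrow> 'k) \<Rightarrow> ('v \<Rightarrow> 'k) \<Rightarrow> 'k) \<Rightarrow> ('v \<Rightarrow> 'k) \<Rightarrow> ('v \<Rightarrow> 'k) \<Rightarrow> 'v" where
  "contr s V \<phi> \<xi> \<eta> = (THE v. v \<in> V \<and> (\<forall>\<zeta>\<in>dual s V. \<zeta> v = \<phi> \<xi> \<eta> \<zeta>))"

section \<open>Operators on finite-dimensional spaces\<close>

text \<open>
  In finite dimension, convergence can be tested on linear forms.
\<close>

definition exp_op :: "('k::rc_field \<Rightarrow> 'v::ab_group_add \<Rightarrow> 'v) \<Rightarrow> 'v set \<Rightarrow> ('v \<Rightarrow> 'v) \<Rightarrow> 'v \<Rightarrow> 'v" where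
  "exp_op s V A v =
     (THE w. w \<in> V \<and> (\<forall>\<xi>\<in>dual s V. (\<lambda>n. \<xi> ((A ^^ n) v) / fact n) sums \<xi> w))"

definition basis_of :: "('k::rc_field \<Rightarrow> 'v::ab_group_add \<Rightarrow> 'v) \<Rightarrow> 'v set \<Rightarrow> 'v list" where
  "basis_of s V = (SOME bs. distinct bs \<and> \<not> Modules.module.dependent s (set bs) \<and>
     Modules.module.span s (set bs) = V)"

definition coord :: "('k::rc_field \<Rightarrow> 'v::ab_group_add \<Rightarrow> 'v) \<Rightarrow> 'v list \<Rightarrow> 'v \<Rightarrow> nat \<Rightarrow> 'k" where
  "coord s bs v i = Modules.module.representation s (set bs) v (bs ! i)"

text \<open>The matrix of \<open>A\<close>, with entries regarded as complex numbers.\<close>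

definition cmatrix :: "('k::rc_field \<Rightarrow> 'v::ab_group_add \<Rightarrow> 'v) \<Rightarrow> 'v list \<Rightarrow> ('v \<Rightarrow> 'v)
    \<Rightarrow> complex mat" where
  "cmatrix s bs A =
     Matrix.mat (length bs) (length bs) (\<lambda>(i, j). to_complex (coord s bs (A (bs ! j)) i))"

definition Sp :: "('k::rc_field \<Rightarrow> 'v::ab_group_add \<Rightarrow> 'v) \<Rightarrow> 'v set \<Rightarrow> ('v \<Rightarrow> 'v) \<Rightarrow> complex set" where
  "Sp s V A = spectrum (cmatrix s (basis_of s V) A)"

definition resolvent :: "complex mat \<Rightarrow> complex \<Rightarrow> complex mat" where
  "resolvent M z = the (mat_inverse (z \<cdot>\<^sub>m 1\<^sub>m (dim_row M) - M))"

text \<open>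
  Holomorphic functional calculus: \<open>f(M)\<close> is \<open>1/(2\<pi>i)\<close> times the integral of
  \<open>f(z) (z - M)\<^sup>-\<^sup>1\<close> along small circles around the eigenvalues of \<open>M\<close>; the library notion
  \<open>residue\<close> is by definition \<open>1/(2\<pi>i)\<close> times the integral along a small circle.
\<close>

definition hol_calc_mat :: "(complex \<Rightarrow> complex) \<Rightarrow> complex mat \<Rightarrow> complex mat" where
  "hol_calc_mat f M = Matrix.mat (dim_row M) (dim_row M) (\<lambda>(i, j).
     \<Sum>e\<in>spectrum M. residue (\<lambda>z. f z * (resolvent M z $$ (i, j))) e)"

text \<open>
  The operator \<open>f(A)\<close> on \<open>V\<close>. Over \<open>\<real>\<close> this is meant for \<open>f\<close> with
  \<open>f (cnj z) = cnj (f z)\<close>, in which case the matrix \<open>f(M)\<close> is real.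
\<close>

definition hol_calc :: "('k::rc_field \<Rightarrow> 'v::ab_group_add \<Rightarrow> 'v) \<Rightarrow> 'v set
    \<Rightarrow> (complex \<Rightarrow> complex) \<Rightarrow> ('v \<Rightarrow> 'v) \<Rightarrow> 'v \<Rightarrow> 'v" where
  "hol_calc s V f A v =
     (let bs = basis_of s V; N = hol_calc_mat f (cmatrix s bs A) in
      \<Sum>i<length bs.
        s (inv_into UNIV to_complex (\<Sum>j<length bs. (N $$ (i, j)) * to_complex (coord s bs v j))) (bs ! i))"

section \<open>Lie quasi-bialgebras\<close>

definition lie_algebra_on :: "('k::rc_field \<Rightarrow> 'v::ab_group_add \<Rightarrow> 'v) \<Rightarrow> 'v set
    \<Rightarrow> ('v \<Rightarrow> 'v \<Rightarrow> 'v) \<Rightarrow> bool" where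
  "lie_algebra_on s V br \<longleftrightarrow>
     Modules.module.subspace s V \<and>
     (\<forall>x\<in>V. \<forall>y\<in>V. br x y \<in> V) \<and>
     (\<forall>x\<in>V. lin_on s s V (br x)) \<and> (\<forall>y\<in>V. lin_on s s V (\<lambda>x. br x y)) \<and>
     (\<forall>x\<in>V. br x x = 0) \<and>
     (\<forall>x\<in>V. \<forall>y\<in>V. \<forall>z\<in>V. br x (br y z) + br y (br z x) + br z (br x y) = 0)"

text \<open>\<open>ad\<^sup>*\<^sub>x\<close> is the plain transpose of \<open>ad\<^sub>x\<close>, without sign.\<close>

definition ad_star :: "'v set \<Rightarrow> ('v \<Rightarrow> 'v \<Rightarrow> 'v) \<Rightarrow> 'v \<Rightarrow> ('v \<Rightarrow> 'k::rc_field) \<Rightarrow> 'v \<Rightarrow> 'k" where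
  "ad_star V br x \<xi> = restr V (\<lambda>y. \<xi> (br x y))"

text \<open>The bracket of the canonical double, on \<open>V \<times> dual s V\<close>.\<close>

definition double_bracket :: "('k::rc_field \<Rightarrow> 'v::ab_group_add \<Rightarrow> 'v) \<Rightarrow> 'v set
    \<Rightarrow> ('v \<Rightarrow> 'v \<Rightarrow> 'v) \<Rightarrow> ('v \<Rightarrow> ('v \<Rightarrow> 'k) \<Rightarrow> 'v)
    \<Rightarrow> (('v \<Rightarrow> 'k) \<Rightarrow> ('v \<Rightarrow> 'k) \<Rightarrow> ('v \<Rightarrow> 'k) \<Rightarrow> 'k)
    \<Rightarrow> 'v \<times> ('v \<Rightarrow> 'k) \<Rightarrow> 'v \<times> ('v \<Rightarrow> 'k) \<Rightarrow> 'v \<times> ('v \<Rightarrow> 'k)" where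
  "double_bracket s V br \<omega> \<phi> u v =
     (let x = fst u; \<xi> = snd u; y = fst v; \<eta> = snd v in
      (br x y + \<omega> x \<eta> - \<omega> y \<xi> + contr s V \<phi> \<xi> \<eta>,
       - ad_star V br x \<eta> + ad_star V br y \<xi> + restr V (\<lambda>z. \<eta> (\<omega> z \<xi>))))"

definition lie_quasi_bialgebra :: "('k::rc_field \<Rightarrow> 'v::ab_group_add \<Rightarrow> 'v) \<Rightarrow> 'v set
    \<Rightarrow> ('v \<Rightarrow> 'v \<Rightarrow> 'v) \<Rightarrow> ('v \<Rightarrow> ('v \<Rightarrow> 'k) \<Rightarrow> 'v)
    \<Rightarrow> (('v \<Rightarrow> 'k) \<Rightarrow> ('v \<Rightarrow> 'k) \<Rightarrow> ('v \<Rightarrow> 'k) \<Rightarrow> 'k) \<Rightarrow> bool" where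
  "lie_quasi_bialgebra s V br \<omega> \<phi> \<longleftrightarrow>
     lie_algebra_on s V br \<and>
     (\<forall>x\<in>V. \<omega> x \<in> skew_maps s V) \<and>
     (\<forall>\<xi>\<in>dual s V. lin_on s s V (\<lambda>x. \<omega> x \<xi>)) \<and>
     (\<forall>x\<in>V. \<forall>y\<in>V. \<forall>\<xi>\<in>dual s V.
        \<omega> (br x y) \<xi> = br x (\<omega> y \<xi>) + \<omega> y (ad_star V br x \<xi>)
                     - br y (\<omega> x \<xi>) - \<omega> x (ad_star V br y \<xi>)) \<and>
     \<phi> \<in> wedge3 s V \<and>
     lie_algebra_on (dscale s) (V \<times> dual s V) (double_bracket s V br \<omega> \<phi>)"

section \<open>Reductive decompositions and compatibility\<close>

definition reductive_decomposition :: "('k::rc_field \<Rightarrow> 'g::ab_group_add \<Rightarrow> 'g)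
    \<Rightarrow> ('g \<Rightarrow> 'g \<Rightarrow> 'g) \<Rightarrow> 'g set \<Rightarrow> 'g set \<Rightarrow> bool" where
  "reductive_decomposition s br l m \<longleftrightarrow>
     Modules.module.subspace s l \<and> Modules.module.subspace s m \<and>
     l \<inter> m = {0} \<and> {x + y | x y. x \<in> l \<and> y \<in> m} = UNIV \<and>
     (\<forall>x\<in>l. \<forall>y\<in>l. br x y \<in> l) \<and> (\<forall>x\<in>l. \<forall>y\<in>m. br x y \<in> m)"

definition proj_l :: "'g::ab_group_add set \<Rightarrow> 'g set \<Rightarrow> 'g \<Rightarrow> 'g" where
  "proj_l l m x = (THE z. z \<in> l \<and> x - z \<in> m)"

text \<open>The transpose \<open>s\<close> of \<open>p\<^sub>l\<close>, from \<open>l\<^sup>*\<close> to \<open>g\<^sup>*\<close>. The transpose of the inclusion is \<open>restr l\<close>.\<close>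

definition s_map :: "'g::ab_group_add set \<Rightarrow> 'g set \<Rightarrow> ('g \<Rightarrow> 'k::rc_field) \<Rightarrow> 'g \<Rightarrow> 'k" where
  "s_map l m \<alpha> = (\<lambda>x. \<alpha> (proj_l l m x))"

definition canonically_compatible :: "('k::rc_field \<Rightarrow> 'g::ab_group_add \<Rightarrow> 'g)
    \<Rightarrow> ('g \<Rightarrow> ('g \<Rightarrow> 'k) \<Rightarrow> 'g) \<Rightarrow> (('g \<Rightarrow> 'k) \<Rightarrow> ('g \<Rightarrow> 'k) \<Rightarrow> ('g \<Rightarrow> 'k) \<Rightarrow> 'k)
    \<Rightarrow> 'g set \<Rightarrow> 'g set \<Rightarrow> bool" where
  "canonically_compatible s \<omega> \<phi> l m \<longleftrightarrow>
     (\<forall>z\<in>l. \<forall>\<xi>\<in>dual s UNIV. \<omega> z \<xi> = 0) \<and>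
     (\<forall>x. \<forall>\<xi>\<in>annih s m. \<forall>\<eta>\<in>annih s m. \<xi> (\<omega> x \<eta>) = 0) \<and>
     \<phi> \<in> Alt_space s UNIV (l \<times> l \<times> l \<union> l \<times> m \<times> m \<union> m \<times> m \<times> m) \<and>
     (\<forall>\<xi>\<in>annih s l. \<forall>\<eta>\<in>annih s l. \<forall>\<zeta>\<in>annih s l. \<phi> \<xi> \<eta> \<zeta> = 0)"

text \<open>The bracket of the canonical double of \<open>(l, [,], 0, p\<^sub>l \<otimes> p\<^sub>l \<otimes> p\<^sub>l \<phi>)\<close>.\<close>

definition l_double_bracket :: "('k::rc_field \<Rightarrow> 'g::ab_group_add \<Rightarrow> 'g) \<Rightarrow> ('g \<Rightarrow> 'g \<Rightarrow> 'g)
    \<Rightarrow> (('g \<Rightarrow> 'k) \<Rightarrow> ('g \<Rightarrow> 'k) \<Rightarrow> ('g \<Rightarrow> 'k) \<Rightarrow> 'k) \<Rightarrow> 'g set \<Rightarrow> 'g set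
    \<Rightarrow> 'g \<times> ('g \<Rightarrow> 'k) \<Rightarrow> 'g \<times> ('g \<Rightarrow> 'k) \<Rightarrow> 'g \<times> ('g \<Rightarrow> 'k)" where
  "l_double_bracket s br \<phi> l m =
     double_bracket s l br (\<lambda>_ _. 0)
       (\<lambda>\<alpha> \<beta> \<gamma>. \<phi> (s_map l m \<alpha>) (s_map l m \<beta>) (s_map l m \<gamma>))"

section \<open>Dynamical l-matrices\<close>

text \<open>
  The group \<open>Ad\<^sub>L\<close> of operators on \<open>g\<close>: the connected group \<open>L\<close> is generated by the exponentials
  of the elements of \<open>l\<close>, and \<open>Ad\<close> of \<open>e\<^sup>z\<close> is the exponential of \<open>ad\<^sub>z\<close>.
\<close>

inductive_set Ad_L :: "('k::rc_field \<Rightarrow> 'g::ab_group_add \<Rightarrow> 'g) \<Rightarrow> ('g \<Rightarrow> 'g \<Rightarrow> 'g) \<Rightarrow> 'g set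
    \<Rightarrow> ('g \<Rightarrow> 'g) set"
  for s :: "'k::rc_field \<Rightarrow> 'g::ab_group_add \<Rightarrow> 'g" and br :: "'g \<Rightarrow> 'g \<Rightarrow> 'g" and l :: "'g set" where
  Ad_L_id: "id \<in> Ad_L s br l"
| Ad_L_step: "g \<in> Ad_L s br l \<Longrightarrow> z \<in> l \<Longrightarrow> exp_op s UNIV (br z) \<circ> g \<in> Ad_L s br l"

text \<open>
  \<open>Ck_on k W U f\<close>: all iterated derivatives of \<open>f\<close> in directions of the space of forms \<open>W\<close>,
  up to order \<open>k\<close>, exist and are continuous on \<open>U \<subseteq> W\<close>. Derivatives are taken over the ground
  field, so over \<open>\<complex>\<close> smooth functions are holomorphic. The topology on \<open>W\<close> is the one
  induced by pointwise convergence, which is the usual one in finite dimension.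
\<close>

primrec Ck_on :: "nat \<Rightarrow> ('v \<Rightarrow> 'k::rc_field) set \<Rightarrow> ('v \<Rightarrow> 'k) set \<Rightarrow> (('v \<Rightarrow> 'k) \<Rightarrow> 'k) \<Rightarrow> bool" where
  "Ck_on 0 W U f \<longleftrightarrow> continuous_on U f"
| "Ck_on (Suc k) W U f \<longleftrightarrow> continuous_on U f \<and>
     (\<forall>\<alpha>\<in>W. \<exists>f'. (\<forall>p\<in>U. ((\<lambda>t. f (p + fscale t \<alpha>)) has_field_derivative f' p) (at 0)) \<and>
                  Ck_on k W U f')"

text \<open>A map into operators from \<open>g\<^sup>*\<close> to \<open>g\<close> is smooth if its matrix coefficients are.\<close>

definition smooth_op :: "('k::rc_field \<Rightarrow> 'g::ab_group_add \<Rightarrow> 'g) \<Rightarrow> 'g set \<Rightarrow> ('g \<Rightarrow> 'k) set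
    \<Rightarrow> (('g \<Rightarrow> 'k) \<Rightarrow> ('g \<Rightarrow> 'k) \<Rightarrow> 'g) \<Rightarrow> bool" where
  "smooth_op s l U r \<longleftrightarrow>
     (\<forall>\<xi>\<in>dual s UNIV. \<forall>\<zeta>\<in>dual s UNIV. \<forall>k. Ck_on k (dual s l) U (\<lambda>p. \<zeta> (r p \<xi>)))"

text \<open>\<open>d\<^sub>p r (\<alpha>) \<eta>\<close>\<close>

definition d_op :: "('k::rc_field \<Rightarrow> 'g::ab_group_add \<Rightarrow> 'g)
    \<Rightarrow> (('g \<Rightarrow> 'k) \<Rightarrow> ('g \<Rightarrow> 'k) \<Rightarrow> 'g) \<Rightarrow> ('g \<Rightarrow> 'k) \<Rightarrow> ('g \<Rightarrow> 'k) \<Rightarrow> ('g \<Rightarrow> 'k) \<Rightarrow> 'g" where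
  "d_op s r p \<alpha> \<eta> = (THE v. \<forall>\<zeta>\<in>dual s UNIV.
     ((\<lambda>t. \<zeta> (r (p + fscale t \<alpha>) \<eta>)) has_field_derivative \<zeta> v) (at 0))"

definition Ad_star_invariant :: "('k::rc_field \<Rightarrow> 'g::ab_group_add \<Rightarrow> 'g) \<Rightarrow> ('g \<Rightarrow> 'g \<Rightarrow> 'g)
    \<Rightarrow> 'g set \<Rightarrow> ('g \<Rightarrow> 'k) set \<Rightarrow> bool" where
  "Ad_star_invariant s br l U \<longleftrightarrow> (\<forall>g\<in>Ad_L s br l. \<forall>p\<in>U. restr l (\<lambda>y. p (g y)) \<in> U)"

definition dynamical_l_matrix :: "('k::rc_field \<Rightarrow> 'g::ab_group_add \<Rightarrow> 'g) \<Rightarrow> ('g \<Rightarrow> 'g \<Rightarrow> 'g)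
    \<Rightarrow> ('g \<Rightarrow> ('g \<Rightarrow> 'k) \<Rightarrow> 'g) \<Rightarrow> (('g \<Rightarrow> 'k) \<Rightarrow> ('g \<Rightarrow> 'k) \<Rightarrow> ('g \<Rightarrow> 'k) \<Rightarrow> 'k)
    \<Rightarrow> 'g set \<Rightarrow> ('g \<Rightarrow> 'k) set \<Rightarrow> (('g \<Rightarrow> 'k) \<Rightarrow> ('g \<Rightarrow> 'k) \<Rightarrow> 'g) \<Rightarrow> bool" where
  "dynamical_l_matrix s br \<omega> \<phi> l U r \<longleftrightarrow>
     openin (top_of_set (dual s l)) U \<and> Ad_star_invariant s br l U \<and>
     (\<forall>p\<in>U. r p \<in> skew_maps s UNIV) \<and> smooth_op s l U r \<and>
     (\<forall>p\<in>U. \<forall>\<xi>\<in>dual s UNIV. \<forall>\<eta>\<in>dual s UNIV. \<forall>\<zeta>\<in>dual s UNIV.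
        (let E = (\<lambda>\<xi> \<eta> \<zeta>. \<zeta> (d_op s r p (restr l \<xi>) \<eta>) - \<zeta> (br (r p \<xi>) (r p \<eta>))
                         - \<zeta> (\<omega> (r p \<xi>) \<eta>))
         in E \<xi> \<eta> \<zeta> + E \<eta> \<zeta> \<xi> + E \<zeta> \<xi> \<eta> = \<phi> \<xi> \<eta> \<zeta>)) \<and>
     (\<forall>p\<in>U. \<forall>z\<in>l. \<forall>\<xi>\<in>dual s UNIV.
        d_op s r p (ad_star l br z p) \<xi> + \<omega> z \<xi> + br z (r p \<xi>)
          + r p (ad_star UNIV br z \<xi>) = 0)"

section \<open>The canonical l-matrix\<close>

text \<open>\<open>coth z - 1/z\<close>, with the removable singularity at \<open>0\<close> filled in.\<close>

definition F_AM :: "complex \<Rightarrow> complex" where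
  "F_AM z = (if z = 0 then 0 else cosh z / sinh z - 1 / z)"

text \<open>
  \<open>F(ad\<^sub>p)\<close> maps \<open>l\<^sup>*\<close> into \<open>l\<close>, because \<open>F\<close> is odd and \<open>ad\<^sub>p\<close> interchanges \<open>l\<close> and \<open>l\<^sup>*\<close>;
  \<open>fst\<close> only identifies \<open>l \<times> 0\<close> with \<open>l\<close>.
\<close>

definition r_AM :: "('k::rc_field \<Rightarrow> 'g::ab_group_add \<Rightarrow> 'g) \<Rightarrow> ('g \<Rightarrow> 'g \<Rightarrow> 'g)
    \<Rightarrow> (('g \<Rightarrow> 'k) \<Rightarrow> ('g \<Rightarrow> 'k) \<Rightarrow> ('g \<Rightarrow> 'k) \<Rightarrow> 'k) \<Rightarrow> 'g set \<Rightarrow> 'g set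
    \<Rightarrow> ('g \<Rightarrow> 'k) \<Rightarrow> ('g \<Rightarrow> 'k) \<Rightarrow> 'g" where
  "r_AM s br \<phi> l m p \<alpha> =
     fst (hol_calc (dscale s) (l \<times> dual s l) F_AM (l_double_bracket s br \<phi> l m (0, p)) (0, \<alpha>))"

text \<open>The operator \<open>p\<^sub>g Ad\<close> of \<open>e\<^sup>-\<^sup>s\<^sup>p\<close>, from the canonical double \<open>d\<close> to \<open>g\<close>.\<close>

definition pAd :: "('k::rc_field \<Rightarrow> 'g::ab_group_add \<Rightarrow> 'g) \<Rightarrow> ('g \<Rightarrow> 'g \<Rightarrow> 'g)
    \<Rightarrow> ('g \<Rightarrow> ('g \<Rightarrow> 'k) \<Rightarrow> 'g) \<Rightarrow> (('g \<Rightarrow> 'k) \<Rightarrow> ('g \<Rightarrow> 'k) \<Rightarrow> ('g \<Rightarrow> 'k) \<Rightarrow> 'k)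
    \<Rightarrow> 'g set \<Rightarrow> 'g set \<Rightarrow> ('g \<Rightarrow> 'k) \<Rightarrow> 'g \<times> ('g \<Rightarrow> 'k) \<Rightarrow> 'g" where
  "pAd s br \<omega> \<phi> l m p u =
     fst (exp_op (dscale s) (UNIV \<times> dual s UNIV)
            (double_bracket s UNIV br \<omega> \<phi> (0, - s_map l m p)) u)"

definition U_can :: "('k::rc_field \<Rightarrow> 'g::ab_group_add \<Rightarrow> 'g) \<Rightarrow> ('g \<Rightarrow> 'g \<Rightarrow> 'g)
    \<Rightarrow> ('g \<Rightarrow> ('g \<Rightarrow> 'k) \<Rightarrow> 'g) \<Rightarrow> (('g \<Rightarrow> 'k) \<Rightarrow> ('g \<Rightarrow> 'k) \<Rightarrow> ('g \<Rightarrow> 'k) \<Rightarrow> 'k)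
    \<Rightarrow> 'g set \<Rightarrow> 'g set \<Rightarrow> ('g \<Rightarrow> 'k) set" where
  "U_can s br \<omega> \<phi> l m = {p \<in> dual s l.
     Sp (dscale s) (l \<times> dual s l) (l_double_bracket s br \<phi> l m (0, p))
       \<inter> {\<i> * complex_of_real pi * of_int k | k::int. k \<noteq> 0} = {} \<and>
     0 \<notin> Sp s UNIV (\<lambda>x. pAd s br \<omega> \<phi> l m p (x, 0))}"

text \<open>
  An element \<open>\<eta>\<close> of \<open>g\<^sup>*\<close> is uniquely \<open>s \<alpha> + \<xi>\<close> with \<open>\<alpha>\<close> a form on \<open>l\<close> and \<open>\<xi>\<close> in the
  annihilator of \<open>l\<close>, namely with \<open>\<alpha>\<close> the restriction of \<open>\<eta>\<close> to \<open>l\<close>.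
\<close>

definition l_can :: "('k::rc_field \<Rightarrow> 'g::ab_group_add \<Rightarrow> 'g) \<Rightarrow> ('g \<Rightarrow> 'g \<Rightarrow> 'g)
    \<Rightarrow> ('g \<Rightarrow> ('g \<Rightarrow> 'k) \<Rightarrow> 'g) \<Rightarrow> (('g \<Rightarrow> 'k) \<Rightarrow> ('g \<Rightarrow> 'k) \<Rightarrow> ('g \<Rightarrow> 'k) \<Rightarrow> 'k)
    \<Rightarrow> 'g set \<Rightarrow> 'g set \<Rightarrow> ('g \<Rightarrow> 'k) \<Rightarrow> ('g \<Rightarrow> 'k) \<Rightarrow> 'g" where
  "l_can s br \<omega> \<phi> l m p \<eta> =
     (let \<alpha> = restr l \<eta>; \<xi> = \<eta> - s_map l m \<alpha> in
      r_AM s br \<phi> l m p \<alpha>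
        - inv_into UNIV (\<lambda>x. pAd s br \<omega> \<phi> l m p (x, 0)) (pAd s br \<omega> \<phi> l m p (0, \<xi>)))"

end

theory Submission
  imports Defs
begin

text \<open>
  The double \<open>d = g \<oplus> g\<^sup>*\<close> carries an invariant pairing \<open>\<kappa>\<close>, and it is the sum of \<open>L = l\<close>, \<open>M = m\<close>,
  \<open>P = m\<^sup>\<bottom>\<close> and \<open>Q = l\<^sup>\<bottom>\<close>. For \<open>p \<in> P\<close> let \<open>a = ad p\<close> and \<open>D \<beta> = (e\<^sup>a - 1)/a \<beta>\<close>, the logarithmic
  derivative of the exponential map, so that \<open>d\<^sub>\<alpha>D \<beta> - d\<^sub>\<beta>D \<alpha> = [D \<alpha>, D \<beta>]\<close>. Let \<open>r\<close> and \<open>\<tau>\<close> be the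
  parts of the l-matrix on \<open>P\<close> and on \<open>Q\<close>. For \<open>\<beta> \<in> P\<close> the vector \<open>\<beta> + r \<beta>\<close> differs from \<open>D \<beta>\<close> by an
  element of \<open>e\<^sup>a L\<close>, and for \<open>\<eta> \<in> Q\<close> the vector \<open>\<eta> + \<tau> \<eta>\<close> lies in \<open>e\<^sup>a Q\<close>. Differentiating these two
  relations and pairing with \<open>\<kappa>\<close>, the dynamical equation becomes the following: for three arguments
  in \<open>P\<close>, the formula for a primitive of the pullback of the Cartan \<open>3\<close>-form under the exponential
  map; for one argument in \<open>P\<close> and two in \<open>Q\<close>, the relation \<open>\<kappa> [L, Q] Q = 0\<close>; for three arguments in
  \<open>Q\<close>, the vanishing of \<open>\<phi>\<close> on \<open>Q\<close>; the remaining case is a matter of orthogonality. Equivariance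
  holds because \<open>ad z\<close>, \<open>z \<in> l\<close>, is a derivation of the double that preserves the four summands.

  The meromorphic function \<open>F\<close> enters only through \<open>F(a) (sinh a/a) = (a cosh a - sinh a)/a\<^sup>2\<close>, an
  identity between entire series in \<open>a\<close> in which \<open>sinh a/a\<close> is invertible exactly when the spectrum of
  \<open>a\<close> avoids the poles of \<open>F\<close>.
\<close>

section \<open>Scalars\<close>

text \<open>Neither part of the l-matrix is differentiated through its definition; each is first
  replaced by a membership. Put S = sinh z/z, G = (z cosh z - sinh z)/z^2 and H = (sinh z - z)/z^2.
  The first membership is the series identity S (e^z - 1)/z = S + G + e^z H. Applied to b in P with
  \<beta> = S b it reads D \<beta> = \<beta> + r \<beta> + e^a H b, and H b lies in L because H is
  odd; this is where coth z - 1/z comes from. The second says that e^-a (\<eta> + \<tau> \<eta>) has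
  no component in g. If e^-a x stays in a fixed subspace X, then the derivative of x along \<alpha>
  is [D \<alpha>, x] plus an element of e^a X. Summands are orthogonal complements, so series and
  derivatives stay in them by pairing alone. The real and the complex case are treated together:
  series are entries of matrix series over the ground field, and complex numbers appear only in
  spectra and in F(a) S(a) = G(a). The dual of g is a set of functions and not a type of finite
  dimension, hence the transport of the double to g x g.\<close>

lemma to_complex_0 [simp]: "to_complex (0 :: 'k::rc_field) = 0"
  by (metis norm_eq_zero norm_to_complex)

lemma to_complex_one [simp]: "to_complex (1 :: 'k::rc_field) = 1"
  by (rule to_complex_1)

lemma bounded_linear_to_complex: "bounded_linear (to_complex :: 'k::rc_field \<Rightarrow> complex)"
  by (rule bounded_linear_intro [where K = 1])
    (simp_all add: to_complex_add to_complex_scaleR norm_to_complex)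

lemma to_complex_sum: "to_complex (sum f A :: 'k::rc_field) = (\<Sum>x\<in>A. to_complex (f x))"
  by (rule bounded_linear_to_complex [THEN bounded_linear.linear, THEN linear_sum])

lemma to_complex_diff: "to_complex (x - y :: 'k::rc_field) = to_complex x - to_complex y"
  by (rule bounded_linear_to_complex [THEN bounded_linear.linear, THEN linear_diff])

lemma to_complex_eq_iff [simp]: "to_complex x = to_complex y \<longleftrightarrow> x = (y :: 'k::rc_field)"
proof
  assume "to_complex x = to_complex y"
  then have "norm (to_complex (x - y)) = 0"
    by (simp add: to_complex_diff)
  then show "x = y"
    by (simp add: norm_to_complex)
qed simp

lemma inj_to_complex: "inj (to_complex :: 'k::rc_field \<Rightarrow> complex)"
  by (simp add: inj_def)

lemma inv_to_complex [simp]: "inv_into UNIV to_complex (to_complex (x :: 'k::rc_field)) = x"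
  by (simp add: inj_to_complex)

lemma dist_to_complex: "dist (to_complex x) (to_complex y) = dist x (y :: 'k::rc_field)"
  by (simp add: dist_norm norm_to_complex flip: to_complex_diff)

text \<open>\<open>to_complex\<close> is an isometry whose range is the real line or the whole
  plane, hence closed, so completeness is inherited. Convergence of series over the ground field
  rests on it.\<close>

instance rc_field \<subseteq> banach
proof
  fix X :: "nat \<Rightarrow> 'a"
  assume "Cauchy X"
  then have "Cauchy (\<lambda>n. to_complex (X n))"
    by (simp add: Cauchy_def dist_to_complex)
  then obtain y where y: "(\<lambda>n. to_complex (X n)) \<longlonglongrightarrow> y"
    by (auto simp: Cauchy_convergent_iff convergent_def)
  have "closed (range (to_complex :: 'a \<Rightarrow> complex))"
    using range_to_complex [where 'k = 'a] closed_complex_Reals by (metis closed_UNIV)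
  then have "y \<in> range (to_complex :: 'a \<Rightarrow> complex)"
    using closed_sequentially [OF _ _ y] by blast
  then obtain x :: 'a where "y = to_complex x"
    by blast
  with y have "X \<longlonglongrightarrow> x"
    by (simp add: lim_sequentially dist_to_complex)
  then show "convergent X"
    by (auto simp: convergent_def)
qed

lemma sums_to_complex: "f sums x \<Longrightarrow> (\<lambda>n. to_complex (f n)) sums to_complex (x :: 'k::rc_field)"
  by (rule bounded_linear.sums [OF bounded_linear_to_complex])

section \<open>Smooth functions of linear forms\<close>

lemma Ck_on_SucI:
  assumes "continuous_on U f"
    and "\<And>\<alpha>. \<alpha> \<in> W \<Longrightarrow> Ck_on k W U (f' \<alpha>)"
    and "\<And>\<alpha> p. \<alpha> \<in> W \<Longrightarrow> p \<in> U \<Longrightarrow>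
      ((\<lambda>t. f (p + fscale t \<alpha>)) has_field_derivative f' \<alpha> p) (at 0)"
  shows "Ck_on (Suc k) W U f"
  unfolding Ck_on.simps using assms(1)
proof (intro conjI ballI)
  fix \<alpha> assume "\<alpha> \<in> W"
  then have "(\<forall>p\<in>U. ((\<lambda>t. f (p + fscale t \<alpha>)) has_field_derivative f' \<alpha> p) (at 0)) \<and> Ck_on k W U (f' \<alpha>)"
    by (intro conjI ballI assms)
  then show "\<exists>f'. (\<forall>p\<in>U. ((\<lambda>t. f (p + fscale t \<alpha>)) has_field_derivative f' p) (at 0)) \<and> Ck_on k W U f'"
    by (rule exI [where x = "f' \<alpha>"])
qed

text \<open>Chooses the derivatives in all directions at once, so that induction steps can combine
  those of two functions.\<close>

lemma Ck_on_SucE: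
  assumes "Ck_on (Suc k) W U f"
  obtains f' where "\<And>\<alpha>. \<alpha> \<in> W \<Longrightarrow> Ck_on k W U (f' \<alpha>)"
    and "\<And>\<alpha> p. \<alpha> \<in> W \<Longrightarrow> p \<in> U \<Longrightarrow>
      ((\<lambda>t. f (p + fscale t \<alpha>)) has_field_derivative f' \<alpha> p) (at 0)"
proof -
  from assms have "\<forall>\<alpha>\<in>W. \<exists>f'. (\<forall>p\<in>U. ((\<lambda>t. f (p + fscale t \<alpha>)) has_field_derivative f' p) (at 0)) \<and> Ck_on k W U f'"
    unfolding Ck_on.simps by (rule conjunct2)
  from bchoice [OF this] show thesis
    using that by metis
qed

declare Ck_on.simps(2) [simp del]

lemma Ck_on_continuous: "Ck_on k W U f \<Longrightarrow> continuous_on U f"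
  by (cases k) (auto simp: Ck_on.simps(2))

lemma Ck_on_Suc_imp: "Ck_on (Suc k) W U f \<Longrightarrow> Ck_on k W U f"
proof (induction k arbitrary: f)
  case (Suc k)
  from Suc.prems obtain f' where f': "\<And>\<alpha>. \<alpha> \<in> W \<Longrightarrow> Ck_on (Suc k) W U (f' \<alpha>)"
    "\<And>\<alpha> p. \<alpha> \<in> W \<Longrightarrow> p \<in> U \<Longrightarrow>
      ((\<lambda>t. f (p + fscale t \<alpha>)) has_field_derivative f' \<alpha> p) (at 0)"
    by (rule Ck_on_SucE) (rule that)
  from Ck_on_continuous [OF Suc.prems] show ?case
    by (rule Ck_on_SucI) (use f' Suc.IH in blast)+
qed (simp add: Ck_on.simps(2))

lemma Ck_on_const: "Ck_on k W U (\<lambda>_. c)"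
proof (induction k arbitrary: c)
  case (Suc k)
  show ?case
    by (rule Ck_on_SucI [where f' = "\<lambda>_ _. 0"]) (auto intro: Suc.IH)
qed auto

lemma Ck_on_add: "Ck_on k W U f \<Longrightarrow> Ck_on k W U g \<Longrightarrow> Ck_on k W U (\<lambda>p. f p + g p)"
proof (induction k arbitrary: f g)
  case (Suc k)
  from Suc.prems(1) obtain f' where f': "\<And>\<alpha>. \<alpha> \<in> W \<Longrightarrow> Ck_on k W U (f' \<alpha>)"
    "\<And>\<alpha> p. \<alpha> \<in> W \<Longrightarrow> p \<in> U \<Longrightarrow>
      ((\<lambda>t. f (p + fscale t \<alpha>)) has_field_derivative f' \<alpha> p) (at 0)"
    by (rule Ck_on_SucE) (rule that)
  from Suc.prems(2) obtain g' where g': "\<And>\<alpha>. \<alpha> \<in> W \<Longrightarrow> Ck_on k W U (g' \<alpha>)"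
    "\<And>\<alpha> p. \<alpha> \<in> W \<Longrightarrow> p \<in> U \<Longrightarrow>
      ((\<lambda>t. g (p + fscale t \<alpha>)) has_field_derivative g' \<alpha> p) (at 0)"
    by (rule Ck_on_SucE) (rule that)
  show ?case
  proof (rule Ck_on_SucI [where f' = "\<lambda>\<alpha> p. f' \<alpha> p + g' \<alpha> p"])
    show "continuous_on U (\<lambda>p. f p + g p)"
      using Suc.prems by (intro continuous_on_add Ck_on_continuous)
  next
    fix \<alpha> p assume "\<alpha> \<in> W" "p \<in> U"
    from DERIV_add [OF f'(2) [OF this] g'(2) [OF this]]
    show "((\<lambda>t. f (p + fscale t \<alpha>) + g (p + fscale t \<alpha>)) has_field_derivative
        f' \<alpha> p + g' \<alpha> p) (at 0)" .
  next
    fix \<alpha> assume "\<alpha> \<in> W"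
    then show "Ck_on k W U (\<lambda>p. f' \<alpha> p + g' \<alpha> p)"
      by (intro Suc.IH f'(1) g'(1))
  qed
qed (auto intro: continuous_on_add)

lemma fscale_0 [simp]: "fscale 0 \<alpha> = 0"
  by (simp add: fscale_def fun_eq_iff)

lemma Ck_on_mult: "Ck_on k W U f \<Longrightarrow> Ck_on k W U g \<Longrightarrow> Ck_on k W U (\<lambda>p. f p * g p)"
proof (induction k arbitrary: f g)
  case (Suc k)
  from Suc.prems(1) obtain f' where f': "\<And>\<alpha>. \<alpha> \<in> W \<Longrightarrow> Ck_on k W U (f' \<alpha>)"
    "\<And>\<alpha> p. \<alpha> \<in> W \<Longrightarrow> p \<in> U \<Longrightarrow>
      ((\<lambda>t. f (p + fscale t \<alpha>)) has_field_derivative f' \<alpha> p) (at 0)"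
    by (rule Ck_on_SucE) (rule that)
  from Suc.prems(2) obtain g' where g': "\<And>\<alpha>. \<alpha> \<in> W \<Longrightarrow> Ck_on k W U (g' \<alpha>)"
    "\<And>\<alpha> p. \<alpha> \<in> W \<Longrightarrow> p \<in> U \<Longrightarrow>
      ((\<lambda>t. g (p + fscale t \<alpha>)) has_field_derivative g' \<alpha> p) (at 0)"
    by (rule Ck_on_SucE) (rule that)
  have fg: "Ck_on k W U f" "Ck_on k W U g"
    using Suc.prems by (auto intro: Ck_on_Suc_imp)
  show ?case
  proof (rule Ck_on_SucI [where f' = "\<lambda>\<alpha> p. f' \<alpha> p * g p + g' \<alpha> p * f p"])
    show "continuous_on U (\<lambda>p. f p * g p)"
      using Suc.prems by (intro continuous_on_mult Ck_on_continuous)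
  next
    fix \<alpha> p assume "\<alpha> \<in> W" "p \<in> U"
    from DERIV_mult [OF f'(2) [OF this] g'(2) [OF this]]
    show "((\<lambda>t. f (p + fscale t \<alpha>) * g (p + fscale t \<alpha>)) has_field_derivative
        f' \<alpha> p * g p + g' \<alpha> p * f p) (at 0)"
      by simp
  next
    fix \<alpha> assume "\<alpha> \<in> W"
    then show "Ck_on k W U (\<lambda>p. f' \<alpha> p * g p + g' \<alpha> p * f p)"
      by (intro Ck_on_add Suc.IH f'(1) g'(1) fg)
  qed
qed (auto intro: continuous_on_mult)

text \<open>The derivative -f^-1 f' f^-1 contains the inverse itself, which the induction hypothesis
  makes one order less smooth; this is exactly what is required of a derivative.\<close>

lemma Ck_on_inverse:
  "Ck_on k W U f \<Longrightarrow> (\<And>p. p \<in> U \<Longrightarrow> f p \<noteq> 0) \<Longrightarrow> Ck_on k W U (\<lambda>p. inverse (f p))"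
proof (induction k)
  case (Suc k)
  from Suc.prems(1) obtain f' where f': "\<And>\<alpha>. \<alpha> \<in> W \<Longrightarrow> Ck_on k W U (f' \<alpha>)"
    "\<And>\<alpha> p. \<alpha> \<in> W \<Longrightarrow> p \<in> U \<Longrightarrow>
      ((\<lambda>t. f (p + fscale t \<alpha>)) has_field_derivative f' \<alpha> p) (at 0)"
    by (rule Ck_on_SucE) (rule that)
  let ?g = "\<lambda>\<alpha> p. (- 1) * (inverse (f p) * f' \<alpha> p * inverse (f p))"
  show ?case
  proof (rule Ck_on_SucI [where f' = ?g])
    show "continuous_on U (\<lambda>p. inverse (f p))"
      using Suc.prems by (intro continuous_on_inverse Ck_on_continuous ballI)
  next
    fix \<alpha> p assume "\<alpha> \<in> W" "p \<in> U"
    from DERIV_inverse' [OF f'(2) [OF this]] Suc.prems(2) [OF this(2)]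
    show "((\<lambda>t. inverse (f (p + fscale t \<alpha>))) has_field_derivative ?g \<alpha> p) (at 0)"
      by simp
  next
    fix \<alpha> assume "\<alpha> \<in> W"
    have i: "Ck_on k W U (\<lambda>p. inverse (f p))"
      by (rule Suc.IH [OF Ck_on_Suc_imp [OF Suc.prems(1)] Suc.prems(2)])
    show "Ck_on k W U (?g \<alpha>)"
      by (rule Ck_on_mult [OF Ck_on_const Ck_on_mult [OF Ck_on_mult [OF i f'(1) [OF \<open>\<alpha> \<in> W\<close>]] i]])
  qed
qed (auto intro: continuous_on_inverse)

lemma Ck_on_sum: "(\<And>i. i \<in> I \<Longrightarrow> Ck_on k W U (f i)) \<Longrightarrow> Ck_on k W U (\<lambda>p. \<Sum>i\<in>I. f i p)"
  by (induction I rule: infinite_finite_induct) (simp_all add: Ck_on_add Ck_on_const)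

section \<open>Power series of matrices\<close>

text \<open>Absolute convergence at every radius, stated on coefficients: in this form the series
  can be compared directly with the bounds (n \<mu>)^k for entries of matrix powers.\<close>

definition entire :: "'a::real_normed_field fps \<Rightarrow> bool" where
  "entire f \<longleftrightarrow> (\<forall>R\<ge>0. summable (\<lambda>n. norm (fps_nth f n) * R ^ n))"

lemma entire_fact_bound:
  assumes "\<And>n. norm (fps_nth f n) \<le> 1 / fact n"
  shows "entire f"
  unfolding entire_def
proof (intro allI impI)
  fix R :: real assume "R \<ge> 0"
  show "summable (\<lambda>n. norm (fps_nth f n) * R ^ n)"
  proof (rule summable_comparison_test', rule summable_exp [of R])
    fix n :: nat
    show "norm (norm (fps_nth f n) * R ^ n) \<le> inverse (fact n) * R ^ n"
      using mult_right_mono [OF assms [of n], of "R ^ n"] \<open>R \<ge> 0\<close> by (simp add: inverse_eq_divide)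
  qed
qed

lemma entire_add: "entire f \<Longrightarrow> entire g \<Longrightarrow> entire (f + g)"
  unfolding entire_def
proof (intro allI impI)
  fix R :: real assume R: "R \<ge> 0"
    and f: "\<forall>R\<ge>0. summable (\<lambda>n. norm (fps_nth f n) * R ^ n)"
    and g: "\<forall>R\<ge>0. summable (\<lambda>n. norm (fps_nth g n) * R ^ n)"
  have "summable (\<lambda>n. norm (fps_nth f n) * R ^ n + norm (fps_nth g n) * R ^ n)"
    using f g R by (intro summable_add) auto
  then show "summable (\<lambda>n. norm (fps_nth (f + g) n) * R ^ n)"
    by (rule summable_comparison_test')
      (auto simp: R norm_mult abs_mult simp flip: distrib_right intro!: mult_right_mono norm_triangle_ineq)
qed

text \<open>The Cauchy product of the two majorant series dominates the product series.\<close>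

lemma entire_mult: "entire f \<Longrightarrow> entire g \<Longrightarrow> entire (f * g)"
  unfolding entire_def
proof (intro allI impI)
  fix R :: real assume R: "R \<ge> 0"
    and f: "\<forall>R\<ge>0. summable (\<lambda>n. norm (fps_nth f n) * R ^ n)"
    and g: "\<forall>R\<ge>0. summable (\<lambda>n. norm (fps_nth g n) * R ^ n)"
  have "summable (\<lambda>n. \<Sum>i\<le>n. (norm (fps_nth f i) * R ^ i) * (norm (fps_nth g (n - i)) * R ^ (n - i)))"
    using f g R by (intro summable_Cauchy_product) auto
  then show "summable (\<lambda>n. norm (fps_nth (f * g) n) * R ^ n)"
  proof (rule summable_comparison_test')
    fix n
    have "norm (fps_nth (f * g) n) \<le> (\<Sum>i\<le>n. norm (fps_nth f i) * norm (fps_nth g (n - i)))"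
      by (simp add: fps_mult_nth atLeast0AtMost norm_mult flip: norm_mult) (rule norm_sum)
    then have "norm (fps_nth (f * g) n) * R ^ n
        \<le> (\<Sum>i\<le>n. norm (fps_nth f i) * norm (fps_nth g (n - i))) * R ^ n"
      using R by (intro mult_right_mono) auto
    also have "\<dots> = (\<Sum>i\<le>n. (norm (fps_nth f i) * R ^ i) * (norm (fps_nth g (n - i)) * R ^ (n - i)))"
      unfolding sum_distrib_right
      by (intro sum.cong refl) (simp add: algebra_simps flip: power_add)
    finally show "norm (norm (fps_nth (f * g) n) * R ^ n)
        \<le> (\<Sum>i\<le>n. (norm (fps_nth f i) * R ^ i) * (norm (fps_nth g (n - i)) * R ^ (n - i)))"
      using R by simp
  qed
qed

lemma entire_const: "entire (fps_const c)"
  unfolding entire_def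
proof (intro allI impI)
  fix R :: real
  show "summable (\<lambda>n. norm (fps_nth (fps_const c) n) * R ^ n)"
    by (rule summable_finite [of "{0}"]) auto
qed

section \<open>Matrix powers: entries and bounds\<close>

lemma mat_mult_index:
  assumes "A \<in> carrier_mat n n" "B \<in> carrier_mat n n" "i < n" "j < n"
  shows "(A * B) $$ (i, j) = (\<Sum>k<n. A $$ (i, k) * B $$ (k, j))"
  using assms by (simp add: scalar_prod_def lessThan_atLeast0)

lemma mat_pow_add:
  assumes "A \<in> carrier_mat n n"
  shows "A ^\<^sub>m (i + j) = A ^\<^sub>m i * A ^\<^sub>m j"
  by (induction j) (use assms in \<open>auto simp: assoc_mult_mat [of _ n n _ n _ n]\<close>)

lemma mat_pow_bound:
  fixes M :: "'a::real_normed_field mat"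
  assumes M: "M \<in> carrier_mat n n" "\<And>i j. i < n \<Longrightarrow> j < n \<Longrightarrow> norm (M $$ (i, j)) \<le> \<mu>"
    and "i < n" "j < n"
  shows "norm ((M ^\<^sub>m k) $$ (i, j)) \<le> (n * \<mu>) ^ k"
  using \<open>j < n\<close>
proof (induction k arbitrary: j)
  case 0
  then show ?case
    using M(1) \<open>i < n\<close> by simp
next
  case (Suc k)
  have "norm ((M ^\<^sub>m Suc k) $$ (i, j)) = norm (\<Sum>l<n. (M ^\<^sub>m k) $$ (i, l) * M $$ (l, j))"
    using M(1) \<open>i < n\<close> Suc.prems by (simp add: mat_mult_index [of _ n] del: index_mult_mat(1))
  also have "\<dots> \<le> (\<Sum>l<n. norm ((M ^\<^sub>m k) $$ (i, l)) * norm (M $$ (l, j)))"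
    by (rule order_trans [OF norm_sum]) (simp add: norm_mult)
  also have "\<dots> \<le> (\<Sum>l<n. (n * \<mu>) ^ k * \<mu>)"
    using Suc M(2) by (intro sum_mono mult_mono') auto
  also have "\<dots> = (n * \<mu>) ^ Suc k"
    by simp
  finally show ?case .
qed

lemma mat_bounded:
  fixes M :: "'a::real_normed_field mat"
  shows "\<exists>\<mu>\<ge>0. \<forall>i<n. \<forall>j<n. norm (M $$ (i, j)) \<le> \<mu>"
proof (intro exI conjI allI impI)
  let ?m = "\<Sum>i<n. \<Sum>j<n. norm (M $$ (i, j))"
  show "?m \<ge> 0"
    by (intro sum_nonneg) auto
  fix i j assume "i < n" "j < n"
  have "norm (M $$ (i, j)) \<le> (\<Sum>j<n. norm (M $$ (i, j)))"
    using \<open>j < n\<close> by (intro member_le_sum) auto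
  also have "\<dots> \<le> ?m"
    using \<open>i < n\<close> by (intro member_le_sum) (auto intro: sum_nonneg)
  finally show "norm (M $$ (i, j)) \<le> ?m" .
qed

text \<open>The sum is taken entrywise, so continuity and differentiability can be studied one
  scalar series at a time.\<close>

definition mps :: "'a::{real_normed_field, banach} fps \<Rightarrow> 'a mat \<Rightarrow> 'a mat" where
  "mps f M = Matrix.mat (dim_row M) (dim_row M) (\<lambda>(i, j). \<Sum>n. fps_nth f n * (M ^\<^sub>m n) $$ (i, j))"

lemma mps_carrier [simp]: "M \<in> carrier_mat n n \<Longrightarrow> mps f M \<in> carrier_mat n n"
  by (simp add: mps_def)

lemma mps_abs_summable:
  assumes "entire f" "M \<in> carrier_mat n n" "i < n" "j < n"
  shows "summable (\<lambda>k. norm (fps_nth f k * (M ^\<^sub>m k) $$ (i, j)))"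
proof -
  obtain \<mu> where \<mu>: "\<mu> \<ge> 0" "\<And>i j. i < n \<Longrightarrow> j < n \<Longrightarrow> norm (M $$ (i, j)) \<le> \<mu>"
    using mat_bounded [of n M] by blast
  have "summable (\<lambda>k. norm (fps_nth f k) * (n * \<mu>) ^ k)"
    using assms(1) \<mu>(1) by (auto simp: entire_def)
  then show ?thesis
    by (rule summable_comparison_test')
      (use mat_pow_bound [OF assms(2) \<mu>(2) assms(3,4)] in \<open>auto simp: norm_mult intro!: mult_left_mono\<close>)
qed

lemma mps_sums:
  assumes "entire f" "M \<in> carrier_mat n n" "i < n" "j < n"
  shows "(\<lambda>k. fps_nth f k * (M ^\<^sub>m k) $$ (i, j)) sums (mps f M $$ (i, j))"
  using summable_sums [OF summable_norm_cancel [OF mps_abs_summable [OF assms]]] assms(2-)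
  by (simp add: mps_def)

text \<open>An entry of the right side is a finite sum of products of absolutely convergent series;
  in their Cauchy products M^a and M^(k-a) recombine to M^k.\<close>

lemma mps_mult:
  assumes "entire f" "entire g" "M \<in> carrier_mat n n"
  shows "mps (f * g) M = mps f M * mps g M"
proof (rule eq_matI)
  fix i j assume "i < dim_row (mps f M * mps g M)" "j < dim_col (mps f M * mps g M)"
  then have ij: "i < n" "j < n"
    using assms(3) by (auto simp: mps_def)
  have "(\<lambda>k. \<Sum>l<n. \<Sum>a\<le>k. (fps_nth f a * (M ^\<^sub>m a) $$ (i, l)) * (fps_nth g (k - a) * (M ^\<^sub>m (k - a)) $$ (l, j)))
      sums (\<Sum>l<n. (\<Sum>k. fps_nth f k * (M ^\<^sub>m k) $$ (i, l)) * (\<Sum>k. fps_nth g k * (M ^\<^sub>m k) $$ (l, j)))"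
    using ij assms by (intro sums_sum Cauchy_product_sums mps_abs_summable [of _ _ n]) auto
  also have "(\<Sum>l<n. (\<Sum>k. fps_nth f k * (M ^\<^sub>m k) $$ (i, l)) * (\<Sum>k. fps_nth g k * (M ^\<^sub>m k) $$ (l, j)))
      = (mps f M * mps g M) $$ (i, j)"
    using assms(3) ij by (simp add: mat_mult_index [of _ n] del: index_mult_mat(1)) (simp add: mps_def)
  also have "(\<lambda>k. \<Sum>l<n. \<Sum>a\<le>k. (fps_nth f a * (M ^\<^sub>m a) $$ (i, l)) * (fps_nth g (k - a) * (M ^\<^sub>m (k - a)) $$ (l, j)))
      = (\<lambda>k. fps_nth (f * g) k * (M ^\<^sub>m k) $$ (i, j))"
  proof
    fix k
    have "(\<Sum>l<n. \<Sum>a\<le>k. (fps_nth f a * (M ^\<^sub>m a) $$ (i, l)) * (fps_nth g (k - a) * (M ^\<^sub>m (k - a)) $$ (l, j)))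
        = (\<Sum>a\<le>k. fps_nth f a * fps_nth g (k - a) * (M ^\<^sub>m a * M ^\<^sub>m (k - a)) $$ (i, j))"
      using assms(3) ij
      by (subst sum.swap) (simp add: mat_mult_index [of _ n] sum_distrib_left algebra_simps del: index_mult_mat(1))
    also have "\<dots> = (\<Sum>a\<le>k. fps_nth f a * fps_nth g (k - a) * (M ^\<^sub>m k) $$ (i, j))"
      by (intro sum.cong refl) (simp flip: mat_pow_add [OF assms(3)])
    finally show "(\<Sum>l<n. \<Sum>a\<le>k. (fps_nth f a * (M ^\<^sub>m a) $$ (i, l)) * (fps_nth g (k - a) * (M ^\<^sub>m (k - a)) $$ (l, j)))
        = fps_nth (f * g) k * (M ^\<^sub>m k) $$ (i, j)"
      by (simp add: fps_mult_nth atLeast0AtMost sum_distrib_right)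
  qed
  finally have "(\<lambda>k. fps_nth (f * g) k * (M ^\<^sub>m k) $$ (i, j)) sums (mps f M * mps g M) $$ (i, j)" .
  with mps_sums [OF entire_mult [OF assms(1,2)] assms(3) ij]
  show "mps (f * g) M $$ (i, j) = (mps f M * mps g M) $$ (i, j)"
    by (rule sums_unique2)
qed (use assms in \<open>auto simp: mps_def\<close>)

text \<open>The Weierstrass test with a local majorant: a power series is dominated uniformly only
  near each point, and continuity is a local matter.\<close>

lemma continuous_on_series:
  fixes g :: "nat \<Rightarrow> 'b::topological_space \<Rightarrow> 'a::banach"
  assumes "\<And>n. continuous_on S (g n)"
    and bound: "\<And>x. x \<in> S \<Longrightarrow> \<exists>T m. open T \<and> x \<in> T \<and> summable m \<and> (\<forall>n. \<forall>y\<in>S \<inter> T. norm (g n y) \<le> m n)"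
  shows "continuous_on S (\<lambda>x. \<Sum>n. g n x)"
  unfolding continuous_on_def
proof
  fix x assume x: "x \<in> S"
  from bound [OF x] obtain T m where T: "open T" "x \<in> T" "summable m" "\<forall>n. \<forall>y\<in>S \<inter> T. norm (g n y) \<le> m n"
    by blast
  have "uniform_limit (S \<inter> T) (\<lambda>n y. \<Sum>i<n. g i y) (\<lambda>y. \<Sum>i. g i y) sequentially"
    using T(3,4) by (intro Weierstrass_m_test [where M = m]) auto
  moreover have "continuous_on (S \<inter> T) (\<lambda>y. \<Sum>i<n. g i y)" for n
    using assms(1) by (intro continuous_on_sum) (auto intro: continuous_on_subset)
  ultimately have "continuous_on (S \<inter> T) (\<lambda>y. \<Sum>i. g i y)"
    by (intro uniform_limit_theorem [where F = sequentially]) (auto simp del: lessThan_iff)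
  then have "((\<lambda>y. \<Sum>i. g i y) \<longlongrightarrow> (\<Sum>i. g i x)) (at x within S \<inter> T)"
    using x T by (simp add: continuous_on_def)
  moreover have "at x within S \<inter> T = at x within S"
    by (rule at_within_nhd [of x T]) (use T in auto)
  ultimately show "((\<lambda>y. \<Sum>i. g i y) \<longlongrightarrow> (\<Sum>i. g i x)) (at x within S)"
    by simp
qed

lemma continuous_on_mat_pow:
  fixes M :: "'b::topological_space \<Rightarrow> 'a::real_normed_field mat"
  assumes M: "\<And>x. M x \<in> carrier_mat n n"
    and c: "\<And>i j. i < n \<Longrightarrow> j < n \<Longrightarrow> continuous_on S (\<lambda>x. M x $$ (i, j))"
    and "i < n" "j < n"
  shows "continuous_on S (\<lambda>x. (M x ^\<^sub>m k) $$ (i, j))"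
  using \<open>j < n\<close>
proof (induction k arbitrary: j)
  case 0
  have "dim_row (M x) = n" for x
    using M [of x] by simp
  then show ?case
    using 0 \<open>i < n\<close> by simp
next
  case (Suc k)
  have "(M x ^\<^sub>m Suc k) $$ (i, j) = (\<Sum>l<n. (M x ^\<^sub>m k) $$ (i, l) * M x $$ (l, j))" for x
    using mat_mult_index [OF pow_carrier_mat [OF M] M] \<open>i < n\<close> Suc.prems by simp
  moreover have "continuous_on S (\<lambda>x. \<Sum>l<n. (M x ^\<^sub>m k) $$ (i, l) * M x $$ (l, j))"
    using Suc c by (intro continuous_on_sum continuous_on_mult) auto
  ultimately show ?case
    by simp
qed

lemma continuous_on_mps:
  fixes M :: "'b::topological_space \<Rightarrow> 'a::{real_normed_field, banach} mat"
  assumes "entire f" and M: "\<And>x. M x \<in> carrier_mat n n"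
    and c: "\<And>i j. i < n \<Longrightarrow> j < n \<Longrightarrow> continuous_on S (\<lambda>x. M x $$ (i, j))"
    and ij: "i < n" "j < n"
  shows "continuous_on S (\<lambda>x. mps f (M x) $$ (i, j))"
proof -
  have *: "mps f (M x) $$ (i, j) = (\<Sum>k. fps_nth f k * (M x ^\<^sub>m k) $$ (i, j))" for x
    using M [of x] ij by (simp add: mps_def)
  show ?thesis
    unfolding *
  proof (rule continuous_on_series)
    show "continuous_on S (\<lambda>x. fps_nth f k * (M x ^\<^sub>m k) $$ (i, j))" for k
      by (intro continuous_on_mult continuous_on_const continuous_on_mat_pow [OF M c ij])
  next
    fix x assume x: "x \<in> S"
    define \<mu> where "\<mu> y = (\<Sum>i<n. \<Sum>j<n. norm (M y $$ (i, j)))" for y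
    have \<mu>0: "\<mu> y \<ge> 0" for y
      unfolding \<mu>_def by (intro sum_nonneg) auto
    have \<mu>: "norm (M y $$ (i, j)) \<le> \<mu> y" if "i < n" "j < n" for i j y
    proof -
      have "norm (M y $$ (i, j)) \<le> (\<Sum>j<n. norm (M y $$ (i, j)))"
        using that by (intro member_le_sum) auto
      also have "\<dots> \<le> \<mu> y"
        unfolding \<mu>_def using that by (intro member_le_sum) (auto intro: sum_nonneg)
      finally show ?thesis .
    qed
    have "continuous_on S \<mu>"
      unfolding \<mu>_def using c by (intro continuous_intros) auto
    then have "\<forall>B. open B \<longrightarrow> \<mu> x \<in> B \<longrightarrow> (\<exists>A. open A \<and> x \<in> A \<and> (\<forall>y\<in>S. y \<in> A \<longrightarrow> \<mu> y \<in> B))"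
      using x by (auto simp: continuous_on_topological)
    \<comment> \<open>On this neighbourhood all entries stay below the one bound \<mu> x + 1, which
      supplies the local majorant.\<close>
    from this [rule_format, of "{..<\<mu> x + 1}"]
    obtain T where T: "open T" "x \<in> T" "\<And>y. y \<in> S \<Longrightarrow> y \<in> T \<Longrightarrow> \<mu> y < \<mu> x + 1"
      by auto
    have "summable (\<lambda>k. norm (fps_nth f k) * (n * (\<mu> x + 1)) ^ k)"
      using assms(1) \<mu>0 [of x] by (auto simp: entire_def)
    moreover have "norm (fps_nth f k * (M y ^\<^sub>m k) $$ (i, j)) \<le> norm (fps_nth f k) * (n * (\<mu> x + 1)) ^ k"
      if "y \<in> S \<inter> T" for y k
    proof -
      have "norm (M y $$ (i, j)) \<le> \<mu> x + 1" if "i < n" "j < n" for i j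
        using \<mu> [OF that, of y] T(3) [of y] \<open>y \<in> S \<inter> T\<close> by simp
      from mat_pow_bound [OF M this ij] show ?thesis
        by (simp add: norm_mult mult_left_mono)
    qed
    ultimately show "\<exists>T m. open T \<and> x \<in> T \<and> summable m \<and>
        (\<forall>k. \<forall>y\<in>S \<inter> T. norm (fps_nth f k * (M y ^\<^sub>m k) $$ (i, j)) \<le> m k)"
      using T by blast
  qed
qed

text \<open>
  The upper right block of a power of \<open>[[X, B], [0, Y]]\<close> is a divided difference; this is how
  derivatives of power series of matrices are again entries of power series of (larger) matrices.
\<close>

primrec mat_ddiff :: "'a::comm_ring_1 mat \<Rightarrow> 'a mat \<Rightarrow> 'a mat \<Rightarrow> nat \<Rightarrow> 'a mat" where
  "mat_ddiff X B Y 0 = 0\<^sub>m (dim_row X) (dim_row X)"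
| "mat_ddiff X B Y (Suc k) = X ^\<^sub>m k * B + mat_ddiff X B Y k * Y"

lemma mat_ddiff_carrier [simp]:
  assumes "X \<in> carrier_mat n n" "B \<in> carrier_mat n n" "Y \<in> carrier_mat n n"
  shows "mat_ddiff X B Y k \<in> carrier_mat n n"
  by (induction k) (use assms in auto)

abbreviation upper_block :: "'a::comm_ring_1 mat \<Rightarrow> 'a mat \<Rightarrow> 'a mat \<Rightarrow> 'a mat" where
  "upper_block X B Y \<equiv> four_block_mat X B (0\<^sub>m (dim_row X) (dim_row X)) Y"

lemma upper_block_pow:
  assumes "X \<in> carrier_mat n n" "B \<in> carrier_mat n n" "Y \<in> carrier_mat n n"
  shows "upper_block X B Y ^\<^sub>m k = four_block_mat (X ^\<^sub>m k) (mat_ddiff X B Y k) (0\<^sub>m n n) (Y ^\<^sub>m k)"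
proof (induction k)
  case 0
  then show ?case
    using assms by simp
next
  case (Suc k)
  have "upper_block X B Y ^\<^sub>m Suc k
      = four_block_mat (X ^\<^sub>m k) (mat_ddiff X B Y k) (0\<^sub>m n n) (Y ^\<^sub>m k) * four_block_mat X B (0\<^sub>m n n) Y"
    using Suc assms by simp
  also have "\<dots> = four_block_mat (X ^\<^sub>m k * X) (X ^\<^sub>m k * B + mat_ddiff X B Y k * Y) (0\<^sub>m n n) (Y ^\<^sub>m k * Y)"
  proof -
    have c: "X ^\<^sub>m k \<in> carrier_mat n n" "mat_ddiff X B Y k \<in> carrier_mat n n" "Y ^\<^sub>m k \<in> carrier_mat n n"
      using assms by auto
    have m: "X ^\<^sub>m k * X \<in> carrier_mat n n" "Y ^\<^sub>m k * Y \<in> carrier_mat n n"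
      using c assms by auto
    show ?thesis
      unfolding mult_four_block_mat [OF c(1,2) zero_carrier_mat c(3) assms(1,2) zero_carrier_mat assms(3)]
      using assms c m by (intro cong_four_block_mat) (simp_all add: right_mult_zero_mat [of _ n n] left_mult_zero_mat [of _ n n]
          right_add_zero_mat [of _ n n] left_add_zero_mat [of _ n n])
  qed
  finally show ?case
    by simp
qed

text \<open>Telescoping: the divided difference is the sum of X^i B Y^(k-1-i), and X - Y = t B. No
  division by t occurs, so t = 0 is included.\<close>

lemma mat_pow_diff:
  fixes X :: "'a::comm_ring_1 mat"
  assumes "X \<in> carrier_mat n n" "B \<in> carrier_mat n n" "Y \<in> carrier_mat n n"
    and "X = Y + t \<cdot>\<^sub>m B" and "i < n" "j < n"
  shows "(X ^\<^sub>m k) $$ (i, j) - (Y ^\<^sub>m k) $$ (i, j) = t * mat_ddiff X B Y k $$ (i, j)"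
  using \<open>j < n\<close>
proof (induction k arbitrary: j)
  case 0
  then show ?case
    using assms by simp
next
  case (Suc k)
  have "(X ^\<^sub>m Suc k) $$ (i, j) - (Y ^\<^sub>m Suc k) $$ (i, j)
      = (\<Sum>l<n. (X ^\<^sub>m k) $$ (i, l) * X $$ (l, j)) - (\<Sum>l<n. (Y ^\<^sub>m k) $$ (i, l) * Y $$ (l, j))"
    using assms(1-3,5) Suc.prems by (simp add: mat_mult_index [of _ n] del: index_mult_mat(1))
  also have "\<dots> = (\<Sum>l<n. (X ^\<^sub>m k) $$ (i, l) * (t * B $$ (l, j))
      + ((X ^\<^sub>m k) $$ (i, l) - (Y ^\<^sub>m k) $$ (i, l)) * Y $$ (l, j))"
    unfolding sum_subtractf [symmetric]
  proof (intro sum.cong refl)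
    fix l assume "l \<in> {..<n}"
    then have "X $$ (l, j) = Y $$ (l, j) + t * B $$ (l, j)"
      using assms(2-4) Suc.prems by simp
    then show "(X ^\<^sub>m k) $$ (i, l) * X $$ (l, j) - (Y ^\<^sub>m k) $$ (i, l) * Y $$ (l, j)
      = (X ^\<^sub>m k) $$ (i, l) * (t * B $$ (l, j)) + ((X ^\<^sub>m k) $$ (i, l) - (Y ^\<^sub>m k) $$ (i, l)) * Y $$ (l, j)"
      by (simp add: algebra_simps)
  qed
  also have "\<dots> = (\<Sum>l<n. (X ^\<^sub>m k) $$ (i, l) * (t * B $$ (l, j)) + (t * mat_ddiff X B Y k $$ (i, l)) * Y $$ (l, j))"
    by (intro sum.cong refl) (simp add: Suc.IH)
  also have "\<dots> = t * (X ^\<^sub>m k * B + mat_ddiff X B Y k * Y) $$ (i, j)"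
  proof -
    have c: "X ^\<^sub>m k \<in> carrier_mat n n" "mat_ddiff X B Y k \<in> carrier_mat n n"
      using assms(1-3) by auto
    have "(X ^\<^sub>m k * B + mat_ddiff X B Y k * Y) $$ (i, j) = (X ^\<^sub>m k * B) $$ (i, j) + (mat_ddiff X B Y k * Y) $$ (i, j)"
      using c assms(3,5) Suc.prems by (subst index_add_mat(1)) auto
    then show ?thesis
      unfolding mat_mult_index [OF c(1) assms(2,5) Suc.prems] mat_mult_index [OF c(2) assms(3,5) Suc.prems]
      by (simp add: sum.distrib sum_distrib_left algebra_simps)
  qed
  finally show ?case
    by simp
qed

lemma upper_block_index:
  assumes "X \<in> carrier_mat n n" "B \<in> carrier_mat n n" "Y \<in> carrier_mat n n" "k < n + n" "l < n + n"
  shows "upper_block X B Y $$ (k, l) = (if k < n then if l < n then X $$ (k, l) else B $$ (k, l - n)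
    else if l < n then 0 else Y $$ (k - n, l - n))"
  using assms by auto

lemma mps_upper_block_index:
  assumes "entire f" "X \<in> carrier_mat n n" "B \<in> carrier_mat n n" "Y \<in> carrier_mat n n" "i < n" "j < n"
  shows "(\<lambda>k. fps_nth f k * mat_ddiff X B Y k $$ (i, j)) sums (mps f (upper_block X B Y) $$ (i, n + j))"
proof -
  have "upper_block X B Y \<in> carrier_mat (n + n) (n + n)"
    using assms by auto
  from mps_sums [OF assms(1) this, of i "n + j"] assms(5,6)
  have "(\<lambda>k. fps_nth f k * (upper_block X B Y ^\<^sub>m k) $$ (i, n + j)) sums (mps f (upper_block X B Y) $$ (i, n + j))"
    by simp
  moreover have "(upper_block X B Y ^\<^sub>m k) $$ (i, n + j) = mat_ddiff X B Y k $$ (i, j)" for k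
  proof -
    have "dim_row (X ^\<^sub>m k) = n" "dim_col (X ^\<^sub>m k) = n" "dim_row (Y ^\<^sub>m k) = n" "dim_col (Y ^\<^sub>m k) = n"
      using pow_carrier_mat [OF assms(2), of k] pow_carrier_mat [OF assms(4), of k] by auto
    then show ?thesis
      unfolding upper_block_pow [OF assms(2-4)] using assms(5,6) by simp
  qed
  ultimately show ?thesis
    by simp
qed

text \<open>The difference quotient is, for t not 0, exactly an off-diagonal entry of a power series
  in a block matrix. That entry is continuous in t also at 0, so the limit is its value
  there.\<close>

lemma mps_has_derivative:
  fixes A :: "'a::{real_normed_field, banach} mat"
  assumes f: "entire f" and A: "A \<in> carrier_mat n n" and B: "B \<in> carrier_mat n n" and ij: "i < n" "j < n"
  shows "((\<lambda>t. mps f (A + t \<cdot>\<^sub>m B) $$ (i, j)) has_field_derivative mps f (upper_block A B A) $$ (i, n + j)) (at 0)"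
proof -
  define g where "g t = mps f (upper_block (A + t \<cdot>\<^sub>m B) B A) $$ (i, n + j)" for t
  have diff: "mps f (A + t \<cdot>\<^sub>m B) $$ (i, j) - mps f A $$ (i, j) = t * g t" for t
  proof (rule sums_unique2)
    have At: "A + t \<cdot>\<^sub>m B \<in> carrier_mat n n"
      using A B by simp
    show "(\<lambda>k. fps_nth f k * ((A + t \<cdot>\<^sub>m B) ^\<^sub>m k) $$ (i, j) - fps_nth f k * (A ^\<^sub>m k) $$ (i, j))
        sums (mps f (A + t \<cdot>\<^sub>m B) $$ (i, j) - mps f A $$ (i, j))"
      by (intro sums_diff mps_sums [of _ _ n] f A At ij)
    have "fps_nth f k * ((A + t \<cdot>\<^sub>m B) ^\<^sub>m k) $$ (i, j) - fps_nth f k * (A ^\<^sub>m k) $$ (i, j)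
        = t * (fps_nth f k * mat_ddiff (A + t \<cdot>\<^sub>m B) B A k $$ (i, j))" for k
      unfolding right_diff_distrib [symmetric] mat_pow_diff [OF At B A refl ij] by simp
    then show "(\<lambda>k. fps_nth f k * ((A + t \<cdot>\<^sub>m B) ^\<^sub>m k) $$ (i, j) - fps_nth f k * (A ^\<^sub>m k) $$ (i, j)) sums (t * g t)"
      using sums_mult [OF mps_upper_block_index [OF f At B A ij], of t] unfolding g_def by (simp only:)
  qed
  have "continuous_on UNIV g"
    unfolding g_def
  proof (rule continuous_on_mps [OF f, where n = "n + n"])
    fix k l assume "k < n + n" "l < n + n"
    then have "upper_block (A + t \<cdot>\<^sub>m B) B A $$ (k, l) = (if k < n then if l < n then A $$ (k, l) + t * B $$ (k, l)
        else B $$ (k, l - n) else if l < n then 0 else A $$ (k - n, l - n))" for t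
      using A B by (subst upper_block_index [of _ n]) auto
    then show "continuous_on UNIV (\<lambda>t. upper_block (A + t \<cdot>\<^sub>m B) B A $$ (k, l))"
      by (cases "k < n"; cases "l < n") (auto intro!: continuous_intros)
  qed (use A B ij in auto)
  then have "(g \<longlongrightarrow> g 0) (at 0)"
    by (simp add: continuous_on_def)
  moreover have "A + 0 \<cdot>\<^sub>m B = A"
    by (rule eq_matI) (use A B in auto)
  then have "g 0 = mps f (upper_block A B A) $$ (i, n + j)"
    by (simp add: g_def)
  moreover have "\<forall>\<^sub>F t in at 0. g t = (mps f (A + t \<cdot>\<^sub>m B) $$ (i, j) - mps f (A + 0 \<cdot>\<^sub>m B) $$ (i, j)) / t"
    unfolding eventually_at_filter
    by (rule always_eventually) (use diff \<open>A + 0 \<cdot>\<^sub>m B = A\<close> in simp)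
  ultimately have "((\<lambda>t. (mps f (A + t \<cdot>\<^sub>m B) $$ (i, j) - mps f (A + 0 \<cdot>\<^sub>m B) $$ (i, j)) / t)
      \<longlongrightarrow> mps f (upper_block A B A) $$ (i, n + j)) (at 0)"
    by (simp add: tendsto_cong)
  then show ?thesis
    unfolding DERIV_def by simp
qed

text \<open>Induction over all matrix sizes: the derivative is again an entry of a power series, of
  a matrix of twice the size that still depends affinely on p, so the hypothesis applies to
  it.\<close>

lemma Ck_on_mps:
  fixes M :: "('v \<Rightarrow> 'k::rc_field) \<Rightarrow> 'k mat"
  assumes "entire f"
    and "\<And>p. M p \<in> carrier_mat n n" "\<And>\<alpha>. L \<alpha> \<in> carrier_mat n n"
    and "\<And>i j. i < n \<Longrightarrow> j < n \<Longrightarrow> continuous_on U (\<lambda>p. M p $$ (i, j))"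
    and "\<And>p \<alpha> t. p \<in> U \<Longrightarrow> \<alpha> \<in> W \<Longrightarrow> M (p + fscale t \<alpha>) = M p + t \<cdot>\<^sub>m L \<alpha>"
    and "i < n" "j < n"
  shows "Ck_on k W U (\<lambda>p. mps f (M p) $$ (i, j))"
  using assms(2-)
proof (induction k arbitrary: n M L i j)
  case 0
  then show ?case
    using continuous_on_mps [OF assms(1), of M n U i j] by simp
next
  case (Suc k)
  show ?case
  proof (rule Ck_on_SucI [where f' = "\<lambda>\<alpha> p. mps f (upper_block (M p) (L \<alpha>) (M p)) $$ (i, n + j)"])
    show "continuous_on U (\<lambda>p. mps f (M p) $$ (i, j))"
      by (rule continuous_on_mps [OF assms(1) Suc.prems(1,3,5,6)])
  next
    fix \<alpha> p assume "\<alpha> \<in> W" "p \<in> U"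
    show "((\<lambda>t. mps f (M (p + fscale t \<alpha>)) $$ (i, j)) has_field_derivative
        mps f (upper_block (M p) (L \<alpha>) (M p)) $$ (i, n + j)) (at 0)"
      unfolding Suc.prems(4) [OF \<open>p \<in> U\<close> \<open>\<alpha> \<in> W\<close>]
      by (rule mps_has_derivative [OF assms(1) Suc.prems(1,2,5,6)])
  next
    fix \<alpha> assume \<alpha>: "\<alpha> \<in> W"
    \<comment> \<open>The off-diagonal block \<open>L \<alpha>\<close> does not move with p; hence
      the slope of the doubled matrix is block diagonal.\<close>
    let ?L = "\<lambda>\<beta>. four_block_mat (L \<beta>) (0\<^sub>m n n) (0\<^sub>m n n) (L \<beta>)"
    have dim: "dim_row (M p) = n" "dim_col (M p) = n" "dim_row (L \<beta>) = n" "dim_col (L \<beta>) = n" for p \<beta>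
      using Suc.prems(1) [of p] Suc.prems(2) [of \<beta>] by auto
    show "Ck_on k W U (\<lambda>p. mps f (upper_block (M p) (L \<alpha>) (M p)) $$ (i, n + j))"
    proof (rule Suc.IH [of _ "n + n" ?L])
      show "continuous_on U (\<lambda>p. upper_block (M p) (L \<alpha>) (M p) $$ (k, l))" if "k < n + n" "l < n + n" for k l
        unfolding upper_block_index [OF Suc.prems(1,2,1) that]
        using that Suc.prems(3) by (cases "k < n"; cases "l < n") auto
      show "upper_block (M (p + fscale t \<beta>)) (L \<alpha>) (M (p + fscale t \<beta>))
          = upper_block (M p) (L \<alpha>) (M p) + t \<cdot>\<^sub>m ?L \<beta>" if "p \<in> U" "\<beta> \<in> W" for p \<beta> t
        unfolding Suc.prems(4) [OF that] by (rule eq_matI) (auto simp: dim not_less)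
    qed (use Suc.prems(1,2,5,6) in \<open>auto simp: dim\<close>)
  qed
qed

section \<open>Finite-dimensional spaces in coordinates\<close>

lemma lin_on_UNIV: "lin_on s t UNIV f \<longleftrightarrow> (\<forall>x y. f (x + y) = f x + f y) \<and> (\<forall>c x. f (s c x) = t c (f x))"
  by (simp add: lin_on_def)

lemma dual_UNIV: "dual s UNIV = {\<xi>. lin_on s (*) UNIV \<xi>}"
  by (simp add: dual_def)

lemma lin_on_sum:
  assumes "Vector_Spaces.vector_space s" "Modules.module.subspace s V" "lin_on s t V f" "Vector_Spaces.vector_space t" "\<And>i. i \<in> I \<Longrightarrow> x i \<in> V"
  shows "f (\<Sum>i\<in>I. s (a i) (x i)) = (\<Sum>i\<in>I. t (a i) (f (x i)))"
proof -
  interpret S: Vector_Spaces.vector_space s by fact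
  interpret T: Vector_Spaces.vector_space t by fact
  have "f 0 = 0"
  proof -
    have "f (s 0 0) = t 0 (f 0)"
      using assms(2,3) S.subspace_0 unfolding lin_on_def by blast
    then show ?thesis by simp
  qed
  show ?thesis
    using assms(5)
  proof (induction I rule: infinite_finite_induct)
    case (insert i I)
    have "s (a i) (x i) \<in> V" "(\<Sum>i\<in>I. s (a i) (x i)) \<in> V"
      using insert assms(2) by (auto intro!: S.subspace_sum S.subspace_scale)
    then show ?case
      using insert assms(3) by (simp add: lin_on_def)
  qed (simp_all add: \<open>f 0 = 0\<close>)
qed

lemma dual_sum:
  fixes s :: "'k::rc_field \<Rightarrow> 'v::ab_group_add \<Rightarrow> 'v"
  assumes "Vector_Spaces.vector_space s" "Modules.module.subspace s V" "\<xi> \<in> dual s V" "\<And>i. i \<in> I \<Longrightarrow> x i \<in> V"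
  shows "\<xi> (\<Sum>i\<in>I. s (a i) (x i)) = (\<Sum>i\<in>I. a i * \<xi> (x i))"
proof (rule lin_on_sum [OF assms(1,2), where t = "(*)"])
  show "Vector_Spaces.vector_space ((*) :: 'k \<Rightarrow> 'k \<Rightarrow> 'k)"
    by unfold_locales (auto simp: algebra_simps)
qed (use assms in \<open>auto simp: dual_def\<close>)

lemma coord_basis:
  assumes "Vector_Spaces.vector_space s" "distinct bs" "\<not> Modules.module.dependent s (set bs)" "Modules.module.span s (set bs) = V"
  shows "v \<in> V \<Longrightarrow> v = (\<Sum>i<length bs. s (coord s bs v i) (bs ! i))"
    and "i < length bs \<Longrightarrow> j < length bs \<Longrightarrow> coord s bs (bs ! j) i = (if i = j then 1 else 0)"
    and "lin_on s (*) V (\<lambda>v. coord s bs v i)"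
    and "i < length bs \<Longrightarrow> bs ! i \<in> V"
    and "Modules.module.subspace s V"
proof -
  interpret Vector_Spaces.vector_space s by fact
  show "Modules.module.subspace s V"
    using assms(4) by auto
  show "lin_on s (*) V (\<lambda>v. coord s bs v i)"
    using assms unfolding lin_on_def coord_def
    by (auto simp: representation_add representation_scale)
  show "bs ! i \<in> V" if "i < length bs"
    using assms(4) span_base that by auto
  show "coord s bs (bs ! j) i = (if i = j then 1 else 0)" if "i < length bs" "j < length bs"
    using that assms(2,3) by (simp add: coord_def representation_basis nth_eq_iff_index_eq)
  show "v = (\<Sum>i<length bs. s (coord s bs v i) (bs ! i))" if "v \<in> V"
  proof -
    have "v = (\<Sum>b\<in>set bs. s (representation (set bs) v b) b)"
      using that assms by (intro sum_representation_eq [symmetric]) auto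
    also have "\<dots> = (\<Sum>i<length bs. s (coord s bs v i) (bs ! i))"
      unfolding coord_def
      by (rule sum.reindex_bij_betw [symmetric]) (rule bij_betw_nth [OF assms(2) refl refl])
    finally show ?thesis .
  qed
qed

lemma basis_of:
  assumes "Vector_Spaces.vector_space s" "Modules.module.subspace s V" "finite B" "V \<subseteq> Modules.module.span s B"
  shows "distinct (basis_of s V)" "\<not> Modules.module.dependent s (set (basis_of s V))"
    "Modules.module.span s (set (basis_of s V)) = V"
proof -
  interpret Vector_Spaces.vector_space s by fact
  obtain C where C: "C \<subseteq> V" "independent C" "V \<subseteq> span C"
    using maximal_independent_subset by blast
  have "finite C"
    using independent_span_bound [OF assms(3) C(2)] C(1) assms(4) by blast
  then obtain bs where bs: "set bs = C" "distinct bs"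
    using finite_distinct_list by blast
  have "span C = V"
    using C assms(2) by (simp add: span_minimal subset_antisym)
  with bs C(2) have "\<exists>bs. distinct bs \<and> independent (set bs) \<and> span (set bs) = V"
    by blast
  from someI_ex [OF this]
  show "distinct (basis_of s V)" "independent (set (basis_of s V))" "span (set (basis_of s V)) = V"
    unfolding basis_of_def by blast+
qed

text \<open>Here the space is a whole type. The double, which lives on a set of pairs of vectors and
  functions, is brought into this form later by a basis.\<close>

locale fin_vs = Vector_Spaces.vector_space s for s :: "'k::rc_field \<Rightarrow> 'v::ab_group_add \<Rightarrow> 'v" +
  assumes finite_span: "\<exists>B. finite B \<and> span B = UNIV"
begin

abbreviation "lin \<equiv> lin_on s s UNIV"
abbreviation "forms \<equiv> dual s UNIV"

definition "bas = (!) (basis_of s UNIV)"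
definition "cof i v = coord s (basis_of s UNIV) v i"
definition "dm = length (basis_of s UNIV)"

lemma basis_facts:
  "v = (\<Sum>i<dm. s (cof i v) (bas i))"
  "i < dm \<Longrightarrow> j < dm \<Longrightarrow> cof i (bas j) = (if i = j then 1 else 0)"
  "cof i \<in> forms"
proof -
  obtain B where B: "finite B" "span B = UNIV"
    using finite_span by blast
  have *: "Vector_Spaces.vector_space s"
    by unfold_locales
  note b = basis_of [OF * subspace_UNIV B(1)]
  note c = coord_basis [OF * b]
  show "v = (\<Sum>i<dm. s (cof i v) (bas i))"
    using c(1) [of v] B by (simp add: dm_def cof_def bas_def)
  show "i < dm \<Longrightarrow> j < dm \<Longrightarrow> cof i (bas j) = (if i = j then 1 else 0)"
    using c(2) B by (simp add: dm_def cof_def bas_def)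
  show "cof i \<in> forms"
    using c(3) [of i] B by (simp add: cof_def [abs_def] dual_def)
qed

lemma lin_add: "lin A \<Longrightarrow> A (x + y) = A x + A y"
  and lin_scale: "lin A \<Longrightarrow> A (s c x) = s c (A x)"
  by (simp_all add: lin_on_UNIV)

lemma lin_linear: "lin A \<Longrightarrow> Vector_Spaces.linear s s A"
  by unfold_locales (simp_all add: lin_on_UNIV)

lemma lin_zero: "lin A \<Longrightarrow> A 0 = 0"
  using lin_scale [of A 0 0] by simp

lemma lin_neg: "lin A \<Longrightarrow> A (- x) = - A x"
  using lin_scale [of A "- 1" x] by simp

lemma lin_diff: "lin A \<Longrightarrow> A (x - y) = A x - A y"
  using lin_add [of A x "- y"] by (simp add: lin_neg)

lemma lin_sum: "lin A \<Longrightarrow> A (sum f I) = (\<Sum>i\<in>I. A (f i))"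
  by (induction I rule: infinite_finite_induct) (simp_all add: lin_zero lin_add)

lemma lin_pow: "lin A \<Longrightarrow> lin (A ^^ n)"
  by (induction n) (auto simp: lin_on_UNIV)

lemma lin_comp: "lin A \<Longrightarrow> lin B \<Longrightarrow> lin (\<lambda>x. A (B x))"
  by (simp add: lin_on_UNIV)

lemma lin_plus: "lin A \<Longrightarrow> lin B \<Longrightarrow> lin (\<lambda>x. A x + B x)"
  by (simp add: lin_on_UNIV scale_right_distrib add_ac)

lemma lin_minus: "lin A \<Longrightarrow> lin B \<Longrightarrow> lin (\<lambda>x. A x - B x)"
  by (simp add: lin_on_UNIV scale_right_diff_distrib)

lemma form_add: "\<xi> \<in> forms \<Longrightarrow> \<xi> (x + y) = \<xi> x + \<xi> y"
  and form_scale: "\<xi> \<in> forms \<Longrightarrow> \<xi> (s c x) = c * \<xi> x"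
  by (simp_all add: dual_UNIV lin_on_UNIV)

lemma form_zero: "\<xi> \<in> forms \<Longrightarrow> \<xi> 0 = 0"
  using form_scale [of \<xi> 0 0] by simp

lemma form_neg: "\<xi> \<in> forms \<Longrightarrow> \<xi> (- x) = - \<xi> x"
  using form_scale [of \<xi> "- 1" x] by simp

lemma form_diff: "\<xi> \<in> forms \<Longrightarrow> \<xi> (x - y) = \<xi> x - \<xi> y"
  using form_add [of \<xi> x "- y"] by (simp add: form_neg)

lemma form_sum: "\<xi> \<in> forms \<Longrightarrow> \<xi> (sum f I) = (\<Sum>i\<in>I. \<xi> (f i))"
  by (induction I rule: infinite_finite_induct) (simp_all add: form_zero form_add)

lemma form_comp: "\<xi> \<in> forms \<Longrightarrow> lin A \<Longrightarrow> (\<lambda>x. \<xi> (A x)) \<in> forms"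
  by (simp add: dual_UNIV lin_on_UNIV)

lemma form_expand: "\<xi> \<in> forms \<Longrightarrow> \<xi> v = (\<Sum>i<dm. cof i v * \<xi> (bas i))"
  by (subst basis_facts(1) [of v]) (simp add: form_sum form_scale)

lemma forms_eqI: "(\<And>\<xi>. \<xi> \<in> forms \<Longrightarrow> \<xi> v = \<xi> w) \<Longrightarrow> v = w"
proof -
  assume h: "\<And>\<xi>. \<xi> \<in> forms \<Longrightarrow> \<xi> v = \<xi> w"
  have "v = (\<Sum>i<dm. s (cof i v) (bas i))"
    by (rule basis_facts(1))
  also have "\<dots> = (\<Sum>i<dm. s (cof i w) (bas i))"
    by (simp add: h basis_facts(3))
  finally show "v = w"
    by (simp flip: basis_facts(1))
qed

lemma cof_sum: "i < dm \<Longrightarrow> cof i (\<Sum>j<dm. s (a j) (bas j)) = a i"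
proof -
  assume i: "i < dm"
  have "cof i (\<Sum>j<dm. s (a j) (bas j)) = (\<Sum>j<dm. a j * cof i (bas j))"
    using basis_facts(3) by (simp add: form_sum form_scale)
  also have "\<dots> = (\<Sum>j<dm. if j = i then a j else 0)"
    using i by (intro sum.cong refl) (auto simp: basis_facts(2))
  finally show ?thesis
    using i by simp
qed

definition opmat :: "('v \<Rightarrow> 'v) \<Rightarrow> 'k mat" where
  "opmat A = Matrix.mat dm dm (\<lambda>(i, j). cof i (A (bas j)))"

lemma opmat_carrier [simp]: "opmat A \<in> carrier_mat dm dm"
  by (simp add: opmat_def)

lemma opmat_index: "i < dm \<Longrightarrow> j < dm \<Longrightarrow> opmat A $$ (i, j) = cof i (A (bas j))"
  by (simp add: opmat_def)

lemma cof_op: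
  assumes "lin A"
  shows "cof i (A v) = (\<Sum>j<dm. cof i (A (bas j)) * cof j v)"
  using form_expand [OF form_comp [OF basis_facts(3) assms], of i v] by (simp add: mult.commute)

lemma opmat_pow:
  assumes "lin A" "i < dm" "j < dm"
  shows "(opmat A ^\<^sub>m n) $$ (i, j) = cof i ((A ^^ n) (bas j))"
  using assms(3)
proof (induction n arbitrary: j)
  case 0
  have "dim_row (opmat A) = dm"
    by (simp add: opmat_def)
  with 0 show ?case
    using assms(2) by (simp add: basis_facts(2))
next
  case (Suc n)
  have "(opmat A ^\<^sub>m Suc n) $$ (i, j) = (\<Sum>k<dm. cof i ((A ^^ n) (bas k)) * cof k (A (bas j)))"
    using mat_mult_index [OF pow_carrier_mat [OF opmat_carrier] opmat_carrier assms(2) Suc.prems, of A n A]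
      Suc assms(2) by (simp add: opmat_index)
  also have "\<dots> = cof i ((A ^^ n) (A (bas j)))"
    by (rule cof_op [OF lin_pow [OF assms(1)], symmetric])
  finally show ?case
    by (simp add: funpow_swap1)
qed

lemma form_op_pow:
  assumes "lin A" "\<xi> \<in> forms"
  shows "\<xi> ((A ^^ n) v) = (\<Sum>i<dm. \<Sum>j<dm. \<xi> (bas i) * ((opmat A ^\<^sub>m n) $$ (i, j) * cof j v))"
proof -
  have "\<xi> ((A ^^ n) v) = (\<Sum>i<dm. cof i ((A ^^ n) v) * \<xi> (bas i))"
    by (rule form_expand [OF assms(2)])
  also have "\<dots> = (\<Sum>i<dm. \<Sum>j<dm. \<xi> (bas i) * ((opmat A ^\<^sub>m n) $$ (i, j) * cof j v))"
    by (intro sum.cong refl, subst cof_op [OF lin_pow [OF assms(1)]])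
      (simp add: sum_distrib_right sum_distrib_left opmat_pow assms algebra_simps)
  finally show ?thesis .
qed

section \<open>Power series of operators\<close>

definition of_mat :: "'k mat \<Rightarrow> 'v \<Rightarrow> 'v" where
  "of_mat M v = (\<Sum>i<dm. s (\<Sum>j<dm. M $$ (i, j) * cof j v) (bas i))"

text \<open>Defined in coordinates, but characterised without a basis by \<open>ps_sums\<close> and
  \<open>ps_eqI\<close>: convergence of the series on every form.\<close>

definition ps :: "'k fps \<Rightarrow> ('v \<Rightarrow> 'v) \<Rightarrow> 'v \<Rightarrow> 'v" where
  "ps f A = of_mat (mps f (opmat A))"

lemma lin_of_mat: "lin (of_mat M)"
  unfolding lin_on_UNIV of_mat_def
  using basis_facts(3)
  by (simp add: form_add form_scale distrib_left sum.distrib scale_left_distrib scale_sum_right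
      sum_distrib_left mult.left_commute)

lemma form_of_mat: "\<xi> \<in> forms \<Longrightarrow> \<xi> (of_mat M v) = (\<Sum>i<dm. \<Sum>j<dm. \<xi> (bas i) * (M $$ (i, j) * cof j v))"
  unfolding of_mat_def by (simp add: form_sum form_scale sum_distrib_right sum_distrib_left mult.commute)

lemma lin_ps: "lin (ps f A)"
  by (simp add: ps_def lin_of_mat)

lemma ps_sums:
  assumes "entire f" "lin A" "\<xi> \<in> forms"
  shows "(\<lambda>n. fps_nth f n * \<xi> ((A ^^ n) v)) sums \<xi> (ps f A v)"
proof -
  have "(\<lambda>n. \<Sum>i<dm. \<Sum>j<dm. \<xi> (bas i) * ((fps_nth f n * (opmat A ^\<^sub>m n) $$ (i, j)) * cof j v)) sums \<xi> (ps f A v)"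
    unfolding ps_def form_of_mat [OF assms(3)]
    by (intro sums_sum sums_mult sums_mult2 mps_sums [of _ _ dm] assms opmat_carrier) auto
  then show ?thesis
    by (simp add: form_op_pow [OF assms(2,3)] sum_distrib_left mult_ac)
qed

lemma ps_abs_summable:
  assumes "entire f" "lin A" "\<xi> \<in> forms"
  shows "summable (\<lambda>n. norm (fps_nth f n * \<xi> ((A ^^ n) v)))"
proof (rule summable_comparison_test')
  show "summable (\<lambda>n. \<Sum>i<dm. \<Sum>j<dm. norm (\<xi> (bas i)) * (norm (fps_nth f n * (opmat A ^\<^sub>m n) $$ (i, j)) * norm (cof j v)))"
    by (intro summable_sum summable_mult summable_mult2 mps_abs_summable [of _ _ dm] assms opmat_carrier) auto
  fix n
  have *: "fps_nth f n * \<xi> ((A ^^ n) v) = (\<Sum>i<dm. \<Sum>j<dm. \<xi> (bas i) * ((fps_nth f n * (opmat A ^\<^sub>m n) $$ (i, j)) * cof j v))"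
    by (simp add: form_op_pow [OF assms(2,3)] sum_distrib_left mult_ac)
  have "norm (fps_nth f n * \<xi> ((A ^^ n) v)) \<le> (\<Sum>i<dm. \<Sum>j<dm. norm (\<xi> (bas i) * ((fps_nth f n * (opmat A ^\<^sub>m n) $$ (i, j)) * cof j v)))"
    unfolding * by (rule order.trans [OF norm_sum sum_mono [OF norm_sum]])
  then show "norm (norm (fps_nth f n * \<xi> ((A ^^ n) v)))
      \<le> (\<Sum>i<dm. \<Sum>j<dm. norm (\<xi> (bas i)) * (norm (fps_nth f n * (opmat A ^\<^sub>m n) $$ (i, j)) * norm (cof j v)))"
    by (simp only: norm_mult real_norm_def abs_mult abs_norm_cancel)
qed

lemma ps_eqI:
  assumes "entire f" "lin A" "\<And>\<xi>. \<xi> \<in> forms \<Longrightarrow> (\<lambda>n. fps_nth f n * \<xi> ((A ^^ n) v)) sums \<xi> w"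
  shows "ps f A v = w"
  by (rule forms_eqI) (rule sums_unique2 [OF ps_sums [OF assms(1,2)] assms(3)])

lemma ps_form_zero:
  assumes "entire f" "lin A" "\<xi> \<in> forms" "\<And>n. fps_nth f n \<noteq> 0 \<Longrightarrow> \<xi> ((A ^^ n) v) = 0"
  shows "\<xi> (ps f A v) = 0"
proof -
  have "fps_nth f n * \<xi> ((A ^^ n) v) = 0" for n
    using assms(4) [of n] by (cases "fps_nth f n = 0") simp_all
  with ps_sums [OF assms(1-3), of v] have "(\<lambda>n. 0) sums \<xi> (ps f A v)"
    by simp
  then show ?thesis
    using sums_unique2 [OF _ sums_zero] by blast
qed

text \<open>T A = B T gives T A^n = B^n T for every n, and limits on forms are unique.\<close>

lemma ps_intertwine:
  assumes "entire f" "lin A" "lin B" "lin T" "\<And>v. T (A v) = B (T v)"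
  shows "T (ps f A v) = ps f B (T v)"
proof (rule ps_eqI [symmetric, OF assms(1,3)])
  fix \<xi> assume "\<xi> \<in> forms"
  from ps_sums [OF assms(1,2) form_comp [OF this assms(4)]]
  have "(\<lambda>n. fps_nth f n * \<xi> (T ((A ^^ n) v))) sums \<xi> (T (ps f A v))" .
  moreover have "T ((A ^^ n) v) = (B ^^ n) (T v)" for n
    by (induction n) (simp_all add: assms(5))
  ultimately show "(\<lambda>n. fps_nth f n * \<xi> ((B ^^ n) (T v))) sums \<xi> (T (ps f A v))"
    by simp
qed

lemma ps_add: "entire f \<Longrightarrow> entire g \<Longrightarrow> lin A \<Longrightarrow> ps (f + g) A v = ps f A v + ps g A v"
proof (rule ps_eqI)
  assume *: "entire f" "entire g" "lin A"
  fix \<xi> assume "\<xi> \<in> forms"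
  then show "(\<lambda>n. fps_nth (f + g) n * \<xi> ((A ^^ n) v)) sums \<xi> (ps f A v + ps g A v)"
    using sums_add [OF ps_sums [OF *(1,3)] ps_sums [OF *(2,3)]] by (simp add: form_add distrib_right)
qed (auto intro: entire_add)

lemma ps_const: "lin A \<Longrightarrow> ps (fps_const c) A v = s c v"
proof (rule ps_eqI [OF entire_const])
  fix \<xi> assume \<xi>: "\<xi> \<in> forms"
  have "(\<lambda>n. fps_nth (fps_const c) n * \<xi> ((A ^^ n) v)) sums (\<Sum>n\<in>{0}. fps_nth (fps_const c) n * \<xi> ((A ^^ n) v))"
    by (intro sums_finite) auto
  then show "(\<lambda>n. fps_nth (fps_const c) n * \<xi> ((A ^^ n) v)) sums \<xi> (s c v)"
    using \<xi> by (simp add: form_scale)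
qed

lemma ps_mult: 
  assumes "entire f" "entire g" "lin A"
  shows "ps (f * g) A v = ps f A (ps g A v)"
proof (rule forms_eqI)
  fix \<xi> assume \<xi>: "\<xi> \<in> forms"
  have "cof j (ps g A v) = (\<Sum>k<dm. mps g (opmat A) $$ (j, k) * cof k v)" if "j < dm" for j
    using that by (simp add: ps_def of_mat_def cof_sum)
  then have "\<xi> (ps f A (ps g A v)) = (\<Sum>i<dm. \<Sum>j<dm. \<xi> (bas i) * (mps f (opmat A) $$ (i, j) * (\<Sum>k<dm. mps g (opmat A) $$ (j, k) * cof k v)))"
    by (subst ps_def) (simp add: form_of_mat [OF \<xi>])
  also have "\<dots> = (\<Sum>i<dm. \<Sum>k<dm. \<xi> (bas i) * ((\<Sum>j<dm. mps f (opmat A) $$ (i, j) * mps g (opmat A) $$ (j, k)) * cof k v))"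
    by (rule sum.cong [OF refl]) (simp add: sum_distrib_left sum_distrib_right mult_ac, rule sum.swap)
  also have "\<dots> = (\<Sum>i<dm. \<Sum>k<dm. \<xi> (bas i) * (mps (f * g) (opmat A) $$ (i, k) * cof k v))"
    by (intro sum.cong refl) (simp add: mps_mult [OF assms(1,2), of _ dm] mat_mult_index [of _ dm] del: index_mult_mat(1))
  also have "\<dots> = \<xi> (ps (f * g) A v)"
    by (simp add: ps_def form_of_mat [OF \<xi>])
  finally show "\<xi> (ps (f * g) A v) = \<xi> (ps f A (ps g A v))"
    by simp
qed

text \<open>In coordinates this is the Cauchy product of scalar series. It reduces every later
  identity between brackets of series in ad p to an identity between binomial coefficients.\<close>

lemma ps_Cauchy:
  assumes "entire f" "entire g" "lin A" "lin B"
    and \<beta>: "\<And>y. (\<lambda>x. \<beta> x y) \<in> forms" "\<And>x. \<beta> x \<in> forms"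
  shows "(\<lambda>n. \<Sum>i\<le>n. fps_nth f i * fps_nth g (n - i) * \<beta> ((A ^^ i) u) ((B ^^ (n - i)) v)) sums \<beta> (ps f A u) (ps g B v)"
proof -
  have expand: "\<beta> x y = (\<Sum>i<dm. \<Sum>j<dm. \<beta> (bas i) (bas j) * (cof i x * cof j y))" for x y
    using form_expand [OF \<beta>(1), of x y] form_expand [OF \<beta>(2), of _ y]
    by (simp add: sum_distrib_left mult_ac)
  have cauchy: "(\<lambda>n. \<Sum>a\<le>n. (fps_nth f a * cof i ((A ^^ a) u)) * (fps_nth g (n - a) * cof j ((B ^^ (n - a)) v)))
      sums (cof i (ps f A u) * cof j (ps g B v))" for i j
    using Cauchy_product_sums [OF ps_abs_summable [OF assms(1,3) basis_facts(3), of i u] ps_abs_summable [OF assms(2,4) basis_facts(3), of j v]]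
    unfolding sums_unique [OF ps_sums [OF assms(1,3) basis_facts(3)], symmetric]
      sums_unique [OF ps_sums [OF assms(2,4) basis_facts(3)], symmetric] .
  have "(\<lambda>n. \<Sum>i<dm. \<Sum>j<dm. \<beta> (bas i) (bas j) * (\<Sum>a\<le>n. (fps_nth f a * cof i ((A ^^ a) u)) * (fps_nth g (n - a) * cof j ((B ^^ (n - a)) v))))
      sums (\<Sum>i<dm. \<Sum>j<dm. \<beta> (bas i) (bas j) * (cof i (ps f A u) * cof j (ps g B v)))"
    by (intro sums_sum sums_mult cauchy)
  also have "(\<Sum>i<dm. \<Sum>j<dm. \<beta> (bas i) (bas j) * (cof i (ps f A u) * cof j (ps g B v))) = \<beta> (ps f A u) (ps g B v)"
    by (rule expand [symmetric])
  also have "(\<lambda>n. \<Sum>i<dm. \<Sum>j<dm. \<beta> (bas i) (bas j) * (\<Sum>a\<le>n. (fps_nth f a * cof i ((A ^^ a) u)) * (fps_nth g (n - a) * cof j ((B ^^ (n - a)) v))))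
      = (\<lambda>n. \<Sum>a\<le>n. fps_nth f a * fps_nth g (n - a) * \<beta> ((A ^^ a) u) ((B ^^ (n - a)) v))"
  proof
    fix n
    have "(\<Sum>i<dm. \<Sum>j<dm. \<beta> (bas i) (bas j) * (\<Sum>a\<le>n. (fps_nth f a * cof i ((A ^^ a) u)) * (fps_nth g (n - a) * cof j ((B ^^ (n - a)) v))))
        = (\<Sum>i<dm. \<Sum>a\<le>n. \<Sum>j<dm. \<beta> (bas i) (bas j) * ((fps_nth f a * cof i ((A ^^ a) u)) * (fps_nth g (n - a) * cof j ((B ^^ (n - a)) v))))"
      unfolding sum_distrib_left by (intro sum.cong refl sum.swap)
    also have "\<dots> = (\<Sum>a\<le>n. \<Sum>i<dm. \<Sum>j<dm. \<beta> (bas i) (bas j) * ((fps_nth f a * cof i ((A ^^ a) u)) * (fps_nth g (n - a) * cof j ((B ^^ (n - a)) v))))"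
      by (rule sum.swap)
    also have "\<dots> = (\<Sum>a\<le>n. fps_nth f a * fps_nth g (n - a) * \<beta> ((A ^^ a) u) ((B ^^ (n - a)) v))"
      by (intro sum.cong refl, subst expand) (simp add: sum_distrib_left mult_ac)
    finally show "(\<Sum>i<dm. \<Sum>j<dm. \<beta> (bas i) (bas j) * (\<Sum>a\<le>n. (fps_nth f a * cof i ((A ^^ a) u)) * (fps_nth g (n - a) * cof j ((B ^^ (n - a)) v))))
      = (\<Sum>a\<le>n. fps_nth f a * fps_nth g (n - a) * \<beta> ((A ^^ a) u) ((B ^^ (n - a)) v))" .
  qed
  finally show ?thesis .
qed

lemma lin_inj_imp_surj:
  assumes "lin A" "\<And>v. A v = 0 \<Longrightarrow> v = 0"
  shows "\<exists>v. A v = w"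
proof -
  obtain B where B: "finite B" "span B = UNIV"
    using finite_span by blast
  then obtain C where C: "C \<subseteq> B" "independent C" "B \<subseteq> span C"
    using maximal_independent_subset by blast
  interpret finite_dimensional_vector_space s C
    using C B finite_subset span_mono [OF C(3)]
    by unfold_locales (auto simp: span_span dest: finite_subset)
  have "inj A"
    using assms lin_diff by (metis eq_iff_diff_eq_0 injI)
  then show ?thesis
    using linear_inj_imp_surj [OF lin_linear [OF assms(1)]] by (metis surjD)
qed

section \<open>Differentiable curves\<close>

text \<open>The derivative of a curve at 0 over the ground field, tested on forms; in finite
  dimension this is ordinary differentiability.\<close>

definition vder :: "('k \<Rightarrow> 'v) \<Rightarrow> 'v \<Rightarrow> bool" where
  "vder F F' \<longleftrightarrow> (\<forall>\<xi>\<in>forms. ((\<lambda>t. \<xi> (F t)) has_field_derivative \<xi> F') (at 0))"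

lemma vder_unique: "vder F F' \<Longrightarrow> vder F F'' \<Longrightarrow> F' = F''"
  unfolding vder_def by (rule forms_eqI) (blast intro: DERIV_unique)

lemma vder_const: "vder (\<lambda>t. v) 0"
  by (auto simp: vder_def form_zero)

lemma vder_add: "vder F F' \<Longrightarrow> vder G G' \<Longrightarrow> vder (\<lambda>t. F t + G t) (F' + G')"
  by (auto simp: vder_def form_add intro!: DERIV_add)

lemma vder_diff: "vder F F' \<Longrightarrow> vder G G' \<Longrightarrow> vder (\<lambda>t. F t - G t) (F' - G')"
  by (auto simp: vder_def form_diff intro!: DERIV_diff)

lemma vder_transform:
  assumes "vder F F'" "\<forall>\<^sub>F t in nhds 0. F t = G t"
  shows "vder G F'"
  unfolding vder_def
proof
  fix \<xi> assume "\<xi> \<in> forms"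
  then have d: "((\<lambda>t. \<xi> (F t)) has_field_derivative \<xi> F') (at 0)"
    using assms(1) by (simp add: vder_def)
  have "\<forall>\<^sub>F t in nhds 0. \<xi> (F t) = \<xi> (G t)"
    using assms(2) by (rule eventually_mono) simp
  from DERIV_cong_ev [OF refl this refl, THEN iffD1, OF d]
  show "((\<lambda>t. \<xi> (G t)) has_field_derivative \<xi> F') (at 0)" .
qed

lemma vder_bilinear:
  assumes \<beta>: "\<And>y. (\<lambda>x. \<beta> x y) \<in> forms" "\<And>x. \<beta> x \<in> forms" and "vder F F'" "vder G G'"
  shows "((\<lambda>t. \<beta> (F t) (G t)) has_field_derivative \<beta> F' (G 0) + \<beta> (F 0) G') (at 0)"
proof -
  have expand: "\<beta> x y = (\<Sum>i<dm. \<Sum>j<dm. \<beta> (bas i) (bas j) * (cof i x * cof j y))" for x y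
    using form_expand [OF \<beta>(1), of x y] form_expand [OF \<beta>(2), of _ y]
    by (simp add: sum_distrib_left mult_ac)
  have "((\<lambda>t. cof i (F t) * cof j (G t)) has_field_derivative cof i F' * cof j (G 0) + cof j G' * cof i (F 0)) (at 0)" for i j
    using assms(3,4) basis_facts(3) unfolding vder_def by (intro DERIV_mult) auto
  then have "((\<lambda>t. \<Sum>i<dm. \<Sum>j<dm. \<beta> (bas i) (bas j) * (cof i (F t) * cof j (G t))) has_field_derivative
      (\<Sum>i<dm. \<Sum>j<dm. \<beta> (bas i) (bas j) * (cof i F' * cof j (G 0) + cof j G' * cof i (F 0)))) (at 0)"
    by (intro DERIV_sum DERIV_cmult)
  then show ?thesis
    by (simp flip: expand add: distrib_left sum.distrib mult.commute [of "cof _ G'"])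
qed

text \<open>The derivative of (A + t B)^n at t = 0, namely the sum of A^i B A^(n-1-i): the operator
  version of \<open>mat_ddiff\<close> with equal diagonal arguments.\<close>

primrec ddiff :: "('v \<Rightarrow> 'v) \<Rightarrow> ('v \<Rightarrow> 'v) \<Rightarrow> nat \<Rightarrow> 'v \<Rightarrow> 'v" where
  "ddiff A B 0 v = 0"
| "ddiff A B (Suc n) v = (A ^^ n) (B v) + ddiff A B n (A v)"

lemma lin_ddiff: "lin A \<Longrightarrow> lin B \<Longrightarrow> lin (ddiff A B n)"
proof (induction n)
  case (Suc n)
  then have "lin (\<lambda>v. (A ^^ n) (B v) + ddiff A B n (A v))"
    by (intro lin_plus lin_comp [of "A ^^ n" B] lin_comp [of "ddiff A B n" A] lin_pow)
  then show ?case
    by (simp add: lin_on_UNIV)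
qed (simp add: lin_on_UNIV)

lemma opmat_ddiff:
  assumes "lin A" "lin B" "i < dm" "j < dm"
  shows "mat_ddiff (opmat A) (opmat B) (opmat A) n $$ (i, j) = cof i (ddiff A B n (bas j))"
  using \<open>j < dm\<close>
proof (induction n arbitrary: j)
  case 0
  then show ?case
    using assms basis_facts(3) by (simp add: opmat_def form_zero)
next
  case (Suc n)
  let ?D = "mat_ddiff (opmat A) (opmat B) (opmat A) n"
  have c: "opmat A ^\<^sub>m n \<in> carrier_mat dm dm" "?D \<in> carrier_mat dm dm"
    by auto
  have "mat_ddiff (opmat A) (opmat B) (opmat A) (Suc n) $$ (i, j) = (opmat A ^\<^sub>m n * opmat B) $$ (i, j) + (?D * opmat A) $$ (i, j)"
    unfolding mat_ddiff.simps using mult_carrier_mat [OF c(2) opmat_carrier [of A]] Suc.prems assms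
    by (intro index_add_mat(1)) auto
  also have "(opmat A ^\<^sub>m n * opmat B) $$ (i, j) = cof i ((A ^^ n) (B (bas j)))"
    unfolding mat_mult_index [OF c(1) opmat_carrier assms(3) Suc.prems]
    using assms Suc.prems by (subst cof_op [OF lin_pow [OF assms(1)]]) (simp add: opmat_pow opmat_index)
  also have "(?D * opmat A) $$ (i, j) = cof i (ddiff A B n (A (bas j)))"
    unfolding mat_mult_index [OF c(2) opmat_carrier assms(3) Suc.prems]
    using assms Suc.prems by (subst cof_op [OF lin_ddiff [OF assms(1,2)]]) (simp add: Suc.IH opmat_index)
  finally show ?case
    using basis_facts(3) by (simp add: form_add)
qed

text \<open>The derivative of f at A in the direction B, read off the upper right block; by
  \<open>dps_sums\<close> it is the termwise derivative.\<close>

definition dps :: "'k fps \<Rightarrow> ('v \<Rightarrow> 'v) \<Rightarrow> ('v \<Rightarrow> 'v) \<Rightarrow> 'v \<Rightarrow> 'v" where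
  "dps f A B = of_mat (Matrix.mat dm dm (\<lambda>(i, j). mps f (upper_block (opmat A) (opmat B) (opmat A)) $$ (i, dm + j)))"

lemma dps_sums:
  assumes "entire f" "lin A" "lin B" "\<xi> \<in> forms"
  shows "(\<lambda>n. fps_nth f n * \<xi> (ddiff A B n v)) sums \<xi> (dps f A B v)"
proof -
  have "(\<lambda>n. \<Sum>i<dm. \<Sum>j<dm. \<xi> (bas i) * ((fps_nth f n * mat_ddiff (opmat A) (opmat B) (opmat A) n $$ (i, j)) * cof j v)) sums \<xi> (dps f A B v)"
    unfolding dps_def form_of_mat [OF assms(4)]
  proof (intro sums_sum sums_mult sums_mult2)
    fix i j assume "i \<in> {..<dm}" "j \<in> {..<dm}"
    then show "(\<lambda>n. fps_nth f n * mat_ddiff (opmat A) (opmat B) (opmat A) n $$ (i, j)) sums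
        (Matrix.mat dm dm (\<lambda>(i, j). mps f (upper_block (opmat A) (opmat B) (opmat A)) $$ (i, dm + j)) $$ (i, j))"
      using mps_upper_block_index [OF assms(1) opmat_carrier opmat_carrier opmat_carrier, of i j A B A] by simp
  qed
  moreover have "\<xi> (ddiff A B n v) = (\<Sum>i<dm. \<Sum>j<dm. \<xi> (bas i) * (mat_ddiff (opmat A) (opmat B) (opmat A) n $$ (i, j) * cof j v))" for n
    unfolding form_expand [OF assms(4), of "ddiff A B n v"]
    by (intro sum.cong refl, subst cof_op [OF lin_ddiff [OF assms(2,3)]])
      (simp add: sum_distrib_right sum_distrib_left opmat_ddiff assms mult_ac)
  ultimately show ?thesis
    by (simp add: sum_distrib_left mult_ac)
qed

lemma opmat_line: "opmat (\<lambda>v. A v + s t (B v)) = opmat A + t \<cdot>\<^sub>m opmat B"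
  by (rule eq_matI) (use basis_facts(3) in \<open>auto simp: opmat_def form_add form_scale\<close>)

lemma vder_ps_const:
  assumes "entire f"
  shows "vder (\<lambda>t. ps f (\<lambda>v. A v + s t (B v)) v) (dps f A B v)"
  unfolding vder_def
proof
  fix \<xi> assume \<xi>: "\<xi> \<in> forms"
  show "((\<lambda>t. \<xi> (ps f (\<lambda>v. A v + s t (B v)) v)) has_field_derivative \<xi> (dps f A B v)) (at 0)"
    unfolding ps_def dps_def form_of_mat [OF \<xi>] opmat_line
  proof (intro DERIV_sum DERIV_cmult DERIV_cmult_right)
    fix i j assume ij: "i \<in> {..<dm}" "j \<in> {..<dm}"
    then show "((\<lambda>t. mps f (opmat A + t \<cdot>\<^sub>m opmat B) $$ (i, j)) has_field_derivative
        Matrix.mat dm dm (\<lambda>(i, j). mps f (upper_block (opmat A) (opmat B) (opmat A)) $$ (i, dm + j)) $$ (i, j)) (at 0)"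
      using mps_has_derivative [OF assms opmat_carrier opmat_carrier, of i j A B] by simp
  qed
qed

lemma vder_ps:
  assumes "entire f" "vder w w'"
  shows "vder (\<lambda>t. ps f (\<lambda>v. A v + s t (B v)) (w t)) (dps f A B (w 0) + ps f A w')"
  unfolding vder_def
proof
  fix \<xi> assume \<xi>: "\<xi> \<in> forms"
  have *: "\<xi> (ps f C v) = (\<Sum>j<dm. \<xi> (ps f C (bas j)) * cof j v)" for C v
    using form_expand [OF form_comp [OF \<xi> lin_ps], of f C v] by (simp add: mult.commute)
  have **: "\<xi> (dps f A B v) = (\<Sum>j<dm. \<xi> (dps f A B (bas j)) * cof j v)" for v
    using form_expand [OF form_comp [OF \<xi> lin_of_mat], of _ v] by (simp add: mult.commute dps_def)
  have "((\<lambda>t. \<xi> (ps f (\<lambda>v. A v + s t (B v)) (bas j)) * cof j (w t)) has_field_derivative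
      \<xi> (dps f A B (bas j)) * cof j (w 0) + cof j w' * \<xi> (ps f (\<lambda>v. A v + s 0 (B v)) (bas j))) (at 0)" for j
    using vder_ps_const [OF assms(1), of A B "bas j"] assms(2) \<xi> basis_facts(3)
    unfolding vder_def by (intro DERIV_mult) auto
  then have "((\<lambda>t. \<Sum>j<dm. \<xi> (ps f (\<lambda>v. A v + s t (B v)) (bas j)) * cof j (w t)) has_field_derivative
      (\<Sum>j<dm. \<xi> (dps f A B (bas j)) * cof j (w 0) + cof j w' * \<xi> (ps f (\<lambda>v. A v + s 0 (B v)) (bas j)))) (at 0)"
    by (intro DERIV_sum)
  then show "((\<lambda>t. \<xi> (ps f (\<lambda>v. A v + s t (B v)) (w t))) has_field_derivative \<xi> (dps f A B (w 0) + ps f A w')) (at 0)"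
    unfolding * [symmetric] sum.distrib ** [symmetric]
    by (simp add: form_add [OF \<xi>] * [of A w'] mult.commute)
qed

end

section \<open>Determinants with entries in an algebra of functions\<close>

text \<open>The Leibniz formula is a polynomial in the entries. The abstract \<open>C\<close> allows
  the same proof to serve for holomorphic, C^k and continuous functions.\<close>

lemma det_closed:
  assumes C: "\<And>c. C (\<lambda>_. c)" "\<And>f g. C f \<Longrightarrow> C g \<Longrightarrow> C (\<lambda>x. f x + g x)" "\<And>f g. C f \<Longrightarrow> C g \<Longrightarrow> C (\<lambda>x. f x * g x)"
    and M: "\<And>x. M x \<in> carrier_mat n n" "\<And>i j. i < n \<Longrightarrow> j < n \<Longrightarrow> C (\<lambda>x. M x $$ (i, j))"
  shows "C (\<lambda>x. det (M x) :: 'a::comm_ring_1)"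
proof -
  have sum: "C (\<lambda>x. \<Sum>i\<in>I. f i x)" if "\<And>i. i \<in> I \<Longrightarrow> C (f i)" for I :: "(nat \<Rightarrow> nat) set" and f
    using that
  proof (induction I rule: infinite_finite_induct)
    case (insert a I)
    then have "C (\<lambda>x. f a x + (\<Sum>i\<in>I. f i x))"
      by (intro C(2)) auto
    then show ?case
      using insert.hyps by simp
  qed (simp_all add: C(1))
  have prod: "C (\<lambda>x. \<Prod>i\<in>I. f i x)" if "\<And>i. i \<in> I \<Longrightarrow> C (f i)" for I :: "nat set" and f
    using that
  proof (induction I rule: infinite_finite_induct)
    case (insert a I)
    then have "C (\<lambda>x. f a x * (\<Prod>i\<in>I. f i x))"
      by (intro C(3)) auto
    then show ?case
      using insert.hyps by simp
  qed (simp_all add: C(1))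
  have "C (\<lambda>x. \<Sum>p | p permutes {0..<n}. signof p * (\<Prod>i = 0..<n. M x $$ (i, p i)))"
  proof (rule sum)
    fix p assume p: "p \<in> {p. p permutes {0..<n}}"
    have "C (\<lambda>x. \<Prod>i = 0..<n. M x $$ (i, p i))"
    proof (rule prod)
      fix i assume "i \<in> {0..<n}"
      then have "i < n" "p i < n"
        using p permutes_in_image [of p "{0..<n}" i] by simp_all
      then show "C (\<lambda>x. M x $$ (i, p i))"
        by (rule M)
    qed
    then show "C (\<lambda>x. signof p * (\<Prod>i = 0..<n. M x $$ (i, p i)))"
      by (rule C(3) [OF C(1)])
  qed
  then show ?thesis
    by (simp add: det_def' [OF M(1)])
qed

lemma adj_mat_closed:
  assumes C: "\<And>c. C (\<lambda>_. c)" "\<And>f g. C f \<Longrightarrow> C g \<Longrightarrow> C (\<lambda>x. f x + g x)" "\<And>f g. C f \<Longrightarrow> C g \<Longrightarrow> C (\<lambda>x. f x * g x)"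
    and M: "\<And>x. M x \<in> carrier_mat n n" "\<And>i j. i < n \<Longrightarrow> j < n \<Longrightarrow> C (\<lambda>x. M x $$ (i, j))"
    and ij: "i < n" "j < n"
  shows "C (\<lambda>x. adj_mat (M x) $$ (i, j) :: 'a::comm_ring_1)"
proof -
  have dim: "dim_row (M x) = n" "dim_col (M x) = n" for x
    using M(1) [of x] by auto
  have "C (\<lambda>x. det (mat_delete (M x) j i))"
  proof (rule det_closed [where C = C and n = "n - 1", OF C])
    show "mat_delete (M x) j i \<in> carrier_mat (n - 1) (n - 1)" for x
      by (rule mat_delete_carrier [OF M(1)])
    show "C (\<lambda>x. mat_delete (M x) j i $$ (k, l))" if "k < n - 1" "l < n - 1" for k l
      using that by (auto simp: mat_delete_def dim intro!: M(2))
  qed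
  then have "C (\<lambda>x. (- 1) ^ (j + i) * det (mat_delete (M x) j i))"
    by (rule C(3) [OF C(1)])
  then show ?thesis
    using ij by (simp add: adj_mat_def cofactor_def dim)
qed

section \<open>The resolvent of a complex matrix\<close>

lemma eval_fps_sums:
  fixes f :: "'a::{real_normed_field, banach} fps"
  assumes "entire f"
  shows "(\<lambda>n. fps_nth f n * z ^ n) sums eval_fps f z"
proof -
  have "summable (\<lambda>n. norm (fps_nth f n) * norm z ^ n)"
    using assms by (simp add: entire_def)
  then have "summable (\<lambda>n. fps_nth f n * z ^ n)"
    by (rule_tac summable_norm_cancel) (simp add: norm_mult norm_power)
  then show ?thesis
    by (simp add: eval_fps_def summable_sums)
qed

lemma holomorphic_eval_fps:
  assumes "entire f"
  shows "eval_fps f holomorphic_on A"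
proof -
  have "summable (\<lambda>n. fps_nth f n * z ^ n)" for z
    by (rule sums_summable [OF eval_fps_sums [OF assms]])
  then have "conv_radius (fps_nth f) = \<infinity>"
    by (rule conv_radius_inftyI'')
  then have "A \<subseteq> eball 0 (fps_conv_radius f)"
    by (auto simp: fps_conv_radius_def)
  then show ?thesis
    by (rule holomorphic_on_eval_fps)
qed

context
  fixes M :: "complex mat" and n :: nat
  assumes M: "M \<in> carrier_mat n n"
begin

private abbreviation "char_mat z \<equiv> z \<cdot>\<^sub>m 1\<^sub>m n - M"
private abbreviation "R z \<equiv> resolvent M z"

lemma spectrum_det: "z \<in> spectrum M \<longleftrightarrow> det (char_mat z) = 0"
proof -
  have "char_mat z = - char_matrix M z"
    by (rule eq_matI) (use M in \<open>simp_all add: char_matrix_def\<close>)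
  then have "det (char_mat z) = 0 \<longleftrightarrow> det (char_matrix M z) = 0"
    by (simp only: det_0_negate [OF char_matrix_closed [OF M]])
  then show ?thesis
    unfolding spectrum_def mem_Collect_eq eigenvalue_det [OF M] by (rule sym)
qed

lemma finite_spectrum: "finite (spectrum M)"
  by (rule card_finite_spectrum [OF M])

lemma resolvent:
  assumes "z \<notin> spectrum M"
  shows "R z \<in> carrier_mat n n" "char_mat z * R z = 1\<^sub>m n" "R z * char_mat z = 1\<^sub>m n"
proof -
  have c: "char_mat z \<in> carrier_mat n n"
    using M by auto
  have "char_mat z \<in> Units (ring_mat TYPE(complex) n ())"
    by (rule det_non_zero_imp_unit [OF c]) (use spectrum_det [of z] assms in simp)
  then have "mat_inverse (char_mat z) \<noteq> None"
    using mat_inverse(1) [OF c, of "()"] by (rule_tac notI) (simp only: simp_thms)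
  then obtain B where B: "mat_inverse (char_mat z) = Some B"
    by blast
  have "dim_row M = n"
    using M by simp
  then have "R z = B"
    unfolding resolvent_def by (simp only: B option.sel)
  then show "R z \<in> carrier_mat n n" "char_mat z * R z = 1\<^sub>m n" "R z * char_mat z = 1\<^sub>m n"
    using mat_inverse(2) [OF c B] by (simp_all only: simp_thms)
qed

text \<open>Cramer's rule: the entries become quotients of polynomials in z, hence holomorphic off
  the spectrum.\<close>

lemma resolvent_eq:
  assumes "z \<notin> spectrum M" "i < n" "j < n"
  shows "R z $$ (i, j) = adj_mat (char_mat z) $$ (i, j) / det (char_mat z)"
proof -
  have c: "char_mat z \<in> carrier_mat n n"
    using M by auto
  note r = resolvent [OF assms(1)] and a = adj_mat [OF c]
  have "adj_mat (char_mat z) = (adj_mat (char_mat z) * char_mat z) * R z"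
    using a(1) r c by (simp add: assoc_mult_mat [of _ n n _ n _ n])
  also have "\<dots> = det (char_mat z) \<cdot>\<^sub>m R z"
    using r(1) by (simp add: a(3) mult_smult_assoc_mat [OF one_carrier_mat r(1)])
  finally have "adj_mat (char_mat z) $$ (i, j) = det (char_mat z) * R z $$ (i, j)"
    using r(1) assms by simp
  then show ?thesis
    using assms(1) spectrum_det by simp
qed

lemma resolvent_holomorphic:
  assumes "i < n" "j < n"
  shows "(\<lambda>z. R z $$ (i, j)) holomorphic_on - spectrum M"
proof -
  have c: "char_mat z \<in> carrier_mat n n" for z
    using M by auto
  have e: "(\<lambda>z. char_mat z $$ (k, l)) holomorphic_on - spectrum M" if "k < n" "l < n" for k l
    using M that by (auto intro!: holomorphic_intros)
  have "(\<lambda>z. adj_mat (char_mat z) $$ (i, j)) holomorphic_on - spectrum M"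
    by (rule adj_mat_closed [where C = "\<lambda>f. f holomorphic_on - spectrum M", OF _ _ _ c e assms])
      (auto intro: holomorphic_intros)
  moreover have "(\<lambda>z. det (char_mat z)) holomorphic_on - spectrum M"
    by (rule det_closed [where C = "\<lambda>f. f holomorphic_on - spectrum M", OF _ _ _ c e])
      (auto intro: holomorphic_intros)
  ultimately have "(\<lambda>z. adj_mat (char_mat z) $$ (i, j) / det (char_mat z)) holomorphic_on - spectrum M"
    using spectrum_det by (intro holomorphic_on_divide) auto
  then show ?thesis
    by (rule holomorphic_transform) (simp add: resolvent_eq assms)
qed

lemma mult_resolvent:
  assumes "z \<notin> spectrum M" "i < n" "j < n"
  shows "z * R z $$ (i, j) = (if i = j then 1 else 0) + (\<Sum>k<n. R z $$ (i, k) * M $$ (k, j))"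
    and "z * R z $$ (i, j) = (if i = j then 1 else 0) + (\<Sum>k<n. M $$ (i, k) * R z $$ (k, j))"
proof -
  note r = resolvent [OF assms(1)]
  have zc: "z \<cdot>\<^sub>m 1\<^sub>m n \<in> carrier_mat n n"
    by simp
  have "R z * char_mat z = R z * (z \<cdot>\<^sub>m 1\<^sub>m n) - R z * M"
    by (rule mult_minus_distrib_mat [OF r(1) zc M])
  also have "R z * (z \<cdot>\<^sub>m 1\<^sub>m n) = z \<cdot>\<^sub>m R z"
    using r(1) by (subst mult_smult_distrib [of _ n n]) auto
  finally have "(1\<^sub>m n :: complex mat) $$ (i, j) = (z \<cdot>\<^sub>m R z - R z * M) $$ (i, j)"
    using r by simp
  also have "\<dots> = z * R z $$ (i, j) - (\<Sum>k<n. R z $$ (i, k) * M $$ (k, j))"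
    using r(1) M assms by (simp add: scalar_prod_def lessThan_atLeast0)
  finally show "z * R z $$ (i, j) = (if i = j then 1 else 0) + (\<Sum>k<n. R z $$ (i, k) * M $$ (k, j))"
    using assms by (simp add: algebra_simps split: if_splits)
  have "char_mat z * R z = (z \<cdot>\<^sub>m 1\<^sub>m n) * R z - M * R z"
    by (rule minus_mult_distrib_mat [OF zc M r(1)])
  also have "(z \<cdot>\<^sub>m 1\<^sub>m n) * R z = z \<cdot>\<^sub>m R z"
    using r(1) by (subst mult_smult_assoc_mat [of _ n n]) auto
  finally have "(1\<^sub>m n :: complex mat) $$ (i, j) = (z \<cdot>\<^sub>m R z - M * R z) $$ (i, j)"
    using r by simp
  also have "\<dots> = z * R z $$ (i, j) - (\<Sum>k<n. M $$ (i, k) * R z $$ (k, j))"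
    using r(1) M assms by (simp add: scalar_prod_def lessThan_atLeast0)
  finally show "z * R z $$ (i, j) = (if i = j then 1 else 0) + (\<Sum>k<n. M $$ (i, k) * R z $$ (k, j))"
    using assms by (simp add: algebra_simps split: if_splits)
qed

text \<open>From z R = 1 + R M a row sum S of R satisfies \<rho> S <= 1 + n \<mu> S, so S <=
  2/\<rho>; the deviation of R from 1/z is R M/z, which is of order 1/\<rho>^2.\<close>

lemma resolvent_bound:
  fixes \<mu> \<rho> :: real
  assumes \<mu>: "\<mu> \<ge> 0" "\<And>i j. i < n \<Longrightarrow> j < n \<Longrightarrow> norm (M $$ (i, j)) \<le> \<mu>"
    and z: "z \<notin> spectrum M" "norm z = \<rho>" "\<rho> > 2 * (n * \<mu>)" and ij: "i < n" "j < n"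
  shows "norm (R z $$ (i, j) - (if i = j then 1 else 0) / z) \<le> 2 * \<mu> / \<rho>\<^sup>2"
proof -
  define S where "S = (\<Sum>j<n. norm (R z $$ (i, j)))"
  have n\<mu>: "real n * \<mu> \<ge> 0" and \<rho>: "\<rho> > 0"
    using \<mu>(1) z(3) by (auto intro: le_less_trans [rotated])
  have S0: "S \<ge> 0"
    by (simp add: S_def sum_nonneg)
  have b: "norm (\<Sum>k<n. R z $$ (i, k) * M $$ (k, l)) \<le> S * \<mu>" if "l < n" for l
    unfolding S_def sum_distrib_right
    by (rule sum_norm_le) (auto simp: norm_mult intro!: mult_left_mono \<mu> that)
  have "\<rho> * S = (\<Sum>l<n. norm (z * R z $$ (i, l)))"
    by (simp add: S_def sum_distrib_left norm_mult z)
  also have "\<dots> \<le> (\<Sum>l<n. (if i = l then 1 else 0) + S * \<mu>)"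
  proof (rule sum_mono)
    fix l assume "l \<in> {..<n}"
    then have l: "l < n" by simp
    show "norm (z * R z $$ (i, l)) \<le> (if i = l then 1 else 0) + S * \<mu>"
      unfolding mult_resolvent(1) [OF z(1) ij(1) l]
      using norm_triangle_mono [OF _ b [OF l], of "if i = l then 1 else 0" "if i = l then 1 else 0"] by simp
  qed
  also have "\<dots> = 1 + n * \<mu> * S"
    using ij by (simp add: sum.distrib)
  finally have "(\<rho> - n * \<mu>) * S \<le> 1"
    by (simp add: algebra_simps)
  moreover have "\<rho> / 2 * S \<le> (\<rho> - n * \<mu>) * S"
    using z(3) S0 by (intro mult_right_mono) auto
  ultimately have S: "S \<le> 2 / \<rho>"
    using \<rho> by (simp add: field_simps)
  have "norm (R z $$ (i, j) - (if i = j then 1 else 0) / z) = norm (z * R z $$ (i, j) - (if i = j then 1 else 0)) / \<rho>"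
    using \<rho> z(2) by (subst z(2) [symmetric], subst norm_divide [symmetric]) (auto simp: diff_divide_distrib)
  also have "\<dots> = norm (\<Sum>k<n. R z $$ (i, k) * M $$ (k, j)) / \<rho>"
    by (simp add: mult_resolvent(1) [OF z(1) ij])
  also have "\<dots> \<le> (2 / \<rho> * \<mu>) / \<rho>"
    using b [OF ij(2)] S \<mu>(1) \<rho> by (intro divide_right_mono order.trans [OF b [OF ij(2)] mult_right_mono]) auto
  finally show ?thesis
    by (simp add: power2_eq_square)
qed

text \<open>The sum of residues is a contour integral over any large circle. There R differs from
  1/z by O(1/\<rho>^2) while the length grows like \<rho>, so the sum is that of 1/z. This is the
  value of the calculus at the constant 1.\<close>

lemma sum_residue_resolvent:
  assumes ij: "i < n" "j < n"
  shows "(\<Sum>e\<in>spectrum M. residue (\<lambda>z. R z $$ (i, j)) e) = (if i = j then 1 else 0)"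
proof -
  define d :: complex where "d = (if i = j then 1 else 0)"
  define T where "T = (\<Sum>e\<in>spectrum M. residue (\<lambda>z. R z $$ (i, j)) e)"
  obtain \<mu> where \<mu>: "\<mu> \<ge> 0" "\<And>i j. i < n \<Longrightarrow> j < n \<Longrightarrow> norm (M $$ (i, j)) \<le> \<mu>"
    using mat_bounded [of n M] by blast
  obtain r where r: "\<And>e. e \<in> spectrum M \<Longrightarrow> norm e \<le> r"
    using finite_imp_bounded [OF finite_spectrum] by (auto simp: bounded_iff)
  have bound: "norm (T - d) * \<rho> \<le> 2 * \<mu>" if \<rho>: "\<rho> > \<bar>r\<bar>" "\<rho> > 2 * (n * \<mu>)" for \<rho>
  proof -
    have \<rho>0: "\<rho> > 0"
      using \<rho>(1) by linarith
    have sp: "norm e < \<rho>" if "e \<in> spectrum M" for e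
      using r [OF that] \<rho>(1) by linarith
    have out: "z \<notin> spectrum M" if "norm z = \<rho>" for z
      using sp that by fastforce
    have hol: "(\<lambda>z. R z $$ (i, j)) holomorphic_on UNIV - spectrum M"
      using resolvent_holomorphic [OF ij] by (simp add: Compl_eq_Diff_UNIV)
    have img: "path_image (circlepath 0 \<rho>) = {z. norm z = \<rho>}"
      using \<rho>0 by (auto simp: path_image_circlepath dist_norm sphere_def)
    have "contour_integral (circlepath 0 \<rho>) (\<lambda>z. R z $$ (i, j))
        = 2 * pi * \<i> * (\<Sum>p\<in>spectrum M. winding_number (circlepath 0 \<rho>) p * residue (\<lambda>z. R z $$ (i, j)) p)"
      using out \<rho>0 by (intro Residue_theorem [OF open_UNIV connected_UNIV finite_spectrum hol]) (auto simp: img)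
    also have "(\<Sum>p\<in>spectrum M. winding_number (circlepath 0 \<rho>) p * residue (\<lambda>z. R z $$ (i, j)) p) = T"
      unfolding T_def using sp by (intro sum.cong refl) (simp add: winding_number_circlepath)
    finally have I1: "contour_integral (circlepath 0 \<rho>) (\<lambda>z. R z $$ (i, j)) = 2 * pi * \<i> * T" .
    have "(\<lambda>z. R z $$ (i, j)) contour_integrable_on circlepath 0 \<rho>"
      using out img by (intro contour_integrable_holomorphic_simple [OF hol]) (auto simp: finite_imp_closed finite_spectrum open_Diff)
    then have h1: "((\<lambda>z. R z $$ (i, j)) has_contour_integral 2 * pi * \<i> * T) (circlepath 0 \<rho>)"
      using I1 has_contour_integral_integral by metis
    have "((\<lambda>z. d / (z - 0)) has_contour_integral 2 * pi * \<i> * d) (circlepath 0 \<rho>)"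
      using Cauchy_integral_circlepath_simple [of "\<lambda>_. d" 0 \<rho> 0] \<rho>0 by simp
    with h1 have "((\<lambda>z. R z $$ (i, j) - d / z) has_contour_integral 2 * pi * \<i> * T - 2 * pi * \<i> * d) (circlepath 0 \<rho>)"
      by (intro has_contour_integral_diff) simp_all
    then have "norm (2 * pi * \<i> * T - 2 * pi * \<i> * d) \<le> (2 * \<mu> / \<rho>\<^sup>2) * (2 * pi * \<rho>)"
    proof (rule has_contour_integral_bound_circlepath)
      show "norm (R z $$ (i, j) - d / z) \<le> 2 * \<mu> / \<rho>\<^sup>2" if "norm (z - 0) = \<rho>" for z
        using resolvent_bound [OF \<mu> out _ \<rho>(2) ij, of z] that by (simp add: d_def)
    qed (use \<mu> \<rho>0 in auto)
    also have "2 * pi * \<i> * T - 2 * pi * \<i> * d = (2 * pi * \<i>) * (T - d)"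
      by (simp add: algebra_simps)
    finally have "2 * pi * norm (T - d) \<le> (2 * \<mu> / \<rho>\<^sup>2) * (2 * pi * \<rho>)"
      by (simp only: norm_mult) simp
    also have "\<dots> = 2 * pi * (2 * \<mu> / \<rho>)"
      using \<rho>0 by (simp add: power2_eq_square)
    finally have "norm (T - d) \<le> 2 * \<mu> / \<rho>"
      by (rule mult_left_le_imp_le) simp
    then show ?thesis
      using \<rho>0 by (simp add: pos_le_divide_eq)
  qed
  have "norm (T - d) = 0"
  proof (rule ccontr)
    assume "norm (T - d) \<noteq> 0"
    then have pos: "norm (T - d) > 0" by simp
    \<comment> \<open>Chosen so large that the bound on norm (T - d) * \<rho> by 2 \<mu> fails if T
      differs from d.\<close>
    define \<rho> where "\<rho> = \<bar>r\<bar> + 2 * (n * \<mu>) + 2 * \<mu> / norm (T - d) + 1"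
    have a: "2 * (n * \<mu>) \<ge> 0" "2 * \<mu> / norm (T - d) \<ge> 0"
      using \<mu>(1) by simp_all
    have "norm (T - d) * \<rho> = norm (T - d) * (\<bar>r\<bar> + 2 * (n * \<mu>) + 1) + 2 * \<mu>"
      using pos by (simp add: \<rho>_def field_simps)
    moreover have "norm (T - d) * (\<bar>r\<bar> + 2 * (n * \<mu>) + 1) > 0"
      using a(1) by (intro mult_pos_pos pos) linarith
    moreover have "\<rho> > \<bar>r\<bar>" "\<rho> > 2 * (n * \<mu>)"
      unfolding \<rho>_def using a by linarith+
    then have "norm (T - d) * \<rho> \<le> 2 * \<mu>"
      by (rule bound)
    ultimately show False by simp
  qed
  then show ?thesis
    by (simp add: T_def d_def)
qed

text \<open>\<open>H f z = (f z - f M) (z - M)\<^sup>-\<^sup>1\<close> is entire, because it is a divided difference.\<close>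

private definition H :: "complex fps \<Rightarrow> complex \<Rightarrow> nat \<Rightarrow> nat \<Rightarrow> complex" where
  "H f z i j = mps f (upper_block (z \<cdot>\<^sub>m 1\<^sub>m n) (1\<^sub>m n) M) $$ (i, n + j)"

text \<open>The divided difference times z - M telescopes to z^k - M^k, and the resolvent undoes the
  factor. In the induction z R = 1 + R M provides the new leading term.\<close>

lemma ddiff_resolvent:
  assumes z: "z \<notin> spectrum M" and ij: "i < n" "j < n"
  shows "mat_ddiff (z \<cdot>\<^sub>m 1\<^sub>m n) (1\<^sub>m n) M k $$ (i, j)
    = z ^ k * R z $$ (i, j) - (\<Sum>l<n. R z $$ (i, l) * (M ^\<^sub>m k) $$ (l, j))"
  using ij(2)
proof (induction k arbitrary: j)
  case 0
  have "(\<Sum>l<n. R z $$ (i, l) * (M ^\<^sub>m 0) $$ (l, j)) = (\<Sum>l<n. if l = j then R z $$ (i, l) else 0)"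
    using M 0 by (intro sum.cong refl) auto
  then show ?case
    using 0 ij by simp
next
  case (Suc k)
  let ?D = "mat_ddiff (z \<cdot>\<^sub>m 1\<^sub>m n) (1\<^sub>m n) M k"
  have D: "?D \<in> carrier_mat n n"
    using M by auto
  have pw: "(z \<cdot>\<^sub>m 1\<^sub>m n) ^\<^sub>m k = z ^ k \<cdot>\<^sub>m 1\<^sub>m n" for k
  proof (induction k)
    case (Suc k)
    then show ?case
      by (simp add: mult_smult_distrib [of _ n n]) (rule eq_matI, auto)
  qed (auto intro!: eq_matI)
  have "mat_ddiff (z \<cdot>\<^sub>m 1\<^sub>m n) (1\<^sub>m n) M (Suc k) $$ (i, j) = z ^ k * (if i = j then 1 else 0) + (?D * M) $$ (i, j)"
  proof -
    have "(z ^ k \<cdot>\<^sub>m 1\<^sub>m n + ?D * M) $$ (i, j) = (z ^ k \<cdot>\<^sub>m 1\<^sub>m n) $$ (i, j) + (?D * M) $$ (i, j)"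
      using mult_carrier_mat [OF D M] ij(1) Suc.prems by (intro index_add_mat(1)) auto
    then show ?thesis
      using ij(1) Suc.prems by (simp add: pw del: index_mult_mat(1) index_add_mat(1))
  qed
  also have "(?D * M) $$ (i, j) = (\<Sum>a<n. (z ^ k * R z $$ (i, a) - (\<Sum>l<n. R z $$ (i, l) * (M ^\<^sub>m k) $$ (l, a))) * M $$ (a, j))"
    using Suc.IH by (simp add: mat_mult_index [OF D M ij(1) Suc.prems])
  also have "\<dots> = z ^ k * (\<Sum>a<n. R z $$ (i, a) * M $$ (a, j)) - (\<Sum>a<n. \<Sum>l<n. R z $$ (i, l) * ((M ^\<^sub>m k) $$ (l, a) * M $$ (a, j)))"
    by (simp add: left_diff_distrib sum_subtractf sum_distrib_left sum_distrib_right mult.assoc)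
  also have "(\<Sum>a<n. \<Sum>l<n. R z $$ (i, l) * ((M ^\<^sub>m k) $$ (l, a) * M $$ (a, j))) = (\<Sum>l<n. R z $$ (i, l) * (M ^\<^sub>m Suc k) $$ (l, j))"
    by (subst sum.swap)
      (simp add: mat_mult_index [OF pow_carrier_mat [OF M] M _ Suc.prems] sum_distrib_left del: index_mult_mat(1))
  finally have e: "mat_ddiff (z \<cdot>\<^sub>m 1\<^sub>m n) (1\<^sub>m n) M (Suc k) $$ (i, j) = z ^ k * (if i = j then 1 else 0)
      + (z ^ k * (\<Sum>a<n. R z $$ (i, a) * M $$ (a, j)) - (\<Sum>l<n. R z $$ (i, l) * (M ^\<^sub>m Suc k) $$ (l, j)))" .
  have "z ^ Suc k * R z $$ (i, j) = z ^ k * (z * R z $$ (i, j))"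
    by simp
  also have "\<dots> = z ^ k * (if i = j then 1 else 0) + z ^ k * (\<Sum>a<n. R z $$ (i, a) * M $$ (a, j))"
    by (simp only: mult_resolvent(1) [OF z ij(1) Suc.prems] distrib_left)
  finally show ?case
    unfolding e by (simp only: add_diff_eq)
qed

lemma H_resolvent:
  assumes f: "entire f" and z: "z \<notin> spectrum M" and ij: "i < n" "j < n"
  shows "(\<Sum>l<n. R z $$ (i, l) * mps f M $$ (l, j)) = eval_fps f z * R z $$ (i, j) - H f z i j"
proof -
  have "(\<lambda>k. fps_nth f k * mat_ddiff (z \<cdot>\<^sub>m 1\<^sub>m n) (1\<^sub>m n) M k $$ (i, j)) sums H f z i j"
    unfolding H_def by (rule mps_upper_block_index [OF f _ _ M ij]) auto
  moreover have "(\<lambda>k. fps_nth f k * z ^ k * R z $$ (i, j) - (\<Sum>l<n. R z $$ (i, l) * (fps_nth f k * (M ^\<^sub>m k) $$ (l, j))))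
      sums (eval_fps f z * R z $$ (i, j) - (\<Sum>l<n. R z $$ (i, l) * mps f M $$ (l, j)))"
    using ij by (intro sums_diff sums_sum sums_mult sums_mult2 eval_fps_sums mps_sums [OF f M] f) auto
  moreover have "fps_nth f k * mat_ddiff (z \<cdot>\<^sub>m 1\<^sub>m n) (1\<^sub>m n) M k $$ (i, j)
      = fps_nth f k * z ^ k * R z $$ (i, j) - (\<Sum>l<n. R z $$ (i, l) * (fps_nth f k * (M ^\<^sub>m k) $$ (l, j)))" for k
    unfolding ddiff_resolvent [OF z ij] by (simp add: right_diff_distrib sum_distrib_left mult_ac)
  ultimately have "H f z i j = eval_fps f z * R z $$ (i, j) - (\<Sum>l<n. R z $$ (i, l) * mps f M $$ (l, j))"
    by (simp add: sums_unique2)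
  then show ?thesis
    by simp
qed

text \<open>Off the spectrum the formula with the resolvent is holomorphic. The finitely many
  eigenvalues are removable singularities, because the block matrix form is continuous
  everywhere.\<close>

lemma H_holomorphic:
  assumes f: "entire f" and ij: "i < n" "j < n"
  shows "(\<lambda>z. H f z i j) holomorphic_on UNIV"
proof (rule no_isolated_singularity [OF _ _ open_UNIV finite_spectrum])
  show "continuous_on UNIV (\<lambda>z. H f z i j)"
    unfolding H_def
  proof (rule continuous_on_mps [OF f, where n = "n + n"])
    fix k l assume kl: "k < n + n" "l < n + n"
    show "continuous_on UNIV (\<lambda>z. upper_block (z \<cdot>\<^sub>m 1\<^sub>m n) (1\<^sub>m n) M $$ (k, l))"
      using M kl by (cases "k < n"; cases "l < n") (auto intro!: continuous_intros)
  qed (use M ij in auto)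
  have "(\<lambda>z. eval_fps f z * R z $$ (i, j) - (\<Sum>l<n. R z $$ (i, l) * mps f M $$ (l, j))) holomorphic_on UNIV - spectrum M"
    using resolvent_holomorphic ij
    by (intro holomorphic_intros holomorphic_eval_fps f) (auto simp: Compl_eq_Diff_UNIV)
  then show "(\<lambda>z. H f z i j) holomorphic_on UNIV - spectrum M"
    by (rule holomorphic_transform) (simp add: H_resolvent [OF f _ ij])
qed

text \<open>Multiplicativity against an entire factor: inside the residue R f(M) equals f R - H, and
  F H is holomorphic near each eigenvalue, so its residue vanishes.\<close>

lemma hol_calc_mat_mult:
  assumes f: "entire f" and ij: "i < n" "j < n"
    and F: "\<And>e. e \<in> spectrum M \<Longrightarrow> \<exists>r>0. F holomorphic_on ball e r"
  shows "(hol_calc_mat F M * mps f M) $$ (i, j)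
    = (\<Sum>e\<in>spectrum M. residue (\<lambda>z. F z * eval_fps f z * R z $$ (i, j)) e)"
proof -
  have N: "hol_calc_mat F M \<in> carrier_mat n n"
    using M by (simp add: hol_calc_mat_def)
  have "(hol_calc_mat F M * mps f M) $$ (i, j)
      = (\<Sum>l<n. (\<Sum>e\<in>spectrum M. residue (\<lambda>z. F z * R z $$ (i, l)) e) * mps f M $$ (l, j))"
    using mat_mult_index [OF N mps_carrier [OF M] ij] M ij by (simp add: hol_calc_mat_def)
  also have "\<dots> = (\<Sum>e\<in>spectrum M. \<Sum>l<n. residue (\<lambda>z. F z * R z $$ (i, l)) e * mps f M $$ (l, j))"
    unfolding sum_distrib_right by (rule sum.swap)
  also have "\<dots> = (\<Sum>e\<in>spectrum M. residue (\<lambda>z. F z * eval_fps f z * R z $$ (i, j)) e)"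
  proof (rule sum.cong [OF refl])
    fix e assume e: "e \<in> spectrum M"
    from F [OF e] obtain r where r: "r > 0" "F holomorphic_on ball e r"
      by blast
    have "open (- (spectrum M - {e}))"
      by (intro open_Compl finite_imp_closed finite_Diff finite_spectrum)
    then obtain r' where r': "r' > 0" "ball e r' \<subseteq> - (spectrum M - {e})"
      using open_contains_ball by blast
    \<comment> \<open>Small enough for F to be holomorphic on it and for e to be the only eigenvalue
      in it.\<close>
    define S where "S = ball e (min r r')"
    have S: "open S" "e \<in> S" "S - {e} \<subseteq> - spectrum M" "F holomorphic_on S"
      using r r' by (auto simp: S_def intro: holomorphic_on_subset)
    have FR: "(\<lambda>z. F z * R z $$ (i, l)) holomorphic_on S - {e}" if "l < n" for l
      using resolvent_holomorphic [OF ij(1) that] S(3,4)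
      by (intro holomorphic_on_mult) (auto intro: holomorphic_on_subset)
    have sum_hol: "(\<lambda>z. \<Sum>l<m. F z * R z $$ (i, l) * mps f M $$ (l, j)) holomorphic_on S - {e}" if "m \<le> n" for m
      using that by (intro holomorphic_on_sum holomorphic_on_mult [OF FR holomorphic_on_const]) auto
    have "(\<Sum>l<m. residue (\<lambda>z. F z * R z $$ (i, l)) e * mps f M $$ (l, j))
        = residue (\<lambda>z. \<Sum>l<m. F z * R z $$ (i, l) * mps f M $$ (l, j)) e" if "m \<le> n" for m
      using that
    proof (induction m)
      case (Suc m)
      then have "residue (\<lambda>z. F z * R z $$ (i, m) * mps f M $$ (m, j)) e = residue (\<lambda>z. F z * R z $$ (i, m)) e * mps f M $$ (m, j)"
        by (intro residue_rmul [OF S(1,2)] FR) simp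
      moreover have "residue (\<lambda>z. (\<Sum>l<m. F z * R z $$ (i, l) * mps f M $$ (l, j)) + F z * R z $$ (i, m) * mps f M $$ (m, j)) e
          = residue (\<lambda>z. \<Sum>l<m. F z * R z $$ (i, l) * mps f M $$ (l, j)) e + residue (\<lambda>z. F z * R z $$ (i, m) * mps f M $$ (m, j)) e"
        using Suc.prems sum_hol [of m] FR [of m]
        by (intro residue_add [OF S(1,2)] holomorphic_on_mult [OF _ holomorphic_on_const]) auto
      ultimately show ?case
        using Suc by simp
    qed (simp add: residue_const)
    then have "(\<Sum>l<n. residue (\<lambda>z. F z * R z $$ (i, l)) e * mps f M $$ (l, j))
        = residue (\<lambda>z. \<Sum>l<n. F z * R z $$ (i, l) * mps f M $$ (l, j)) e"
      by simp
    also have "\<dots> = residue (\<lambda>z. F z * eval_fps f z * R z $$ (i, j) - F z * H f z i j) e"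
    proof (rule residue_cong)
      have "\<forall>\<^sub>F z in at e. z \<in> S - {e}"
        unfolding eventually_at_topological using S(1,2) by (intro exI [where x = S]) auto
      then show "\<forall>\<^sub>F z in at e. (\<Sum>l<n. F z * R z $$ (i, l) * mps f M $$ (l, j)) = F z * eval_fps f z * R z $$ (i, j) - F z * H f z i j"
      proof (rule eventually_mono)
        fix z assume "z \<in> S - {e}"
        then have "z \<notin> spectrum M"
          using S(3) by blast
        have "(\<Sum>l<n. F z * R z $$ (i, l) * mps f M $$ (l, j)) = F z * (\<Sum>l<n. R z $$ (i, l) * mps f M $$ (l, j))"
          by (simp add: sum_distrib_left mult.assoc)
        then show "(\<Sum>l<n. F z * R z $$ (i, l) * mps f M $$ (l, j)) = F z * eval_fps f z * R z $$ (i, j) - F z * H f z i j"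
          using H_resolvent [OF f \<open>z \<notin> spectrum M\<close> ij] by (simp add: algebra_simps)
      qed
    qed simp
    also have "\<dots> = residue (\<lambda>z. F z * eval_fps f z * R z $$ (i, j)) e - residue (\<lambda>z. F z * H f z i j) e"
    proof (rule residue_diff [OF S(1,2)])
      have "(\<lambda>z. eval_fps f z * (F z * R z $$ (i, j))) holomorphic_on S - {e}"
        by (intro holomorphic_on_mult holomorphic_eval_fps f FR ij)
      then show "(\<lambda>z. F z * eval_fps f z * R z $$ (i, j)) holomorphic_on S - {e}"
        by (simp add: mult_ac)
      show "(\<lambda>z. F z * H f z i j) holomorphic_on S - {e}"
        using S(4) H_holomorphic [OF f ij] by (intro holomorphic_on_mult) (auto intro: holomorphic_on_subset)
    qed
    also have "residue (\<lambda>z. F z * H f z i j) e = 0"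
      using S(4) H_holomorphic [OF f ij]
      by (intro residue_holo [OF S(1,2)] holomorphic_on_mult) (auto intro: holomorphic_on_subset)
    finally show "(\<Sum>l<n. residue (\<lambda>z. F z * R z $$ (i, l)) e * mps f M $$ (l, j))
        = residue (\<lambda>z. F z * eval_fps f z * R z $$ (i, j)) e"
      by simp
  qed
  finally show ?thesis .
qed

lemma hol_calc_mat_one: "hol_calc_mat (\<lambda>_. 1) M = 1\<^sub>m n"
  by (rule eq_matI) (use M sum_residue_resolvent in \<open>auto simp: hol_calc_mat_def\<close>)

text \<open>The case F = 1: for entire functions the residue calculus and the power series
  agree.\<close>

lemma sum_residue_entire:
  assumes f: "entire f" and ij: "i < n" "j < n"
  shows "(\<Sum>e\<in>spectrum M. residue (\<lambda>z. eval_fps f z * R z $$ (i, j)) e) = mps f M $$ (i, j)"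
proof -
  have "\<exists>r>0. (\<lambda>_. 1 :: complex) holomorphic_on ball e r" for e
    by (intro exI [where x = 1]) auto
  from hol_calc_mat_mult [OF f ij this] show ?thesis
    by (simp add: hol_calc_mat_one left_mult_one_mat [OF mps_carrier [OF M]])
qed

text \<open>Near an eigenvalue f has no zero, so F = g/f is holomorphic there and F f = g under the
  residue. In this way a meromorphic function is replaced by two entire ones.\<close>

lemma hol_calc_mat_quotient:
  assumes f: "entire f" and g: "entire g" and F: "\<And>z. eval_fps f z \<noteq> 0 \<Longrightarrow> F z * eval_fps f z = eval_fps g z"
    and nz: "\<And>e. e \<in> spectrum M \<Longrightarrow> eval_fps f e \<noteq> 0"
  shows "hol_calc_mat F M * mps f M = mps g M"
proof (rule eq_matI)
  have near: "\<exists>r>0. \<forall>z\<in>ball e r. eval_fps f z \<noteq> 0" if "e \<in> spectrum M" for e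
  proof -
    have "continuous_on UNIV (eval_fps f)"
      by (intro holomorphic_on_imp_continuous_on holomorphic_eval_fps f)
    then have "open (eval_fps f -` (- {0}))"
      by (rule open_vimage [rotated]) (intro open_Compl closed_singleton)
    moreover have "e \<in> eval_fps f -` (- {0})"
      using nz [OF that] by simp
    ultimately obtain r where r: "r > 0" "ball e r \<subseteq> eval_fps f -` (- {0})"
      by (meson open_contains_ball)
    have "eval_fps f z \<noteq> 0" if "z \<in> ball e r" for z
      using subsetD [OF r(2) that] by simp
    with r(1) show ?thesis
      by blast
  qed
  fix i j assume "i < dim_row (mps g M)" "j < dim_col (mps g M)"
  then have ij: "i < n" "j < n"
    using M by (auto simp: mps_def)
  have "(hol_calc_mat F M * mps f M) $$ (i, j) = (\<Sum>e\<in>spectrum M. residue (\<lambda>z. F z * eval_fps f z * R z $$ (i, j)) e)"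
  proof (rule hol_calc_mat_mult [OF f ij])
    fix e assume "e \<in> spectrum M"
    from near [OF this] obtain r where r: "r > 0" "\<forall>z\<in>ball e r. eval_fps f z \<noteq> 0"
      by blast
    have "(\<lambda>z. eval_fps g z / eval_fps f z) holomorphic_on ball e r"
      using r(2) by (intro holomorphic_on_divide holomorphic_eval_fps f g) auto
    then have "F holomorphic_on ball e r"
    proof (rule holomorphic_transform)
      show "eval_fps g z / eval_fps f z = F z" if "z \<in> ball e r" for z
        using F [of z] r(2) that by (auto simp: field_simps)
    qed
    with r(1) show "\<exists>r>0. F holomorphic_on ball e r"
      by blast
  qed
  also have "\<dots> = (\<Sum>e\<in>spectrum M. residue (\<lambda>z. eval_fps g z * R z $$ (i, j)) e)"
  proof (intro sum.cong refl residue_cong)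
    fix e assume "e \<in> spectrum M"
    from near [OF this] obtain r where r: "r > 0" "\<forall>z\<in>ball e r. eval_fps f z \<noteq> 0"
      by blast
    have "\<forall>\<^sub>F z in at e. z \<in> ball e r"
      unfolding eventually_at_topological using r(1) by (intro exI [where x = "ball e r"]) auto
    then show "\<forall>\<^sub>F z in at e. F z * eval_fps f z * R z $$ (i, j) = eval_fps g z * R z $$ (i, j)"
      by (rule eventually_mono) (use r(2) F in auto)
  qed
  also have "\<dots> = mps g M $$ (i, j)"
    by (rule sum_residue_entire [OF g ij])
  finally show "(hol_calc_mat F M * mps f M) $$ (i, j) = mps g M $$ (i, j)" .
qed (use M in \<open>auto simp: mps_def hol_calc_mat_def\<close>)

end

section \<open>The power series of the problem\<close>

text \<open>All series of the problem have real coefficients: identities are proved once over the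
  reals and then read over the ground field and over the complex numbers.\<close>

definition rfps :: "real fps \<Rightarrow> 'a::real_normed_field fps" where
  "rfps f = Abs_fps (\<lambda>n. of_real (fps_nth f n))"

lemma rfps_nth [simp]: "fps_nth (rfps f) n = of_real (fps_nth f n)"
  by (simp add: rfps_def)

lemma rfps_mult: "rfps (f * g) = rfps f * rfps g"
  by (rule fps_ext) (simp add: fps_mult_nth)

lemma rfps_add: "rfps (f + g) = rfps f + rfps g"
  by (rule fps_ext) simp

lemma rfps_1: "rfps 1 = fps_const 1"
  by (rule fps_ext) simp

lemma entire_rfps: "entire f \<Longrightarrow> entire (rfps f)"
  by (simp add: entire_def)

text \<open>
  \<open>e\<^sup>z\<close>, \<open>e\<^sup>-\<^sup>z\<close>, \<open>(e\<^sup>z - 1)/z\<close>, \<open>(1 - e\<^sup>-\<^sup>z)/z\<close>, \<open>(e\<^sup>z - 1 - z)/z\<^sup>2\<close>, \<open>sinh z/z\<close>,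
  \<open>(z cosh z - sinh z)/z\<^sup>2\<close> and \<open>(sinh z - z)/z\<^sup>2\<close>; note \<open>F_AM = sG/sS\<close>.
\<close>

definition sE :: "real fps" where "sE = Abs_fps (\<lambda>n. 1 / fact n)"
definition sEm :: "real fps" where "sEm = Abs_fps (\<lambda>n. (- 1) ^ n / fact n)"
definition sE1 :: "real fps" where "sE1 = Abs_fps (\<lambda>n. 1 / fact (Suc n))"
definition sE1m :: "real fps" where "sE1m = Abs_fps (\<lambda>n. (- 1) ^ n / fact (Suc n))"
definition sE2 :: "real fps" where "sE2 = Abs_fps (\<lambda>n. 1 / fact (Suc (Suc n)))"
definition sS :: "real fps" where "sS = Abs_fps (\<lambda>n. if even n then 1 / fact (Suc n) else 0)"
definition sG :: "real fps" where
  "sG = Abs_fps (\<lambda>n. if even n then 0 else 1 / fact (Suc n) - 1 / fact (Suc (Suc n)))"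
definition sH :: "real fps" where "sH = Abs_fps (\<lambda>n. if even n then 0 else 1 / fact (Suc (Suc n)))"

lemmas series_defs = sE_def sEm_def sE1_def sE1m_def sE2_def sS_def sG_def sH_def

lemma inverse_fact_Suc: "1 / fact (Suc n) \<le> (1 / fact n :: real)"
  by (intro divide_left_mono fact_mono) auto

lemma inverse_fact_Suc_Suc: "1 / fact (Suc (Suc n)) \<le> (1 / fact n :: real)"
  by (intro divide_left_mono fact_mono) auto

lemma entire_series: "entire sE" "entire sEm" "entire sE1" "entire sE1m" "entire sE2" "entire sS" "entire sG" "entire sH"
proof -
  show "entire sG"
  proof (rule entire_fact_bound)
    fix n
    have "\<bar>1 / fact (Suc n) - 1 / fact (Suc (Suc n)) :: real\<bar> \<le> 1 / fact n"
    proof (rule abs_leI)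
      have "0 < (1 / fact (Suc (Suc n)) :: real)" "0 < (1 / fact (Suc n) :: real)"
        by simp_all
      then show "1 / fact (Suc n) - 1 / fact (Suc (Suc n)) \<le> (1 / fact n :: real)"
        "- (1 / fact (Suc n) - 1 / fact (Suc (Suc n))) \<le> (1 / fact n :: real)"
        using inverse_fact_Suc [of n] inverse_fact_Suc_Suc [of n] by linarith+
    qed
    then show "norm (fps_nth sG n) \<le> 1 / fact n"
      by (simp add: sG_def del: fact_Suc)
  qed
qed (rule entire_fact_bound, use inverse_fact_Suc inverse_fact_Suc_Suc in \<open>simp add: series_defs power_abs del: fact_Suc\<close>)+

lemma sE_fps_exp: "sE = fps_exp 1" "sEm = fps_exp (- 1)"
  by (simp_all add: fps_eq_iff series_defs)

lemma sE_sEm: "sE * sEm = 1" "sEm * sE = 1"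
  by (simp_all add: sE_fps_exp flip: fps_exp_add_mult)

text \<open>Clearing the denominators expresses every series by e^z and e^-z, so that the identities
  below become algebra in these two.\<close>

lemma X_series:
  "fps_X * sE1 = sE - 1" "fps_X * sE1m = 1 - sEm" "2 * (fps_X * sS) = sE - sEm"
  "2 * (fps_X\<^sup>2 * sG) = fps_X * (sE + sEm) - (sE - sEm)" "2 * (fps_X\<^sup>2 * sH) = (sE - sEm) - 2 * fps_X"
proof -
  have num: "fps_nth (2 * f) n = 2 * fps_nth f n" for f :: "real fps" and n
    by (simp add: fps_numeral_fps_const)
  have f0: "fact (Suc 0) = (1::real)"
    by simp
  show "fps_X * sE1 = sE - 1"
  proof (rule fps_ext)
    fix n show "fps_nth (fps_X * sE1) n = fps_nth (sE - 1) n"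
      by (cases n) (simp_all add: series_defs del: fact_Suc)
  qed
  show "fps_X * sE1m = 1 - sEm"
  proof (rule fps_ext)
    fix n show "fps_nth (fps_X * sE1m) n = fps_nth (1 - sEm) n"
      by (cases n) (simp_all add: series_defs del: fact_Suc)
  qed
  show "2 * (fps_X * sS) = sE - sEm"
  proof (rule fps_ext)
    fix n show "fps_nth (2 * (fps_X * sS)) n = fps_nth (sE - sEm) n"
      by (cases n) (simp_all add: num series_defs del: fact_Suc)
  qed
  show "2 * (fps_X\<^sup>2 * sG) = fps_X * (sE + sEm) - (sE - sEm)"
  proof (rule fps_ext)
    fix n
    consider "n = 0" | "n = 1" | m where "n = Suc (Suc m)"
      by (cases n; cases "n - 1") auto
    then show "fps_nth (2 * (fps_X\<^sup>2 * sG)) n = fps_nth (fps_X * (sE + sEm) - (sE - sEm)) n"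
      by cases (simp_all add: num series_defs power2_eq_square mult.assoc f0 del: fact_Suc)
  qed
  show "2 * (fps_X\<^sup>2 * sH) = (sE - sEm) - 2 * fps_X"
  proof (rule fps_ext)
    fix n
    consider "n = 0" | "n = 1" | m where "n = Suc (Suc m)"
      by (cases n; cases "n - 1") auto
    then show "fps_nth (2 * (fps_X\<^sup>2 * sH)) n = fps_nth ((sE - sEm) - 2 * fps_X) n"
      by cases (simp_all add: num series_defs power2_eq_square mult.assoc f0 fps_numeral_nth del: fact_Suc)
  qed
qed

lemma sE1m_sE: "sE1m * sE = sE1"
proof -
  have "fps_X * (sE1m * sE) = (1 - sEm) * sE"
    by (simp only: X_series flip: mult.assoc)
  also have "\<dots> = fps_X * sE1"
    by (simp add: left_diff_distrib sE_sEm X_series)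
  finally show ?thesis
    by simp
qed

text \<open>The key identity. Applied to b with \<beta> = S b it says D \<beta> = \<beta> + r
  \<beta> + e^a H b, which characterises r without a quotient. After multiplication by 2 z^2 both
  sides are polynomials in z, e^z and e^-z.\<close>

lemma sE1_sS: "sE1 * sS = sS + sG + sE * sH"
proof -
  have e: "sE * (sE * sEm) = sE" "sE * sEm = 1"
    by (simp_all add: sE_sEm)
  have "fps_X\<^sup>2 * 2 * (sE1 * sS) = (fps_X * sE1) * (2 * (fps_X * sS))"
    by (simp add: power2_eq_square mult_ac)
  also have "\<dots> = (sE - 1) * (sE - sEm)"
    by (simp only: X_series)
  also have "\<dots> = sE * sE - sE * sEm - sE + sEm"
    by (simp add: algebra_simps)
  also have "\<dots> = fps_X * (sE - sEm) + (fps_X * (sE + sEm) - (sE - sEm)) + sE * ((sE - sEm) - 2 * fps_X)"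
    by (simp add: algebra_simps e)
  also have "\<dots> = fps_X * (2 * (fps_X * sS)) + 2 * (fps_X\<^sup>2 * sG) + sE * (2 * (fps_X\<^sup>2 * sH))"
    by (simp only: X_series)
  also have "\<dots> = fps_X\<^sup>2 * 2 * (sS + sG + sE * sH)"
    by (simp add: power2_eq_square algebra_simps)
  finally have "fps_X\<^sup>2 * 2 * (sE1 * sS) = fps_X\<^sup>2 * 2 * (sS + sG + sE * sH)" .
  \<comment> \<open>Formal power series over the reals form an integral domain, so the factor can be
    cancelled.\<close>
  moreover have "fps_X\<^sup>2 * 2 \<noteq> (0 :: real fps)"
    by simp
  ultimately show ?thesis
    using mult_left_cancel by blast
qed

lemma eval_sS: "z * eval_fps (rfps sS) z = sinh z" for z :: complex
proof -
  have "(\<lambda>n. z * (fps_nth (rfps sS) n * z ^ n)) sums (z * eval_fps (rfps sS) z)"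
    by (intro sums_mult eval_fps_sums entire_rfps entire_series)
  moreover have "(\<lambda>n. if even (Suc n) then 0 else z ^ Suc n /\<^sub>R fact (Suc n)) sums sinh z"
    using sinh_converges [of z] by (subst sums_Suc_iff) simp
  moreover have "z * (fps_nth (rfps sS) n * z ^ n) = (if even (Suc n) then 0 else z ^ Suc n /\<^sub>R fact (Suc n))" for n
    by (simp add: sS_def scaleR_conv_of_real divide_simps del: fact_Suc)
  ultimately show ?thesis
    using sums_unique2 by simp
qed

lemma eval_sG: "z\<^sup>2 * eval_fps (rfps sG) z = z * cosh z - sinh z" for z :: complex
proof -
  let ?c = "\<lambda>n. if even n then z ^ n /\<^sub>R fact n else 0" and ?g = "\<lambda>n. if even n then 0 else z ^ n /\<^sub>R fact n"
  have g: "(\<lambda>n. ?g (Suc n)) sums sinh z"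
    using sinh_converges [of z] by (subst sums_Suc_iff) simp
  have "(\<lambda>n. z * ?c n - ?g (Suc n)) sums (z * cosh z - sinh z)"
    by (intro sums_diff [OF sums_mult [OF cosh_converges] g])
  then have "(\<lambda>n. z * ?c (Suc n) - ?g (Suc (Suc n))) sums (z * cosh z - sinh z)"
    by (subst sums_Suc_iff) simp
  moreover have "(\<lambda>n. z\<^sup>2 * (fps_nth (rfps sG) n * z ^ n)) sums (z\<^sup>2 * eval_fps (rfps sG) z)"
    by (intro sums_mult eval_fps_sums entire_rfps entire_series)
  moreover have "z\<^sup>2 * (fps_nth (rfps sG) n * z ^ n) = z * ?c (Suc n) - ?g (Suc (Suc n))" for n
    by (simp add: sG_def scaleR_conv_of_real power2_eq_square divide_inverse algebra_simps del: fact_Suc)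
  ultimately show ?thesis
    using sums_unique2 by simp
qed

text \<open>Dividing by z removes the zero of sinh at 0, where the value is 1, and keeps all
  others.\<close>

lemma eval_sS_zero: "eval_fps (rfps sS) z = 0 \<longleftrightarrow> z \<in> {\<i> * complex_of_real pi * of_int k | k::int. k \<noteq> 0}"
proof (cases "z = 0")
  case True
  then show ?thesis
    by (auto simp: eval_fps_at_0 sS_def)
next
  case False
  have "eval_fps (rfps sS) z = 0 \<longleftrightarrow> sinh z = 0"
    using eval_sS [of z] False by auto
  also have "\<dots> \<longleftrightarrow> exp z = exp (- z)"
    by (simp add: sinh_def)
  also have "\<dots> \<longleftrightarrow> exp (2 * z) = 1"
  proof -
    have "exp (2 * z) = exp z * exp z"
      by (simp flip: exp_add)
    then show ?thesis
      by (simp add: exp_minus field_simps)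
  qed
  also have "\<dots> \<longleftrightarrow> Re z = 0 \<and> (\<exists>n::int. Im z = of_int n * pi)"
    unfolding exp_eq_1 by auto
  also have "\<dots> \<longleftrightarrow> (\<exists>k::int. z = \<i> * complex_of_real pi * of_int k)"
    by (auto simp: complex_eq_iff)
  also have "\<dots> \<longleftrightarrow> z \<in> {\<i> * complex_of_real pi * of_int k | k::int. k \<noteq> 0}"
    using False by auto
  finally show ?thesis .
qed

lemma F_AM_eval: "eval_fps (rfps sS) z \<noteq> 0 \<Longrightarrow> F_AM z * eval_fps (rfps sS) z = eval_fps (rfps sG) z"
proof (cases "z = 0")
  case True
  then show ?thesis
    by (simp add: F_AM_def eval_fps_at_0 sG_def)
next
  case False
  assume nz: "eval_fps (rfps sS) z \<noteq> 0"
  with False eval_sS [of z] have "sinh z \<noteq> 0"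
    by auto
  have "z\<^sup>2 * (F_AM z * eval_fps (rfps sS) z) = z * F_AM z * sinh z"
    by (simp add: power2_eq_square mult_ac flip: eval_sS)
  also have "\<dots> = z\<^sup>2 * eval_fps (rfps sG) z"
    unfolding eval_sG using False \<open>sinh z \<noteq> 0\<close> by (simp add: F_AM_def field_simps)
  finally show ?thesis
    using False by simp
qed

section \<open>Functional calculus on subspaces\<close>

interpretation to_complex: field_hom "to_complex :: 'k::rc_field \<Rightarrow> complex"
  by unfold_locales (simp_all add: to_complex_add to_complex_mult)

lemma map_mat_pow_index:
  assumes "K \<in> carrier_mat n n" "i < n" "j < n"
  shows "(map_mat to_complex K ^\<^sub>m k) $$ (i, j) = to_complex ((K ^\<^sub>m k) $$ (i, j))"
  using assms(3)
proof (induction k arbitrary: j)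
  case 0
  then show ?case
    using assms by simp
next
  case (Suc k)
  have m: "map_mat to_complex K \<in> carrier_mat n n"
    using assms by simp
  show ?case
    unfolding pow_mat.simps mat_mult_index [OF pow_carrier_mat [OF m] m assms(2) Suc.prems]
      mat_mult_index [OF pow_carrier_mat [OF assms(1)] assms(1,2) Suc.prems] to_complex_sum to_complex_mult
    using assms Suc by (intro sum.cong refl) auto
qed

lemma map_mat_mps:
  fixes K :: "'k::rc_field mat"
  assumes f: "entire f" and K: "K \<in> carrier_mat n n"
  shows "mps (rfps f) (map_mat to_complex K) = map_mat to_complex (mps (rfps f) K)"
proof (rule eq_matI)
  fix i j
  assume "i < dim_row (map_mat to_complex (mps (rfps f) K))" "j < dim_col (map_mat to_complex (mps (rfps f) K))"
  then have ij: "i < n" "j < n"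
    using K by (auto simp: mps_def)
  have m: "map_mat to_complex K \<in> carrier_mat n n"
    using K by simp
  from sums_to_complex [OF mps_sums [OF entire_rfps [OF f] K ij]]
  have "(\<lambda>k. fps_nth (rfps f) k * (map_mat to_complex K ^\<^sub>m k) $$ (i, j)) sums to_complex (mps (rfps f) K $$ (i, j))"
    by (simp add: to_complex_mult to_complex_of_real map_mat_pow_index [OF K ij])
  from sums_unique2 [OF mps_sums [OF entire_rfps [OF f] m ij] this]
  show "mps (rfps f) (map_mat to_complex K) $$ (i, j) = map_mat to_complex (mps (rfps f) K) $$ (i, j)"
    using ij carrier_matD [OF mps_carrier [OF K, of "rfps f"]] by simp
qed (use K in \<open>auto simp: mps_def\<close>)

lemma mps_const_one: "M \<in> carrier_mat n n \<Longrightarrow> mps (fps_const 1) M = 1\<^sub>m n"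
proof (rule eq_matI)
  fix i j assume M: "M \<in> carrier_mat n n" and "i < dim_row (1\<^sub>m n)" "j < dim_col (1\<^sub>m n)"
  then have ij: "i < n" "j < n" by auto
  have "(\<lambda>k. fps_nth (fps_const 1) k * (M ^\<^sub>m k) $$ (i, j)) sums (\<Sum>k\<in>{0}. fps_nth (fps_const 1) k * (M ^\<^sub>m k) $$ (i, j))"
    by (intro sums_finite) auto
  from sums_unique2 [OF mps_sums [OF entire_const M ij] this] show "mps (fps_const 1) M $$ (i, j) = 1\<^sub>m n $$ (i, j)"
    using M ij by simp
qed (auto simp: mps_def)

context
  fixes s :: "'k::rc_field \<Rightarrow> 'v::ab_group_add \<Rightarrow> 'v" and V B A
  assumes vs: "Vector_Spaces.vector_space s" and subspace: "Modules.module.subspace s V"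
    and fin: "finite B" and span: "V \<subseteq> Modules.module.span s B"
    and lin: "lin_on s s V A" and endo: "A ` V \<subseteq> V"
begin

private abbreviation "bs \<equiv> basis_of s V"
private abbreviation "N \<equiv> length bs"
private abbreviation "crd v i \<equiv> coord s bs v i"

text \<open>Entries stay in the ground field; its image under \<open>to_complex\<close> is the
  matrix whose spectrum and residues occur in \<open>Sp\<close> and \<open>hol_calc\<close>.\<close>

definition "opmat_on = Matrix.mat N N (\<lambda>(i, j). crd (A (bs ! j)) i)"

lemmas crd_facts = coord_basis [OF vs basis_of [OF vs subspace fin span]]

lemma opmat_on_carrier: "opmat_on \<in> carrier_mat N N"
  by (simp add: opmat_on_def)

lemma cmatrix_opmat_on: "cmatrix s bs A = map_mat to_complex opmat_on"
  by (rule eq_matI) (simp_all add: cmatrix_def opmat_on_def)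

lemma pow_in: "v \<in> V \<Longrightarrow> (A ^^ n) v \<in> V"
  by (induction n) (use endo in auto)

lemma lin_pow_on: "lin_on s s V (A ^^ n)"
proof (induction n)
  case (Suc n)
  then show ?case
    using lin pow_in by (simp add: lin_on_def)
qed (simp add: lin_on_def)

lemma restr_dual: "lin_on s (*) V f \<Longrightarrow> restr V f \<in> dual s V"
proof -
  interpret Vector_Spaces.vector_space s by (rule vs)
  show "lin_on s (*) V f \<Longrightarrow> restr V f \<in> dual s V"
    using subspace by (simp add: dual_def restr_def lin_on_def subspace_add subspace_scale)
qed

lemma crd_dual: "restr V (\<lambda>v. crd v i) \<in> dual s V"
  by (rule restr_dual [OF crd_facts(3)])

lemma dual_expand:
  assumes "\<xi> \<in> dual s V" "v \<in> V"
  shows "\<xi> v = (\<Sum>i<N. crd v i * \<xi> (bs ! i))"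
  by (subst crd_facts(1) [OF assms(2)]) (rule dual_sum [OF vs subspace assms(1)], use crd_facts(4) in simp)

lemma crd_pow:
  assumes "v \<in> V"
  shows "crd ((A ^^ n) v) i = (\<Sum>j<N. crd ((A ^^ n) (bs ! j)) i * crd v j)"
proof -
  have d: "restr V (\<lambda>v. crd ((A ^^ n) v) i) \<in> dual s V"
    using crd_facts(3) [of i] lin_pow_on [of n] pow_in [of _ n] by (intro restr_dual) (simp add: lin_on_def)
  have "crd ((A ^^ n) v) i = (\<Sum>j<N. crd v j * restr V (\<lambda>v. crd ((A ^^ n) v) i) (bs ! j))"
    using dual_expand [OF d assms] assms by (simp add: restr_def)
  then show ?thesis
    using crd_facts(4) by (simp add: restr_def mult.commute)
qed

lemma opmat_on_pow:
  assumes "i < N" "j < N"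
  shows "(opmat_on ^\<^sub>m n) $$ (i, j) = crd ((A ^^ n) (bs ! j)) i"
  using assms(2)
proof (induction n arbitrary: j)
  case 0
  have "dim_row opmat_on = N"
    by (simp add: opmat_on_def)
  with 0 show ?case
    using assms(1) crd_facts(2) by simp
next
  case (Suc n)
  have "A (bs ! j) \<in> V"
    using crd_facts(4) [OF Suc.prems] endo by auto
  have "(opmat_on ^\<^sub>m Suc n) $$ (i, j) = (\<Sum>k<N. crd ((A ^^ n) (bs ! k)) i * crd (A (bs ! j)) k)"
    unfolding pow_mat.simps mat_mult_index [OF pow_carrier_mat [OF opmat_on_carrier] opmat_on_carrier assms(1) Suc.prems]
    using Suc by (intro sum.cong refl) (simp add: opmat_on_def)
  also have "\<dots> = crd ((A ^^ n) (A (bs ! j))) i"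
    by (rule crd_pow [OF \<open>A (bs ! j) \<in> V\<close>, symmetric])
  finally show ?case
    by (simp add: funpow_swap1)
qed

lemma crd_series:
  assumes f: "entire f" and v: "v \<in> V" "w \<in> V" and i: "i < N"
    and w: "\<And>\<xi>. \<xi> \<in> dual s V \<Longrightarrow> (\<lambda>n. fps_nth f n * \<xi> ((A ^^ n) v)) sums \<xi> w"
  shows "crd w i = (\<Sum>j<N. mps f opmat_on $$ (i, j) * crd v j)"
proof -
  have "(\<lambda>n. fps_nth f n * crd ((A ^^ n) v) i) sums crd w i"
    using w [OF crd_dual [of i]] v pow_in by (simp add: restr_def)
  moreover have "(\<lambda>n. \<Sum>j<N. (fps_nth f n * (opmat_on ^\<^sub>m n) $$ (i, j)) * crd v j) sums (\<Sum>j<N. mps f opmat_on $$ (i, j) * crd v j)"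
    using i by (intro sums_sum sums_mult2 mps_sums [OF f opmat_on_carrier]) auto
  moreover have "fps_nth f n * crd ((A ^^ n) v) i = (\<Sum>j<N. (fps_nth f n * (opmat_on ^\<^sub>m n) $$ (i, j)) * crd v j)" for n
    unfolding crd_pow [OF v(1)] using i by (simp add: opmat_on_pow sum_distrib_left mult.assoc)
  ultimately show ?thesis
    using sums_unique2 by simp
qed

text \<open>F(M) S(M) = G(M) is applied to the coordinates of u. The result consists of images under
  \<open>to_complex\<close> of the coordinates of w, so inverting \<open>to_complex\<close> in
  \<open>hol_calc\<close> recovers w also over the reals.\<close>

lemma hol_calc_F_AM:
  assumes sp: "Sp s V A \<inter> {\<i> * complex_of_real pi * of_int k | k::int. k \<noteq> 0} = {}"
    and v: "u \<in> V" "v \<in> V" "w \<in> V"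
    and S: "\<And>\<xi>. \<xi> \<in> dual s V \<Longrightarrow> (\<lambda>n. fps_nth (rfps sS) n * \<xi> ((A ^^ n) u)) sums \<xi> v"
    and G: "\<And>\<xi>. \<xi> \<in> dual s V \<Longrightarrow> (\<lambda>n. fps_nth (rfps sG) n * \<xi> ((A ^^ n) u)) sums \<xi> w"
  shows "hol_calc s V F_AM A v = w"
proof -
  let ?M = "map_mat to_complex opmat_on"
  have M: "?M \<in> carrier_mat N N"
    using opmat_on_carrier by simp
  have sp': "eval_fps (rfps sS) e \<noteq> 0" if "e \<in> spectrum ?M" for e
    using sp that unfolding eval_sS_zero Sp_def cmatrix_opmat_on by blast
  note eS = entire_rfps [OF entire_series(6)] and eG = entire_rfps [OF entire_series(7)]
  have NS: "hol_calc_mat F_AM ?M * mps (rfps sS) ?M = mps (rfps sG) ?M"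
    using hol_calc_mat_quotient [OF M eS eG F_AM_eval sp'] by simp
  have Nc: "hol_calc_mat F_AM ?M \<in> carrier_mat N N"
    using opmat_on_carrier by (simp add: hol_calc_mat_def)
  have mc: "mps (rfps f) opmat_on \<in> carrier_mat N N" for f
    using opmat_on_carrier by simp
  have "(\<Sum>j<N. hol_calc_mat F_AM ?M $$ (i, j) * to_complex (crd v j)) = to_complex (crd w i)" if i: "i < N" for i
  proof -
    have "(\<Sum>j<N. hol_calc_mat F_AM ?M $$ (i, j) * to_complex (crd v j))
        = (\<Sum>j<N. \<Sum>l<N. hol_calc_mat F_AM ?M $$ (i, j) * (mps (rfps sS) ?M $$ (j, l) * to_complex (crd u l)))"
    proof (rule sum.cong [OF refl])
      fix j assume "j \<in> {..<N}"
      then have j: "j < N" by simp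
      have "crd v j = (\<Sum>l<N. mps (rfps sS) opmat_on $$ (j, l) * crd u l)"
        by (rule crd_series [OF eS v(1,2) j S])
      then have "to_complex (crd v j) = (\<Sum>l<N. to_complex (mps (rfps sS) opmat_on $$ (j, l)) * to_complex (crd u l))"
        by (simp only: to_complex_sum to_complex_mult)
      also have "\<dots> = (\<Sum>l<N. mps (rfps sS) ?M $$ (j, l) * to_complex (crd u l))"
        unfolding map_mat_mps [OF entire_series(6) opmat_on_carrier]
        using j carrier_matD [OF mc [of sS]] by (intro sum.cong refl) simp
      finally have "to_complex (crd v j) = (\<Sum>l<N. mps (rfps sS) ?M $$ (j, l) * to_complex (crd u l))" .
      then show "hol_calc_mat F_AM ?M $$ (i, j) * to_complex (crd v j)
          = (\<Sum>l<N. hol_calc_mat F_AM ?M $$ (i, j) * (mps (rfps sS) ?M $$ (j, l) * to_complex (crd u l)))"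
        by (simp add: sum_distrib_left)
    qed
    also have "\<dots> = (\<Sum>l<N. \<Sum>j<N. hol_calc_mat F_AM ?M $$ (i, j) * (mps (rfps sS) ?M $$ (j, l) * to_complex (crd u l)))"
      by (rule sum.swap)
    also have "\<dots> = (\<Sum>l<N. mps (rfps sG) ?M $$ (i, l) * to_complex (crd u l))"
    proof (rule sum.cong [OF refl])
      fix l assume "l \<in> {..<N}"
      then have l: "l < N" by simp
      show "(\<Sum>j<N. hol_calc_mat F_AM ?M $$ (i, j) * (mps (rfps sS) ?M $$ (j, l) * to_complex (crd u l)))
          = mps (rfps sG) ?M $$ (i, l) * to_complex (crd u l)"
        unfolding NS [symmetric] mat_mult_index [OF Nc mps_carrier [OF M] i l]
        by (simp add: sum_distrib_right mult.assoc)
    qed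
    also have "\<dots> = (\<Sum>l<N. to_complex (mps (rfps sG) opmat_on $$ (i, l)) * to_complex (crd u l))"
      unfolding map_mat_mps [OF entire_series(7) opmat_on_carrier]
      using i carrier_matD [OF mc [of sG]] by (intro sum.cong refl) simp
    also have "\<dots> = to_complex (crd w i)"
    proof -
      have "crd w i = (\<Sum>l<N. mps (rfps sG) opmat_on $$ (i, l) * crd u l)"
        by (rule crd_series [OF eG v(1,3) i G])
      then show ?thesis
        by (simp only: to_complex_sum to_complex_mult)
    qed
    finally show ?thesis .
  qed
  then have "hol_calc s V F_AM A v = (\<Sum>i<N. s (crd w i) (bs ! i))"
    unfolding hol_calc_def Let_def cmatrix_opmat_on by (intro sum.cong refl) simp
  also have "\<dots> = w"
    by (rule crd_facts(1) [OF v(3), symmetric])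
  finally show ?thesis .
qed

lemma kernel_vector:
  fixes K :: "'k mat"
  assumes "K \<in> carrier_mat N N" "det K = 0"
  obtains v where "v \<in> V" "v \<noteq> 0" "\<And>i. i < N \<Longrightarrow> (\<Sum>j<N. K $$ (i, j) * crd v j) = 0"
proof -
  interpret Vector_Spaces.vector_space s by (rule vs)
  from assms obtain y where y: "y \<in> carrier_vec N" "y \<noteq> 0\<^sub>v N" "K *\<^sub>v y = 0\<^sub>v N"
    using det_0_iff_vec_prod_zero by blast
  define v where "v = (\<Sum>j<N. s (y $ j) (bs ! j))"
  have v: "v \<in> V"
    unfolding v_def using crd_facts(4) subspace by (intro subspace_sum subspace_scale) auto
  have c: "crd v i = y $ i" if "i < N" for i
  proof -
    have "crd v i = (\<Sum>j<N. y $ j * restr V (\<lambda>v. crd v i) (bs ! j))"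
      using dual_sum [OF vs subspace crd_dual [of i], of "{..<N}" "\<lambda>j. bs ! j" "\<lambda>j. y $ j"] crd_facts(4) v
      by (simp add: v_def restr_def)
    also have "\<dots> = (\<Sum>j<N. if j = i then y $ j else 0)"
      using crd_facts(2,4) that by (intro sum.cong refl) (auto simp: restr_def)
    finally show ?thesis
      using that by simp
  qed
  show thesis
  proof (rule that [OF v])
    show "v \<noteq> 0"
    proof
      assume "v = 0"
      have "restr V (\<lambda>v. crd v i) 0 = 0" for i
        using dual_sum [OF vs subspace crd_dual [of i], of "{}"] by simp
      then have "crd 0 i = 0" for i
        using subspace_0 [OF subspace] by (simp add: restr_def)
      then have "y = 0\<^sub>v N"
        using c y(1) \<open>v = 0\<close> by (intro eq_vecI) auto
      with y(2) show False ..
    qed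
    fix i assume i: "i < N"
    have "(\<Sum>j<N. K $$ (i, j) * crd v j) = (K *\<^sub>v y) $ i"
      using assms(1) i y(1) c by (simp add: scalar_prod_def lessThan_atLeast0)
    then show "(\<Sum>j<N. K $$ (i, j) * crd v j) = 0"
      using y(3) i by simp
  qed
qed

text \<open>If the spectrum avoids the zeros of sinh z/z, the calculus of the reciprocal inverts the
  matrix of sinh A/A. If a zero is an eigenvalue, its eigenvector is annihilated by that matrix. The
  operator itself appears only as a series convergent on forms of V.\<close>

lemma Sp_sinh:
  "Sp s V A \<inter> {\<i> * complex_of_real pi * of_int k | k::int. k \<noteq> 0} = {} \<longleftrightarrow>
    (\<forall>v\<in>V. (\<forall>\<xi>\<in>dual s V. (\<lambda>n. fps_nth (rfps sS) n * \<xi> ((A ^^ n) v)) sums 0) \<longrightarrow> v = 0)"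
  (is "?L \<longleftrightarrow> ?R")
proof -
  interpret Vector_Spaces.vector_space s by (rule vs)
  let ?M = "map_mat to_complex opmat_on"
  have M: "?M \<in> carrier_mat N N"
    using opmat_on_carrier by simp
  note eS = entire_rfps [OF entire_series(6)]
  have dual0: "\<xi> 0 = 0" if "\<xi> \<in> dual s V" for \<xi>
    using dual_sum [OF vs subspace that, of "{}"] by simp
  have mc: "mps (rfps sS) opmat_on \<in> carrier_mat N N"
    using opmat_on_carrier by simp
  show ?thesis
  proof
    assume ?L
    then have sp: "eval_fps (rfps sS) e \<noteq> 0" if "e \<in> spectrum ?M" for e
      using that unfolding eval_sS_zero Sp_def cmatrix_opmat_on by blast
    \<comment> \<open>With this F the quotient lemma, taken with g = 1, exhibits a left
      inverse.\<close>
    define F where "F z = 1 / eval_fps (rfps sS) z" for z :: complex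
    have "eval_fps (fps_const 1) z = 1" for z :: complex
      by simp
    then have "hol_calc_mat F ?M * mps (rfps sS) ?M = mps (fps_const 1) ?M"
      using hol_calc_mat_quotient [OF M eS entire_const, of F 1] sp by (simp add: F_def)
    then have *: "hol_calc_mat F ?M * mps (rfps sS) ?M = 1\<^sub>m N"
      unfolding mps_const_one [OF M] .
    have Nc: "hol_calc_mat F ?M \<in> carrier_mat N N"
      using opmat_on_carrier by (simp add: hol_calc_mat_def)
    show ?R
    proof (intro ballI impI)
      fix v assume v: "v \<in> V" and "\<forall>\<xi>\<in>dual s V. (\<lambda>n. fps_nth (rfps sS) n * \<xi> ((A ^^ n) v)) sums 0"
      then have h: "(\<lambda>n. fps_nth (rfps sS) n * \<xi> ((A ^^ n) v)) sums \<xi> 0" if "\<xi> \<in> dual s V" for \<xi>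
        using that dual0 [OF that] by simp
      have c0: "crd 0 i = 0" for i
        using dual0 [OF crd_dual [of i]] subspace_0 [OF subspace] by (simp add: restr_def)
      have z: "(\<Sum>j<N. mps (rfps sS) ?M $$ (i, j) * to_complex (crd v j)) = 0" if i: "i < N" for i
      proof -
        have "(\<Sum>j<N. mps (rfps sS) ?M $$ (i, j) * to_complex (crd v j))
            = (\<Sum>j<N. to_complex (mps (rfps sS) opmat_on $$ (i, j)) * to_complex (crd v j))"
          unfolding map_mat_mps [OF entire_series(6) opmat_on_carrier]
          using i carrier_matD [OF mc] by (intro sum.cong refl) simp
        also have "\<dots> = to_complex (crd 0 i)"
        proof -
          have "crd 0 i = (\<Sum>l<N. mps (rfps sS) opmat_on $$ (i, l) * crd v l)"
            by (rule crd_series [OF eS v subspace_0 [OF subspace] i h])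
          then show ?thesis
            by (simp only: to_complex_sum to_complex_mult)
        qed
        finally have "(\<Sum>j<N. mps (rfps sS) ?M $$ (i, j) * to_complex (crd v j)) = to_complex (crd 0 i)" .
        then show ?thesis
          by (simp add: c0)
      qed
      have "crd v i = 0" if i: "i < N" for i
      proof -
        have "to_complex (crd v i) = (\<Sum>j<N. if j = i then to_complex (crd v j) else 0)"
          using i by simp
        also have "\<dots> = (\<Sum>j<N. (1\<^sub>m N :: complex mat) $$ (i, j) * to_complex (crd v j))"
          using i by (intro sum.cong refl) auto
        also have "\<dots> = (\<Sum>j<N. \<Sum>l<N. hol_calc_mat F ?M $$ (i, l) * mps (rfps sS) ?M $$ (l, j) * to_complex (crd v j))"
          unfolding * [symmetric] using mat_mult_index [OF Nc mps_carrier [OF M] i]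
          by (intro sum.cong refl) (simp add: sum_distrib_right del: index_mult_mat(1))
        also have "\<dots> = (\<Sum>l<N. \<Sum>j<N. hol_calc_mat F ?M $$ (i, l) * mps (rfps sS) ?M $$ (l, j) * to_complex (crd v j))"
          by (rule sum.swap)
        also have "\<dots> = (\<Sum>l<N. hol_calc_mat F ?M $$ (i, l) * (\<Sum>j<N. mps (rfps sS) ?M $$ (l, j) * to_complex (crd v j)))"
          by (simp add: sum_distrib_left mult.assoc)
        also have "\<dots> = 0"
          using z by simp
        finally show ?thesis
          by (metis to_complex_0 to_complex_eq_iff)
      qed
      then have "(\<Sum>i<N. s (crd v i) (bs ! i)) = 0"
        by simp
      then show "v = 0"
        using crd_facts(1) [OF v] by simp
    qed
  next
    assume R: ?R
    show ?L
    proof (rule ccontr)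
      assume "\<not> ?L"
      then obtain e where e: "e \<in> spectrum ?M" "eval_fps (rfps sS) e = 0"
        unfolding eval_sS_zero Sp_def cmatrix_opmat_on by blast
      then obtain x where x: "eigenvector ?M x e"
        unfolding spectrum_def eigenvalue_def by blast
      then have xc: "x \<in> carrier_vec N" "x \<noteq> 0\<^sub>v N"
        using M by (auto simp: eigenvector_def)
      have "mps (rfps sS) ?M *\<^sub>v x = 0\<^sub>v N"
      proof (rule eq_vecI)
        fix i assume "i < dim_vec (0\<^sub>v N)"
        then have i: "i < N" by simp
        have "(\<lambda>n. \<Sum>j<N. fps_nth (rfps sS) n * (?M ^\<^sub>m n) $$ (i, j) * x $ j) sums (\<Sum>j<N. mps (rfps sS) ?M $$ (i, j) * x $ j)"
          using i by (intro sums_sum sums_mult2 mps_sums [OF eS M]) auto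
        moreover have "(\<lambda>n. fps_nth (rfps sS) n * e ^ n * x $ i) sums (eval_fps (rfps sS) e * x $ i)"
          by (intro sums_mult2 eval_fps_sums eS)
        moreover have "(\<Sum>j<N. fps_nth (rfps sS) n * (?M ^\<^sub>m n) $$ (i, j) * x $ j) = fps_nth (rfps sS) n * e ^ n * x $ i" for n
        proof -
          have "(\<Sum>j<N. (?M ^\<^sub>m n) $$ (i, j) * x $ j) = (?M ^\<^sub>m n *\<^sub>v x) $ i"
            using carrier_matD [OF pow_carrier_mat [OF M, of n]] carrier_matD [OF opmat_on_carrier] i xc
            by (simp add: scalar_prod_def lessThan_atLeast0)
          also have "\<dots> = e ^ n * x $ i"
            using eigenvector_pow [OF M x, of n] i xc by simp
          finally show ?thesis
            by (simp add: mult.assoc flip: sum_distrib_left)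
        qed
        ultimately have "(\<Sum>j<N. mps (rfps sS) ?M $$ (i, j) * x $ j) = 0"
          using e(2) sums_unique2 by simp
        then show "(mps (rfps sS) ?M *\<^sub>v x) $ i = 0\<^sub>v N $ i"
          using i xc mps_carrier [OF M, of "rfps sS"] by (auto simp: scalar_prod_def lessThan_atLeast0)
      qed (use mps_carrier [OF M, of "rfps sS"] in auto)
      \<comment> \<open>The complex kernel vector need not come from V, but the determinant does: it
        commutes with \<open>to_complex\<close>, and its vanishing gives a kernel vector over the
        ground field.\<close>
      then have "det (mps (rfps sS) ?M) = 0"
        using det_0_iff_vec_prod_zero [OF mps_carrier [OF M]] xc by blast
      then have "det (mps (rfps sS) opmat_on) = 0"
        unfolding map_mat_mps [OF entire_series(6) opmat_on_carrier] to_complex.hom_det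
        by (metis to_complex_0 to_complex_eq_iff)
      then obtain v where v: "v \<in> V" "v \<noteq> 0" "\<And>i. i < N \<Longrightarrow> (\<Sum>j<N. mps (rfps sS) opmat_on $$ (i, j) * crd v j) = 0"
        using kernel_vector [OF mc] by blast
      have "(\<lambda>n. fps_nth (rfps sS) n * \<xi> ((A ^^ n) v)) sums 0" if \<xi>: "\<xi> \<in> dual s V" for \<xi>
      proof -
        have "(\<lambda>n. \<Sum>i<N. (\<Sum>j<N. fps_nth (rfps sS) n * (opmat_on ^\<^sub>m n) $$ (i, j) * crd v j) * \<xi> (bs ! i))
            sums (\<Sum>i<N. (\<Sum>j<N. mps (rfps sS) opmat_on $$ (i, j) * crd v j) * \<xi> (bs ! i))"
          by (intro sums_sum sums_mult2 mps_sums [OF eS opmat_on_carrier]) auto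
        moreover have "(\<Sum>i<N. (\<Sum>j<N. fps_nth (rfps sS) n * (opmat_on ^\<^sub>m n) $$ (i, j) * crd v j) * \<xi> (bs ! i))
            = fps_nth (rfps sS) n * \<xi> ((A ^^ n) v)" for n
          unfolding dual_expand [OF \<xi> pow_in [OF v(1)]] sum_distrib_left crd_pow [OF v(1)] sum_distrib_right
          by (intro sum.cong refl) (simp add: opmat_on_pow mult.assoc)
        ultimately show ?thesis
          using v(3) by simp
      qed
      with R v show False
        by blast
    qed
  qed
qed

text \<open>Again the determinant transfers singularity between the complex matrix and the ground
  field.\<close>

lemma zero_in_Sp: "0 \<in> Sp s V A \<longleftrightarrow> (\<exists>v\<in>V. v \<noteq> 0 \<and> A v = 0)"
proof -
  interpret Vector_Spaces.vector_space s by (rule vs)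
  let ?M = "map_mat to_complex opmat_on"
  have M: "?M \<in> carrier_mat N N"
    using opmat_on_carrier by simp
  have A: "crd (A v) i = (\<Sum>j<N. opmat_on $$ (i, j) * crd v j)" if "v \<in> V" "i < N" for v i
    using crd_pow [OF that(1), of 1 i] that(2) by (simp add: opmat_on_def)
  have dual0: "\<xi> 0 = 0" if "\<xi> \<in> dual s V" for \<xi>
    using dual_sum [OF vs subspace that, of "{}"] by simp
  have c0: "crd 0 i = 0" for i
    using dual0 [OF crd_dual [of i]] subspace_0 [OF subspace] by (simp add: restr_def)
  have "0 \<in> Sp s V A \<longleftrightarrow> det (0 \<cdot>\<^sub>m 1\<^sub>m N - ?M) = 0"
    unfolding Sp_def cmatrix_opmat_on by (rule spectrum_det [OF M])
  also have "0 \<cdot>\<^sub>m 1\<^sub>m N - ?M = - ?M"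
    by (rule eq_matI) (use opmat_on_carrier in auto)
  also have "det (- ?M) = 0 \<longleftrightarrow> det opmat_on = 0"
    unfolding det_0_negate [OF M] to_complex.hom_det by (metis to_complex_0 to_complex_eq_iff)
  also have "\<dots> \<longleftrightarrow> (\<exists>v\<in>V. v \<noteq> 0 \<and> A v = 0)"
  proof
    assume "det opmat_on = 0"
    from kernel_vector [OF opmat_on_carrier this] obtain v where
      v: "v \<in> V" "v \<noteq> 0" "\<And>i. i < N \<Longrightarrow> (\<Sum>j<N. opmat_on $$ (i, j) * crd v j) = 0"
      by blast
    have "A v \<in> V"
      using v(1) endo by blast
    from crd_facts(1) [OF this] have "A v = 0"
      using A [OF v(1)] v(3) by simp
    with v show "\<exists>v\<in>V. v \<noteq> 0 \<and> A v = 0"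
      by blast
  next
    assume "\<exists>v\<in>V. v \<noteq> 0 \<and> A v = 0"
    then obtain v where v: "v \<in> V" "v \<noteq> 0" "A v = 0"
      by blast
    define y where "y = Matrix.vec N (crd v)"
    have "opmat_on *\<^sub>v y = 0\<^sub>v N"
    proof (rule eq_vecI)
      fix i assume "i < dim_vec (0\<^sub>v N)"
      then have i: "i < N" by simp
      then have "(opmat_on *\<^sub>v y) $ i = (\<Sum>j<N. opmat_on $$ (i, j) * crd v j)"
        using opmat_on_carrier by (auto simp: y_def scalar_prod_def lessThan_atLeast0)
      also have "\<dots> = 0"
        using A [OF v(1) i] v(3) c0 by simp
      finally show "(opmat_on *\<^sub>v y) $ i = 0\<^sub>v N $ i"
        using i by simp
    qed (use opmat_on_carrier in auto)
    moreover have "y \<noteq> 0\<^sub>v N"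
    proof
      assume y0: "y = 0\<^sub>v N"
      have "crd v i = 0" if "i < N" for i
        using arg_cong [OF y0, of "\<lambda>y. vec_index y i"] that by (simp add: y_def)
      with crd_facts(1) [OF v(1)] v(2) show False
        by simp
    qed
    ultimately show "det opmat_on = 0"
      using det_0_iff_vec_prod_zero [OF opmat_on_carrier] by (metis y_def vec_carrier)
  qed
  finally show ?thesis .
qed

end

section \<open>Quadratic Lie algebras\<close>

locale quad_lie = fin_vs s for s :: "'k::rc_field \<Rightarrow> 'd::ab_group_add \<Rightarrow> 'd" +
  fixes B :: "'d \<Rightarrow> 'd \<Rightarrow> 'd" and \<kappa> :: "'d \<Rightarrow> 'd \<Rightarrow> 'k"
  assumes B_left: "lin (\<lambda>x. B x y)" and B_right: "lin (B x)" and B_alt: "B x x = 0"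
    and Jacobi: "B x (B y z) + B y (B z x) + B z (B x y) = 0"
    and \<kappa>_left: "(\<lambda>x. \<kappa> x y) \<in> forms" and \<kappa>_sym: "\<kappa> x y = \<kappa> y x"
    and \<kappa>_inv: "\<kappa> (B x y) z = \<kappa> x (B y z)"
begin

lemma \<kappa>_right: "\<kappa> x \<in> forms"
proof -
  have "\<kappa> x = (\<lambda>y. \<kappa> y x)"
    by (rule ext) (rule \<kappa>_sym)
  then show ?thesis
    using \<kappa>_left by simp
qed

lemmas B_add = lin_add [OF B_right] lin_add [OF B_left]
lemmas B_scale = lin_scale [OF B_right] lin_scale [OF B_left]
lemmas B_diff = lin_diff [OF B_right] lin_diff [OF B_left]
lemmas B_neg = lin_neg [OF B_right] lin_neg [OF B_left]
lemmas B_zero = lin_zero [OF B_right] lin_zero [OF B_left]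
lemmas \<kappa>_add = form_add [OF \<kappa>_right] form_add [OF \<kappa>_left]
lemmas \<kappa>_scale = form_scale [OF \<kappa>_right] form_scale [OF \<kappa>_left]
lemmas \<kappa>_diff = form_diff [OF \<kappa>_right] form_diff [OF \<kappa>_left]
lemmas \<kappa>_neg = form_neg [OF \<kappa>_right] form_neg [OF \<kappa>_left]
lemmas \<kappa>_zero = form_zero [OF \<kappa>_right] form_zero [OF \<kappa>_left]

lemma B_anti: "B x y = - B y x"
proof -
  have "B (x + y) (x + y) = B x x + B y x + (B x y + B y y)"
    by (simp only: B_add)
  then have "B y x + B x y = 0"
    by (simp add: B_alt)
  then show ?thesis
    by (simp add: eq_neg_iff_add_eq_0 add.commute)
qed

lemma B_deriv: "B x (B y z) = B (B x y) z + B y (B x z)"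
proof -
  have "B y (B z x) = - B y (B x z)"
    by (subst B_anti [of z x]) (simp add: B_neg)
  moreover have "B z (B x y) = - B (B x y) z"
    by (rule B_anti)
  ultimately have "B x (B y z) - B y (B x z) - B (B x y) z = 0"
    using Jacobi [of x y z] by simp
  then show ?thesis
    by (simp add: algebra_simps)
qed

lemma \<kappa>_skew: "\<kappa> (B a u) v = - \<kappa> u (B a v)"
proof -
  have "\<kappa> u (B a v) = \<kappa> (B u a) v"
    by (rule \<kappa>_inv [symmetric])
  also have "\<dots> = - \<kappa> (B a u) v"
    by (subst B_anti) (simp add: \<kappa>_neg)
  finally show ?thesis
    by simp
qed

lemma \<kappa>_cyc: "\<kappa> (B x y) z = \<kappa> (B y z) x"
  by (rule trans [OF \<kappa>_inv \<kappa>_sym])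

lemma \<kappa>_deriv: "\<kappa> (B (B p x) y) z + \<kappa> (B x (B p y)) z + \<kappa> (B x y) (B p z) = 0"
proof -
  have "\<kappa> (B x y) (B p z) = - \<kappa> (B p (B x y)) z"
    by (simp add: \<kappa>_skew)
  then show ?thesis
    by (simp add: B_deriv [of p x y] \<kappa>_add)
qed

lemma ps_rfps_sums:
  assumes "entire f" "lin A" "\<xi> \<in> forms"
  shows "(\<lambda>n. of_real (fps_nth f n) * \<xi> ((A ^^ n) v)) sums \<xi> (ps (rfps f) A v)"
  using ps_sums [OF entire_rfps [OF assms(1)] assms(2,3)] by simp

definition "fs f p = ps (rfps f) (B p)"

lemma lin_fs: "lin (fs f p)"
  by (simp add: fs_def lin_ps)

lemmas fs_add' = lin_add [OF lin_fs]
lemmas fs_diff = lin_diff [OF lin_fs]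
lemmas fs_neg = lin_neg [OF lin_fs]
lemmas fs_scale = lin_scale [OF lin_fs]
lemmas fs_zero = lin_zero [OF lin_fs]

lemma fs_mult: "entire f \<Longrightarrow> entire g \<Longrightarrow> fs (f * g) p v = fs f p (fs g p v)"
  by (simp add: fs_def rfps_mult ps_mult entire_rfps B_right)

lemma fs_plus: "entire f \<Longrightarrow> entire g \<Longrightarrow> fs (f + g) p v = fs f p v + fs g p v"
  by (simp add: fs_def rfps_add ps_add entire_rfps B_right)

lemma fs_one: "fs 1 p v = v"
  unfolding fs_def rfps_1 ps_const [OF B_right] by simp

lemma fs_commute: "entire f \<Longrightarrow> entire g \<Longrightarrow> fs f p (fs g p v) = fs g p (fs f p v)"
  by (simp only: fs_mult [symmetric] mult.commute)

lemma fs_sums: "entire f \<Longrightarrow> \<xi> \<in> forms \<Longrightarrow> (\<lambda>n. of_real (fps_nth f n) * \<xi> ((B p ^^ n) v)) sums \<xi> (fs f p v)"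
  unfolding fs_def by (rule ps_rfps_sums [OF _ B_right])

abbreviation "e \<equiv> fs sE"
abbreviation "em \<equiv> fs sEm"
abbreviation "D \<equiv> fs sE1"

lemma e_em [simp]: "e p (em p v) = v" and em_e [simp]: "em p (e p v) = v"
  by (simp_all add: sE_sEm fs_one entire_series flip: fs_mult)

text \<open>
  The three binomial identities below (Leibniz rule, derivative of the exponential, flatness)
  arise from iterating \<open>a (T i j) = T (i + 1) j + T i (j + 1)\<close> with different boundary terms.
\<close>

lemma derivation_sum:
  assumes a: "lin a" and T: "\<And>i j. a (T i j) = T (Suc i) j + T i (Suc j)"
  shows "a (\<Sum>i\<le>N. s (of_nat (c i)) (T i (N - i)))
    = (\<Sum>i\<le>Suc N. s (of_nat ((if i = 0 then 0 else c (i - 1)) + (if i = Suc N then 0 else c i))) (T i (Suc N - i)))"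
proof -
  have "a (\<Sum>i\<le>N. s (of_nat (c i)) (T i (N - i)))
      = (\<Sum>i\<le>N. s (of_nat (c i)) (T (Suc i) (N - i))) + (\<Sum>i\<le>N. s (of_nat (c i)) (T i (Suc (N - i))))"
    by (simp add: lin_sum [OF a] lin_scale [OF a] T scale_right_distrib sum.distrib)
  also have "(\<Sum>i\<le>N. s (of_nat (c i)) (T (Suc i) (N - i)))
      = (\<Sum>i\<le>Suc N. s (of_nat (if i = 0 then 0 else c (i - 1))) (T i (Suc N - i)))"
    unfolding sum.atMost_Suc_shift [of _ N] by simp
  also have "(\<Sum>i\<le>N. s (of_nat (c i)) (T i (Suc (N - i))))
      = (\<Sum>i\<le>Suc N. s (of_nat (if i = Suc N then 0 else c i)) (T i (Suc N - i)))"
  proof -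
    have "(\<Sum>i\<le>N. s (of_nat (c i)) (T i (Suc (N - i)))) = (\<Sum>i\<le>N. s (of_nat (if i = Suc N then 0 else c i)) (T i (Suc N - i)))"
      by (intro sum.cong refl) (auto simp: Suc_diff_le)
    then show ?thesis
      by simp
  qed
  finally show ?thesis
    by (simp only: of_nat_add scale_left_distrib sum.distrib)
qed

lemma derivation_T: "B p (B ((B p ^^ i) u) ((B p ^^ j) v)) = B ((B p ^^ Suc i) u) ((B p ^^ j) v) + B ((B p ^^ i) u) ((B p ^^ Suc j) v)"
  by (simp add: B_deriv [of p "(B p ^^ i) u"])

lemma Leibniz: "(B p ^^ n) (B u v) = (\<Sum>i\<le>n. s (of_nat (n choose i)) (B ((B p ^^ i) u) ((B p ^^ (n - i)) v)))"
proof (induction n)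
  case (Suc n)
  have "(B p ^^ Suc n) (B u v) = B p (\<Sum>i\<le>n. s (of_nat (n choose i)) (B ((B p ^^ i) u) ((B p ^^ (n - i)) v)))"
    by (simp add: Suc)
  also have "\<dots> = (\<Sum>i\<le>Suc n. s (of_nat ((if i = 0 then 0 else n choose (i - 1)) + (if i = Suc n then 0 else n choose i)))
      (B ((B p ^^ i) u) ((B p ^^ (Suc n - i)) v)))"
    by (rule derivation_sum [where T = "\<lambda>i j. B ((B p ^^ i) u) ((B p ^^ j) v)", OF B_right derivation_T])
  also have "\<dots> = (\<Sum>i\<le>Suc n. s (of_nat (Suc n choose i)) (B ((B p ^^ i) u) ((B p ^^ (Suc n - i)) v)))"
  proof (rule sum.cong [OF refl])
    fix i assume "i \<in> {..Suc n}"
    have "(if i = 0 then 0 else n choose (i - 1)) + (if i = Suc n then 0 else n choose i) = Suc n choose i"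
      by (cases i) auto
    then show "s (of_nat ((if i = 0 then 0 else n choose (i - 1)) + (if i = Suc n then 0 else n choose i)))
          (B ((B p ^^ i) u) ((B p ^^ (Suc n - i)) v))
        = s (of_nat (Suc n choose i)) (B ((B p ^^ i) u) ((B p ^^ (Suc n - i)) v))"
      by (simp only:)
  qed
  finally show ?case .
qed simp

lemma ddiff_Suc_left:
  assumes "lin A"
  shows "ddiff A C (Suc n) v = A (ddiff A C n v) + C ((A ^^ n) v)"
proof (induction n arbitrary: v)
  case 0
  then show ?case
    by (simp add: lin_zero [OF assms])
next
  case (Suc n)
  have "ddiff A C (Suc (Suc n)) v = A ((A ^^ n) (C v)) + ddiff A C (Suc n) (A v)"
    by simp
  also have "ddiff A C (Suc n) (A v) = A (ddiff A C n (A v)) + C ((A ^^ n) (A v))"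
    by (rule Suc.IH)
  finally show ?case
    by (simp add: lin_add [OF assms] funpow_swap1 add.assoc)
qed

lemma ddiff_exp:
  "ddiff (B p) (B \<alpha>) (Suc N) v = (\<Sum>i\<le>N. s (of_nat (Suc N choose Suc i)) (B ((B p ^^ i) \<alpha>) ((B p ^^ (N - i)) v)))"
proof (induction N)
  case 0
  then show ?case
    by simp
next
  case (Suc N)
  let ?T = "\<lambda>i j. B ((B p ^^ i) \<alpha>) ((B p ^^ j) v)"
  have "ddiff (B p) (B \<alpha>) (Suc (Suc N)) v = B p (\<Sum>i\<le>N. s (of_nat (Suc N choose Suc i)) (?T i (N - i))) + ?T 0 (Suc N)"
    unfolding ddiff_Suc_left [OF B_right, of p "B \<alpha>" "Suc N" v] Suc.IH by (simp only: funpow_0)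
  also have "B p (\<Sum>i\<le>N. s (of_nat (Suc N choose Suc i)) (?T i (N - i)))
    = (\<Sum>i\<le>Suc N. s (of_nat ((if i = 0 then 0 else Suc N choose Suc (i - 1)) + (if i = Suc N then 0 else Suc N choose Suc i))) (?T i (Suc N - i)))"
    by (rule derivation_sum [where T = ?T, OF B_right derivation_T])
  \<comment> \<open>The boundary term supplies the unit that Pascal's rule lacks at i = 0.\<close>
  also have "?T 0 (Suc N) = (\<Sum>i\<le>Suc N. s (of_nat (if i = 0 then 1 else 0)) (?T i (Suc N - i)))"
    unfolding sum.atMost_Suc_shift [of _ N] by simp
  also have "(\<Sum>i\<le>Suc N. s (of_nat ((if i = 0 then 0 else Suc N choose Suc (i - 1)) + (if i = Suc N then 0 else Suc N choose Suc i))) (?T i (Suc N - i)))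
      + (\<Sum>i\<le>Suc N. s (of_nat (if i = 0 then 1 else 0)) (?T i (Suc N - i)))
      = (\<Sum>i\<le>Suc N. s (of_nat (Suc (Suc N) choose Suc i)) (?T i (Suc N - i)))"
    unfolding sum.distrib [symmetric] scale_left_distrib [symmetric] of_nat_add [symmetric]
  proof (rule sum.cong [OF refl])
    fix i assume "i \<in> {..Suc N}"
    have "(if i = 0 then 0 else Suc N choose Suc (i - 1)) + (if i = Suc N then 0 else Suc N choose Suc i) + (if i = 0 then 1 else 0)
        = Suc (Suc N) choose Suc i"
      by (cases i) auto
    then show "s (of_nat ((if i = 0 then 0 else Suc N choose Suc (i - 1)) + (if i = Suc N then 0 else Suc N choose Suc i) + (if i = 0 then 1 else 0))) (?T i (Suc N - i))
        = s (of_nat (Suc (Suc N) choose Suc i)) (?T i (Suc N - i))"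
      by (simp only:)
  qed
  finally show ?case .
qed

lemma ddiff_flat:
  "ddiff (B p) (B \<alpha>) (Suc N) \<beta> - ddiff (B p) (B \<beta>) (Suc N) \<alpha>
    = (\<Sum>i\<le>N. s (of_nat (Suc (Suc N) choose Suc i)) (B ((B p ^^ i) \<alpha>) ((B p ^^ (N - i)) \<beta>)))"
proof (induction N)
  case 0
  have "B \<alpha> \<beta> - B \<beta> \<alpha> = s (of_nat 2) (B \<alpha> \<beta>)"
    using scale_left_distrib [of 1 1 "B \<alpha> \<beta>"] by (subst B_anti [of \<beta> \<alpha>]) simp
  then show ?case
    by (simp add: numeral_2_eq_2)
next
  case (Suc N)
  let ?T = "\<lambda>i j. B ((B p ^^ i) \<alpha>) ((B p ^^ j) \<beta>)"
  have group: "a + b - (c + d) = a - c + b - d" for a b c d :: 'd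
    by simp
  have "ddiff (B p) (B \<alpha>) (Suc (Suc N)) \<beta> - ddiff (B p) (B \<beta>) (Suc (Suc N)) \<alpha>
      = B p (ddiff (B p) (B \<alpha>) (Suc N) \<beta> - ddiff (B p) (B \<beta>) (Suc N) \<alpha>) + ?T 0 (Suc N) - B \<beta> ((B p ^^ Suc N) \<alpha>)"
    unfolding ddiff_Suc_left [OF B_right, of p _ "Suc N"] B_diff(1) funpow_0
    by (rule group)
  also have "\<dots> = B p (\<Sum>i\<le>N. s (of_nat (Suc (Suc N) choose Suc i)) (?T i (N - i))) + ?T 0 (Suc N) + ?T (Suc N) 0"
    \<comment> \<open>Antisymmetry turns the second boundary term into the summand with i = N + 1;
      the two boundary terms complete Pascal's rule at both ends.\<close>
    unfolding Suc.IH B_anti [of \<beta> "(B p ^^ Suc N) \<alpha>"] by (simp only: funpow_0 diff_minus_eq_add)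
  also have "B p (\<Sum>i\<le>N. s (of_nat (Suc (Suc N) choose Suc i)) (?T i (N - i)))
    = (\<Sum>i\<le>Suc N. s (of_nat ((if i = 0 then 0 else Suc (Suc N) choose Suc (i - 1)) + (if i = Suc N then 0 else Suc (Suc N) choose Suc i))) (?T i (Suc N - i)))"
    by (rule derivation_sum [where T = ?T, OF B_right derivation_T])
  also have "?T 0 (Suc N) = (\<Sum>i\<le>Suc N. s (of_nat (if i = 0 then 1 else 0)) (?T i (Suc N - i)))"
    unfolding sum.atMost_Suc_shift [of _ N] by simp
  also have "?T (Suc N) 0 = (\<Sum>i\<le>Suc N. s (of_nat (if i = Suc N then 1 else 0)) (?T i (Suc N - i)))"
    by simp
  also have "(\<Sum>i\<le>Suc N. s (of_nat ((if i = 0 then 0 else Suc (Suc N) choose Suc (i - 1)) + (if i = Suc N then 0 else Suc (Suc N) choose Suc i))) (?T i (Suc N - i)))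
      + (\<Sum>i\<le>Suc N. s (of_nat (if i = 0 then 1 else 0)) (?T i (Suc N - i)))
      + (\<Sum>i\<le>Suc N. s (of_nat (if i = Suc N then 1 else 0)) (?T i (Suc N - i)))
      = (\<Sum>i\<le>Suc N. s (of_nat (Suc (Suc (Suc N)) choose Suc i)) (?T i (Suc N - i)))"
    unfolding sum.distrib [symmetric] scale_left_distrib [symmetric] of_nat_add [symmetric]
  proof (rule sum.cong [OF refl])
    fix i assume "i \<in> {..Suc N}"
    have "(if i = 0 then 0 else Suc (Suc N) choose Suc (i - 1)) + (if i = Suc N then 0 else Suc (Suc N) choose Suc i)
        + (if i = 0 then 1 else 0) + (if i = Suc N then 1 else 0) = Suc (Suc (Suc N)) choose Suc i"
      by (cases i) auto
    then show "s (of_nat ((if i = 0 then 0 else Suc (Suc N) choose Suc (i - 1)) + (if i = Suc N then 0 else Suc (Suc N) choose Suc i)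
        + (if i = 0 then 1 else 0) + (if i = Suc N then 1 else 0))) (?T i (Suc N - i))
      = s (of_nat (Suc (Suc (Suc N)) choose Suc i)) (?T i (Suc N - i))"
      by (simp only:)
  qed
  finally show ?case .
qed

lemma form_B: "\<xi> \<in> forms \<Longrightarrow> (\<lambda>x. \<xi> (B x y)) \<in> forms" "\<xi> \<in> forms \<Longrightarrow> (\<lambda>y. \<xi> (B x y)) \<in> forms"
  by (rule form_comp [OF _ B_left], assumption) (rule form_comp [OF _ B_right])

lemma binomial_fact_Suc:
  "i \<le> N \<Longrightarrow> of_nat (Suc N choose Suc i) / fact (Suc N) = (1 / fact (Suc i) * (1 / fact (N - i)) :: real)"
  by (subst binomial_fact) (simp_all del: fact_Suc)

lemma binomial_fact_Suc_Suc:
  "i \<le> N \<Longrightarrow> of_nat (Suc (Suc N) choose Suc i) / fact (Suc (Suc N)) = (1 / fact (Suc i) * (1 / fact (Suc (N - i))) :: real)"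
  by (subst binomial_fact) (simp_all add: Suc_diff_le del: fact_Suc)

lemma binomial_fact_0:
  "i \<le> N \<Longrightarrow> of_nat (N choose i) / fact N = (1 / fact i * (1 / fact (N - i)) :: real)"
  by (subst binomial_fact) (simp_all del: fact_Suc)

lemma Cauchy_B:
  assumes "entire f" "entire g" "\<xi> \<in> forms"
    and c: "\<And>i. i \<le> N \<Longrightarrow> fps_nth f i * fps_nth g (N - i) = of_nat (c i) * d"
  shows "(\<Sum>i\<le>N. fps_nth (rfps f) i * fps_nth (rfps g) (N - i) * \<xi> (B ((B p ^^ i) u) ((B p ^^ (N - i)) v)))
    = of_real d * \<xi> (\<Sum>i\<le>N. s (of_nat (c i)) (B ((B p ^^ i) u) ((B p ^^ (N - i)) v)))"
proof -
  have "fps_nth (rfps f) i * fps_nth (rfps g) (N - i) = (of_real d * of_nat (c i) :: 'k)" if "i \<le> N" for i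
    using c [OF that] by (simp flip: of_real_mult) (simp add: mult.commute)
  then show ?thesis
    by (simp add: form_sum [OF assms(3)] form_scale [OF assms(3)] sum_distrib_left mult.assoc)
qed

text \<open>The Leibniz rule divided by n! has the coefficients 1/i! and 1/(n-i)! of the Cauchy
  product of the exponential series with itself.\<close>

lemma exp_automorphism: "e p (B u v) = B (e p u) (e p v)"
proof (rule forms_eqI)
  fix \<xi> assume \<xi>: "\<xi> \<in> forms"
  have "(\<lambda>n. \<Sum>i\<le>n. fps_nth (rfps sE) i * fps_nth (rfps sE) (n - i) * \<xi> (B ((B p ^^ i) u) ((B p ^^ (n - i)) v)))
      sums \<xi> (B (e p u) (e p v))"
    unfolding fs_def
    by (rule ps_Cauchy [OF entire_rfps entire_rfps B_right B_right form_B(1) form_B(2)]) (simp_all add: entire_series \<xi>)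
  moreover have "(\<Sum>i\<le>n. fps_nth (rfps sE) i * fps_nth (rfps sE) (n - i) * \<xi> (B ((B p ^^ i) u) ((B p ^^ (n - i)) v)))
      = of_real (fps_nth sE n) * \<xi> ((B p ^^ n) (B u v))" for n
    unfolding Leibniz
    by (rule Cauchy_B [OF entire_series(1,1) \<xi>]) (use binomial_fact_0 in \<open>simp add: sE_def\<close>)
  ultimately show "\<xi> (e p (B u v)) = \<xi> (B (e p u) (e p v))"
    using sums_unique2 [OF fs_sums [OF entire_series(1) \<xi>, of p "B u v"]] by simp
qed

lemma \<kappa>_pow: "\<kappa> ((B p ^^ n) u) v = (- 1) ^ n * \<kappa> u ((B p ^^ n) v)"
proof (induction n arbitrary: v)
  case (Suc n)
  have "\<kappa> ((B p ^^ Suc n) u) v = - \<kappa> ((B p ^^ n) u) (B p v)"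
    by (simp add: \<kappa>_skew)
  also have "\<dots> = (- 1) ^ Suc n * \<kappa> u ((B p ^^ n) (B p v))"
    by (simp add: Suc)
  finally show ?case
    by (simp add: funpow_swap1)
qed simp

text \<open>ad p is skew for \<kappa>, so the adjoint of f(ad p) is f(-ad p).\<close>

lemma \<kappa>_fs:
  assumes "entire f" "entire g" "\<And>n. fps_nth g n = (- 1) ^ n * fps_nth f n"
  shows "\<kappa> (fs f p u) v = \<kappa> u (fs g p v)"
proof (rule sums_unique2)
  show "(\<lambda>n. of_real (fps_nth f n) * \<kappa> ((B p ^^ n) u) v) sums \<kappa> (fs f p u) v"
    by (rule fs_sums [OF assms(1) \<kappa>_left])
  have "(\<lambda>n. of_real (fps_nth g n) * \<kappa> u ((B p ^^ n) v)) sums \<kappa> u (fs g p v)"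
    by (rule fs_sums [OF assms(2) \<kappa>_right])
  then show "(\<lambda>n. of_real (fps_nth f n) * \<kappa> ((B p ^^ n) u) v) sums \<kappa> u (fs g p v)"
    by (simp add: assms(3) \<kappa>_pow mult_ac)
qed

lemma \<kappa>_e: "\<kappa> (e p u) v = \<kappa> u (em p v)" "\<kappa> (em p u) v = \<kappa> u (e p v)"
  by (rule \<kappa>_fs [OF entire_series(1,2)], simp add: sE_def sEm_def)
    (rule \<kappa>_fs [OF entire_series(2,1)], simp add: sE_def sEm_def flip: power_mult_distrib)

lemma \<kappa>_D: "\<kappa> (D p u) v = \<kappa> u (fs sE1m p v)"
  by (rule \<kappa>_fs [OF entire_series(3,4)]) (simp add: sE1_def sE1m_def)

lemma \<kappa>_e_e [simp]: "\<kappa> (e p u) (e p v) = \<kappa> u v"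
  by (simp add: \<kappa>_e)

section \<open>Derivatives of series in ad p with respect to p\<close>

definition "dfs f p \<alpha> = dps (rfps f) (B p) (B \<alpha>)"

lemma dfs_sums: "entire f \<Longrightarrow> \<xi> \<in> forms \<Longrightarrow> (\<lambda>n. of_real (fps_nth f n) * \<xi> (ddiff (B p) (B \<alpha>) n v)) sums \<xi> (dfs f p \<alpha> v)"
  using dps_sums [OF entire_rfps B_right B_right] unfolding dfs_def by simp

lemma vder_fs:
  assumes "entire f" "vder w w'"
  shows "vder (\<lambda>t. fs f (p + s t \<alpha>) (w t)) (dfs f p \<alpha> (w 0) + fs f p w')"
proof -
  have "B (p + s t \<alpha>) = (\<lambda>v. B p v + s t (B \<alpha> v))" for t
    by (rule ext) (simp add: B_add B_scale)
  then show ?thesis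
    using vder_ps [OF entire_rfps [OF assms(1)] assms(2), of "B p" "B \<alpha>"] by (simp add: fs_def dfs_def)
qed

lemma vder_fs_const: "entire f \<Longrightarrow> vder (\<lambda>t. fs f (p + s t \<alpha>) v) (dfs f p \<alpha> v)"
  using vder_fs [OF _ vder_const, of f p \<alpha> v] by (simp add: fs_zero)

text \<open>The derivative of e^(ad p) is ad of the logarithmic derivative D \<alpha> followed by
  e^(ad p); on coefficients this is \<open>ddiff_exp\<close> divided by (N+1)!.\<close>

lemma dfs_exp: "dfs sE p \<alpha> v = B (D p \<alpha>) (e p v)"
proof (rule forms_eqI)
  fix \<xi> assume \<xi>: "\<xi> \<in> forms"
  let ?F = "\<lambda>n. of_real (fps_nth sE n) * \<xi> (ddiff (B p) (B \<alpha>) n v)"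
  have "(\<lambda>n. \<Sum>i\<le>n. fps_nth (rfps sE1) i * fps_nth (rfps sE) (n - i) * \<xi> (B ((B p ^^ i) \<alpha>) ((B p ^^ (n - i)) v)))
      sums \<xi> (B (D p \<alpha>) (e p v))"
    unfolding fs_def
    by (rule ps_Cauchy [OF entire_rfps entire_rfps B_right B_right form_B(1) form_B(2)]) (simp_all add: entire_series \<xi>)
  moreover have "(\<Sum>i\<le>n. fps_nth (rfps sE1) i * fps_nth (rfps sE) (n - i) * \<xi> (B ((B p ^^ i) \<alpha>) ((B p ^^ (n - i)) v)))
      = ?F (Suc n)" for n
    unfolding ddiff_exp
    by (rule Cauchy_B [OF entire_series(3,1) \<xi>])
      (use binomial_fact_Suc in \<open>simp add: sE_def sE1_def del: fact_Suc binomial_Suc_Suc\<close>)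
  ultimately have "(\<lambda>n. ?F (Suc n)) sums \<xi> (B (D p \<alpha>) (e p v))"
    by (simp only:)
  \<comment> \<open>The Cauchy product starts with the term of index 1; the term of index 0 is zero
    because the divided difference of order 0 vanishes.\<close>
  then have "?F sums \<xi> (B (D p \<alpha>) (e p v))"
    by (subst (asm) sums_Suc_iff) (simp add: form_zero [OF \<xi>])
  then show "\<xi> (dfs sE p \<alpha> v) = \<xi> (B (D p \<alpha>) (e p v))"
    using sums_unique2 [OF dfs_sums [OF entire_series(1) \<xi>]] by simp
qed

text \<open>The Maurer-Cartan equation for D. The coefficients 1/(i+1)! and 1/(N-i+1)! multiply to
  C(N+2, i+1)/(N+2)!, the ones produced by \<open>ddiff_flat\<close>.\<close>

lemma flatness: "dfs sE1 p \<alpha> \<beta> - dfs sE1 p \<beta> \<alpha> = B (D p \<alpha>) (D p \<beta>)"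
proof (rule forms_eqI)
  fix \<xi> assume \<xi>: "\<xi> \<in> forms"
  let ?F = "\<lambda>n. of_real (fps_nth sE1 n) * \<xi> (ddiff (B p) (B \<alpha>) n \<beta> - ddiff (B p) (B \<beta>) n \<alpha>)"
  have "(\<lambda>n. \<Sum>i\<le>n. fps_nth (rfps sE1) i * fps_nth (rfps sE1) (n - i) * \<xi> (B ((B p ^^ i) \<alpha>) ((B p ^^ (n - i)) \<beta>)))
      sums \<xi> (B (D p \<alpha>) (D p \<beta>))"
    unfolding fs_def
    by (rule ps_Cauchy [OF entire_rfps entire_rfps B_right B_right form_B(1) form_B(2)]) (simp_all add: entire_series \<xi>)
  moreover have "(\<Sum>i\<le>n. fps_nth (rfps sE1) i * fps_nth (rfps sE1) (n - i) * \<xi> (B ((B p ^^ i) \<alpha>) ((B p ^^ (n - i)) \<beta>)))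
      = ?F (Suc n)" for n
    unfolding ddiff_flat
    by (rule Cauchy_B [OF entire_series(3,3) \<xi>])
      (use binomial_fact_Suc_Suc in \<open>simp add: sE1_def del: fact_Suc binomial_Suc_Suc\<close>)
  ultimately have "(\<lambda>n. ?F (Suc n)) sums \<xi> (B (D p \<alpha>) (D p \<beta>))"
    by (simp only:)
  then have "?F sums \<xi> (B (D p \<alpha>) (D p \<beta>))"
    by (subst (asm) sums_Suc_iff) (simp add: form_zero [OF \<xi>])
  moreover have "?F sums (\<xi> (dfs sE1 p \<alpha> \<beta>) - \<xi> (dfs sE1 p \<beta> \<alpha>))"
    using sums_diff [OF dfs_sums [OF entire_series(3) \<xi>, of p \<alpha> \<beta>] dfs_sums [OF entire_series(3) \<xi>, of p \<beta> \<alpha>]]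
    by (simp add: form_diff [OF \<xi>] right_diff_distrib)
  ultimately show "\<xi> (dfs sE1 p \<alpha> \<beta> - dfs sE1 p \<beta> \<alpha>) = \<xi> (B (D p \<alpha>) (D p \<beta>))"
    using sums_unique2 by (simp add: form_diff [OF \<xi>])
qed

lemma vder_zero:
  assumes "vder F F'" "\<beta> \<in> forms" "\<forall>\<^sub>F t in nhds 0. \<beta> (F t) = 0"
  shows "\<beta> F' = 0"
proof -
  have "((\<lambda>t. \<beta> (F t)) has_field_derivative \<beta> F') (at 0)"
    using assms(1,2) by (simp add: vder_def)
  from DERIV_cong_ev [OF refl assms(3) refl, THEN iffD1, OF this]
  have "((\<lambda>t. 0) has_field_derivative \<beta> F') (at 0)" .
  then show ?thesis
    by (rule DERIV_unique [OF _ DERIV_const])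
qed

text \<open>ad of -[z, p] is the commutator of ad p and ad z, so the sum of A^i B A^(n-1-i)
  telescopes to the commutator of (ad p)^n with ad z. This is the infinitesimal equivariance of p ->
  f(ad p).\<close>

lemma dfs_ad: "entire f \<Longrightarrow> dfs f p (- B z p) v = fs f p (B z v) - B z (fs f p v)"
proof (rule forms_eqI)
  fix \<xi> assume f: "entire f" and \<xi>: "\<xi> \<in> forms"
  have "ddiff (B p) (B (- B z p)) n v = (B p ^^ n) (B z v) - B z ((B p ^^ n) v)" for n
  proof (induction n)
    case (Suc n)
    let ?x = "(B p ^^ n) v"
    have "B (- B z p) ?x = B p (B z ?x) - B z (B p ?x)"
      by (simp add: B_neg B_deriv [of z p ?x])
    then show ?case
      by (subst ddiff_Suc_left [OF B_right]) (simp add: Suc B_diff)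
  qed simp
  moreover have "(\<lambda>n. of_real (fps_nth f n) * \<xi> ((B p ^^ n) (B z v)) - of_real (fps_nth f n) * \<xi> (B z ((B p ^^ n) v)))
      sums (\<xi> (fs f p (B z v)) - \<xi> (B z (fs f p v)))"
    by (intro sums_diff fs_sums [OF f \<xi>] fs_sums [OF f form_B(2) [OF \<xi>]])
  ultimately have "(\<lambda>n. of_real (fps_nth f n) * \<xi> (ddiff (B p) (B (- B z p)) n v)) sums (\<xi> (fs f p (B z v)) - \<xi> (B z (fs f p v)))"
    by (simp add: form_diff [OF \<xi>] right_diff_distrib)
  then show "\<xi> (dfs f p (- B z p) v) = \<xi> (fs f p (B z v) - B z (fs f p v))"
    using sums_unique2 [OF dfs_sums [OF f \<xi>]] by (simp add: form_diff [OF \<xi>])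
qed

text \<open>Termwise differentiation of the antiderivative of an everywhere convergent series. Along
  a ray t p, series in ad p become power series in t, to which it is applied.\<close>

lemma exponential_series_deriv:
  fixes h :: "nat \<Rightarrow> 'k"
  assumes "\<And>t. summable (\<lambda>n. h n * t ^ n / fact n)"
  shows "((\<lambda>t. \<Sum>n. h n * t ^ Suc n / fact (Suc n)) has_field_derivative (\<Sum>n. h n * x ^ n / fact n)) (at x)"
    and "summable (\<lambda>n. h n * x ^ Suc n / fact (Suc n))"
proof -
  \<comment> \<open>The coefficients of the antiderivative with value 0 at 0; their formal
    derivative is h n / n!.\<close>
  define c where "c n = (case n of 0 \<Rightarrow> 0 | Suc m \<Rightarrow> h m / fact (Suc m))" for n
  have diffs: "diffs c n = h n / fact n" for n
  proof -
    have "of_nat (Suc n) \<noteq> (0 :: 'k)"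
      by (rule of_nat_neq_0)
    then show ?thesis
      by (simp add: diffs_def c_def del: of_nat_Suc)
  qed
  have sd: "summable (\<lambda>n. diffs c n * t ^ n)" for t
    using assms [of t] by (simp add: diffs)
  have sc: "summable (\<lambda>n. c n * t ^ n)" for t
  proof (rule summable_comparison_test')
    have "summable (\<lambda>n. diffs c n * (of_real (norm t + 1)) ^ n)"
      by (rule sd)
    then have "summable (\<lambda>n. norm (diffs c n * t ^ n))"
      by (rule powser_insidea) simp
    then have "summable (\<lambda>n. norm t * norm (diffs c n * t ^ n))"
      by (rule summable_mult)
    then show "summable (\<lambda>n. case n of 0 \<Rightarrow> 0 | Suc m \<Rightarrow> norm t * norm (diffs c m * t ^ m))"
      by (subst summable_Suc_iff [symmetric]) simp
    fix n
    show "norm (c n * t ^ n) \<le> (case n of 0 \<Rightarrow> 0 | Suc m \<Rightarrow> norm t * norm (diffs c m * t ^ m))"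
    proof (cases n)
      case (Suc m)
      \<comment> \<open>The larger factorial only shrinks a coefficient, so the derivative series
        times norm t is a majorant.\<close>
      have "norm (h m / fact (Suc m)) \<le> norm (h m / fact m)"
        by (simp add: norm_divide del: fact_Suc) (intro divide_left_mono fact_mono, auto)
      then have "norm (c n) \<le> norm (diffs c m)"
        by (simp only: diffs) (simp add: c_def Suc del: fact_Suc)
      then have "norm (c n) * norm (t ^ n) \<le> norm (diffs c m) * norm (t ^ n)"
        by (rule mult_right_mono) simp
      then show ?thesis
        by (simp add: Suc norm_mult mult_ac)
    qed (simp add: c_def)
  qed
  have eq: "(\<Sum>n. c n * t ^ n) = (\<Sum>n. h n * t ^ Suc n / fact (Suc n))" for t
    using suminf_split_head [OF sc [of t]] by (simp add: c_def del: fact_Suc)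
  have "((\<lambda>t. \<Sum>n. c n * t ^ n) has_field_derivative (\<Sum>n. diffs c n * x ^ n)) (at x)"
    by (rule termdiffs_strong_converges_everywhere [OF sc])
  then show "((\<lambda>t. \<Sum>n. h n * t ^ Suc n / fact (Suc n)) has_field_derivative (\<Sum>n. h n * x ^ n / fact n)) (at x)"
    by (simp only: eq diffs) simp
  show "summable (\<lambda>n. h n * x ^ Suc n / fact (Suc n))"
    using sc [of x] by (subst (asm) summable_Suc_iff [symmetric]) (simp add: c_def del: fact_Suc)
qed

lemma pow_scaled: "(B (s t p) ^^ n) v = s (t ^ n) ((B p ^^ n) v)"
  by (induction n) (simp_all add: B_scale mult_ac)

lemma ddiff_scaled: "ddiff (B (s t p)) (B (s t \<alpha>)) n v = s (t ^ n) (ddiff (B p) (B \<alpha>) n v)"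
proof (induction n)
  case (Suc n)
  show ?case
    unfolding ddiff_Suc_left [OF B_right] Suc.IH pow_scaled
    by (simp add: B_scale scale_right_distrib mult_ac)
qed simp

end

section \<open>The dynamical equation in a graded quadratic Lie algebra\<close>

text \<open>(cosh z - 1)/z, the odd part of (e^z - 1)/z; \<open>sJ\<close> is (cosh z - 1)/z^2, the
  even part of (e^z - 1 - z)/z^2. Parity decides which summand receives the image of P or of
  L.\<close>

definition sK :: "real fps" where "sK = Abs_fps (\<lambda>n. if even n then 0 else 1 / fact (Suc n))"
definition sJ :: "real fps" where "sJ = Abs_fps (\<lambda>n. if even n then 1 / fact (Suc (Suc n)) else 0)"

lemma entire_sK: "entire sK" and entire_sJ: "entire sJ"
  by (rule entire_fact_bound, use inverse_fact_Suc inverse_fact_Suc_Suc in \<open>simp add: sK_def sJ_def del: fact_Suc\<close>)+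

lemma sE1_split: "sE1 = sS + sK" and sE2_split: "sE2 = sH + sJ"
  by (simp_all add: fps_eq_iff series_defs sK_def sJ_def del: fact_Suc)

text \<open>The product is (e^z + e^-z - 2)/z^2, an even function.\<close>

lemma sE1m_sE1_odd: "odd n \<Longrightarrow> fps_nth (sE1m * sE1) n = 0"
proof -
  assume n: "odd n"
  have "fps_X\<^sup>2 * (sE1m * sE1) = (fps_X * sE1m) * (fps_X * sE1)"
    by (simp add: power2_eq_square mult_ac)
  also have "\<dots> = (1 - sEm) * (sE - 1)"
    by (simp only: X_series)
  also have "\<dots> = sE + sEm - 2"
    by (simp add: algebra_simps sE_sEm)
  finally have "fps_nth (fps_X\<^sup>2 * (sE1m * sE1)) (Suc (Suc n)) = fps_nth (sE + sEm - 2) (Suc (Suc n))"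
    by simp
  with n show ?thesis
    by (simp add: power2_eq_square mult.assoc fps_numeral_nth sE_def sEm_def del: fact_Suc)
qed

context quad_lie
begin

lemma fs_form_zero:
  assumes "entire f" "\<xi> \<in> forms" "\<And>n. fps_nth f n \<noteq> 0 \<Longrightarrow> \<xi> ((B p ^^ n) v) = 0"
  shows "\<xi> (fs f p v) = 0"
  unfolding fs_def by (rule ps_form_zero [OF entire_rfps [OF assms(1)] B_right assms(2)]) (use assms(3) in simp)

lemma B_D: "B p (D p v) = e p v - v"
proof -
  have "fs (fps_X * sE1) p v = fs (fps_X :: real fps) p (D p v)"
  proof (rule fs_mult)
    show "entire (fps_X :: real fps)"
      unfolding entire_def by (intro allI impI summable_finite [of "{1}"]) (auto simp: fps_X_def)
  qed (rule entire_series)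
  moreover have "fs (fps_X :: real fps) p u = B p u" for u
    unfolding fs_def
  proof (rule ps_eqI [OF _ B_right])
    show "entire (rfps fps_X :: 'k fps)"
      unfolding entire_def by (intro allI impI summable_finite [of "{1}"]) (auto simp: fps_X_def)
    fix \<xi> assume "\<xi> \<in> forms"
    have "(\<lambda>n. fps_nth (rfps fps_X) n * \<xi> ((B p ^^ n) u)) sums (\<Sum>n\<in>{1}. fps_nth (rfps fps_X) n * \<xi> ((B p ^^ n) u))"
      by (rule sums_finite) (auto simp: fps_X_def)
    then show "(\<lambda>n. fps_nth (rfps fps_X) n * \<xi> ((B p ^^ n) u)) sums \<xi> (B p u)"
      by (simp add: fps_X_def)
  qed
  moreover have "fs (fps_X * sE1 + 1) p v = e p v"
    by (simp add: X_series)
  moreover have "fs (fps_X * sE1 + 1) p v = fs (fps_X * sE1) p v + fs 1 p v"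
  proof (rule fs_plus)
    show "entire (fps_X * sE1)"
      by (intro entire_mult entire_series) (unfold entire_def, intro allI impI summable_finite [of "{1}"], auto simp: fps_X_def)
    show "entire (1 :: real fps)"
      using entire_const [of 1] by simp
  qed
  ultimately show ?thesis
    by (simp add: fs_one eq_diff_eq)
qed

lemma vder_B: "vder F F' \<Longrightarrow> vder G G' \<Longrightarrow> vder (\<lambda>t. B (F t) (G t)) (B F' (G 0) + B (F 0) G')"
proof -
  assume v: "vder F F'" "vder G G'"
  show ?thesis
    unfolding vder_def
  proof
    fix \<xi> assume \<xi>: "\<xi> \<in> forms"
    have "((\<lambda>t. \<xi> (B (F t) (G t))) has_field_derivative \<xi> (B F' (G 0)) + \<xi> (B (F 0) G')) (at 0)"
      by (rule vder_bilinear [where \<beta> = "\<lambda>x y. \<xi> (B x y)", OF form_B(1) [OF \<xi>] form_B(2) [OF \<xi>] v])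
    then show "((\<lambda>t. \<xi> (B (F t) (G t))) has_field_derivative \<xi> (B F' (G 0) + B (F 0) G')) (at 0)"
      by (simp add: form_add [OF \<xi>])
  qed
qed

lemma vder_\<kappa>: "vder F F' \<Longrightarrow> vder G G' \<Longrightarrow>
    ((\<lambda>t. \<kappa> (F t) (G t)) has_field_derivative \<kappa> F' (G 0) + \<kappa> (F 0) G') (at 0)"
  by (rule vder_bilinear [OF \<kappa>_left \<kappa>_right])

text \<open>t D at t p is (e^(t a) - 1)/a, whose derivative in t is e^(t a).\<close>

lemma vder_D_line:
  "vder (\<lambda>t. D (s (x + t) p) (s (x + t) \<alpha>)) (e (s x p) \<alpha>)"
  unfolding vder_def
proof
  fix \<xi> assume \<xi>: "\<xi> \<in> forms"
  let ?h = "\<lambda>n. \<xi> ((B p ^^ n) \<alpha>)"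
  have E: "(\<lambda>n. ?h n * t ^ n / fact n) sums \<xi> (e (s t p) \<alpha>)" for t
    using fs_sums [OF entire_series(1) \<xi>, of "s t p" \<alpha>]
    by (simp add: pow_scaled form_scale [OF \<xi>] sE_def mult_ac)
  have D: "(\<lambda>n. ?h n * t ^ Suc n / fact (Suc n)) sums \<xi> (D (s t p) (s t \<alpha>))" for t
    using sums_mult [OF fs_sums [OF entire_series(3) \<xi>, of "s t p" \<alpha>], of t]
    by (simp add: pow_scaled form_scale [OF \<xi>] sE1_def mult_ac fs_scale del: fact_Suc)
  have "((\<lambda>t. \<Sum>n. ?h n * t ^ Suc n / fact (Suc n)) has_field_derivative (\<Sum>n. ?h n * x ^ n / fact n)) (at x)"
    by (rule exponential_series_deriv(1)) (rule sums_summable [OF E])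
  then have "((\<lambda>t. \<xi> (D (s t p) (s t \<alpha>))) has_field_derivative \<xi> (e (s x p) \<alpha>)) (at (0 + x))"
    by (simp only: sums_unique [OF D, symmetric] sums_unique [OF E, symmetric] add_0)
  then show "((\<lambda>t. \<xi> (D (s (x + t) p) (s (x + t) \<alpha>))) has_field_derivative \<xi> (e (s x p) \<alpha>)) (at 0)"
    by (subst (asm) DERIV_shift) (simp add: add.commute)
qed

end

text \<open>L pairs with P and M with Q. Each summand is given as an orthogonal complement, so that
  membership of limits and of derivatives reduces to the vanishing of a form.\<close>

locale graded_lie = quad_lie s B \<kappa>
  for s :: "'k::rc_field \<Rightarrow> 'd::ab_group_add \<Rightarrow> 'd" and B \<kappa> +
  fixes L M P Q :: "'d set"
  assumes L_iff: "x \<in> L \<longleftrightarrow> (\<forall>y\<in>L \<union> M \<union> Q. \<kappa> x y = 0)"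
    and M_iff: "x \<in> M \<longleftrightarrow> (\<forall>y\<in>L \<union> M \<union> P. \<kappa> x y = 0)"
    and P_iff: "x \<in> P \<longleftrightarrow> (\<forall>y\<in>M \<union> P \<union> Q. \<kappa> x y = 0)"
    and Q_iff: "x \<in> Q \<longleftrightarrow> (\<forall>y\<in>L \<union> P \<union> Q. \<kappa> x y = 0)"
    and LL: "x \<in> L \<Longrightarrow> y \<in> L \<Longrightarrow> B x y \<in> L" and LP: "x \<in> L \<Longrightarrow> y \<in> P \<Longrightarrow> B x y \<in> P"
    and PP: "x \<in> P \<Longrightarrow> y \<in> P \<Longrightarrow> B x y \<in> L" and LM: "x \<in> L \<Longrightarrow> y \<in> M \<Longrightarrow> B x y \<in> M"
    and LQ: "x \<in> L \<Longrightarrow> y \<in> Q \<Longrightarrow> B x y \<in> Q"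
    and QQQ: "x \<in> Q \<Longrightarrow> y \<in> Q \<Longrightarrow> z \<in> Q \<Longrightarrow> \<kappa> (B x y) z = 0"
    and decomposition: "\<exists>a\<in>L. \<exists>b\<in>M. \<exists>c\<in>P. \<exists>d\<in>Q. x = a + b + c + d"
    and nondegenerate: "(\<And>y. \<kappa> x y = 0) \<Longrightarrow> x = 0"
begin

lemma orth:
  "x \<in> L \<Longrightarrow> y \<in> L \<Longrightarrow> \<kappa> x y = 0" "x \<in> L \<Longrightarrow> y \<in> M \<Longrightarrow> \<kappa> x y = 0" "x \<in> L \<Longrightarrow> y \<in> Q \<Longrightarrow> \<kappa> x y = 0"
  "x \<in> M \<Longrightarrow> y \<in> L \<Longrightarrow> \<kappa> x y = 0" "x \<in> M \<Longrightarrow> y \<in> M \<Longrightarrow> \<kappa> x y = 0" "x \<in> M \<Longrightarrow> y \<in> P \<Longrightarrow> \<kappa> x y = 0"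
  "x \<in> P \<Longrightarrow> y \<in> M \<Longrightarrow> \<kappa> x y = 0" "x \<in> P \<Longrightarrow> y \<in> P \<Longrightarrow> \<kappa> x y = 0" "x \<in> P \<Longrightarrow> y \<in> Q \<Longrightarrow> \<kappa> x y = 0"
  "x \<in> Q \<Longrightarrow> y \<in> L \<Longrightarrow> \<kappa> x y = 0" "x \<in> Q \<Longrightarrow> y \<in> P \<Longrightarrow> \<kappa> x y = 0" "x \<in> Q \<Longrightarrow> y \<in> Q \<Longrightarrow> \<kappa> x y = 0"
  using L_iff [of x] M_iff [of x] P_iff [of x] Q_iff [of x] by simp_all

lemma subspaces:
  "x \<in> L \<Longrightarrow> y \<in> L \<Longrightarrow> x + y \<in> L" "x \<in> L \<Longrightarrow> s c x \<in> L" "x \<in> L \<Longrightarrow> - x \<in> L"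
  "x \<in> M \<Longrightarrow> y \<in> M \<Longrightarrow> x + y \<in> M" "x \<in> M \<Longrightarrow> s c x \<in> M" "x \<in> M \<Longrightarrow> - x \<in> M"
  "x \<in> P \<Longrightarrow> y \<in> P \<Longrightarrow> x + y \<in> P" "x \<in> P \<Longrightarrow> s c x \<in> P" "x \<in> P \<Longrightarrow> - x \<in> P"
  "x \<in> Q \<Longrightarrow> y \<in> Q \<Longrightarrow> x + y \<in> Q" "x \<in> Q \<Longrightarrow> s c x \<in> Q" "x \<in> Q \<Longrightarrow> - x \<in> Q"
  unfolding L_iff [of "_ + _"] L_iff [of "s _ _"] L_iff [of "- _"]
    M_iff [of "_ + _"] M_iff [of "s _ _"] M_iff [of "- _"]
    P_iff [of "_ + _"] P_iff [of "s _ _"] P_iff [of "- _"]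
    Q_iff [of "_ + _"] Q_iff [of "s _ _"] Q_iff [of "- _"]
  by (auto simp: \<kappa>_add \<kappa>_scale \<kappa>_neg orth)

lemma PL: "x \<in> P \<Longrightarrow> y \<in> L \<Longrightarrow> B x y \<in> P"
  by (subst B_anti) (rule subspaces(9) [OF LP])

text \<open>[P, P] lies in L and [P, L] in P, as for a symmetric pair: ad p interchanges the
  two.\<close>

lemma pow_parity:
  assumes p: "p \<in> P"
  shows "x \<in> P \<Longrightarrow> (if even n then (B p ^^ n) x \<in> P else (B p ^^ n) x \<in> L)"
    and "x \<in> L \<Longrightarrow> (if even n then (B p ^^ n) x \<in> L else (B p ^^ n) x \<in> P)"
  by (induction n) (use PP [OF p] PL [OF p] in \<open>auto split: if_splits\<close>)

lemma fs_parity: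
  assumes f: "entire f" and p: "p \<in> P"
  shows "(\<And>n. odd n \<Longrightarrow> fps_nth f n = 0) \<Longrightarrow> x \<in> P \<Longrightarrow> fs f p x \<in> P"
    and "(\<And>n. odd n \<Longrightarrow> fps_nth f n = 0) \<Longrightarrow> x \<in> L \<Longrightarrow> fs f p x \<in> L"
    and "(\<And>n. even n \<Longrightarrow> fps_nth f n = 0) \<Longrightarrow> x \<in> P \<Longrightarrow> fs f p x \<in> L"
    and "(\<And>n. even n \<Longrightarrow> fps_nth f n = 0) \<Longrightarrow> x \<in> L \<Longrightarrow> fs f p x \<in> P"
proof -
  note par = pow_parity [OF p, of x]
  have P: "fs f p x \<in> P" if "\<And>n. fps_nth f n \<noteq> 0 \<Longrightarrow> (B p ^^ n) x \<in> P"
    unfolding P_iff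
  proof
    fix y assume "y \<in> M \<union> P \<union> Q"
    then show "\<kappa> (fs f p x) y = 0"
      by (intro fs_form_zero [OF f \<kappa>_left]) (use that orth in blast)
  qed
  have L: "fs f p x \<in> L" if "\<And>n. fps_nth f n \<noteq> 0 \<Longrightarrow> (B p ^^ n) x \<in> L"
    unfolding L_iff
  proof
    fix y assume "y \<in> L \<union> M \<union> Q"
    then show "\<kappa> (fs f p x) y = 0"
      by (intro fs_form_zero [OF f \<kappa>_left]) (use that orth in blast)
  qed
  show "fs f p x \<in> P" if "\<And>n. odd n \<Longrightarrow> fps_nth f n = 0" "x \<in> P"
    by (rule P) (use par(1) that in \<open>metis\<close>)
  show "fs f p x \<in> L" if "\<And>n. odd n \<Longrightarrow> fps_nth f n = 0" "x \<in> L"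
    by (rule L) (use par(2) that in \<open>metis\<close>)
  show "fs f p x \<in> L" if "\<And>n. even n \<Longrightarrow> fps_nth f n = 0" "x \<in> P"
    by (rule L) (use par(1) that in \<open>metis\<close>)
  show "fs f p x \<in> P" if "\<And>n. even n \<Longrightarrow> fps_nth f n = 0" "x \<in> L"
    by (rule P) (use par(2) that in \<open>metis\<close>)
qed

lemma sS_P: "p \<in> P \<Longrightarrow> x \<in> P \<Longrightarrow> fs sS p x \<in> P"
  by (rule fs_parity(1) [OF entire_series(6)]) (simp_all add: sS_def)

lemma sS_L: "p \<in> P \<Longrightarrow> x \<in> L \<Longrightarrow> fs sS p x \<in> L"
  by (rule fs_parity(2) [OF entire_series(6)]) (simp_all add: sS_def)

lemma sG_P: "p \<in> P \<Longrightarrow> x \<in> P \<Longrightarrow> fs sG p x \<in> L"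
  by (rule fs_parity(3) [OF entire_series(7)]) (simp_all add: sG_def)

lemma sH_P: "p \<in> P \<Longrightarrow> x \<in> P \<Longrightarrow> fs sH p x \<in> L"
  by (rule fs_parity(3) [OF entire_series(8)]) (simp_all add: sH_def)

lemma sK_L: "p \<in> P \<Longrightarrow> x \<in> L \<Longrightarrow> fs sK p x \<in> P"
  by (rule fs_parity(4) [OF entire_sK]) (simp_all add: sK_def)

lemma sJ_P: "p \<in> P \<Longrightarrow> x \<in> P \<Longrightarrow> fs sJ p x \<in> P"
  by (rule fs_parity(1) [OF entire_sJ]) (simp_all add: sJ_def)

lemma D_split: "D p x = fs sS p x + fs sK p x"
  by (simp add: sE1_split fs_plus entire_series entire_sK)

lemma E2_split: "fs sE2 p x = fs sH p x + fs sJ p x"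
  by (simp add: sE2_split fs_plus entire_series entire_sJ)

text \<open>P is isotropic, so only the odd part of D, which sends P to L, is visible in the
  pairing; an odd function of the skew operator ad p is skew.\<close>

lemma D_skew: "p \<in> P \<Longrightarrow> \<beta> \<in> P \<Longrightarrow> \<gamma> \<in> P \<Longrightarrow> \<kappa> \<gamma> (D p \<beta>) + \<kappa> \<beta> (D p \<gamma>) = 0"
proof -
  assume a: "p \<in> P" "\<beta> \<in> P" "\<gamma> \<in> P"
  have "\<kappa> (fs sK p \<gamma>) \<beta> = \<kappa> \<gamma> (fs (- sK) p \<beta>)"
  proof (rule \<kappa>_fs [OF entire_sK])
    show "entire (- sK)"
      using entire_sK by (simp add: entire_def)
    show "fps_nth (- sK) n = (- 1) ^ n * fps_nth sK n" for n
      by (simp add: sK_def)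
  qed
  moreover have "fs (- sK) p \<beta> + fs sK p \<beta> = 0"
  proof -
    have "entire (- sK)"
      using entire_sK by (simp add: entire_def)
    then have "fs (- sK) p \<beta> + fs sK p \<beta> = fs (fps_const 0) p \<beta>"
      by (subst fs_plus [symmetric]) (simp_all add: entire_sK)
    moreover have "rfps (fps_const 0) = fps_const (0 :: 'k)"
      by (rule fps_ext) simp
    ultimately show ?thesis
      unfolding fs_def by (simp only: ps_const [OF B_right] scale_zero_left)
  qed
  ultimately have "\<kappa> \<beta> (fs sK p \<gamma>) = - \<kappa> \<gamma> (fs sK p \<beta>)"
    unfolding eq_neg_iff_add_eq_0 [symmetric] \<kappa>_sym [of \<beta>] by (simp add: eq_neg_iff_add_eq_0 \<kappa>_neg)
  then show ?thesis
    using a by (simp add: D_split \<kappa>_add orth sS_P)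
qed

text \<open>The adjoint of D composed with D is an even function of ad p; it maps P into P, which is
  isotropic.\<close>

lemma D_isotropic: "p \<in> P \<Longrightarrow> \<beta> \<in> P \<Longrightarrow> \<gamma> \<in> P \<Longrightarrow> \<kappa> (D p \<beta>) (D p \<gamma>) = 0"
proof -
  assume a: "p \<in> P" "\<beta> \<in> P" "\<gamma> \<in> P"
  have "\<kappa> (D p \<beta>) (D p \<gamma>) = \<kappa> \<beta> (fs (sE1m * sE1) p \<gamma>)"
    by (simp add: \<kappa>_D fs_mult entire_series)
  also have "\<dots> = 0"
    by (rule orth(8) [OF a(2) fs_parity(1) [OF entire_mult [OF entire_series(4,3)] a(1) sE1m_sE1_odd a(3)]])
  finally show ?thesis .
qed

lemma P_line: "p \<in> P \<Longrightarrow> \<alpha> \<in> P \<Longrightarrow> p + s t \<alpha> \<in> P"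
  by (rule subspaces(7) [OF _ subspaces(8)])

text \<open>\<open>D_skew\<close> holds along a whole line in P, so its derivative vanishes.\<close>

lemma dD_skew:
  assumes "p \<in> P" "\<alpha> \<in> P" "\<beta> \<in> P" "\<gamma> \<in> P"
  shows "\<kappa> \<gamma> (dfs sE1 p \<alpha> \<beta>) = - \<kappa> \<beta> (dfs sE1 p \<alpha> \<gamma>)"
proof -
  have "((\<lambda>t. \<kappa> \<gamma> (D (p + s t \<alpha>) \<beta>) + \<kappa> \<beta> (D (p + s t \<alpha>) \<gamma>)) has_field_derivative
      \<kappa> \<gamma> (dfs sE1 p \<alpha> \<beta>) + \<kappa> \<beta> (dfs sE1 p \<alpha> \<gamma>)) (at 0)"
    using vder_fs_const [OF entire_series(3)] \<kappa>_right unfolding vder_def by (intro DERIV_add) blast+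
  then have "((\<lambda>t. 0) has_field_derivative \<kappa> \<gamma> (dfs sE1 p \<alpha> \<beta>) + \<kappa> \<beta> (dfs sE1 p \<alpha> \<gamma>)) (at 0)"
    by (simp only: D_skew [OF P_line [OF assms(1,2)] assms(3,4)])
  from DERIV_unique [OF this DERIV_const] show ?thesis
    by (simp add: eq_neg_iff_add_eq_0)
qed

lemma dD_isotropic:
  assumes "p \<in> P" "\<alpha> \<in> P" "\<beta> \<in> P" "\<gamma> \<in> P"
  shows "\<kappa> (dfs sE1 p \<alpha> \<beta>) (D p \<gamma>) = - \<kappa> (dfs sE1 p \<alpha> \<gamma>) (D p \<beta>)"
proof -
  have "((\<lambda>t. \<kappa> (D (p + s t \<alpha>) \<beta>) (D (p + s t \<alpha>) \<gamma>)) has_field_derivative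
      \<kappa> (dfs sE1 p \<alpha> \<beta>) (D (p + s 0 \<alpha>) \<gamma>) + \<kappa> (D (p + s 0 \<alpha>) \<beta>) (dfs sE1 p \<alpha> \<gamma>)) (at 0)"
    by (intro vder_\<kappa> vder_fs_const entire_series)
  then have "((\<lambda>t. 0) has_field_derivative
      \<kappa> (dfs sE1 p \<alpha> \<beta>) (D (p + s 0 \<alpha>) \<gamma>) + \<kappa> (D (p + s 0 \<alpha>) \<beta>) (dfs sE1 p \<alpha> \<gamma>)) (at 0)"
    by (simp only: D_isotropic [OF P_line [OF assms(1,2)] assms(3,4)])
  from DERIV_unique [OF this DERIV_const] show ?thesis
    by (simp add: eq_neg_iff_add_eq_0 \<kappa>_sym [of "D p \<beta>"])
qed

text \<open>
  With \<open>\<omega>\<^sub>p(\<beta>, \<gamma>) = \<kappa> \<beta> ((sinh a - a)/a\<^sup>2 \<gamma>)\<close>, \<open>a = ad p\<close>, this says that \<open>d\<omega>\<close> is the pullback of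
  the Cartan \<open>3\<close>-form under \<open>exp\<close>. Along the ray \<open>t p\<close> both sides have the same derivative.
\<close>

lemma Cartan_form:
  assumes p: "p \<in> P" and a: "\<alpha> \<in> P" "\<beta> \<in> P" "\<gamma> \<in> P"
  shows "2 * (\<kappa> \<gamma> (dfs sE2 p \<alpha> \<beta>) + \<kappa> \<alpha> (dfs sE2 p \<beta> \<gamma>) + \<kappa> \<beta> (dfs sE2 p \<gamma> \<alpha>))
    = \<kappa> (B (D p \<alpha>) (D p \<beta>)) (D p \<gamma>)"
proof -
  define g where "g n = \<kappa> \<gamma> (ddiff (B p) (B \<alpha>) n \<beta>) + \<kappa> \<alpha> (ddiff (B p) (B \<beta>) n \<gamma>) + \<kappa> \<beta> (ddiff (B p) (B \<gamma>) n \<alpha>)" for n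
  \<comment> \<open>Shifting g by one index makes the series below fit
    \<open>exponential_series_deriv\<close>.\<close>
  define h where "h n = (case n of 0 \<Rightarrow> 0 | Suc m \<Rightarrow> g m)" for n
  \<comment> \<open>The factor t^2 turns the left side at t p into the sum of g n t^(n+2)/(n+2)!,
    whose derivative is \<open>S1\<close>.\<close>
  define S where "S t = t * (t * (\<kappa> \<gamma> (dfs sE2 (s t p) (s t \<alpha>) \<beta>) + \<kappa> \<alpha> (dfs sE2 (s t p) (s t \<beta>) \<gamma>) + \<kappa> \<beta> (dfs sE2 (s t p) (s t \<gamma>) \<alpha>)))" for t
  define S1 where "S1 t = t * (\<kappa> \<gamma> (dfs sE1 (s t p) (s t \<alpha>) \<beta>) + \<kappa> \<alpha> (dfs sE1 (s t p) (s t \<beta>) \<gamma>) + \<kappa> \<beta> (dfs sE1 (s t p) (s t \<gamma>) \<alpha>))" for t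
  define X where "X t = D (s t p) (s t \<alpha>)" for t
  define Y where "Y t = D (s t p) (s t \<beta>)" for t
  define Z where "Z t = D (s t p) (s t \<gamma>)" for t
  have tP: "s t p \<in> P" "s t \<alpha> \<in> P" "s t \<beta> \<in> P" "s t \<gamma> \<in> P" for t
    using p a by (auto intro: subspaces)
  have series: "(\<lambda>n. of_real (fps_nth f n) * (t ^ n * g n)) sums
      (\<kappa> \<gamma> (dfs f (s t p) (s t \<alpha>) \<beta>) + \<kappa> \<alpha> (dfs f (s t p) (s t \<beta>) \<gamma>) + \<kappa> \<beta> (dfs f (s t p) (s t \<gamma>) \<alpha>))"
    if "entire f" for f t
    using sums_add [OF sums_add [OF dfs_sums [OF that \<kappa>_right, of \<gamma> "s t p" "s t \<alpha>" \<beta>]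
        dfs_sums [OF that \<kappa>_right, of \<alpha> "s t p" "s t \<beta>" \<gamma>]] dfs_sums [OF that \<kappa>_right, of \<beta> "s t p" "s t \<gamma>" \<alpha>]]
    by (simp add: ddiff_scaled \<kappa>_scale g_def distrib_left)
  have h1: "(\<lambda>n. h n * t ^ n / fact n) sums S1 t" for t
  proof -
    have "(\<lambda>n. t * (of_real (fps_nth sE1 n) * (t ^ n * g n))) sums S1 t"
      unfolding S1_def by (rule sums_mult [OF series [OF entire_series(3)]])
    then have "(\<lambda>n. h (Suc n) * t ^ Suc n / fact (Suc n)) sums S1 t"
      by (simp add: h_def sE1_def mult_ac del: fact_Suc)
    then show ?thesis
      by (subst (asm) sums_Suc_iff) (simp add: h_def)
  qed
  have h2: "(\<lambda>n. h n * t ^ Suc n / fact (Suc n)) sums S t" for t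
  proof -
    have "(\<lambda>n. t * (t * (of_real (fps_nth sE2 n) * (t ^ n * g n)))) sums S t"
      unfolding S_def by (intro sums_mult series entire_series)
    then have "(\<lambda>n. h (Suc n) * t ^ Suc (Suc n) / fact (Suc (Suc n))) sums S t"
      by (simp add: h_def sE2_def mult_ac del: fact_Suc)
    then show ?thesis
      by (subst (asm) sums_Suc_iff) (simp add: h_def)
  qed
  have dS: "(S has_field_derivative S1 x) (at x)" for x
  proof -
    have "((\<lambda>t. \<Sum>n. h n * t ^ Suc n / fact (Suc n)) has_field_derivative (\<Sum>n. h n * x ^ n / fact n)) (at x)"
      by (rule exponential_series_deriv(1)) (rule sums_summable [OF h1])
    moreover have "(\<lambda>t. \<Sum>n. h n * t ^ Suc n / fact (Suc n)) = S"
      by (rule ext) (rule sums_unique [OF h2, symmetric])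
    moreover have "(\<Sum>n. h n * x ^ n / fact n) = S1 x"
      by (rule sums_unique [OF h1, symmetric])
    ultimately show ?thesis
      by simp
  qed
  have lin_d: "dfs sE1 q \<delta> (s t v) = s t (dfs sE1 q \<delta> v)" for q \<delta> t v
    unfolding dfs_def dps_def by (rule lin_scale [OF lin_of_mat])
  \<comment> \<open>Flatness writes each bracket as a difference of two derivatives of D; skewness
    of these identifies the six terms in pairs.\<close>
  have S1: "2 * S1 t = \<kappa> (B (X t) (Y t)) \<gamma> + \<kappa> (B (Y t) (Z t)) \<alpha> + \<kappa> (B (Z t) (X t)) \<beta>" for t
  proof -
    have flat: "\<kappa> (B (D (s t p) (s t \<delta>)) (D (s t p) (s t \<epsilon>))) \<zeta> = t * \<kappa> \<zeta> (dfs sE1 (s t p) (s t \<delta>) \<epsilon>) - t * \<kappa> \<zeta> (dfs sE1 (s t p) (s t \<epsilon>) \<delta>)" for \<delta> \<epsilon> \<zeta>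
      unfolding flatness [symmetric] lin_d by (simp add: \<kappa>_sym [of _ \<zeta>] \<kappa>_diff \<kappa>_scale)
    have skew: "t * \<kappa> \<zeta> (dfs sE1 (s t p) (s t \<delta>) \<epsilon>) = - (t * \<kappa> \<epsilon> (dfs sE1 (s t p) (s t \<delta>) \<zeta>))"
      if "\<delta> \<in> P" "\<epsilon> \<in> P" "\<zeta> \<in> P" for \<delta> \<epsilon> \<zeta>
      by (subst dD_skew [OF subspaces(8) [OF p] subspaces(8) [OF that(1)] that(2,3)]) simp
    show ?thesis
      unfolding X_def Y_def Z_def flat S1_def
      using skew [OF a(1,3,2)] skew [OF a(2,1,3)] skew [OF a(3,2,1)] by (simp add: algebra_simps)
  qed
  \<comment> \<open>The derivative e^(t a) \<delta> of a curve such as X is \<delta> + [p, X]: the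
    constant part will give \<open>S1\<close>, the part with p will cancel.\<close>
  have deriv: "e (s x p) \<delta> = \<delta> + B p (D (s x p) (s x \<delta>))" for x \<delta>
    using B_D [of "s x p" \<delta>] by (simp add: B_scale fs_scale algebra_simps)
  have dX: "vder (\<lambda>t. X (x + t)) (\<alpha> + B p (X x))" and dY: "vder (\<lambda>t. Y (x + t)) (\<beta> + B p (Y x))"
    and dZ: "vder (\<lambda>t. Z (x + t)) (\<gamma> + B p (Z x))" for x
    unfolding X_def Y_def Z_def deriv [symmetric] by (rule vder_D_line)+
  have dR: "((\<lambda>t. \<kappa> (B (X t) (Y t)) (Z t)) has_field_derivative 2 * S1 x) (at x)" for x
  proof -
    from vder_\<kappa> [OF vder_B [OF dX dY] dZ, of x x x]
    have "((\<lambda>t. \<kappa> (B (X (x + t)) (Y (x + t))) (Z (x + t))) has_field_derivative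
        \<kappa> (B (\<alpha> + B p (X x)) (Y x) + B (X x) (\<beta> + B p (Y x))) (Z x) + \<kappa> (B (X x) (Y x)) (\<gamma> + B p (Z x))) (at 0)"
      by simp
    moreover have "\<kappa> (B (\<alpha> + B p (X x)) (Y x) + B (X x) (\<beta> + B p (Y x))) (Z x) + \<kappa> (B (X x) (Y x)) (\<gamma> + B p (Z x)) = 2 * S1 x"
    \<comment> \<open>By invariance of \<kappa> the three terms in which p is bracketed with one
      factor add up to zero.\<close>
    proof -
      have "\<kappa> (B (Y x) (Z x)) \<alpha> = \<kappa> (B \<alpha> (Y x)) (Z x)" "\<kappa> (B (Z x) (X x)) \<beta> = \<kappa> (B (X x) \<beta>) (Z x)"
        by (simp_all only: \<kappa>_cyc [of \<alpha>] \<kappa>_cyc [of "Z x"])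
      with \<kappa>_deriv [of p "X x" "Y x" "Z x"] show ?thesis
        unfolding S1 by (simp add: B_add \<kappa>_add algebra_simps)
    qed
    ultimately have "((\<lambda>t. \<kappa> (B (X (t + x)) (Y (t + x))) (Z (t + x))) has_field_derivative 2 * S1 x) (at 0)"
      by (simp add: add.commute)
    then show ?thesis
      using DERIV_shift [of "\<lambda>t. \<kappa> (B (X t) (Y t)) (Z t)" "2 * S1 x" 0 x] by simp
  qed
  have "((\<lambda>t. 2 * S t - \<kappa> (B (X t) (Y t)) (Z t)) has_field_derivative 2 * S1 x - 2 * S1 x) (at x within UNIV)" for x
    by (intro DERIV_diff DERIV_cmult dS dR)
  then have "\<exists>c. \<forall>x\<in>UNIV. 2 * S x - \<kappa> (B (X x) (Y x)) (Z x) = c"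
    by (intro has_field_derivative_zero_constant) simp_all
  then obtain c where c: "\<And>x. 2 * S x - \<kappa> (B (X x) (Y x)) (Z x) = c"
    by blast
  \<comment> \<open>Both sides vanish at the origin of the ray, which fixes the constant.\<close>
  have "X 0 = 0"
    by (simp add: X_def fs_zero)
  then have "c = 0"
    using c [of 0] by (simp add: S_def B_zero \<kappa>_zero)
  then have "2 * S 1 = \<kappa> (B (X 1) (Y 1)) (Z 1)"
    using c [of 1] by simp
  then show ?thesis
    by (simp add: S_def X_def Y_def Z_def)
qed

text \<open>
  \<open>regR r p\<close> says that \<open>r p = F (ad p)\<close> on \<open>P\<close>, with the denominator \<open>sinh z/z\<close> of \<open>F\<close> cleared.
\<close>

definition regR :: "('d \<Rightarrow> 'd \<Rightarrow> 'd) \<Rightarrow> 'd \<Rightarrow> bool" where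
  "regR r p \<longleftrightarrow> (\<forall>\<beta>\<in>P. \<exists>\<beta>'\<in>P. fs sS p \<beta>' = \<beta>) \<and> (\<forall>\<beta>\<in>P. r p (fs sS p \<beta>) = fs sG p \<beta>)"

text \<open>The first clause puts \<eta> + \<tau> \<eta> into e^a Q, the second makes such a \<tau>
  \<eta> in M unique; uniqueness is what equivariance uses.\<close>

definition regT :: "('d \<Rightarrow> 'd \<Rightarrow> 'd) \<Rightarrow> 'd \<Rightarrow> bool" where
  "regT \<tau> p \<longleftrightarrow> (\<forall>\<eta>\<in>Q. \<tau> p \<eta> \<in> M \<and> em p (\<eta> + \<tau> p \<eta>) \<in> Q) \<and> (\<forall>x\<in>M. em p x \<in> Q \<longrightarrow> x = 0)"

text \<open>The defect of D \<beta> against \<beta> + r \<beta>; by \<open>regR_facts\<close> it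
  lies in e^a L.\<close>

definition w :: "('d \<Rightarrow> 'd \<Rightarrow> 'd) \<Rightarrow> 'd \<Rightarrow> 'd \<Rightarrow> 'd" where
  "w r p \<beta> = D p \<beta> - \<beta> - r p \<beta>"

text \<open>Everything follows from w = e^a H b, where \<beta> = S b and r \<beta> = G b. For the
  skewness of r the even S is moved across the pairing and commuted with the odd G.\<close>

lemma regR_facts:
  assumes R: "regR r p" and p: "p \<in> P" and \<beta>: "\<beta> \<in> P"
  shows "r p \<beta> \<in> L" "em p (w r p \<beta>) \<in> L" "\<gamma> \<in> P \<Longrightarrow> \<kappa> (D p \<gamma>) (w r p \<beta>) = \<kappa> \<gamma> (fs sE2 p \<beta>)"
    "\<gamma> \<in> P \<Longrightarrow> \<kappa> (r p \<beta>) \<gamma> = - \<kappa> \<beta> (r p \<gamma>)"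
proof -
  obtain b where b: "b \<in> P" "fs sS p b = \<beta>"
    using R \<beta> by (auto simp: regR_def)
  then have r: "r p \<beta> = fs sG p b"
    using R by (auto simp: regR_def)
  show "r p \<beta> \<in> L"
    unfolding r by (rule sG_P [OF p b(1)])
  have Db: "D p (fs sS p b) = fs sS p b + fs sG p b + e p (fs sH p b)"
    by (simp add: sE1_sS entire_series entire_mult entire_add fs_plus flip: fs_mult)
  have w: "w r p \<beta> = e p (fs sH p b)"
    unfolding w_def r unfolding b(2) [symmetric] Db by (simp add: algebra_simps)
  then show "em p (w r p \<beta>) \<in> L"
    using sH_P [OF p b(1)] by simp
  show "\<kappa> (D p \<gamma>) (w r p \<beta>) = \<kappa> \<gamma> (fs sE2 p \<beta>)" if \<gamma>: "\<gamma> \<in> P"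
  proof -
    have "\<kappa> (D p \<gamma>) (w r p \<beta>) = \<kappa> \<gamma> (fs (sE1m * sE) p (fs sH p b))"
      by (simp add: w \<kappa>_D fs_mult entire_series)
    also have "\<dots> = \<kappa> \<gamma> (fs sS p (fs sH p b)) + \<kappa> \<gamma> (fs sK p (fs sH p b))"
      by (simp add: sE1m_sE D_split \<kappa>_add)
    also have "\<kappa> \<gamma> (fs sK p (fs sH p b)) = 0"
      by (rule orth(8) [OF \<gamma> sK_L [OF p sH_P [OF p b(1)]]])
    \<comment> \<open>Commuting S with H eliminates the preimage b, which depends on p; what remains
      is an entire series in ad p applied to the fixed \<beta> and can be differentiated.\<close>
    also have "fs sS p (fs sH p b) = fs sH p \<beta>"
      by (simp add: fs_commute [of sS sH] entire_series b(2))
    also have "\<kappa> \<gamma> (fs sH p \<beta>) + 0 = \<kappa> \<gamma> (fs sE2 p \<beta>)"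
      using orth(8) [OF \<gamma> sJ_P [OF p \<beta>]] by (simp add: E2_split \<kappa>_add)
    finally show ?thesis .
  qed
  show "\<kappa> (r p \<beta>) \<gamma> = - \<kappa> \<beta> (r p \<gamma>)" if \<gamma>: "\<gamma> \<in> P"
  proof -
    obtain c where c: "c \<in> P" "fs sS p c = \<gamma>"
      using R \<gamma> by (auto simp: regR_def)
    then have r': "r p \<gamma> = fs sG p c"
      using R by (auto simp: regR_def)
    have m: "entire (- sG)"
      using entire_series(7) by (simp add: entire_def)
    have "\<kappa> (r p \<beta>) \<gamma> = \<kappa> b (fs (- sG) p \<gamma>)"
      unfolding r by (rule \<kappa>_fs [OF entire_series(7) m]) (simp add: sG_def)
    moreover have "\<kappa> \<beta> (r p \<gamma>) = \<kappa> b (fs sS p (r p \<gamma>))"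
      unfolding b(2) [symmetric] by (rule \<kappa>_fs [OF entire_series(6,6)]) (simp add: sS_def)
    moreover have "fs sS p (r p \<gamma>) = fs sG p \<gamma>"
      unfolding r' by (simp add: fs_commute [of sS sG] entire_series c(2))
    moreover have "fs (- sG) p \<gamma> + fs sG p \<gamma> = 0"
    proof -
      have "fs (- sG) p \<gamma> + fs sG p \<gamma> = fs (fps_const 0) p \<gamma>"
        by (subst fs_plus [symmetric]) (simp_all add: entire_series m)
      moreover have "rfps (fps_const 0) = fps_const (0 :: 'k)"
        by (rule fps_ext) simp
      ultimately show ?thesis
        unfolding fs_def by (simp only: ps_const [OF B_right] scale_zero_left)
    qed
    then have "fs (- sG) p \<gamma> = - fs sG p \<gamma>"
      by (simp add: eq_neg_iff_add_eq_0)
    ultimately show ?thesis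
      by (simp add: \<kappa>_neg)
  qed
qed

lemma vder_w:
  assumes "vder (\<lambda>t. r (p + s t \<alpha>) \<beta>) d"
  shows "vder (\<lambda>t. w r (p + s t \<alpha>) \<beta>) (dfs sE1 p \<alpha> \<beta> - d)"
proof -
  have "vder (\<lambda>t. D (p + s t \<alpha>) \<beta> - \<beta> - r (p + s t \<alpha>) \<beta>) (dfs sE1 p \<alpha> \<beta> - 0 - d)"
    by (intro vder_diff vder_fs_const vder_const assms entire_series)
  then show ?thesis
    by (simp add: w_def)
qed

text \<open>F is e^a applied to e^-a F. When e^-a F runs in a fixed subspace so does its derivative,
  and this product rule turns that into information on the derivative of F.\<close>

lemma conjugate_derivative:
  assumes "vder F F'"
  obtains G' where "vder (\<lambda>t. em (p + s t \<alpha>) (F t)) G'" "F' = B (D p \<alpha>) (F 0) + e p G'"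
proof -
  define G' where "G' = dfs sEm p \<alpha> (F 0) + em p F'"
  have G: "vder (\<lambda>t. em (p + s t \<alpha>) (F t)) G'"
    unfolding G'_def by (rule vder_fs [OF entire_series(2) assms])
  from vder_fs [OF entire_series(1) G, of p \<alpha>]
  have "vder F (dfs sE p \<alpha> (em p (F 0)) + e p G')"
    by simp
  then have "F' = B (D p \<alpha>) (F 0) + e p G'"
    using vder_unique [OF assms] by (simp add: dfs_exp)
  with G show thesis
    by (rule that)
qed

lemma eventually_at_0: "\<forall>\<^sub>F t in nhds 0. A (p + s t \<alpha>) \<Longrightarrow> A p"
  using eventually_nhds_x_imp_x by fastforce

text \<open>d lies in L, so only its pairing with P matters. Write \<gamma> = D \<gamma> - r
  \<gamma> - w \<gamma>: r \<gamma> is orthogonal to d, the pairing with D \<gamma> comes from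
  differentiating the third of \<open>regR_facts\<close>, that with w \<gamma> from e^-a w staying
  in L.\<close>

lemma r_derivative:
  assumes P: "p \<in> P" "\<alpha> \<in> P" "\<beta> \<in> P" "\<gamma> \<in> P" and R: "\<forall>\<^sub>F t in nhds 0. regR r (p + s t \<alpha>)"
    and d: "vder (\<lambda>t. r (p + s t \<alpha>) \<beta>) d"
  shows "d \<in> L"
    and "\<kappa> d \<gamma> = \<kappa> (dfs sE1 p \<alpha> \<gamma>) (w r p \<beta>) + \<kappa> (dfs sE1 p \<alpha> \<beta>) (D p \<gamma>) - \<kappa> \<gamma> (dfs sE2 p \<alpha> \<beta>)
      - \<kappa> (dfs sE1 p \<alpha> \<beta>) (w r p \<gamma>) + \<kappa> (B (D p \<alpha>) (w r p \<beta>)) (w r p \<gamma>)"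
proof -
  have R0: "regR r p"
    using R by (rule eventually_at_0)
  have evL: "\<forall>\<^sub>F t in nhds 0. r (p + s t \<alpha>) \<beta> \<in> L"
    using R by (rule eventually_mono) (rule regR_facts(1) [OF _ P_line [OF P(1,2)] P(3)])
  show "d \<in> L"
    unfolding L_iff
  proof
    fix y assume y: "y \<in> L \<union> M \<union> Q"
    have "\<forall>\<^sub>F t in nhds 0. \<kappa> (r (p + s t \<alpha>) \<beta>) y = 0"
      using evL by (rule eventually_mono) (use y orth in blast)
    then show "\<kappa> d y = 0"
      by (rule vder_zero [OF d \<kappa>_left])
  qed
  then have "\<kappa> d (r p \<gamma>) = 0"
    using regR_facts(1) [OF R0 P(1,4)] by (rule orth(1))
  then have 1: "\<kappa> d \<gamma> = \<kappa> d (D p \<gamma>) - \<kappa> d (w r p \<gamma>)"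
    by (simp add: w_def \<kappa>_diff)
  note vw = vder_w [where r = r and p = p and \<alpha> = \<alpha> and \<beta> = \<beta>, OF d]
  have "((\<lambda>t. \<kappa> (D (p + s t \<alpha>) \<gamma>) (w r (p + s t \<alpha>) \<beta>)) has_field_derivative
      \<kappa> (dfs sE1 p \<alpha> \<gamma>) (w r (p + s 0 \<alpha>) \<beta>) + \<kappa> (D (p + s 0 \<alpha>) \<gamma>) (dfs sE1 p \<alpha> \<beta> - d)) (at 0)"
    by (rule vder_\<kappa> [OF vder_fs_const [OF entire_series(3)] vw])
  note d1 = this
  have ev: "\<forall>\<^sub>F t in nhds 0. \<kappa> (D (p + s t \<alpha>) \<gamma>) (w r (p + s t \<alpha>) \<beta>) = \<kappa> \<gamma> (fs sE2 (p + s t \<alpha>) \<beta>)"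
    using R by (rule eventually_mono) (rule regR_facts(3) [OF _ P_line [OF P(1,2)] P(3,4)])
  from DERIV_cong_ev [OF refl ev refl, THEN iffD1, OF d1] have "((\<lambda>t. \<kappa> \<gamma> (fs sE2 (p + s t \<alpha>) \<beta>)) has_field_derivative
      \<kappa> (dfs sE1 p \<alpha> \<gamma>) (w r (p + s 0 \<alpha>) \<beta>) + \<kappa> (D (p + s 0 \<alpha>) \<gamma>) (dfs sE1 p \<alpha> \<beta> - d)) (at 0)"
    .
  moreover have "((\<lambda>t. \<kappa> \<gamma> (fs sE2 (p + s t \<alpha>) \<beta>)) has_field_derivative \<kappa> \<gamma> (dfs sE2 p \<alpha> \<beta>)) (at 0)"
    using vder_fs_const [OF entire_series(5)] \<kappa>_right unfolding vder_def by blast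
  ultimately have "\<kappa> (dfs sE1 p \<alpha> \<gamma>) (w r (p + s 0 \<alpha>) \<beta>) + \<kappa> (D (p + s 0 \<alpha>) \<gamma>) (dfs sE1 p \<alpha> \<beta> - d) = \<kappa> \<gamma> (dfs sE2 p \<alpha> \<beta>)"
    by (rule DERIV_unique)
  then have 2: "\<kappa> d (D p \<gamma>) = \<kappa> (dfs sE1 p \<alpha> \<gamma>) (w r p \<beta>) + \<kappa> (dfs sE1 p \<alpha> \<beta>) (D p \<gamma>) - \<kappa> \<gamma> (dfs sE2 p \<alpha> \<beta>)"
    by (simp add: \<kappa>_diff \<kappa>_sym [of "D p \<gamma>"] algebra_simps)
  \<comment> \<open>q is the derivative of e^-a w \<beta>, hence orthogonal to the fixed element
    e^-a w \<gamma> of L.\<close>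
  obtain q where q: "vder (\<lambda>t. em (p + s t \<alpha>) (w r (p + s t \<alpha>) \<beta>)) q"
    "dfs sE1 p \<alpha> \<beta> - d = B (D p \<alpha>) (w r (p + s 0 \<alpha>) \<beta>) + e p q"
    by (rule conjugate_derivative [OF vw])
  have "\<forall>\<^sub>F t in nhds 0. \<kappa> (em (p + s t \<alpha>) (w r (p + s t \<alpha>) \<beta>)) (em p (w r p \<gamma>)) = 0"
    using R by (rule eventually_mono)
      (rule orth(1) [OF regR_facts(2) [OF _ P_line [OF P(1,2)] P(3)] regR_facts(2) [OF R0 P(1,4)]])
  from vder_zero [OF q(1) \<kappa>_left this] have "\<kappa> q (em p (w r p \<gamma>)) = 0" .
  then have "\<kappa> (e p q) (w r p \<gamma>) = 0"
    by (simp add: \<kappa>_e)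
  with arg_cong [OF q(2), of "\<lambda>x. \<kappa> x (w r p \<gamma>)"]
  have 3: "\<kappa> d (w r p \<gamma>) = \<kappa> (dfs sE1 p \<alpha> \<beta>) (w r p \<gamma>) - \<kappa> (B (D p \<alpha>) (w r p \<beta>)) (w r p \<gamma>)"
    by (simp add: \<kappa>_diff \<kappa>_add algebra_simps)
  show "\<kappa> d \<gamma> = \<kappa> (dfs sE1 p \<alpha> \<gamma>) (w r p \<beta>) + \<kappa> (dfs sE1 p \<alpha> \<beta>) (D p \<gamma>) - \<kappa> \<gamma> (dfs sE2 p \<alpha> \<beta>)
      - \<kappa> (dfs sE1 p \<alpha> \<beta>) (w r p \<gamma>) + \<kappa> (B (D p \<alpha>) (w r p \<beta>)) (w r p \<gamma>)"
    unfolding 1 2 3 by simp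
qed

text \<open>Substitute \<alpha> + r \<alpha> = D \<alpha> - w \<alpha>. Terms with two factors w
  match the derivative formula directly, those with one by flatness, those with none by
  \<open>Cartan_form\<close>.\<close>

theorem dynamical_PPP:
  assumes P: "p \<in> P" "\<alpha> \<in> P" "\<beta> \<in> P" "\<gamma> \<in> P"
    and R: "\<And>\<delta>. \<delta> \<in> P \<Longrightarrow> \<forall>\<^sub>F t in nhds 0. regR r (p + s t \<delta>)"
    and d: "vder (\<lambda>t. r (p + s t \<alpha>) \<beta>) d1" "vder (\<lambda>t. r (p + s t \<beta>) \<gamma>) d2" "vder (\<lambda>t. r (p + s t \<gamma>) \<alpha>) d3"
  shows "\<kappa> d1 \<gamma> + \<kappa> d2 \<alpha> + \<kappa> d3 \<beta> = \<kappa> (B (\<alpha> + r p \<alpha>) (\<beta> + r p \<beta>)) (\<gamma> + r p \<gamma>)"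
proof -
  have R0: "regR r p"
    using R [OF P(1)] by (rule eventually_at_0)
  let ?d = "dfs sE1 p" and ?D = "D p" and ?w = "w r p"
  have u: "\<delta> + r p \<delta> = ?D \<delta> - ?w \<delta>" for \<delta>
    by (simp add: w_def)
  \<comment> \<open>e^a L is an isotropic subalgebra.\<close>
  have www: "\<kappa> (B (?w \<alpha>) (?w \<beta>)) (?w \<gamma>) = 0"
  proof -
    have "?w \<delta> = e p (em p (?w \<delta>))" for \<delta>
      by simp
    then have "\<kappa> (B (?w \<alpha>) (?w \<beta>)) (?w \<gamma>) = \<kappa> (e p (B (em p (?w \<alpha>)) (em p (?w \<beta>)))) (e p (em p (?w \<gamma>)))"
      by (simp only: exp_automorphism)
    also have "\<dots> = \<kappa> (B (em p (?w \<alpha>)) (em p (?w \<beta>))) (em p (?w \<gamma>))"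
      by (rule \<kappa>_e_e)
    also have "\<dots> = 0"
      by (intro orth(1) LL regR_facts(2) R0 P)
    finally show ?thesis .
  qed
  have flat: "\<kappa> (B (?D \<delta>) (?D \<epsilon>)) x = \<kappa> (?d \<delta> \<epsilon>) x - \<kappa> (?d \<epsilon> \<delta>) x" for \<delta> \<epsilon> x
    by (simp add: \<kappa>_diff flip: flatness)
  note cyc = \<kappa>_cyc [of "?D \<alpha>" "?D \<beta>" "?D \<gamma>"] \<kappa>_cyc [of "?D \<beta>" "?D \<gamma>" "?D \<alpha>"]
  have rhs: "\<kappa> (B (\<alpha> + r p \<alpha>) (\<beta> + r p \<beta>)) (\<gamma> + r p \<gamma>) = \<kappa> (B (?D \<alpha>) (?D \<beta>)) (?D \<gamma>)
      - (\<kappa> (B (?D \<alpha>) (?D \<beta>)) (?w \<gamma>) + \<kappa> (B (?D \<beta>) (?D \<gamma>)) (?w \<alpha>) + \<kappa> (B (?D \<gamma>) (?D \<alpha>)) (?w \<beta>))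
      + (\<kappa> (B (?D \<alpha>) (?w \<beta>)) (?w \<gamma>) + \<kappa> (B (?D \<beta>) (?w \<gamma>)) (?w \<alpha>) + \<kappa> (B (?D \<gamma>) (?w \<alpha>)) (?w \<beta>))"
  proof -
    have c: "\<kappa> (B (?D \<beta>) (?D \<gamma>)) (?w \<alpha>) = \<kappa> (B (?w \<alpha>) (?D \<beta>)) (?D \<gamma>)"
      "\<kappa> (B (?D \<gamma>) (?D \<alpha>)) (?w \<beta>) = \<kappa> (B (?D \<alpha>) (?w \<beta>)) (?D \<gamma>)"
      "\<kappa> (B (?D \<beta>) (?w \<gamma>)) (?w \<alpha>) = \<kappa> (B (?w \<alpha>) (?D \<beta>)) (?w \<gamma>)"
      "\<kappa> (B (?D \<gamma>) (?w \<alpha>)) (?w \<beta>) = \<kappa> (B (?w \<alpha>) (?w \<beta>)) (?D \<gamma>)"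
      by (simp_all only: \<kappa>_cyc [of "?w \<alpha>"] \<kappa>_cyc [of "?D \<gamma>"])
    show ?thesis
      unfolding u c using www by (simp add: B_diff \<kappa>_diff \<kappa>_add algebra_simps)
  qed
  have DD: "\<kappa> (?d \<alpha> \<beta>) (?D \<gamma>) + \<kappa> (?d \<beta> \<gamma>) (?D \<alpha>) + \<kappa> (?d \<gamma> \<alpha>) (?D \<beta>)
      = \<kappa> (B (?D \<alpha>) (?D \<beta>)) (?D \<gamma>) + \<kappa> (\<gamma>) (dfs sE2 p \<alpha> \<beta>) + \<kappa> \<alpha> (dfs sE2 p \<beta> \<gamma>) + \<kappa> \<beta> (dfs sE2 p \<gamma> \<alpha>)"
  proof -
    \<comment> \<open>Each of three cyclic copies of the bracket is, by flatness, a difference of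
      two pairings; the differentiated isotropy of D turns the subtracted one into another member of
      the cyclic sum.\<close>
    have "2 * (\<kappa> (?d \<alpha> \<beta>) (?D \<gamma>) + \<kappa> (?d \<beta> \<gamma>) (?D \<alpha>) + \<kappa> (?d \<gamma> \<alpha>) (?D \<beta>)) = 3 * \<kappa> (B (?D \<alpha>) (?D \<beta>)) (?D \<gamma>)"
      using flat [of \<alpha> \<beta> "?D \<gamma>"] flat [of \<beta> \<gamma> "?D \<alpha>"] flat [of \<gamma> \<alpha> "?D \<beta>"] cyc
        dD_isotropic [OF P(1,2,3,4)] dD_isotropic [OF P(1,3,4,2)] dD_isotropic [OF P(1,4,2,3)]
      by (simp add: algebra_simps)
    with Cartan_form [OF P]
    have "2 * (\<kappa> (?d \<alpha> \<beta>) (?D \<gamma>) + \<kappa> (?d \<beta> \<gamma>) (?D \<alpha>) + \<kappa> (?d \<gamma> \<alpha>) (?D \<beta>))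
      = 2 * (\<kappa> (B (?D \<alpha>) (?D \<beta>)) (?D \<gamma>) + \<kappa> (\<gamma>) (dfs sE2 p \<alpha> \<beta>) + \<kappa> \<alpha> (dfs sE2 p \<beta> \<gamma>) + \<kappa> \<beta> (dfs sE2 p \<gamma> \<alpha>))"
      by (simp add: algebra_simps)
    note two = this
    have "x = y" if "2 * x = 2 * y" for x y :: 'k
      using that by simp
    from this [OF two] show ?thesis .
  qed
  show ?thesis
    unfolding rhs r_derivative(2) [OF P(1,2,3,4) R [OF P(2)] d(1)] r_derivative(2) [OF P(1,3,4,2) R [OF P(3)] d(2)]
      r_derivative(2) [OF P(1,4,2,3) R [OF P(4)] d(3)]
    using DD unfolding flat by (simp add: algebra_simps)
qed

text \<open>D \<alpha> differs from \<alpha> + r \<alpha> by w in e^a L, and the derivative of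
  \<eta> + \<tau> \<eta> differs from its bracket with D \<alpha> by an element orthogonal to e^a
  Q.\<close>

theorem dynamical_PQQ:
  assumes P: "p \<in> P" "\<alpha> \<in> P" and Q: "\<eta> \<in> Q" "\<zeta> \<in> Q"
    and R: "regR r p" and T: "\<forall>\<^sub>F t in nhds 0. regT \<tau> (p + s t \<alpha>)"
    and d: "vder (\<lambda>t. \<tau> (p + s t \<alpha>) \<eta>) d"
  shows "d \<in> M" "\<kappa> d \<zeta> = \<kappa> (B (\<alpha> + r p \<alpha>) (\<eta> + \<tau> p \<eta>)) (\<zeta> + \<tau> p \<zeta>)"
proof -
  have T0: "regT \<tau> p"
    using T by (rule eventually_at_0)
  have evM: "\<forall>\<^sub>F t in nhds 0. \<tau> (p + s t \<alpha>) \<eta> \<in> M"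
    using T by (rule eventually_mono) (use Q in \<open>simp add: regT_def\<close>)
  show dM: "d \<in> M"
    unfolding M_iff
  proof
    fix y assume y: "y \<in> L \<union> M \<union> P"
    have "\<forall>\<^sub>F t in nhds 0. \<kappa> (\<tau> (p + s t \<alpha>) \<eta>) y = 0"
      using evM by (rule eventually_mono) (use y orth in blast)
    then show "\<kappa> d y = 0"
      by (rule vder_zero [OF d \<kappa>_left])
  qed
  have tM: "\<tau> p \<zeta> \<in> M" and v: "em p (\<eta> + \<tau> p \<eta>) \<in> Q" "em p (\<zeta> + \<tau> p \<zeta>) \<in> Q"
    using T0 Q by (simp_all add: regT_def)
  have "vder (\<lambda>t. \<eta> + \<tau> (p + s t \<alpha>) \<eta>) (0 + d)"
    by (intro vder_add vder_const d)
  then obtain v' where v': "vder (\<lambda>t. em (p + s t \<alpha>) (\<eta> + \<tau> (p + s t \<alpha>) \<eta>)) v'"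
    "0 + d = B (D p \<alpha>) (\<eta> + \<tau> (p + s 0 \<alpha>) \<eta>) + e p v'"
    by (rule conjugate_derivative)
  have "\<forall>\<^sub>F t in nhds 0. \<kappa> (em (p + s t \<alpha>) (\<eta> + \<tau> (p + s t \<alpha>) \<eta>)) (em p (\<zeta> + \<tau> p \<zeta>)) = 0"
    using T by (rule eventually_mono) (rule orth(12) [OF _ v(2)], use Q in \<open>simp add: regT_def\<close>)
  from vder_zero [OF v'(1) \<kappa>_left this] have z1: "\<kappa> (e p v') (\<zeta> + \<tau> p \<zeta>) = 0"
    by (simp add: \<kappa>_e)
  \<comment> \<open>After conjugation by e^-a this is \<kappa> of [L, Q] with Q, and [L, Q] stays in
    the isotropic Q.\<close>
  have z2: "\<kappa> (B (w r p \<alpha>) (\<eta> + \<tau> p \<eta>)) (\<zeta> + \<tau> p \<zeta>) = 0"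
  proof -
    have "\<kappa> (B (e p (em p (w r p \<alpha>))) (e p (em p (\<eta> + \<tau> p \<eta>)))) (e p (em p (\<zeta> + \<tau> p \<zeta>))) = 0"
      unfolding exp_automorphism [symmetric] \<kappa>_e_e
      by (rule orth(12) [OF LQ [OF regR_facts(2) [OF R P] v(1)] v(2)])
    then show ?thesis
      by simp
  qed
  have "D p \<alpha> = (\<alpha> + r p \<alpha>) + w r p \<alpha>"
    by (simp add: w_def)
  then have "\<kappa> (B (D p \<alpha>) (\<eta> + \<tau> p \<eta>)) (\<zeta> + \<tau> p \<zeta>) = \<kappa> (B (\<alpha> + r p \<alpha>) (\<eta> + \<tau> p \<eta>)) (\<zeta> + \<tau> p \<zeta>)"
    using z2 by (simp only: B_add(2) [of "\<alpha> + r p \<alpha>"] \<kappa>_add(2) [of "B (\<alpha> + r p \<alpha>) (\<eta> + \<tau> p \<eta>)"]) simp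
  moreover have "\<kappa> d \<zeta> = \<kappa> d (\<zeta> + \<tau> p \<zeta>)"
    using orth(5) [OF dM tM] by (simp add: \<kappa>_add)
  moreover have "d = B (D p \<alpha>) (\<eta> + \<tau> p \<eta>) + e p v'"
    using v'(2) by simp
  then have "\<kappa> d (\<zeta> + \<tau> p \<zeta>) = \<kappa> (B (D p \<alpha>) (\<eta> + \<tau> p \<eta>)) (\<zeta> + \<tau> p \<zeta>) + \<kappa> (e p v') (\<zeta> + \<tau> p \<zeta>)"
    by (simp only: \<kappa>_add(2))
  ultimately show "\<kappa> d \<zeta> = \<kappa> (B (\<alpha> + r p \<alpha>) (\<eta> + \<tau> p \<eta>)) (\<zeta> + \<tau> p \<zeta>)"
    using z1 by simp
qed

theorem dynamical_QQQ:
  assumes T: "regT \<tau> p" and Q: "\<xi> \<in> Q" "\<eta> \<in> Q" "\<zeta> \<in> Q"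
  shows "\<kappa> (B (\<xi> + \<tau> p \<xi>) (\<eta> + \<tau> p \<eta>)) (\<zeta> + \<tau> p \<zeta>) = 0"
proof -
  have v: "em p (\<delta> + \<tau> p \<delta>) \<in> Q" if "\<delta> \<in> Q" for \<delta>
    using T that by (simp add: regT_def)
  have "\<kappa> (B (e p (em p (\<xi> + \<tau> p \<xi>))) (e p (em p (\<eta> + \<tau> p \<eta>)))) (e p (em p (\<zeta> + \<tau> p \<zeta>))) = 0"
    unfolding exp_automorphism [symmetric] \<kappa>_e_e by (intro QQQ v Q)
  then show ?thesis
    by simp
qed

lemma \<tau>_skew:
  assumes T: "regT \<tau> p" and Q: "\<eta> \<in> Q" "\<zeta> \<in> Q"
  shows "\<kappa> (\<tau> p \<eta>) \<zeta> = - \<kappa> \<eta> (\<tau> p \<zeta>)"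
proof -
  have v: "em p (\<delta> + \<tau> p \<delta>) \<in> Q" "\<tau> p \<delta> \<in> M" if "\<delta> \<in> Q" for \<delta>
    using T that by (simp_all add: regT_def)
  have "\<kappa> (e p (em p (\<eta> + \<tau> p \<eta>))) (e p (em p (\<zeta> + \<tau> p \<zeta>))) = 0"
    unfolding \<kappa>_e_e by (intro orth(12) v Q)
  then have "\<kappa> (\<eta> + \<tau> p \<eta>) (\<zeta> + \<tau> p \<zeta>) = 0"
    by simp
  then show ?thesis
    using orth(5) [OF v(2) v(2)] orth(12) Q by (simp add: \<kappa>_add eq_neg_iff_add_eq_0)
qed

text \<open>L + P is a subalgebra orthogonal to M + Q; this settles two arguments in P and one in
  Q.\<close>

lemma LP_L_P: "a \<in> L \<Longrightarrow> b \<in> P \<Longrightarrow> a' \<in> L \<Longrightarrow> b' \<in> P \<Longrightarrow> y \<in> M \<Longrightarrow> z \<in> Q \<Longrightarrow> \<kappa> (B (b + a) (b' + a')) (z + y) = 0"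
  using LL [of a a'] LP [of a b'] PL [of b a'] PP [of b b']
  by (simp add: B_add \<kappa>_add orth)

text \<open>The triple product is sorted by the number of its arguments from Q: none or two produce
  the derivative terms, one or three produce zero.\<close>

theorem dynamical_equation:
  assumes P: "p \<in> P" "\<alpha> \<in> P" "\<beta> \<in> P" "\<gamma> \<in> P" and Q: "\<xi> \<in> Q" "\<eta> \<in> Q" "\<zeta> \<in> Q"
    and R: "\<And>\<delta>. \<delta> \<in> P \<Longrightarrow> \<forall>\<^sub>F t in nhds 0. regR r (p + s t \<delta>)"
    and T: "\<And>\<delta>. \<delta> \<in> P \<Longrightarrow> \<forall>\<^sub>F t in nhds 0. regT \<tau> (p + s t \<delta>)"
    and d: "vder (\<lambda>t. r (p + s t \<alpha>) \<beta>) d1" "vder (\<lambda>t. r (p + s t \<beta>) \<gamma>) d2" "vder (\<lambda>t. r (p + s t \<gamma>) \<alpha>) d3"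
    and c: "vder (\<lambda>t. \<tau> (p + s t \<alpha>) \<eta>) c1" "vder (\<lambda>t. \<tau> (p + s t \<beta>) \<zeta>) c2" "vder (\<lambda>t. \<tau> (p + s t \<gamma>) \<xi>) c3"
  shows "\<kappa> (d1 + c1) (\<gamma> + \<zeta>) + \<kappa> (d2 + c2) (\<alpha> + \<xi>) + \<kappa> (d3 + c3) (\<beta> + \<eta>)
    = \<kappa> (B ((\<alpha> + r p \<alpha>) + (\<xi> + \<tau> p \<xi>)) ((\<beta> + r p \<beta>) + (\<eta> + \<tau> p \<eta>))) ((\<gamma> + r p \<gamma>) + (\<zeta> + \<tau> p \<zeta>))"
proof -
  have R0: "regR r p" and T0: "regT \<tau> p"
    using R [OF P(1)] T [OF P(1)] by (auto dest: eventually_at_0)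
  have rL: "r p \<delta> \<in> L" if "\<delta> \<in> P" for \<delta>
    by (rule regR_facts(1) [OF R0 P(1) that])
  have \<tau>M: "\<tau> p \<delta> \<in> M" if "\<delta> \<in> Q" for \<delta>
    using T0 that by (simp add: regT_def)
  define u1 u2 u3 where u: "u1 = \<alpha> + r p \<alpha>" "u2 = \<beta> + r p \<beta>" "u3 = \<gamma> + r p \<gamma>"
  define y1 y2 y3 where y: "y1 = \<xi> + \<tau> p \<xi>" "y2 = \<eta> + \<tau> p \<eta>" "y3 = \<zeta> + \<tau> p \<zeta>"
  have uuy: "\<kappa> (B u1 u2) y3 = 0" "\<kappa> (B u2 u3) y1 = 0" "\<kappa> (B u3 u1) y2 = 0"
    unfolding u y by (intro LP_L_P rL \<tau>M P Q)+
  have yyy: "\<kappa> (B y1 y2) y3 = 0"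
    unfolding y by (rule dynamical_QQQ [OF T0 Q])
  have uuu: "\<kappa> d1 \<gamma> + \<kappa> d2 \<alpha> + \<kappa> d3 \<beta> = \<kappa> (B u1 u2) u3"
    unfolding u by (rule dynamical_PPP [OF P R d])
  have uyy: "\<kappa> c1 \<zeta> = \<kappa> (B u1 y2) y3" "\<kappa> c2 \<xi> = \<kappa> (B u2 y3) y1" "\<kappa> c3 \<eta> = \<kappa> (B u3 y1) y2"
    unfolding u y
    by (rule dynamical_PQQ(2) [OF P(1,2) Q(2,3) R0 T [OF P(2)] c(1)],
        rule dynamical_PQQ(2) [OF P(1,3) Q(3,1) R0 T [OF P(3)] c(2)],
        rule dynamical_PQQ(2) [OF P(1,4) Q(1,2) R0 T [OF P(4)] c(3)])
  have cM: "c1 \<in> M" "c2 \<in> M" "c3 \<in> M"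
    by (rule dynamical_PQQ(1) [OF P(1,2) Q(2,3) R0 T [OF P(2)] c(1)],
        rule dynamical_PQQ(1) [OF P(1,3) Q(3,1) R0 T [OF P(3)] c(2)],
        rule dynamical_PQQ(1) [OF P(1,4) Q(1,2) R0 T [OF P(4)] c(3)])
  have dL: "d1 \<in> L" "d2 \<in> L" "d3 \<in> L"
    by (rule r_derivative(1) [OF P(1,2,3,4) R [OF P(2)] d(1)], rule r_derivative(1) [OF P(1,3,4,2) R [OF P(3)] d(2)],
        rule r_derivative(1) [OF P(1,4,2,3) R [OF P(4)] d(3)])
  have lhs: "\<kappa> (d1 + c1) (\<gamma> + \<zeta>) + \<kappa> (d2 + c2) (\<alpha> + \<xi>) + \<kappa> (d3 + c3) (\<beta> + \<eta>)
      = \<kappa> (B u1 u2) u3 + (\<kappa> (B u1 y2) y3 + \<kappa> (B u2 y3) y1 + \<kappa> (B u3 y1) y2)"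
    unfolding uuu [symmetric] uyy [symmetric] using cM dL P Q by (simp add: \<kappa>_add orth add_ac)
  have cyc: "\<kappa> (B u2 y3) y1 = \<kappa> (B y1 u2) y3" "\<kappa> (B u3 y1) y2 = \<kappa> (B y1 y2) u3"
    "\<kappa> (B u2 u3) y1 = \<kappa> (B y1 u2) u3" "\<kappa> (B u3 u1) y2 = \<kappa> (B u1 y2) u3"
    by (simp_all only: \<kappa>_cyc [of y1] \<kappa>_cyc [of u3])
  show ?thesis
    unfolding lhs u [symmetric] y [symmetric] using uuy yyy
    by (simp only: cyc) (simp add: B_add \<kappa>_add)
qed

text \<open>With c fixed, \<kappa> (r \<beta>) (S c) + \<kappa> \<beta> (G c) = 0 holds along the
  line; it is free of the inverse of S, and \<open>dfs_ad\<close> differentiates S and G along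
  -[z, p].\<close>

lemma equivariance_r:
  assumes z: "z \<in> L" and P: "p \<in> P" "\<beta> \<in> P" and R: "\<forall>\<^sub>F t in nhds 0. regR r (p + s t (- B z p))"
    and d: "vder (\<lambda>t. r (p + s t (- B z p)) \<beta>) d"
  shows "d + B z (r p \<beta>) = r p (B z \<beta>)"
proof -
  have R0: "regR r p"
    using R by (rule eventually_at_0)
  have zp: "- B z p \<in> P" and z\<beta>: "B z \<beta> \<in> P"
    by (intro subspaces(9) LP z P)+
  have dL: "d \<in> L"
    by (rule r_derivative(1) [OF P(1) zp P(2) P(2) R d])
  have mem: "d + B z (r p \<beta>) - r p (B z \<beta>) \<in> L"
    using subspaces(1) [OF subspaces(1) [OF dL LL [OF z regR_facts(1) [OF R0 P]]] subspaces(3) [OF regR_facts(1) [OF R0 P(1) z\<beta>]]]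
    by simp
  have main: "\<kappa> (d + B z (r p \<beta>) - r p (B z \<beta>)) \<gamma> = 0" if \<gamma>: "\<gamma> \<in> P" for \<gamma>
  proof -
    obtain c where c: "c \<in> P" "fs sS p c = \<gamma>"
      using R0 \<gamma> by (auto simp: regR_def)
    let ?p = "\<lambda>t. p + s t (- B z p)"
    have "((\<lambda>t. \<kappa> (r (?p t) \<beta>) (fs sS (?p t) c)) has_field_derivative
        \<kappa> d (fs sS (?p 0) c) + \<kappa> (r (?p 0) \<beta>) (dfs sS p (- B z p) c)) (at 0)"
      by (rule vder_\<kappa> [OF d vder_fs_const [OF entire_series(6)]])
    moreover have "((\<lambda>t. \<kappa> \<beta> (fs sG (?p t) c)) has_field_derivative \<kappa> \<beta> (dfs sG p (- B z p) c)) (at 0)"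
      using vder_fs_const [OF entire_series(7)] \<kappa>_right unfolding vder_def by blast
    ultimately have sum: "((\<lambda>t. \<kappa> (r (?p t) \<beta>) (fs sS (?p t) c) + \<kappa> \<beta> (fs sG (?p t) c)) has_field_derivative
        \<kappa> d (fs sS (?p 0) c) + \<kappa> (r (?p 0) \<beta>) (dfs sS p (- B z p) c) + \<kappa> \<beta> (dfs sG p (- B z p) c)) (at 0)"
      by (rule DERIV_add)
    have "\<forall>\<^sub>F t in nhds 0. \<kappa> (r (?p t) \<beta>) (fs sS (?p t) c) + \<kappa> \<beta> (fs sG (?p t) c) = 0"
      using R
    proof (rule eventually_mono)
      fix t assume Rt: "regR r (?p t)"
      have "r (?p t) (fs sS (?p t) c) = fs sG (?p t) c"
        using Rt c(1) by (simp add: regR_def)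
      then show "\<kappa> (r (?p t) \<beta>) (fs sS (?p t) c) + \<kappa> \<beta> (fs sG (?p t) c) = 0"
        using regR_facts(4) [OF Rt P_line [OF P(1) zp] P(2) sS_P [OF P_line [OF P(1) zp] c(1)]] by simp
    qed
    from DERIV_cong_ev [OF refl this refl, THEN iffD1, OF sum] have
      "((\<lambda>t. 0) has_field_derivative
        \<kappa> d (fs sS (?p 0) c) + \<kappa> (r (?p 0) \<beta>) (dfs sS p (- B z p) c) + \<kappa> \<beta> (dfs sG p (- B z p) c)) (at 0)" .
    from DERIV_unique [OF this DERIV_const]
    have 0: "\<kappa> d \<gamma> + \<kappa> (r p \<beta>) (fs sS p (B z c)) - \<kappa> (r p \<beta>) (B z \<gamma>) + \<kappa> \<beta> (fs sG p (B z c)) - \<kappa> \<beta> (B z (fs sG p c)) = 0"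
      by (simp add: dfs_ad entire_series c(2) \<kappa>_diff add_diff_eq)
    have zc: "B z c \<in> P"
      by (rule LP [OF z c(1)])
    have 1: "\<kappa> (r p \<beta>) (fs sS p (B z c)) = - \<kappa> \<beta> (fs sG p (B z c))"
      using regR_facts(4) [OF R0 P sS_P [OF P(1) zc]] R0 zc by (simp add: regR_def)
    have 2: "\<kappa> \<beta> (B z (fs sG p c)) = \<kappa> (r p (B z \<beta>)) \<gamma>"
    proof -
      have "fs sG p c = r p \<gamma>"
        using R0 c by (auto simp: regR_def)
      then have "\<kappa> \<beta> (B z (fs sG p c)) = - \<kappa> (B z \<beta>) (r p \<gamma>)"
        by (simp add: \<kappa>_skew)
      also have "\<dots> = \<kappa> (r p (B z \<beta>)) \<gamma>"
        by (simp add: regR_facts(4) [OF R0 P(1) z\<beta> \<gamma>])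
      finally show ?thesis .
    qed
    have 3: "\<kappa> (r p \<beta>) (B z \<gamma>) = - \<kappa> (B z (r p \<beta>)) \<gamma>"
      by (simp add: \<kappa>_skew)
    from 0 show ?thesis
      unfolding 1 2 3 by (simp add: \<kappa>_add \<kappa>_diff)
  qed
  have "d + B z (r p \<beta>) - r p (B z \<beta>) = 0"
  proof (rule nondegenerate)
    fix y
    obtain a b c x where y: "a \<in> L" "b \<in> M" "c \<in> P" "x \<in> Q" "y = a + b + c + x"
      using decomposition by blast
    show "\<kappa> (d + B z (r p \<beta>) - r p (B z \<beta>)) y = 0"
      unfolding y(5) using main [OF y(3)] orth(1) [OF mem y(1)] orth(2) [OF mem y(2)] orth(3) [OF mem y(4)]
      by (simp only: \<kappa>_add(1)) simp
  qed
  then show ?thesis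
    by simp
qed

text \<open>The difference of the two sides lies in M, and differentiating the membership in e^a Q
  shows that e^-a carries it into Q; the uniqueness clause of \<open>regT\<close> makes it
  zero.\<close>

lemma equivariance_\<tau>:
  assumes z: "z \<in> L" and p: "p \<in> P" and \<eta>: "\<eta> \<in> Q" and T: "\<forall>\<^sub>F t in nhds 0. regT \<tau> (p + s t (- B z p))"
    and d: "vder (\<lambda>t. \<tau> (p + s t (- B z p)) \<eta>) d"
  shows "d + B z (\<tau> p \<eta>) = \<tau> p (B z \<eta>)"
proof -
  let ?p = "\<lambda>t. p + s t (- B z p)"
  have T0: "regT \<tau> p"
    using T by (rule eventually_at_0)
  have z\<eta>: "B z \<eta> \<in> Q"
    by (rule LQ [OF z \<eta>])
  have \<tau>: "\<tau> p \<eta> \<in> M" "\<tau> p (B z \<eta>) \<in> M" "em p (\<eta> + \<tau> p \<eta>) \<in> Q" "em p (B z \<eta> + \<tau> p (B z \<eta>)) \<in> Q"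
    using T0 \<eta> z\<eta> by (simp_all add: regT_def)
  have evM: "\<forall>\<^sub>F t in nhds 0. \<tau> (?p t) \<eta> \<in> M \<and> em (?p t) (\<eta> + \<tau> (?p t) \<eta>) \<in> Q"
    using T by (rule eventually_mono) (use \<eta> in \<open>simp add: regT_def\<close>)
  have dM: "d \<in> M"
    unfolding M_iff
  proof
    fix y assume y: "y \<in> L \<union> M \<union> P"
    have "\<forall>\<^sub>F t in nhds 0. \<kappa> (\<tau> (?p t) \<eta>) y = 0"
      using evM by (rule eventually_mono) (use y orth in blast)
    then show "\<kappa> d y = 0"
      by (rule vder_zero [OF d \<kappa>_left])
  qed
  have "vder (\<lambda>t. \<eta> + \<tau> (?p t) \<eta>) (0 + d)"
    by (intro vder_add vder_const d)
  from vder_fs [OF entire_series(2) this, of p "- B z p"]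
  have v: "vder (\<lambda>t. em (?p t) (\<eta> + \<tau> (?p t) \<eta>)) (em p (B z (\<eta> + \<tau> p \<eta>)) - B z (em p (\<eta> + \<tau> p \<eta>)) + em p d)"
    by (simp add: dfs_ad entire_series)
  have "em p (B z (\<eta> + \<tau> p \<eta>)) - B z (em p (\<eta> + \<tau> p \<eta>)) + em p d \<in> Q"
    unfolding Q_iff
  proof
    fix y assume y: "y \<in> L \<union> P \<union> Q"
    have "\<forall>\<^sub>F t in nhds 0. \<kappa> (em (?p t) (\<eta> + \<tau> (?p t) \<eta>)) y = 0"
      using evM by (rule eventually_mono) (use y orth(10-12) in auto)
    then show "\<kappa> (em p (B z (\<eta> + \<tau> p \<eta>)) - B z (em p (\<eta> + \<tau> p \<eta>)) + em p d) y = 0"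
      by (rule vder_zero [OF v \<kappa>_left])
  qed
  from subspaces(10) [OF subspaces(10) [OF this LQ [OF z \<tau>(3)]] subspaces(12) [OF \<tau>(4)]]
  have "em p (d + B z (\<tau> p \<eta>) - \<tau> p (B z \<eta>)) \<in> Q"
    by (simp add: B_add fs_add' fs_diff algebra_simps)
  moreover have "d + B z (\<tau> p \<eta>) - \<tau> p (B z \<eta>) \<in> M"
    using subspaces(4) [OF subspaces(4) [OF dM LM [OF z \<tau>(1)]] subspaces(6) [OF \<tau>(2)]] by simp
  moreover have "\<forall>x\<in>M. em p x \<in> Q \<longrightarrow> x = 0"
    using T0 by (simp add: regT_def)
  ultimately have "d + B z (\<tau> p \<eta>) - \<tau> p (B z \<eta>) = 0"
    by blast
  then show ?thesis
    by simp
qed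

end

section \<open>Smooth families of operators\<close>

text \<open>Openness along lines only, which is all that a directional derivative at a point of U
  can see.\<close>

definition W_open :: "('v \<Rightarrow> 'k::rc_field) set \<Rightarrow> ('v \<Rightarrow> 'k) set \<Rightarrow> bool" where
  "W_open W U \<longleftrightarrow> U \<subseteq> W \<and> (\<forall>p\<in>U. \<forall>\<alpha>\<in>W. \<forall>\<^sub>F t in nhds 0. p + fscale t \<alpha> \<in> U)"

lemma continuous_line: "continuous_on UNIV (\<lambda>t. p + fscale t \<alpha> :: 'v \<Rightarrow> 'k::rc_field)"
proof (rule continuous_on_coordinatewise_then_product)
  fix i
  have "(p + fscale t \<alpha>) i = p i + t * \<alpha> i" for t
    by (simp add: fscale_def)
  then show "continuous_on UNIV (\<lambda>t. (p + fscale t \<alpha>) i)"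
    by (simp add: continuous_intros)
qed

lemma W_openI:
  assumes "openin (top_of_set W) U" and W: "\<And>p \<alpha> t. p \<in> W \<Longrightarrow> \<alpha> \<in> W \<Longrightarrow> p + fscale t \<alpha> \<in> W"
  shows "W_open W U"
proof -
  from assms(1) obtain T where T: "open T" "U = W \<inter> T"
    by (auto simp: openin_open)
  have "\<forall>\<^sub>F t in nhds 0. p + fscale t \<alpha> \<in> U" if "p \<in> U" "\<alpha> \<in> W" for p \<alpha>
  proof -
    have "open ((\<lambda>t. p + fscale t \<alpha>) -` T)"
      by (rule open_vimage [OF T(1) continuous_line])
    moreover have "0 \<in> (\<lambda>t. p + fscale t \<alpha>) -` T"
      using that T by simp
    ultimately show ?thesis
      unfolding eventually_nhds using W that T by (intro exI [where x = "(\<lambda>t. p + fscale t \<alpha>) -` T"]) auto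
  qed
  then show ?thesis
    unfolding W_open_def using T(2) by (intro conjI ballI) simp_all
qed

text \<open>The formulas for the l-matrix hold on U only; since lines stay in U for small t, they
  determine the derivatives there.\<close>

lemma Ck_on_cong_open:
  assumes U: "W_open W U"
  shows "(\<And>p. p \<in> U \<Longrightarrow> f p = g p) \<Longrightarrow> Ck_on k W U f \<Longrightarrow> Ck_on k W U g"
proof (induction k arbitrary: f g)
  case 0
  then show ?case
    using continuous_on_cong [OF refl, of U f g] by simp
next
  case (Suc k)
  from Suc.prems(2) obtain f' where f': "\<And>\<alpha>. \<alpha> \<in> W \<Longrightarrow> Ck_on k W U (f' \<alpha>)"
    "\<And>\<alpha> p. \<alpha> \<in> W \<Longrightarrow> p \<in> U \<Longrightarrow>
      ((\<lambda>t. f (p + fscale t \<alpha>)) has_field_derivative f' \<alpha> p) (at 0)"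
    by (rule Ck_on_SucE) (rule that)
  show ?case
  proof (rule Ck_on_SucI [OF _ f'(1)])
    show "continuous_on U g"
      using Ck_on_continuous [OF Suc.prems(2)] continuous_on_cong [OF refl, of U f g] Suc.prems(1) by simp
    fix \<alpha> p assume a: "\<alpha> \<in> W" "p \<in> U"
    have "\<forall>\<^sub>F t in nhds 0. p + fscale t \<alpha> \<in> U"
      using U a by (simp add: W_open_def)
    then have "\<forall>\<^sub>F t in nhds 0. f (p + fscale t \<alpha>) = g (p + fscale t \<alpha>)"
      by (rule eventually_mono) (rule Suc.prems(1))
    from DERIV_cong_ev [OF refl this refl, THEN iffD1, OF f'(2) [OF a]]
    show "((\<lambda>t. g (p + fscale t \<alpha>)) has_field_derivative f' \<alpha> p) (at 0)" .
  qed
qed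

section \<open>Smooth vector-valued maps and Cramer's rule\<close>

context fin_vs
begin

lemma det_opmat:
  assumes "lin A"
  shows "det (opmat A) \<noteq> 0 \<longleftrightarrow> (\<forall>v. A v = 0 \<longrightarrow> v = 0)"
proof -
  have mv: "(opmat A *\<^sub>v y) $ i = cof i (A (\<Sum>j<dm. s (y $ j) (bas j)))"
    if "y \<in> carrier_vec dm" "i < dm" for y i
  proof -
    have "cof i (A (\<Sum>j<dm. s (y $ j) (bas j))) = (\<Sum>j<dm. y $ j * cof i (A (bas j)))"
      by (simp add: lin_sum [OF assms] lin_scale [OF assms] form_sum [OF basis_facts(3)] form_scale [OF basis_facts(3)])
    then show ?thesis
      using that by (simp add: scalar_prod_def opmat_def lessThan_atLeast0 mult.commute)
  qed
  have "det (opmat A) = 0 \<longleftrightarrow> (\<exists>v. v \<noteq> 0 \<and> A v = 0)"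
    unfolding det_0_iff_vec_prod_zero [OF opmat_carrier]
  proof
    assume "\<exists>y. y \<in> carrier_vec dm \<and> y \<noteq> 0\<^sub>v dm \<and> opmat A *\<^sub>v y = 0\<^sub>v dm"
    then obtain y where y: "y \<in> carrier_vec dm" "y \<noteq> 0\<^sub>v dm" "opmat A *\<^sub>v y = 0\<^sub>v dm"
      by blast
    define v where "v = (\<Sum>j<dm. s (y $ j) (bas j))"
    have "cof i (A v) = 0" if "i < dm" for i
      using mv [OF y(1) that] y(3) that by (simp add: v_def)
    then have "A v = 0"
      by (subst basis_facts(1)) simp
    moreover have "v \<noteq> 0"
    proof
      assume "v = 0"
      have "y $ i = 0" if "i < dm" for i
        using cof_sum [OF that, of "\<lambda>j. y $ j"] form_zero [OF basis_facts(3)] \<open>v = 0\<close> by (simp add: v_def)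
      then have "y = 0\<^sub>v dm"
        using y(1) by (intro eq_vecI) auto
      with y(2) show False ..
    qed
    ultimately show "\<exists>v. v \<noteq> 0 \<and> A v = 0"
      by blast
  next
    assume "\<exists>v. v \<noteq> 0 \<and> A v = 0"
    then obtain v where v: "v \<noteq> 0" "A v = 0"
      by blast
    define y where "y = Matrix.vec dm (\<lambda>i. cof i v)"
    have y: "y \<in> carrier_vec dm"
      by (simp add: y_def)
    have yv: "(\<Sum>j<dm. s (y $ j) (bas j)) = v"
      by (subst (2) basis_facts(1)) (simp add: y_def)
    have "opmat A *\<^sub>v y = 0\<^sub>v dm"
      by (rule eq_vecI) (use mv [OF y] yv v(2) form_zero [OF basis_facts(3)] in \<open>simp_all add: opmat_def\<close>)
    moreover have "y \<noteq> 0\<^sub>v dm"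
    proof
      assume "y = 0\<^sub>v dm"
      then have "(\<Sum>j<dm. s (y $ j) (bas j)) = 0"
        by simp
      with yv v(1) show False
        by simp
    qed
    ultimately show "\<exists>y. y \<in> carrier_vec dm \<and> y \<noteq> 0\<^sub>v dm \<and> opmat A *\<^sub>v y = 0\<^sub>v dm"
      using y by blast
  qed
  then show ?thesis
    by blast
qed

lemma cof_solve:
  assumes A: "lin A" and x: "A x = b" and i: "i < dm"
  shows "(\<Sum>j<dm. adj_mat (opmat A) $$ (i, j) * cof j b) = det (opmat A) * cof i x"
proof -
  note adj = adj_mat [OF opmat_carrier [of A]]
  have "(\<Sum>j<dm. adj_mat (opmat A) $$ (i, j) * cof j b)
      = (\<Sum>j<dm. \<Sum>k<dm. adj_mat (opmat A) $$ (i, j) * (opmat A $$ (j, k) * cof k x))"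
    unfolding x [symmetric] by (intro sum.cong refl) (simp add: cof_op [OF A, of _ x] opmat_index sum_distrib_left)
  also have "\<dots> = (\<Sum>k<dm. (adj_mat (opmat A) * opmat A) $$ (i, k) * cof k x)"
    by (subst sum.swap) (intro sum.cong refl, simp add: mat_mult_index [OF adj(1) opmat_carrier i] sum_distrib_right mult.assoc del: index_mult_mat(1))
  also have "\<dots> = (\<Sum>k<dm. if k = i then det (opmat A) * cof k x else 0)"
    unfolding adj(3) using i by (intro sum.cong refl) simp
  finally show ?thesis
    using i by simp
qed

definition smooth_on :: "('a \<Rightarrow> 'k) set \<Rightarrow> ('a \<Rightarrow> 'k) set \<Rightarrow> (('a \<Rightarrow> 'k) \<Rightarrow> 'v) \<Rightarrow> bool" where
  "smooth_on W U f \<longleftrightarrow> (\<forall>\<xi>\<in>forms. \<forall>k. Ck_on k W U (\<lambda>p. \<xi> (f p)))"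

lemma smooth_onD: "smooth_on W U f \<Longrightarrow> \<xi> \<in> forms \<Longrightarrow> Ck_on k W U (\<lambda>p. \<xi> (f p))"
  by (simp add: smooth_on_def)

lemma smooth_on_cof:
  assumes "\<And>i k. i < dm \<Longrightarrow> Ck_on k W U (\<lambda>p. cof i (f p))"
  shows "smooth_on W U f"
  unfolding smooth_on_def
proof (intro ballI allI)
  fix \<xi> k assume \<xi>: "\<xi> \<in> forms"
  have "Ck_on k W U (\<lambda>p. \<Sum>i<dm. cof i (f p) * \<xi> (bas i))"
    by (rule Ck_on_sum, rule Ck_on_mult [OF assms Ck_on_const]) simp
  then show "Ck_on k W U (\<lambda>p. \<xi> (f p))"
    unfolding form_expand [OF \<xi>, symmetric] .
qed

text \<open>By Cramer's rule the coordinates of the solution are adjugate entries times the right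
  side over the determinant, all built from C^k functions by sums, products and inverses.\<close>

lemma smooth_inverse:
  assumes U: "W_open W U" and A: "\<And>p. lin (A p)" and inj: "\<And>p v. p \<in> U \<Longrightarrow> A p v = 0 \<Longrightarrow> v = 0"
    and sA: "\<And>v. smooth_on W U (\<lambda>p. A p v)" and sb: "smooth_on W U b"
    and x: "\<And>p. p \<in> U \<Longrightarrow> A p (x p) = b p"
  shows "smooth_on W U x"
proof (rule smooth_on_cof)
  fix i k assume i: "i < dm"
  have det: "det (opmat (A p)) \<noteq> 0" if "p \<in> U" for p
    using det_opmat [OF A [of p], THEN iffD2] inj [OF that] by simp
  have e: "Ck_on k W U (\<lambda>p. opmat (A p) $$ (a, b))" if "a < dm" "b < dm" for a b
    using that smooth_onD [OF sA basis_facts(3)] by (simp add: opmat_index)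
  have d: "Ck_on k W U (\<lambda>p. det (opmat (A p)))"
    by (rule det_closed [where C = "Ck_on k W U", OF Ck_on_const Ck_on_add Ck_on_mult opmat_carrier e])
  have adj: "Ck_on k W U (\<lambda>p. adj_mat (opmat (A p)) $$ (i, j))" if "j < dm" for j
    by (rule adj_mat_closed [where C = "Ck_on k W U", OF Ck_on_const Ck_on_add Ck_on_mult opmat_carrier e i that])
  have "Ck_on k W U (\<lambda>p. inverse (det (opmat (A p))) * (\<Sum>j<dm. adj_mat (opmat (A p)) $$ (i, j) * cof j (b p)))"
  proof (rule Ck_on_mult [OF Ck_on_inverse [OF d det] Ck_on_sum])
    show "Ck_on k W U (\<lambda>p. adj_mat (opmat (A p)) $$ (i, j) * cof j (b p))" if "j \<in> {..<dm}" for j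
      by (rule Ck_on_mult [OF adj smooth_onD [OF sb basis_facts(3)]]) (use that in simp)
  qed
  then show "Ck_on k W U (\<lambda>p. cof i (x p))"
    by (rule Ck_on_cong_open [OF U, rotated]) (simp add: cof_solve [OF A x i] det)
qed

lemma smooth_ps_op:
  assumes f: "entire f"
    and A: "\<And>p \<alpha> t v. p \<in> U \<Longrightarrow> \<alpha> \<in> W \<Longrightarrow> A (p + fscale t \<alpha>) v = A p v + s t (A \<alpha> v)"
    and c: "\<And>\<xi> v. \<xi> \<in> forms \<Longrightarrow> continuous_on U (\<lambda>p. \<xi> (A p v))"
    and x: "smooth_on W U x"
  shows "smooth_on W U (\<lambda>p. ps f (A p) (x p))"
  unfolding smooth_on_def
proof (intro ballI allI)
  fix \<xi> k assume \<xi>: "\<xi> \<in> forms"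
  have e: "Ck_on k W U (\<lambda>p. mps f (opmat (A p)) $$ (i, j))" if "i < dm" "j < dm" for i j
  proof (rule Ck_on_mps [where M = "\<lambda>p. opmat (A p)" and L = "\<lambda>\<alpha>. opmat (A \<alpha>)", OF f opmat_carrier opmat_carrier])
    show "continuous_on U (\<lambda>p. opmat (A p) $$ (i, j))" if "i < dm" "j < dm" for i j
      using that c [OF basis_facts(3)] by (simp add: opmat_index)
    show "opmat (A (p + fscale t \<alpha>)) = opmat (A p) + t \<cdot>\<^sub>m opmat (A \<alpha>)" if "p \<in> U" "\<alpha> \<in> W" for p \<alpha> t
    proof -
      have "A (p + fscale t \<alpha>) = (\<lambda>v. A p v + s t (A \<alpha> v))"
        by (rule ext) (rule A [OF that])
      then show ?thesis
        by (simp only: opmat_line)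
    qed
  qed (simp_all add: that)
  show "Ck_on k W U (\<lambda>p. \<xi> (ps f (A p) (x p)))"
    unfolding ps_def form_of_mat [OF \<xi>]
  proof (rule Ck_on_sum, rule Ck_on_sum, rule Ck_on_mult [OF Ck_on_const Ck_on_mult [OF e smooth_onD [OF x basis_facts(3)]]])
  qed simp_all
qed

lemma smooth_const: "smooth_on W U (\<lambda>_. v)"
  by (simp add: smooth_on_def Ck_on_const)

lemma smooth_add: "smooth_on W U f \<Longrightarrow> smooth_on W U g \<Longrightarrow> smooth_on W U (\<lambda>p. f p + g p)"
  by (simp add: smooth_on_def form_add Ck_on_add)

lemma smooth_vder:
  assumes "smooth_on W U f" "p \<in> U" "\<alpha> \<in> W"
  shows "\<exists>d. vder (\<lambda>t. f (p + fscale t \<alpha>)) d"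
proof -
  have "\<exists>D. ((\<lambda>t. cof i (f (p + fscale t \<alpha>))) has_field_derivative D) (at 0)" for i
  proof -
    have "Ck_on (Suc 0) W U (\<lambda>p. cof i (f p))"
      by (rule smooth_onD [OF assms(1) basis_facts(3)])
    then obtain f' where "\<And>\<alpha>. \<alpha> \<in> W \<Longrightarrow> Ck_on 0 W U (f' \<alpha>)"
      "\<And>\<alpha> p. \<alpha> \<in> W \<Longrightarrow> p \<in> U \<Longrightarrow> ((\<lambda>t. cof i (f (p + fscale t \<alpha>))) has_field_derivative f' \<alpha> p) (at 0)"
      by (rule Ck_on_SucE) (rule that)
    then show ?thesis
      using assms(2,3) by (intro exI [where x = "f' \<alpha> p"])
  qed
  then have "\<forall>i. \<exists>D. ((\<lambda>t. cof i (f (p + fscale t \<alpha>))) has_field_derivative D) (at 0)"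
    by (rule allI)
  from choice [OF this] obtain D
    where D: "\<And>i. ((\<lambda>t. cof i (f (p + fscale t \<alpha>))) has_field_derivative D i) (at 0)"
    by (elim exE) (rule that, elim allE)
  have "vder (\<lambda>t. f (p + fscale t \<alpha>)) (\<Sum>i<dm. s (D i) (bas i))"
    unfolding vder_def
  proof
    fix \<xi> assume \<xi>: "\<xi> \<in> forms"
    have "((\<lambda>t. \<Sum>i<dm. cof i (f (p + fscale t \<alpha>)) * \<xi> (bas i)) has_field_derivative (\<Sum>i<dm. D i * \<xi> (bas i))) (at 0)"
      by (intro DERIV_sum DERIV_cmult_right D)
    then show "((\<lambda>t. \<xi> (f (p + fscale t \<alpha>))) has_field_derivative \<xi> (\<Sum>i<dm. s (D i) (bas i))) (at 0)"
      by (simp add: form_expand [OF \<xi>, symmetric] form_sum [OF \<xi>] form_scale [OF \<xi>])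
  qed
  then show ?thesis
    by (rule exI)
qed

text \<open>Injectivity is the non-vanishing of a determinant that depends continuously on
  p.\<close>

lemma open_injective:
  assumes A: "\<And>p. lin (A p)" and c: "\<And>\<xi> v. \<xi> \<in> forms \<Longrightarrow> continuous_on W (\<lambda>p. \<xi> (A p v))"
  shows "openin (top_of_set W) {p \<in> W. \<forall>v. A p v = 0 \<longrightarrow> v = 0}"
proof -
  have "continuous_on W (\<lambda>p. det (opmat (A p)))"
  proof (rule det_closed [where C = "continuous_on W", OF _ _ _ opmat_carrier])
    show "continuous_on W (\<lambda>p. opmat (A p) $$ (i, j))" if "i < dm" "j < dm" for i j
      using that c [OF basis_facts(3)] by (simp add: opmat_index)
  qed (fact continuous_on_const continuous_on_add continuous_on_mult)+
  then have "openin (top_of_set W) (W \<inter> (\<lambda>p. det (opmat (A p))) -` (- {0}))"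
    by (rule continuous_openin_preimage_gen) (intro open_Compl closed_singleton)
  moreover have "W \<inter> (\<lambda>p. det (opmat (A p))) -` (- {0}) = {p \<in> W. \<forall>v. A p v = 0 \<longrightarrow> v = 0}"
    by (auto simp: det_opmat [OF A])
  ultimately show ?thesis
    by simp
qed

end

section \<open>Series in ad q under conjugation by exponentials\<close>

context quad_lie
begin

lemma em_automorphism: "em z (B u v) = B (em z u) (em z v)"
proof -
  have "em z (e z (B (em z u) (em z v))) = em z (B u v)"
    unfolding exp_automorphism by simp
  then show ?thesis
    by simp
qed

text \<open>e^(-ad z) is an automorphism, so it intertwines ad q with ad of the image of q and hence
  every series in them.\<close>

lemma fs_conj: "entire f \<Longrightarrow> fs f (em z q) (em z v) = em z (fs f q v)"
  unfolding fs_def [of f]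
  by (rule ps_intertwine [where T = "em z" and A = "B q" and B = "B (em z q)", symmetric])
    (simp_all only: entire_rfps B_right lin_fs em_automorphism)

lemma fs_zero_left: "entire f \<Longrightarrow> fs f 0 v = s (of_real (fps_nth f 0)) v"
proof (rule forms_eqI)
  fix \<xi> assume f: "entire f" and \<xi>: "\<xi> \<in> forms"
  have "(B 0 ^^ n) v = (if n = 0 then v else 0)" for n
    by (cases n) (simp_all add: B_zero)
  then have "(\<lambda>n. of_real (fps_nth f n) * \<xi> (if n = 0 then v else 0)) sums \<xi> (fs f 0 v)"
    using fs_sums [OF f \<xi>, of 0 v] by simp
  moreover have "(\<lambda>n. of_real (fps_nth f n) * \<xi> (if n = 0 then v else 0)) sums
      (\<Sum>n\<in>{0}. of_real (fps_nth f n) * \<xi> (if n = 0 then v else 0))"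
    by (rule sums_finite) (auto simp: form_zero [OF \<xi>])
  ultimately have "\<xi> (fs f 0 v) = (\<Sum>n\<in>{0}. of_real (fps_nth f n) * \<xi> (if n = 0 then v else 0))"
    by (rule sums_unique2)
  then show "\<xi> (fs f 0 v) = \<xi> (s (of_real (fps_nth f 0)) v)"
    by (simp add: form_scale [OF \<xi>])
qed

end

context graded_lie
begin

lemma pow_LP:
  assumes "p \<in> P" "x \<in> L \<union> P"
  shows "(B p ^^ n) x \<in> L \<union> P"
  using pow_parity(1) [OF assms(1), of x n] pow_parity(2) [OF assms(1), of x n] assms(2)
  by (cases "even n") auto

lemma fs_D0:
  assumes "entire f" "q \<in> P" "x \<in> L \<union> P" "y \<in> M \<union> Q"
  shows "\<kappa> (fs f q x) y = 0"
proof (rule fs_form_zero [OF assms(1) \<kappa>_left])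
  fix n
  show "\<kappa> ((B q ^^ n) x) y = 0"
    using pow_LP [OF assms(2,3), of n] assms(4) by (elim UnE) (simp_all add: orth)
qed

text \<open>Skewness moves the powers of ad q onto y, and these keep y inside L or P.\<close>

lemma fs_D1:
  assumes "entire f" "q \<in> P" "x \<in> M \<union> Q" "y \<in> L \<union> P"
  shows "\<kappa> (fs f q x) y = 0"
proof (rule fs_form_zero [OF assms(1) \<kappa>_left])
  fix n
  have "\<kappa> x ((B q ^^ n) y) = 0"
    using pow_LP [OF assms(2,4), of n] assms(3) by (elim UnE) (simp_all add: orth)
  then show "\<kappa> ((B q ^^ n) x) y = 0"
    by (simp add: \<kappa>_pow)
qed

lemma fs_L:
  assumes f: "entire f" and z: "z \<in> L"
  shows "x \<in> L \<Longrightarrow> fs f z x \<in> L" "x \<in> M \<Longrightarrow> fs f z x \<in> M" "x \<in> P \<Longrightarrow> fs f z x \<in> P" "x \<in> Q \<Longrightarrow> fs f z x \<in> Q"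
proof -
  have pow: "(B z ^^ n) x \<in> X" if "\<And>x. x \<in> X \<Longrightarrow> B z x \<in> X" "x \<in> X" for X n
    by (induction n) (simp_all add: that)
  have zero: "\<kappa> (fs f z x) y = 0" if "\<And>n. \<kappa> ((B z ^^ n) x) y = 0" for y
    by (rule fs_form_zero [OF f \<kappa>_left that])
  show "fs f z x \<in> L" if "x \<in> L"
  proof (rule L_iff [THEN iffD2], rule ballI, rule zero)
    fix y n assume y: "y \<in> L \<union> M \<union> Q"
    have "(B z ^^ n) x \<in> L"
      by (rule pow [OF LL [OF z] that])
    with y show "\<kappa> ((B z ^^ n) x) y = 0"
      by (elim UnE) (simp_all add: orth)
  qed
  show "fs f z x \<in> M" if "x \<in> M"
  proof (rule M_iff [THEN iffD2], rule ballI, rule zero)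
    fix y n assume y: "y \<in> L \<union> M \<union> P"
    have "(B z ^^ n) x \<in> M"
      by (rule pow [OF LM [OF z] that])
    with y show "\<kappa> ((B z ^^ n) x) y = 0"
      by (elim UnE) (simp_all add: orth)
  qed
  show "fs f z x \<in> P" if "x \<in> P"
  proof (rule P_iff [THEN iffD2], rule ballI, rule zero)
    fix y n assume y: "y \<in> M \<union> P \<union> Q"
    have "(B z ^^ n) x \<in> P"
      by (rule pow [OF LP [OF z] that])
    with y show "\<kappa> ((B z ^^ n) x) y = 0"
      by (elim UnE) (simp_all add: orth)
  qed
  show "fs f z x \<in> Q" if "x \<in> Q"
  proof (rule Q_iff [THEN iffD2], rule ballI, rule zero)
    fix y n assume y: "y \<in> L \<union> P \<union> Q"
    have "(B z ^^ n) x \<in> Q"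
      by (rule pow [OF LQ [OF z] that])
    with y show "\<kappa> ((B z ^^ n) x) y = 0"
      by (elim UnE) (simp_all add: orth)
  qed
qed

end

section \<open>The double of a canonically compatible Lie quasi-bialgebra\<close>

locale compatible_quasi_bialgebra =
  fixes s :: "'k::rc_field \<Rightarrow> 'g::ab_group_add \<Rightarrow> 'g"
    and br :: "'g \<Rightarrow> 'g \<Rightarrow> 'g"
    and \<omega> :: "'g \<Rightarrow> ('g \<Rightarrow> 'k) \<Rightarrow> 'g"
    and \<phi> :: "('g \<Rightarrow> 'k) \<Rightarrow> ('g \<Rightarrow> 'k) \<Rightarrow> ('g \<Rightarrow> 'k) \<Rightarrow> 'k"
    and l m :: "'g set"
  assumes fin: "fin_dim s"
    and quasi_bialgebra: "lie_quasi_bialgebra s UNIV br \<omega> \<phi>"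
    and reductive: "reductive_decomposition s br l m"
    and compatible: "canonically_compatible s \<omega> \<phi> l m"
begin

sublocale g: fin_vs s
  using fin by (simp add: fin_dim_def fin_vs_def fin_vs_axioms_def)

lemma br_right: "g.lin (br x)" and br_left: "g.lin (\<lambda>x. br x y)"
  using quasi_bialgebra by (simp_all add: lie_quasi_bialgebra_def lie_algebra_on_def)

lemmas br_add = g.lin_add [OF br_right] g.lin_add [OF br_left]
lemmas br_scale = g.lin_scale [OF br_right] g.lin_scale [OF br_left]
lemmas br_zero = g.lin_zero [OF br_right] g.lin_zero [OF br_left]

lemma br_anti: "br x y = - br y x"
proof -
  have alt: "br x x = 0" for x
    using quasi_bialgebra by (simp add: lie_quasi_bialgebra_def lie_algebra_on_def)
  have "br (x + y) (x + y) = 0"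
    by (rule alt)
  then have "br y x + br x y = 0"
    unfolding br_add by (simp add: alt)
  then show ?thesis
    by (simp add: eq_neg_iff_add_eq_0 add.commute)
qed

lemma \<omega>_skew: "\<xi> \<in> g.forms \<Longrightarrow> \<eta> \<in> g.forms \<Longrightarrow> \<eta> (\<omega> x \<xi>) = - \<xi> (\<omega> x \<eta>)"
  and \<omega>_scale: "\<xi> \<in> g.forms \<Longrightarrow> \<omega> x (fscale c \<xi>) = s c (\<omega> x \<xi>)"
  and \<omega>_left: "\<xi> \<in> g.forms \<Longrightarrow> g.lin (\<lambda>x. \<omega> x \<xi>)"
proof -
  have "\<omega> x \<in> skew_maps s UNIV"
    using quasi_bialgebra by (simp add: lie_quasi_bialgebra_def)
  then have skew: "\<forall>\<xi>\<in>g.forms. \<forall>\<eta>\<in>g.forms. \<eta> (\<omega> x \<xi>) = - \<xi> (\<omega> x \<eta>)"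
    and lin: "lin_on fscale s g.forms (\<omega> x)"
    unfolding skew_maps_def mem_Collect_eq by - (elim conjE, assumption)+
  show "\<xi> \<in> g.forms \<Longrightarrow> \<eta> \<in> g.forms \<Longrightarrow> \<eta> (\<omega> x \<xi>) = - \<xi> (\<omega> x \<eta>)"
    by (rule skew [rule_format])
  show "\<xi> \<in> g.forms \<Longrightarrow> \<omega> x (fscale c \<xi>) = s c (\<omega> x \<xi>)"
    using lin by (simp add: lin_on_def)
  show "\<xi> \<in> g.forms \<Longrightarrow> g.lin (\<lambda>x. \<omega> x \<xi>)"
    using quasi_bialgebra by (simp add: lie_quasi_bialgebra_def)
qed

lemma \<omega>_l: "z \<in> l \<Longrightarrow> \<xi> \<in> g.forms \<Longrightarrow> \<omega> z \<xi> = 0"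
  and \<omega>_m: "\<xi> \<in> annih s m \<Longrightarrow> \<eta> \<in> annih s m \<Longrightarrow> \<xi> (\<omega> x \<eta>) = 0"
  and \<phi>_Q: "\<xi> \<in> annih s l \<Longrightarrow> \<eta> \<in> annih s l \<Longrightarrow> \<zeta> \<in> annih s l \<Longrightarrow> \<phi> \<xi> \<eta> \<zeta> = 0"
  using compatible by (simp_all add: canonically_compatible_def)

lemma l_subspace: "g.subspace l" and m_subspace: "g.subspace m"
  and lm_disjoint: "l \<inter> m = {0}" and lm_UNIV: "{y + z | y z. y \<in> l \<and> z \<in> m} = UNIV"
  and br_ll: "x \<in> l \<Longrightarrow> y \<in> l \<Longrightarrow> br x y \<in> l" and br_lm: "x \<in> l \<Longrightarrow> y \<in> m \<Longrightarrow> br x y \<in> m"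
  using reductive by (simp_all add: reductive_decomposition_def)

lemma annih_form: "\<xi> \<in> annih s A \<Longrightarrow> \<xi> \<in> g.forms" and annih_zero: "\<xi> \<in> annih s A \<Longrightarrow> x \<in> A \<Longrightarrow> \<xi> x = 0"
  by (simp_all add: annih_def)

lemma annihI: "\<xi> \<in> g.forms \<Longrightarrow> (\<And>x. x \<in> A \<Longrightarrow> \<xi> x = 0) \<Longrightarrow> \<xi> \<in> annih s A"
  by (simp add: annih_def)

abbreviation "pr \<equiv> proj_l l m"

lemma pr_eqI: "z \<in> l \<Longrightarrow> x - z \<in> m \<Longrightarrow> pr x = z"
  unfolding proj_l_def
proof (rule the_equality)
  fix z' assume z: "z \<in> l" "x - z \<in> m" "z' \<in> l \<and> x - z' \<in> m"
  have "(x - z) - (x - z') \<in> m"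
    using z by (intro g.subspace_diff [OF m_subspace, of "x - z" "x - z'"]) simp_all
  then have "z' - z \<in> l \<inter> m"
    using z l_subspace by (simp add: g.subspace_diff)
  then show "z' = z"
    unfolding lm_disjoint by simp
qed simp

lemma pr_l [simp]: "pr x \<in> l" and pr_m [simp]: "x - pr x \<in> m"
proof -
  obtain y z where "y \<in> l" "z \<in> m" "x = y + z"
    using lm_UNIV UNIV_I [of x] by blast
  moreover from this have "pr x = y"
    by (intro pr_eqI) simp_all
  ultimately show "pr x \<in> l" "x - pr x \<in> m"
    by simp_all
qed

lemma pr_id [simp]: "z \<in> l \<Longrightarrow> pr z = z"
  using m_subspace by (intro pr_eqI) (simp_all add: g.subspace_0)

lemma pr_zero [simp]: "z \<in> m \<Longrightarrow> pr z = 0"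
  using l_subspace by (intro pr_eqI) (simp_all add: g.subspace_0)

lemma lin_pr: "g.lin pr"
  unfolding lin_on_UNIV
proof (intro conjI allI)
  fix x y c
  have "(x - pr x) + (y - pr y) \<in> m"
    using m_subspace by (simp add: g.subspace_add)
  then show "pr (x + y) = pr x + pr y"
    using l_subspace by (intro pr_eqI) (simp_all add: g.subspace_add algebra_simps)
  have "s c (x - pr x) \<in> m"
    using m_subspace by (simp add: g.subspace_scale)
  then show "pr (s c x) = s c (pr x)"
    using l_subspace by (intro pr_eqI) (simp_all add: g.subspace_scale g.scale_right_diff_distrib)
qed

lemma s_map_annih: "\<alpha> \<in> dual s l \<Longrightarrow> s_map l m \<alpha> \<in> annih s m"
proof (rule annihI)
  assume \<alpha>: "\<alpha> \<in> dual s l"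
  then have a: "x \<in> l \<Longrightarrow> y \<in> l \<Longrightarrow> \<alpha> (x + y) = \<alpha> x + \<alpha> y" "x \<in> l \<Longrightarrow> \<alpha> (s c x) = c * \<alpha> x" for x y c
    by (simp_all add: dual_def lin_on_def)
  show "s_map l m \<alpha> \<in> g.forms"
    unfolding dual_UNIV lin_on_UNIV mem_Collect_eq s_map_def
    by (simp add: g.lin_add [OF lin_pr] g.lin_scale [OF lin_pr] a)
  have "\<alpha> (0 + 0) = \<alpha> 0 + \<alpha> 0"
    using l_subspace by (intro a) (simp_all add: g.subspace_0)
  then show "s_map l m \<alpha> x = 0" if "x \<in> m" for x
    using that by (simp add: s_map_def)
qed

lemma restr_l: "\<xi> \<in> g.forms \<Longrightarrow> restr l \<xi> \<in> dual s l"
proof -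
  assume \<xi>: "\<xi> \<in> g.forms"
  note add = g.form_add [OF \<xi>] and scale = g.form_scale [OF \<xi>]
  have "x + y \<in> l" "s c x \<in> l" if "x \<in> l" "y \<in> l" for x y c
    using that by (simp_all add: g.subspace_add [OF l_subspace] g.subspace_scale [OF l_subspace])
  then show "restr l \<xi> \<in> dual s l"
    unfolding dual_def lin_on_def restr_def by (simp add: add scale)
qed

lemma restr_s_map: "\<alpha> \<in> dual s l \<Longrightarrow> restr l (s_map l m \<alpha>) = \<alpha>"
  by (rule ext) (simp add: restr_def s_map_def dual_def)

lemma s_map_restr: "\<xi> \<in> g.forms \<Longrightarrow> s_map l m (restr l \<xi>) x = \<xi> (pr x)"
  by (simp add: s_map_def restr_def)

lemma s_map_restr_annih: "\<xi> \<in> annih s m \<Longrightarrow> s_map l m (restr l \<xi>) = \<xi>"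
proof (rule ext)
  fix x assume \<xi>: "\<xi> \<in> annih s m"
  then have "\<xi> x - \<xi> (pr x) = 0"
    using annih_zero [OF \<xi> pr_m, of x] by (simp add: g.form_diff [OF annih_form])
  then show "s_map l m (restr l \<xi>) x = \<xi> x"
    by (simp add: s_map_restr [OF annih_form [OF \<xi>]])
qed

lemma diff_s_map_annih:
  assumes \<xi>: "\<xi> \<in> g.forms"
  shows "\<xi> - s_map l m (restr l \<xi>) \<in> annih s l"
proof (rule annihI)
  have "s_map l m (restr l \<xi>) \<in> g.forms"
    by (rule annih_form [OF s_map_annih [OF restr_l [OF \<xi>]]])
  then show "\<xi> - s_map l m (restr l \<xi>) \<in> g.forms"
    using \<xi> unfolding dual_UNIV lin_on_UNIV mem_Collect_eq by (simp add: algebra_simps)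
qed (simp add: s_map_restr [OF \<xi>])

text \<open>For any form \<xi> the form \<xi> minus s of its restriction to l annihilates l; so
  \<xi> takes equal values at x and at its projection to l.\<close>

lemma sep_l: "(\<And>\<xi>. \<xi> \<in> annih s l \<Longrightarrow> \<xi> x = 0) \<Longrightarrow> x \<in> l"
proof -
  assume h: "\<And>\<xi>. \<xi> \<in> annih s l \<Longrightarrow> \<xi> x = 0"
  have "\<xi> x = \<xi> (pr x)" if \<xi>: "\<xi> \<in> g.forms" for \<xi>
    using h [OF diff_s_map_annih [OF \<xi>]] by (simp add: s_map_restr [OF \<xi>])
  then have "x = pr x"
    by (rule g.forms_eqI)
  then show ?thesis
    using pr_l [of x] by simp
qed

lemma sep_m: "(\<And>\<xi>. \<xi> \<in> annih s m \<Longrightarrow> \<xi> x = 0) \<Longrightarrow> x \<in> m"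
proof -
  assume h: "\<And>\<xi>. \<xi> \<in> annih s m \<Longrightarrow> \<xi> x = 0"
  have "\<xi> (pr x) = \<xi> 0" if \<xi>: "\<xi> \<in> g.forms" for \<xi>
    using h [OF s_map_annih [OF restr_l [OF \<xi>]]] by (simp add: s_map_restr [OF \<xi>] g.form_zero [OF \<xi>])
  then have "pr x = 0"
    by (rule g.forms_eqI)
  then show ?thesis
    using pr_m [of x] by simp
qed

lemma forms_lm_eqI: "\<xi> \<in> g.forms \<Longrightarrow> \<eta> \<in> g.forms \<Longrightarrow> (\<And>x. x \<in> l \<Longrightarrow> \<xi> x = \<eta> x) \<Longrightarrow> (\<And>x. x \<in> m \<Longrightarrow> \<xi> x = \<eta> x) \<Longrightarrow> \<xi> = \<eta>"
proof (rule ext)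
  fix x
  assume f: "\<xi> \<in> g.forms" "\<eta> \<in> g.forms" and h: "\<And>x. x \<in> l \<Longrightarrow> \<xi> x = \<eta> x" "\<And>x. x \<in> m \<Longrightarrow> \<xi> x = \<eta> x"
  have "\<xi> (pr x + (x - pr x)) = \<eta> (pr x + (x - pr x))"
    unfolding f [THEN g.form_add] by (simp add: h(1) h(2) del: add_diff_cancel)
  then show "\<xi> x = \<eta> x"
    by simp
qed

lemma \<phi>_alt:
  obtains N a b c where "\<And>j. j < (N::nat) \<Longrightarrow> (a j, b j, c j) \<in> l \<times> l \<times> l \<union> l \<times> m \<times> m \<union> m \<times> m \<times> m"
    "\<And>\<xi> \<eta> \<zeta>. \<xi> \<in> g.forms \<Longrightarrow> \<eta> \<in> g.forms \<Longrightarrow> \<zeta> \<in> g.forms \<Longrightarrow> \<phi> \<xi> \<eta> \<zeta> = (\<Sum>j<N. alt3 (a j) (b j) (c j) \<xi> \<eta> \<zeta>)"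
proof -
  have "\<phi> \<in> Alt_space s UNIV (l \<times> l \<times> l \<union> l \<times> m \<times> m \<union> m \<times> m \<times> m)"
    using compatible by (simp add: canonically_compatible_def)
  then obtain N a b c where "\<forall>j<(N::nat). (a j, b j, c j) \<in> l \<times> l \<times> l \<union> l \<times> m \<times> m \<union> m \<times> m \<times> m"
    "\<forall>\<xi>\<in>g.forms. \<forall>\<eta>\<in>g.forms. \<forall>\<zeta>\<in>g.forms. \<phi> \<xi> \<eta> \<zeta> = (\<Sum>j<N. alt3 (a j) (b j) (c j) \<xi> \<eta> \<zeta>)"
    unfolding Alt_space_def mem_Collect_eq by (elim exE conjE)
  then show ?thesis
    by (intro that [of N a b c]) simp_all
qed

lemma zero_form: "(\<lambda>x. 0) \<in> g.forms"
  by (simp add: dual_UNIV lin_on_UNIV)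

lemma \<phi>_cyc: "\<xi> \<in> g.forms \<Longrightarrow> \<eta> \<in> g.forms \<Longrightarrow> \<zeta> \<in> g.forms \<Longrightarrow> \<phi> \<xi> \<eta> \<zeta> = \<phi> \<eta> \<zeta> \<xi>"
  by (rule \<phi>_alt) (simp add: alt3_def algebra_simps)

lemma \<phi>_zero: "\<eta> \<in> g.forms \<Longrightarrow> \<zeta> \<in> g.forms \<Longrightarrow> \<phi> (\<lambda>x. 0) \<eta> \<zeta> = 0"
    "\<eta> \<in> g.forms \<Longrightarrow> \<zeta> \<in> g.forms \<Longrightarrow> \<phi> \<eta> (\<lambda>x. 0) \<zeta> = 0" "\<eta> \<in> g.forms \<Longrightarrow> \<zeta> \<in> g.forms \<Longrightarrow> \<phi> \<eta> \<zeta> (\<lambda>x. 0) = 0"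
  by (rule \<phi>_alt, simp add: alt3_def zero_form)+

text \<open>A generator from l, l, l is killed by the form vanishing on l; every other generator has
  at least two factors in m, and two of the three forms vanish there.\<close>

lemma \<phi>_PPQ:
  assumes "\<xi> \<in> annih s m" "\<eta> \<in> annih s m" "\<zeta> \<in> annih s l"
  shows "\<phi> \<xi> \<eta> \<zeta> = 0"
proof (rule \<phi>_alt)
  fix N a b c
  assume abc: "\<And>j. j < (N::nat) \<Longrightarrow> (a j, b j, c j) \<in> l \<times> l \<times> l \<union> l \<times> m \<times> m \<union> m \<times> m \<times> m"
    and \<phi>: "\<And>\<xi> \<eta> \<zeta>. \<xi> \<in> g.forms \<Longrightarrow> \<eta> \<in> g.forms \<Longrightarrow> \<zeta> \<in> g.forms \<Longrightarrow> \<phi> \<xi> \<eta> \<zeta> = (\<Sum>j<N. alt3 (a j) (b j) (c j) \<xi> \<eta> \<zeta>)"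
  have "alt3 (a j) (b j) (c j) \<xi> \<eta> \<zeta> = 0" if "j < N" for j
    using abc [OF that] annih_zero [OF assms(1)] annih_zero [OF assms(2)] annih_zero [OF assms(3)]
    by (auto simp: alt3_def)
  then show ?thesis
    by (simp add: \<phi> assms [THEN annih_form])
qed

lemma contr:
  assumes "\<xi> \<in> g.forms" "\<eta> \<in> g.forms" "\<zeta> \<in> g.forms"
  shows "\<zeta> (contr s UNIV \<phi> \<xi> \<eta>) = \<phi> \<xi> \<eta> \<zeta>"
proof (rule \<phi>_alt)
  fix N a b c
  assume \<phi>: "\<And>\<xi> \<eta> \<zeta>. \<xi> \<in> g.forms \<Longrightarrow> \<eta> \<in> g.forms \<Longrightarrow> \<zeta> \<in> g.forms \<Longrightarrow> \<phi> \<xi> \<eta> \<zeta> = (\<Sum>j<(N::nat). alt3 (a j) (b j) (c j) \<xi> \<eta> \<zeta>)"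
  \<comment> \<open>The contraction of the alternating sums in their first two slots, which shows
    that the described vector exists.\<close>
  define v where "v = (\<Sum>j<N. s (\<xi> (a j) * \<eta> (b j)) (c j) + s (\<xi> (b j) * \<eta> (c j)) (a j) + s (\<xi> (c j) * \<eta> (a j)) (b j)
    - s (\<xi> (b j) * \<eta> (a j)) (c j) - s (\<xi> (a j) * \<eta> (c j)) (b j) - s (\<xi> (c j) * \<eta> (b j)) (a j))"
  have v: "\<zeta> v = \<phi> \<xi> \<eta> \<zeta>" if "\<zeta> \<in> g.forms" for \<zeta>
    using that assms(1,2)
    by (simp add: \<phi> v_def g.form_sum g.form_add g.form_diff g.form_scale alt3_def)
  have "contr s UNIV \<phi> \<xi> \<eta> = v"
    unfolding contr_def
  proof (rule the_equality)
    show "w = v" if "w \<in> UNIV \<and> (\<forall>\<zeta>\<in>g.forms. \<zeta> w = \<phi> \<xi> \<eta> \<zeta>)" for w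
      by (rule g.forms_eqI) (use that v in simp)
  qed (simp add: v)
  then show ?thesis
    by (simp add: v assms(3))
qed

text \<open>
  A basis identifies the dual of \<open>g\<close> with \<open>g\<close>, so that the double becomes the type \<open>g \<times> g\<close>.
\<close>

definition j :: "'g \<Rightarrow> 'g \<Rightarrow> 'k" where "j y = (\<lambda>x. \<Sum>i<g.dm. g.cof i y * g.cof i x)"
definition jinv :: "('g \<Rightarrow> 'k) \<Rightarrow> 'g" where "jinv \<xi> = (\<Sum>i<g.dm. s (\<xi> (g.bas i)) (g.bas i))"

lemmas cof_add = g.form_add [OF g.basis_facts(3)] and cof_scale = g.form_scale [OF g.basis_facts(3)]

lemma j_form [simp]: "j y \<in> g.forms"
  by (simp add: dual_UNIV lin_on_UNIV j_def cof_add cof_scale sum.distrib sum_distrib_left algebra_simps)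

lemma j_add: "j (x + y) = j x + j y"
  by (rule ext) (simp add: j_def cof_add sum.distrib algebra_simps)

lemma j_scale: "j (s c x) = fscale c (j x)"
  by (rule ext) (simp add: j_def fscale_def cof_scale sum_distrib_left algebra_simps)

lemma j_zero: "j 0 = (\<lambda>x. 0)"
  by (rule ext) (simp add: j_def g.form_zero [OF g.basis_facts(3)])

lemma j_neg: "j (- x) = - j x"
  by (rule ext) (simp add: j_def g.form_neg [OF g.basis_facts(3)] sum_negf)

lemma j_jinv: "\<xi> \<in> g.forms \<Longrightarrow> j (jinv \<xi>) = \<xi>"
proof (rule ext)
  fix x assume \<xi>: "\<xi> \<in> g.forms"
  have "j (jinv \<xi>) x = (\<Sum>i<g.dm. g.cof i x * \<xi> (g.bas i))"
    unfolding j_def jinv_def by (intro sum.cong refl) (simp add: g.cof_sum)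
  then show "j (jinv \<xi>) x = \<xi> x"
    by (simp add: g.form_expand [OF \<xi>, symmetric])
qed

lemma jinv_j: "jinv (j y) = y"
proof -
  have "j y (g.bas i) = g.cof i y" if "i < g.dm" for i
  proof -
    have "j y (g.bas i) = (\<Sum>k<g.dm. if k = i then g.cof i y else 0)"
      unfolding j_def using that by (intro sum.cong refl) (simp add: g.basis_facts(2))
    then show ?thesis
      using that by simp
  qed
  then show ?thesis
    by (simp add: jinv_def g.basis_facts(1) [symmetric])
qed

lemma jinv_add: "jinv (\<xi> + \<eta>) = jinv \<xi> + jinv \<eta>"
  by (simp add: jinv_def g.scale_left_distrib sum.distrib)

lemma jinv_fscale: "jinv (fscale c \<xi>) = s c (jinv \<xi>)"
  by (simp add: jinv_def fscale_def g.scale_sum_right)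

lemma j_inject: "(\<And>x. j y x = j z x) \<Longrightarrow> y = z"
proof -
  assume "\<And>x. j y x = j z x"
  then have "jinv (j y) = jinv (j z)"
    by (intro arg_cong [where f = jinv] ext)
  then show ?thesis
    unfolding jinv_j .
qed

section \<open>The double on the type g x g, its pairing and its summands\<close>

definition sd :: "'k \<Rightarrow> 'g \<times> 'g \<Rightarrow> 'g \<times> 'g" where "sd c u = (s c (fst u), s c (snd u))"

sublocale d: fin_vs sd
proof
  have V: "Vector_Spaces.vector_space sd"
    by unfold_locales (simp_all add: sd_def g.scale_right_distrib g.scale_left_distrib)
  then interpret d: Vector_Spaces.vector_space sd .
  show "sd a (x + y) = sd a x + sd a y" "sd (a + b) x = sd a x + sd b x" "sd a (sd b x) = sd (a * b) x" "sd 1 x = x" for a b x y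
    by (simp_all add: sd_def g.scale_right_distrib g.scale_left_distrib)
  let ?B = "(\<lambda>i. (g.bas i, 0)) ` {..<g.dm} \<union> (\<lambda>i. (0, g.bas i)) ` {..<g.dm}"
  have "u \<in> d.span ?B" for u
  proof -
    have "u = (\<Sum>i<g.dm. sd (g.cof i (fst u)) (g.bas i, 0)) + (\<Sum>i<g.dm. sd (g.cof i (snd u)) (0, g.bas i))"
      by (rule prod_eqI) (simp_all add: fst_sum snd_sum sd_def g.basis_facts(1) [symmetric])
    also have "\<dots> \<in> d.span ?B"
      by (intro d.span_add d.span_sum d.span_scale d.span_base) simp_all
    finally show ?thesis .
  qed
  then show "\<exists>B. finite B \<and> d.span B = UNIV"
    by (intro exI [of _ ?B]) auto
qed

definition T :: "'g \<times> 'g \<Rightarrow> 'g \<times> ('g \<Rightarrow> 'k)" where "T u = (fst u, j (snd u))"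
definition Tinv :: "'g \<times> ('g \<Rightarrow> 'k) \<Rightarrow> 'g \<times> 'g" where "Tinv u = (fst u, jinv (snd u))"

abbreviation "Db \<equiv> double_bracket s UNIV br \<omega> \<phi>"

definition Bd :: "'g \<times> 'g \<Rightarrow> 'g \<times> 'g \<Rightarrow> 'g \<times> 'g" where "Bd u v = Tinv (Db (T u) (T v))"
definition kap :: "'g \<times> 'g \<Rightarrow> 'g \<times> 'g \<Rightarrow> 'k" where "kap u v = j (snd u) (fst v) + j (snd v) (fst u)"

lemma T_mem [simp]: "T u \<in> UNIV \<times> g.forms"
  by (simp add: T_def)

lemma T_Tinv: "U \<in> UNIV \<times> g.forms \<Longrightarrow> T (Tinv U) = U"
  by (auto simp: T_def Tinv_def j_jinv)

lemma Tinv_T: "Tinv (T u) = u"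
  by (simp add: T_def Tinv_def jinv_j)

lemma T_add: "T (u + v) = T u + T v" and T_scale: "T (sd c u) = dscale s c (T u)"
  by (simp_all add: T_def sd_def dscale_def j_add j_scale)

lemma Tinv_add: "Tinv (u + v) = Tinv u + Tinv v" and Tinv_scale: "Tinv (dscale s c U) = sd c (Tinv U)"
  by (simp_all add: Tinv_def sd_def dscale_def jinv_add jinv_fscale)

lemma Db_lie:
  "\<forall>x\<in>UNIV \<times> g.forms. \<forall>y\<in>UNIV \<times> g.forms. Db x y \<in> UNIV \<times> g.forms"
  "\<forall>x\<in>UNIV \<times> g.forms. lin_on (dscale s) (dscale s) (UNIV \<times> g.forms) (Db x)"
  "\<forall>y\<in>UNIV \<times> g.forms. lin_on (dscale s) (dscale s) (UNIV \<times> g.forms) (\<lambda>x. Db x y)"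
  "\<forall>x\<in>UNIV \<times> g.forms. Db x x = 0"
  "\<forall>x\<in>UNIV \<times> g.forms. \<forall>y\<in>UNIV \<times> g.forms. \<forall>z\<in>UNIV \<times> g.forms. Db x (Db y z) + Db y (Db z x) + Db z (Db x y) = 0"
  using quasi_bialgebra unfolding lie_quasi_bialgebra_def lie_algebra_on_def by - (elim conjE, assumption)+

lemma T_Bd: "T (Bd u v) = Db (T u) (T v)"
proof -
  have "Db (T u) (T v) \<in> UNIV \<times> g.forms"
    by (rule Db_lie(1) [rule_format, OF T_mem T_mem])
  then show ?thesis
    by (simp add: Bd_def T_Tinv)
qed

lemma T_zero: "T 0 = 0" and Tinv_zero: "Tinv 0 = 0"
  by (simp_all add: T_def Tinv_def j_zero jinv_def zero_fun_def prod_eq_iff)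

text \<open>The bracket tested against a third vector. The grading relations and the invariance of
  the pairing are read off this formula.\<close>

lemma kap_Bd:
  "kap (Bd (x, y) (x', y')) (x'', y'') =
    j y'' (br x x') + j y'' (\<omega> x (j y')) - j y'' (\<omega> x' (j y)) + \<phi> (j y) (j y') (j y'')
    - j y' (br x x'') + j y (br x' x'') + j y' (\<omega> x'' (j y))"
proof -
  let ?w = "Bd (x, y) (x', y')"
  have "T ?w = Db (x, j y) (x', j y')"
    unfolding T_Bd by (simp add: T_def)
  then have fst: "fst ?w = br x x' + \<omega> x (j y') - \<omega> x' (j y) + contr s UNIV \<phi> (j y) (j y')"
    and snd: "j (snd ?w) = - ad_star UNIV br x (j y') + ad_star UNIV br x' (j y) + restr UNIV (\<lambda>z. j y' (\<omega> z (j y)))"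
    by (simp_all add: T_def double_bracket_def Let_def)
  show ?thesis
    unfolding kap_def fst snd
    by (simp add: fst g.form_add [OF j_form] g.form_diff [OF j_form] contr ad_star_def restr_def)
qed

definition "Ls = l \<times> {0 :: 'g}"
definition "Ms = m \<times> {0 :: 'g}"
definition "Ps = {0 :: 'g} \<times> {y. j y \<in> annih s m}"
definition "Qs = {0 :: 'g} \<times> {y. j y \<in> annih s l}"

lemmas sets_def = Ls_def Ms_def Ps_def Qs_def

lemma jinv_annih: "\<xi> \<in> annih s A \<Longrightarrow> j (jinv \<xi>) \<in> annih s A"
  by (simp add: j_jinv [OF annih_form])

lemma snd_zeroI: "(\<And>x. x \<in> l \<Longrightarrow> j y x = 0) \<Longrightarrow> (\<And>x. x \<in> m \<Longrightarrow> j y x = 0) \<Longrightarrow> y = 0"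
proof -
  assume "\<And>x. x \<in> l \<Longrightarrow> j y x = 0" "\<And>x. x \<in> m \<Longrightarrow> j y x = 0"
  then have "j y = j 0"
    by (intro forms_lm_eqI) (simp_all add: j_zero zero_form)
  then show ?thesis
    by (intro j_inject) simp
qed

lemma fst_zeroI: "(\<And>\<xi>. \<xi> \<in> annih s l \<Longrightarrow> \<xi> x = 0) \<Longrightarrow> (\<And>\<xi>. \<xi> \<in> annih s m \<Longrightarrow> \<xi> x = 0) \<Longrightarrow> x = 0"
proof -
  assume "\<And>\<xi>. \<xi> \<in> annih s l \<Longrightarrow> \<xi> x = 0" "\<And>\<xi>. \<xi> \<in> annih s m \<Longrightarrow> \<xi> x = 0"
  then have "x \<in> l \<inter> m"
    by (intro IntI sep_l sep_m)
  then show ?thesis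
    unfolding lm_disjoint by simp
qed

lemma Ls_iff: "u \<in> Ls \<longleftrightarrow> (\<forall>v\<in>Ls \<union> Ms \<union> Qs. kap u v = 0)"
proof
  show "u \<in> Ls \<Longrightarrow> \<forall>v\<in>Ls \<union> Ms \<union> Qs. kap u v = 0"
    by (auto simp: sets_def kap_def j_zero annih_zero)
  assume h: "\<forall>v\<in>Ls \<union> Ms \<union> Qs. kap u v = 0"
  obtain x y where u: "u = (x, y)"
    by fastforce
  have "y = 0"
  proof (rule snd_zeroI)
    show "z \<in> l \<Longrightarrow> j y z = 0" "z \<in> m \<Longrightarrow> j y z = 0" for z
      using h [THEN bspec, of "(z, 0)"] by (simp_all add: sets_def kap_def u j_zero)
  qed
  moreover have "x \<in> l"
  proof (rule sep_l)
    show "\<xi> x = 0" if "\<xi> \<in> annih s l" for \<xi>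
      using h [THEN bspec, of "(0, jinv \<xi>)"] jinv_annih [OF that] j_jinv [OF annih_form [OF that]]
      by (simp add: sets_def kap_def u g.form_zero [OF j_form])
  qed
  ultimately show "u \<in> Ls"
    by (simp add: sets_def u)
qed

lemma Ms_iff: "u \<in> Ms \<longleftrightarrow> (\<forall>v\<in>Ls \<union> Ms \<union> Ps. kap u v = 0)"
proof
  show "u \<in> Ms \<Longrightarrow> \<forall>v\<in>Ls \<union> Ms \<union> Ps. kap u v = 0"
    by (auto simp: sets_def kap_def j_zero annih_zero)
  assume h: "\<forall>v\<in>Ls \<union> Ms \<union> Ps. kap u v = 0"
  obtain x y where u: "u = (x, y)"
    by fastforce
  have "y = 0"
  proof (rule snd_zeroI)
    show "z \<in> l \<Longrightarrow> j y z = 0" "z \<in> m \<Longrightarrow> j y z = 0" for z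
      using h [THEN bspec, of "(z, 0)"] by (simp_all add: sets_def kap_def u j_zero)
  qed
  moreover have "x \<in> m"
  proof (rule sep_m)
    show "\<xi> x = 0" if "\<xi> \<in> annih s m" for \<xi>
      using h [THEN bspec, of "(0, jinv \<xi>)"] jinv_annih [OF that] j_jinv [OF annih_form [OF that]]
      by (simp add: sets_def kap_def u g.form_zero [OF j_form])
  qed
  ultimately show "u \<in> Ms"
    by (simp add: sets_def u)
qed

lemma Ps_iff: "u \<in> Ps \<longleftrightarrow> (\<forall>v\<in>Ms \<union> Ps \<union> Qs. kap u v = 0)"
proof
  show "u \<in> Ps \<Longrightarrow> \<forall>v\<in>Ms \<union> Ps \<union> Qs. kap u v = 0"
    by (auto simp: sets_def kap_def j_zero annih_zero g.form_zero [OF j_form])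
  assume h: "\<forall>v\<in>Ms \<union> Ps \<union> Qs. kap u v = 0"
  obtain x y where u: "u = (x, y)"
    by fastforce
  have "x = 0"
  proof (rule fst_zeroI)
    show "\<xi> x = 0" if "\<xi> \<in> annih s l" for \<xi>
      using h [THEN bspec, of "(0, jinv \<xi>)"] jinv_annih [OF that] j_jinv [OF annih_form [OF that]]
      by (simp add: sets_def kap_def u g.form_zero [OF j_form])
    show "\<xi> x = 0" if "\<xi> \<in> annih s m" for \<xi>
      using h [THEN bspec, of "(0, jinv \<xi>)"] jinv_annih [OF that] j_jinv [OF annih_form [OF that]]
      by (simp add: sets_def kap_def u g.form_zero [OF j_form])
  qed
  moreover have "j y \<in> annih s m"
  proof (rule annihI)
    show "j y z = 0" if "z \<in> m" for z
      using h [THEN bspec, of "(z, 0)"] that by (simp add: sets_def kap_def u j_zero)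
  qed simp
  ultimately show "u \<in> Ps"
    by (simp add: sets_def u)
qed

lemma Qs_iff: "u \<in> Qs \<longleftrightarrow> (\<forall>v\<in>Ls \<union> Ps \<union> Qs. kap u v = 0)"
proof
  show "u \<in> Qs \<Longrightarrow> \<forall>v\<in>Ls \<union> Ps \<union> Qs. kap u v = 0"
    by (auto simp: sets_def kap_def j_zero annih_zero g.form_zero [OF j_form])
  assume h: "\<forall>v\<in>Ls \<union> Ps \<union> Qs. kap u v = 0"
  obtain x y where u: "u = (x, y)"
    by fastforce
  have "x = 0"
  proof (rule fst_zeroI)
    show "\<xi> x = 0" if "\<xi> \<in> annih s l" for \<xi>
      using h [THEN bspec, of "(0, jinv \<xi>)"] jinv_annih [OF that] j_jinv [OF annih_form [OF that]]
      by (simp add: sets_def kap_def u g.form_zero [OF j_form])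
    show "\<xi> x = 0" if "\<xi> \<in> annih s m" for \<xi>
      using h [THEN bspec, of "(0, jinv \<xi>)"] jinv_annih [OF that] j_jinv [OF annih_form [OF that]]
      by (simp add: sets_def kap_def u g.form_zero [OF j_form])
  qed
  moreover have "j y \<in> annih s l"
  proof (rule annihI)
    show "j y z = 0" if "z \<in> l" for z
      using h [THEN bspec, of "(z, 0)"] that by (simp add: sets_def kap_def u j_zero)
  qed simp
  ultimately show "u \<in> Qs"
    by (simp add: sets_def u)
qed

lemma \<omega>_zero: "\<omega> x (\<lambda>x. 0) = 0"
  using \<omega>_scale [of "\<lambda>x. 0" x 0] by (simp add: zero_form fscale_def)

lemma \<omega>_left_zero: "\<omega> 0 (j y) = 0"
  by (rule g.lin_zero [OF \<omega>_left [OF j_form]])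

lemmas bracket_simps = sets_def zero_form kap_Bd j_zero br_zero \<omega>_zero \<omega>_left_zero \<phi>_zero g.form_zero [OF j_form]

sublocale d: graded_lie sd Bd kap Ls Ms Ps Qs
proof
  note right = Db_lie(2) [THEN bspec, OF T_mem, unfolded lin_on_def, THEN conjunct1, rule_format, OF T_mem T_mem]
    Db_lie(2) [THEN bspec, OF T_mem, unfolded lin_on_def, THEN conjunct2, rule_format, OF T_mem]
  note left = Db_lie(3) [THEN bspec, OF T_mem, unfolded lin_on_def, THEN conjunct1, rule_format, OF T_mem T_mem]
    Db_lie(3) [THEN bspec, OF T_mem, unfolded lin_on_def, THEN conjunct2, rule_format, OF T_mem]
  show "d.lin (\<lambda>x. Bd x y)" "d.lin (Bd x)" for x y
    unfolding lin_on_UNIV Bd_def T_add T_scale Tinv_add [symmetric] Tinv_scale [symmetric]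
    by (intro conjI allI arg_cong [where f = Tinv] left right)+
  show "Bd x x = 0" for x
    unfolding Bd_def Db_lie(4) [THEN bspec, OF T_mem] by (rule Tinv_zero)
  show "Bd x (Bd y z) + Bd y (Bd z x) + Bd z (Bd x y) = 0" for x y z
  proof -
    have "T (Bd x (Bd y z) + Bd y (Bd z x) + Bd z (Bd x y)) = T 0"
      unfolding T_add T_Bd T_zero by (intro Db_lie(5) [rule_format] T_mem)
    then have "Tinv (T (Bd x (Bd y z) + Bd y (Bd z x) + Bd z (Bd x y))) = Tinv (T 0)"
      by (rule arg_cong)
    then show ?thesis
      unfolding Tinv_T .
  qed
  show "(\<lambda>x. kap x y) \<in> d.forms" for y
    by (simp add: dual_UNIV lin_on_UNIV kap_def sd_def j_add j_scale g.form_add [OF j_form] g.form_scale [OF j_form] fscale_def algebra_simps)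
  show "kap x y = kap y x" for x y
    by (simp add: kap_def)
  \<comment> \<open>Both sides are expanded by \<open>kap_Bd\<close>; they agree by the cyclic
    symmetry of \<phi> and the skewness of \<omega> and of the bracket.\<close>
  have inv: "kap (Bd (x, y) (x', y')) (x'', y'') = kap (x, y) (Bd (x', y') (x'', y''))" for x y x' y' x'' y''
  proof -
    have "kap (x, y) (Bd (x', y') (x'', y'')) = kap (Bd (x', y') (x'', y'')) (x, y)"
      by (simp add: kap_def)
    moreover have "br x' x = - br x x'" "br x'' x = - br x x''"
      by (rule br_anti)+
    ultimately show ?thesis
      using \<phi>_cyc [OF j_form [of y] j_form [of y'] j_form [of y'']] \<omega>_skew [OF j_form [of y''] j_form [of y], of x']
        \<omega>_skew [OF j_form [of y'] j_form [of y], of x'']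
      by (simp add: kap_Bd g.form_neg [OF j_form])
  qed
  show "kap (Bd x y) z = kap x (Bd y z)" for x y z
    using inv [of "fst x" "snd x" "fst y" "snd y" "fst z" "snd z"] by simp
  show "u \<in> Ls \<longleftrightarrow> (\<forall>v\<in>Ls \<union> Ms \<union> Qs. kap u v = 0)" "u \<in> Ms \<longleftrightarrow> (\<forall>v\<in>Ls \<union> Ms \<union> Ps. kap u v = 0)"
    "u \<in> Ps \<longleftrightarrow> (\<forall>v\<in>Ms \<union> Ps \<union> Qs. kap u v = 0)" "u \<in> Qs \<longleftrightarrow> (\<forall>v\<in>Ls \<union> Ps \<union> Qs. kap u v = 0)" for u
    by (rule Ls_iff Ms_iff Ps_iff Qs_iff)+
  \<comment> \<open>Canonical compatibility enters here: \<omega> vanishing on l handles brackets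
    with L, \<open>\<omega>_m\<close> and \<open>\<phi>_PPQ\<close> give [P, P] in L, and
    \<open>\<phi>_Q\<close> gives the vanishing on Q.\<close>
  show "x \<in> Ls \<Longrightarrow> y \<in> Ls \<Longrightarrow> Bd x y \<in> Ls" for x y
    unfolding Ls_iff [of "Bd x y"] by (auto simp: bracket_simps \<omega>_l br_ll annih_zero)
  show "x \<in> Ls \<Longrightarrow> y \<in> Ps \<Longrightarrow> Bd x y \<in> Ps" for x y
    unfolding Ps_iff [of "Bd x y"] by (auto simp: bracket_simps \<omega>_l br_lm annih_zero)
  show "x \<in> Ps \<Longrightarrow> y \<in> Ps \<Longrightarrow> Bd x y \<in> Ls" for x y
    unfolding Ls_iff [of "Bd x y"] by (auto simp: bracket_simps \<omega>_m \<phi>_PPQ)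
  show "x \<in> Ls \<Longrightarrow> y \<in> Ms \<Longrightarrow> Bd x y \<in> Ms" for x y
    unfolding Ms_iff [of "Bd x y"] by (auto simp: bracket_simps \<omega>_l br_lm annih_zero)
  show "x \<in> Ls \<Longrightarrow> y \<in> Qs \<Longrightarrow> Bd x y \<in> Qs" for x y
    unfolding Qs_iff [of "Bd x y"] by (auto simp: bracket_simps \<omega>_l br_ll annih_zero)
  show "x \<in> Qs \<Longrightarrow> y \<in> Qs \<Longrightarrow> z \<in> Qs \<Longrightarrow> kap (Bd x y) z = 0" for x y z
    by (auto simp: bracket_simps \<phi>_Q)
  show "\<exists>a\<in>Ls. \<exists>b\<in>Ms. \<exists>c\<in>Ps. \<exists>d\<in>Qs. x = a + b + c + d" for x
  proof (intro bexI)
    let ?\<xi> = "j (snd x)"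
    show "x = (pr (fst x), 0) + (fst x - pr (fst x), 0) + (0, jinv (s_map l m (restr l ?\<xi>))) + (0, jinv (?\<xi> - s_map l m (restr l ?\<xi>)))"
      by (rule prod_eqI) (simp_all add: jinv_add [symmetric] jinv_j)
    show "(0, jinv (?\<xi> - s_map l m (restr l ?\<xi>))) \<in> Qs" "(0, jinv (s_map l m (restr l ?\<xi>))) \<in> Ps"
      by (simp_all add: sets_def jinv_annih s_map_annih restr_l diff_s_map_annih)
  qed (simp_all add: sets_def)
  show "x = 0" if "\<And>y. kap x y = 0" for x
  proof (rule prod_eqI)
    have "j (snd x) z = j 0 z" for z
      using that [of "(z, 0)"] by (simp add: kap_def j_zero)
    then show "snd x = snd 0"
      unfolding snd_zero by (rule j_inject)
    have "\<xi> (fst x) = 0" if "\<xi> \<in> g.forms" for \<xi>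
      using \<open>\<And>y. kap x y = 0\<close> [of "(0, jinv \<xi>)"] by (simp add: kap_def j_jinv [OF that] g.form_zero [OF j_form])
    then show "fst x = fst 0"
      by (intro g.forms_eqI) (simp add: g.form_zero)
  qed
qed

end

lemma dual_add: "\<xi> \<in> dual t V \<Longrightarrow> x \<in> V \<Longrightarrow> y \<in> V \<Longrightarrow> \<xi> (x + y) = \<xi> x + \<xi> y"
  and dual_scale: "\<xi> \<in> dual t V \<Longrightarrow> x \<in> V \<Longrightarrow> \<xi> (t c x) = c * \<xi> x"
  by (simp_all add: dual_def lin_on_def)

lemma dual_closed: "\<xi> \<in> dual t V \<Longrightarrow> \<eta> \<in> dual t V \<Longrightarrow> \<xi> + \<eta> \<in> dual t V"
  "\<xi> \<in> dual t V \<Longrightarrow> fscale c \<xi> \<in> dual t V" "0 \<in> dual t V"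
  by (simp_all add: dual_def lin_on_def fscale_def algebra_simps)

lemma restr_dualI:
  assumes "\<And>x y. x \<in> V \<Longrightarrow> y \<in> V \<Longrightarrow> x + y \<in> V" "\<And>c x. x \<in> V \<Longrightarrow> t c x \<in> V"
    and "\<And>x y. f (x + y) = f x + f y" "\<And>c x. f (t c x) = c * f x"
  shows "restr V f \<in> dual t V"
  using assms by (simp add: dual_def lin_on_def restr_def)

section \<open>The point p inside the double, and the exponentials of the statement\<close>

context compatible_quasi_bialgebra
begin

abbreviation "W \<equiv> dual s l"

definition \<sigma> :: "('g \<Rightarrow> 'k) \<Rightarrow> 'g \<times> 'g" where "\<sigma> p = (0, jinv (s_map l m p))"

lemma \<sigma>_P: "p \<in> W \<Longrightarrow> \<sigma> p \<in> Ps"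
  by (simp add: \<sigma>_def Ps_def jinv_annih s_map_annih)

lemma s_map_add: "s_map l m (p + q) = s_map l m p + s_map l m q"
  and s_map_fscale: "s_map l m (fscale t p) = fscale t (s_map l m p)"
  by (simp_all add: s_map_def fscale_def fun_eq_iff)

lemma \<sigma>_line: "\<sigma> (p + fscale t \<alpha>) = \<sigma> p + sd t (\<sigma> \<alpha>)"
  by (simp add: \<sigma>_def sd_def s_map_add s_map_fscale jinv_add jinv_fscale)

lemma \<sigma>_restr: "u \<in> Ps \<Longrightarrow> \<sigma> (restr l (j (snd u))) = u"
  by (auto simp: \<sigma>_def Ps_def s_map_restr_annih jinv_j)

lemma restr_\<sigma>: "p \<in> W \<Longrightarrow> restr l (j (snd (\<sigma> p))) = p"
  by (simp add: \<sigma>_def j_jinv [OF annih_form [OF s_map_annih]] restr_s_map)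

lemma W_line: "p \<in> W \<Longrightarrow> \<alpha> \<in> W \<Longrightarrow> p + fscale t \<alpha> \<in> W"
  by (intro dual_closed)

lemma W_at_0: "p \<in> W \<Longrightarrow> p 0 = 0"
  using dual_scale [of p s l 0 0] by (simp add: g.subspace_0 [OF l_subspace])

text \<open>\<open>\<sigma> p\<close> is linear in finitely many values of p, and each value is
  continuous for pointwise convergence.\<close>

lemma continuous_B_\<sigma>:
  assumes \<psi>: "\<psi> \<in> d.forms"
  shows "continuous_on U (\<lambda>p. \<psi> (Bd (\<sigma> p) v))"
proof -
  have eq: "\<psi> (Bd (\<sigma> p) v) = (\<Sum>i<g.dm. p (pr (g.bas i)) * \<psi> (Bd (0, g.bas i) v))" for p
  proof -
    have "\<sigma> p = (\<Sum>i<g.dm. sd (p (pr (g.bas i))) (0, g.bas i))"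
      by (rule prod_eqI) (simp_all add: \<sigma>_def jinv_def s_map_def sd_def fst_sum snd_sum)
    then show ?thesis
      by (simp add: d.lin_sum [OF d.B_left] d.B_scale d.form_sum [OF \<psi>] d.form_scale [OF \<psi>])
  qed
  have "continuous_on U (\<lambda>p :: 'g \<Rightarrow> 'k. p i)" for i
    by (rule continuous_on_subset [OF continuous_on_product_coordinates subset_UNIV])
  then show ?thesis
    unfolding eq by (intro continuous_on_sum continuous_on_mult continuous_on_const)
qed

lemma smooth_fs:
  assumes "entire f" "d.smooth_on W U x"
  shows "d.smooth_on W U (\<lambda>p. d.fs f (\<sigma> p) (x p))"
  unfolding d.fs_def
  by (rule d.smooth_ps_op [where A = "\<lambda>p. Bd (\<sigma> p)", OF entire_rfps [OF assms(1)] _ _ assms(2)])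
    (simp_all add: \<sigma>_line d.B_add d.B_scale continuous_B_\<sigma>)

lemma form_fst:
  assumes \<xi>: "\<xi> \<in> g.forms"
  shows "(\<lambda>u. \<xi> (fst u)) \<in> d.forms"
  unfolding dual_UNIV lin_on_UNIV mem_Collect_eq by (simp add: sd_def g.form_add [OF \<xi>] g.form_scale [OF \<xi>])

lemma form_left:
  assumes \<psi>: "\<psi> \<in> d.forms"
  shows "(\<lambda>x. \<psi> (x, 0)) \<in> g.forms"
  unfolding dual_UNIV lin_on_UNIV mem_Collect_eq
  using d.form_add [OF \<psi>, of "(_, 0)" "(_, 0)"] d.form_scale [OF \<psi>, of _ "(_, 0)"] by (simp add: sd_def)

lemma smooth_fst: "d.smooth_on W U f \<Longrightarrow> g.smooth_on W U (\<lambda>p. fst (f p))"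
  unfolding g.smooth_on_def by (intro ballI allI) (rule d.smooth_onD [OF _ form_fst])

text \<open>The operator of the second condition in \<open>U_can\<close>, written in the transported
  double; see \<open>pAd_A2\<close>.\<close>

definition A2 :: "('g \<Rightarrow> 'k) \<Rightarrow> 'g \<Rightarrow> 'g" where "A2 p x = fst (d.em (\<sigma> p) (x, 0))"

lemma lin_A2: "g.lin (A2 p)"
proof -
  have "A2 p (x + y) = A2 p x + A2 p y" "A2 p (s c x) = s c (A2 p x)" for x y c
    using d.fs_add' [of sEm "\<sigma> p" "(x, 0)" "(y, 0)"] d.fs_scale [of sEm "\<sigma> p" c "(x, 0)"]
    by (simp_all add: A2_def sd_def)
  then show ?thesis
    unfolding lin_on_UNIV by simp
qed

lemma form_T:
  assumes \<Xi>: "\<Xi> \<in> dual (dscale s) (UNIV \<times> g.forms)"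
  shows "(\<lambda>v. \<Xi> (T v)) \<in> d.forms"
  unfolding dual_UNIV [of sd] lin_on_UNIV mem_Collect_eq
  by (simp only: T_add T_scale dual_add [OF \<Xi> T_mem T_mem] dual_scale [OF \<Xi> T_mem]) simp

lemma pow_neg: "(Bd (- q) ^^ n) v = sd ((- 1) ^ n) ((Bd q ^^ n) v)"
proof -
  have "sd (- 1) q = - q"
    by (rule prod_eqI) (simp_all add: sd_def)
  then show ?thesis
    using d.pow_scaled [where t = "- 1" and p = q and n = n and v = v] by simp
qed

text \<open>\<open>T\<close> carries the powers of ad to the powers in the original double, and
  forms pull back both ways, which gives existence and uniqueness of the limit. The sign of the
  exponent appears as the alternating series \<open>sEm\<close>.\<close>

lemma exp_Db:
  assumes p: "p \<in> W" and u: "u \<in> UNIV \<times> g.forms"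
  shows "exp_op (dscale s) (UNIV \<times> g.forms) (Db (0, - s_map l m p)) u = T (d.em (\<sigma> p) (Tinv u))"
  unfolding exp_op_def
proof (rule the_equality)
  have q: "T (- \<sigma> p) = (0, - s_map l m p)"
    by (simp add: T_def \<sigma>_def j_neg j_jinv [OF annih_form [OF s_map_annih [OF p]]])
  have pow': "(Db (T (- \<sigma> p)) ^^ n) (T v) = T ((Bd (- \<sigma> p) ^^ n) v)" for n v
    by (induction n) (simp_all add: T_Bd)
  have pow: "(Db (0, - s_map l m p) ^^ n) u = T (sd ((- 1) ^ n) ((Bd (\<sigma> p) ^^ n) (Tinv u)))" for n
    using pow' [of n "Tinv u"] unfolding q T_Tinv [OF u] pow_neg .
  have sums: "(\<lambda>n. \<Xi> ((Db (0, - s_map l m p) ^^ n) u) / fact n) sums \<Xi> (T (d.em (\<sigma> p) (Tinv u)))"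
    if \<Xi>: "\<Xi> \<in> dual (dscale s) (UNIV \<times> g.forms)" for \<Xi>
  proof -
    have "\<Xi> ((Db (0, - s_map l m p) ^^ n) u) / fact n = of_real (fps_nth sEm n) * \<Xi> (T ((Bd (\<sigma> p) ^^ n) (Tinv u)))" for n
      unfolding pow d.form_scale [OF form_T [OF \<Xi>]] by (simp add: sEm_def)
    then show ?thesis
      using d.fs_sums [OF entire_series(2) form_T [OF \<Xi>], of "\<sigma> p" "Tinv u"] by simp
  qed
  then show "T (d.em (\<sigma> p) (Tinv u)) \<in> UNIV \<times> g.forms \<and>
    (\<forall>\<Xi>\<in>dual (dscale s) (UNIV \<times> g.forms). (\<lambda>n. \<Xi> ((Db (0, - s_map l m p) ^^ n) u) / fact n) sums \<Xi> (T (d.em (\<sigma> p) (Tinv u))))"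
    by (intro conjI T_mem ballI)
  fix w
  assume w: "w \<in> UNIV \<times> g.forms \<and>
    (\<forall>\<Xi>\<in>dual (dscale s) (UNIV \<times> g.forms). (\<lambda>n. \<Xi> ((Db (0, - s_map l m p) ^^ n) u) / fact n) sums \<Xi> w)"
  have "Tinv w = d.em (\<sigma> p) (Tinv u)"
  proof (rule d.forms_eqI)
    fix \<psi> assume \<psi>: "\<psi> \<in> d.forms"
    let ?\<Xi> = "restr (UNIV \<times> g.forms) (\<lambda>w. \<psi> (Tinv w))"
    have \<Xi>: "?\<Xi> \<in> dual (dscale s) (UNIV \<times> g.forms)"
    proof (rule restr_dualI)
      show "x + y \<in> UNIV \<times> g.forms" if "x \<in> UNIV \<times> g.forms" "y \<in> UNIV \<times> g.forms" for x y :: "'g \<times> ('g \<Rightarrow> 'k)"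
        using that by (auto simp: dual_closed)
      show "dscale s c x \<in> UNIV \<times> g.forms" if "x \<in> UNIV \<times> g.forms" for x c
        using that by (auto simp: dscale_def dual_closed)
    qed (simp_all only: Tinv_add Tinv_scale d.form_add [OF \<psi>] d.form_scale [OF \<psi>])
    have "?\<Xi> w = ?\<Xi> (T (d.em (\<sigma> p) (Tinv u)))"
      by (rule sums_unique2 [OF w [THEN conjunct2, THEN bspec, OF \<Xi>] sums [OF \<Xi>]])
    then show "\<psi> (Tinv w) = \<psi> (d.em (\<sigma> p) (Tinv u))"
      unfolding restr_def using w T_mem by (simp add: Tinv_T)
  qed
  then have "T (Tinv w) = T (d.em (\<sigma> p) (Tinv u))"
    by (rule arg_cong)
  then show "w = T (d.em (\<sigma> p) (Tinv u))"
    by (simp add: T_Tinv w)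
qed

abbreviation "pAd' \<equiv> pAd s br \<omega> \<phi> l m"

lemma pAd_eq: "p \<in> W \<Longrightarrow> \<xi> \<in> g.forms \<Longrightarrow> pAd' p (x, \<xi>) = fst (d.em (\<sigma> p) (x, jinv \<xi>))"
  by (simp add: pAd_def exp_Db T_def Tinv_def)

lemma pAd_A2:
  assumes "p \<in> W"
  shows "pAd' p (x, 0) = A2 p x"
  using pAd_eq [OF assms dual_closed(3), of x] by (simp add: A2_def jinv_def)

lemma zero_notin_Sp_iff:
  assumes p: "p \<in> W"
  shows "0 \<notin> Sp s UNIV (\<lambda>x. pAd' p (x, 0)) \<longleftrightarrow> (\<forall>x. A2 p x = 0 \<longrightarrow> x = 0)"
proof -
  obtain B where B: "finite B" "UNIV \<subseteq> g.span B"
    using g.finite_span by blast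
  show ?thesis
    unfolding pAd_A2 [OF p] zero_in_Sp [OF g.vector_space_axioms g.subspace_UNIV B lin_A2 subset_UNIV] by blast
qed

section \<open>The double of l as the subspace L + P, and U as an injectivity condition\<close>

lemma vs_dscale: "Vector_Spaces.vector_space (dscale s)"
  by unfold_locales (simp_all add: dscale_def fscale_def fun_eq_iff g.scale_right_distrib g.scale_left_distrib algebra_simps)

text \<open>\<open>Tl\<close> embeds the double of l into g x g with image \<open>D0\<close>, that
  is L + P; \<open>Rl\<close> is its left inverse, defined on all of g x g.\<close>

definition Tl :: "'g \<times> ('g \<Rightarrow> 'k) \<Rightarrow> 'g \<times> 'g" where "Tl v = (fst v, jinv (s_map l m (snd v)))"
definition Rl :: "'g \<times> 'g \<Rightarrow> 'g \<times> ('g \<Rightarrow> 'k)" where "Rl u = (pr (fst u), restr l (j (snd u)))"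
definition D0 :: "('g \<times> 'g) set" where "D0 = l \<times> {y. j y \<in> annih s m}"
definition D1 :: "('g \<times> 'g) set" where "D1 = m \<times> {y. j y \<in> annih s l}"

abbreviation "Vl \<equiv> l \<times> W"

lemma Vl_add: "u \<in> Vl \<Longrightarrow> v \<in> Vl \<Longrightarrow> u + v \<in> Vl" and Vl_scale: "u \<in> Vl \<Longrightarrow> dscale s c u \<in> Vl"
  by (auto simp: dscale_def dual_closed g.subspace_add [OF l_subspace] g.subspace_scale [OF l_subspace])

lemma Rl_mem: "Rl u \<in> Vl"
  by (simp add: Rl_def restr_l)

lemma Rl_add: "Rl (u + v) = Rl u + Rl v" and Rl_scale: "Rl (sd c u) = dscale s c (Rl u)"
  by (simp_all add: Rl_def sd_def dscale_def fscale_def restr_def fun_eq_iff j_add j_scale g.lin_add [OF lin_pr] g.lin_scale [OF lin_pr])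

lemma Tl_add: "Tl (u + v) = Tl u + Tl v" and Tl_scale: "Tl (dscale s c u) = sd c (Tl u)"
  by (simp_all add: Tl_def sd_def dscale_def s_map_add s_map_fscale jinv_add jinv_fscale)

lemma Rl_Tl: "v \<in> Vl \<Longrightarrow> Rl (Tl v) = v"
  by (auto simp: Rl_def Tl_def j_jinv [OF annih_form [OF s_map_annih]] restr_s_map)

lemma Tl_Rl: "u \<in> D0 \<Longrightarrow> Tl (Rl u) = u"
  by (auto simp: Rl_def Tl_def D0_def s_map_restr_annih jinv_j)

lemma Tl_D0: "v \<in> Vl \<Longrightarrow> Tl v \<in> D0"
  by (auto simp: Tl_def D0_def jinv_annih s_map_annih)

lemma Rl_zero: "Rl 0 = 0" and Tl_zero: "Tl 0 = 0"
proof -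
  show "Rl 0 = 0"
    using Rl_add [of 0 0] by simp
  show "Tl 0 = 0"
    using Tl_add [of 0 0] by simp
qed

lemma D0_split: "u \<in> D0 \<Longrightarrow> (fst u, 0) \<in> Ls \<and> (0, snd u) \<in> Ps"
  by (auto simp: D0_def Ls_def Ps_def)

lemma pair_split: "u = (fst u, 0) + (0, snd u)" for u :: "'g \<times> 'g"
  by (rule prod_eqI) simp_all

lemma D0I: "(\<And>y. y \<in> Ms \<union> Qs \<Longrightarrow> kap u y = 0) \<Longrightarrow> u \<in> D0"
proof -
  assume h: "\<And>y. y \<in> Ms \<union> Qs \<Longrightarrow> kap u y = 0"
  have "fst u \<in> l"
  proof (rule sep_l)
    show "\<xi> (fst u) = 0" if "\<xi> \<in> annih s l" for \<xi>
      using h [of "(0, jinv \<xi>)"] jinv_annih [OF that] j_jinv [OF annih_form [OF that]]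
      by (simp add: sets_def kap_def g.form_zero [OF j_form])
  qed
  moreover have "j (snd u) \<in> annih s m"
  proof (rule annihI)
    show "j (snd u) z = 0" if "z \<in> m" for z
      using h [of "(z, 0)"] that by (simp add: sets_def kap_def j_zero)
  qed simp
  ultimately show "u \<in> D0"
    by (simp add: D0_def mem_Times_iff)
qed

lemma D1I: "(\<And>y. y \<in> Ls \<union> Ps \<Longrightarrow> kap u y = 0) \<Longrightarrow> u \<in> D1"
proof -
  assume h: "\<And>y. y \<in> Ls \<union> Ps \<Longrightarrow> kap u y = 0"
  have "fst u \<in> m"
  proof (rule sep_m)
    show "\<xi> (fst u) = 0" if "\<xi> \<in> annih s m" for \<xi>
      using h [of "(0, jinv \<xi>)"] jinv_annih [OF that] j_jinv [OF annih_form [OF that]]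
      by (simp add: sets_def kap_def g.form_zero [OF j_form])
  qed
  moreover have "j (snd u) \<in> annih s l"
  proof (rule annihI)
    show "j (snd u) z = 0" if "z \<in> l" for z
      using h [of "(z, 0)"] that by (simp add: sets_def kap_def j_zero)
  qed simp
  ultimately show "u \<in> D1"
    by (simp add: D1_def mem_Times_iff)
qed

lemma fs_D0:
  assumes f: "entire f" and p: "p \<in> W" and x: "x \<in> D0"
  shows "d.fs f (\<sigma> p) x \<in> D0"
proof (rule D0I)
  fix y assume y: "y \<in> Ms \<union> Qs"
  have "kap (d.fs f (\<sigma> p) (fst x, 0)) y = 0" "kap (d.fs f (\<sigma> p) (0, snd x)) y = 0"
    using D0_split [OF x] by (auto intro!: d.fs_D0 [OF f \<sigma>_P [OF p] _ y])
  then show "kap (d.fs f (\<sigma> p) x) y = 0"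
    by (subst pair_split [of x]) (simp add: d.fs_add' d.\<kappa>_add del: add_Pair)
qed

lemma fs_D1:
  assumes f: "entire f" and p: "p \<in> W" and x: "x \<in> D1"
  shows "d.fs f (\<sigma> p) x \<in> D1"
proof (rule D1I)
  fix y assume y: "y \<in> Ls \<union> Ps"
  have "(fst x, 0) \<in> Ms" "(0, snd x) \<in> Qs"
    using x by (auto simp: D1_def Ms_def Qs_def)
  then have "kap (d.fs f (\<sigma> p) (fst x, 0)) y = 0" "kap (d.fs f (\<sigma> p) (0, snd x)) y = 0"
    by (auto intro!: d.fs_D1 [OF f \<sigma>_P [OF p] _ y])
  then show "kap (d.fs f (\<sigma> p) x) y = 0"
    by (subst pair_split [of x]) (simp add: d.fs_add' d.\<kappa>_add del: add_Pair)
qed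

abbreviation "Al p \<equiv> l_double_bracket s br \<phi> l m (0, p)"

text \<open>The double of l is a subalgebra of the large double. Both components of the bracket are
  recovered by pairing: the one in l against forms s \<zeta>, the form against elements of l, where
  \<omega> vanishes.\<close>

lemma Al_eq:
  assumes p: "p \<in> W" and v: "v \<in> Vl"
  shows "Bd (\<sigma> p) (Tl v) \<in> D0" "Al p v = Rl (Bd (\<sigma> p) (Tl v))"
proof -
  obtain z \<alpha> where v_eq: "v = (z, \<alpha>)" and z: "z \<in> l" and \<alpha>: "\<alpha> \<in> W"
    using v by blast
  have s: "j (jinv (s_map l m q)) = s_map l m q" if "q \<in> W" for q
    by (rule j_jinv [OF annih_form [OF s_map_annih [OF that]]])
  have sf: "s_map l m q \<in> g.forms" if "q \<in> W" for q
    by (rule annih_form [OF s_map_annih [OF that]])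
  define r where "r = Bd (\<sigma> p) (Tl v)"
  have r_eq: "r = Bd (0, jinv (s_map l m p)) (z, jinv (s_map l m \<alpha>))"
    by (simp add: r_def \<sigma>_def Tl_def v_eq)
  have sum: "r = Bd (\<sigma> p) (z, 0) + Bd (\<sigma> p) (0, jinv (s_map l m \<alpha>))"
    unfolding r_def d.B_add [symmetric] by (simp add: Tl_def v_eq)
  have 1: "Bd (\<sigma> p) (z, 0) \<in> Ps"
    by (rule d.PL [OF \<sigma>_P [OF p]]) (simp add: Ls_def z)
  have 2: "Bd (\<sigma> p) (0, jinv (s_map l m \<alpha>)) \<in> Ls"
    by (rule d.PP [OF \<sigma>_P [OF p]]) (simp add: Ps_def jinv_annih s_map_annih \<alpha>)
  show "Bd (\<sigma> p) (Tl v) \<in> D0"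
    using 1 2 unfolding r_def [symmetric] sum D0_def Ps_def Ls_def by auto
  then have r: "fst r \<in> l"
    by (simp add: r_def D0_def mem_Times_iff)
  have key: "\<zeta> (fst r) = \<phi> (s_map l m p) (s_map l m \<alpha>) (s_map l m \<zeta>)" if \<zeta>: "\<zeta> \<in> W" for \<zeta>
  proof -
    have "\<zeta> (fst r) = s_map l m \<zeta> (fst r)"
      using r by (simp add: s_map_def)
    also have "\<dots> = kap r (0, jinv (s_map l m \<zeta>))"
      by (simp add: kap_def s [OF \<zeta>] g.form_zero [OF j_form])
    also have "\<dots> = \<phi> (s_map l m p) (s_map l m \<alpha>) (s_map l m \<zeta>)"
      unfolding r_eq by (simp add: bracket_simps \<omega>_l [OF z] s [OF \<zeta>] s [OF p] s [OF \<alpha>] sf [OF p] sf [OF \<alpha>] sf [OF \<zeta>]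
          g.form_zero [OF sf [OF p]] g.form_zero [OF sf [OF \<alpha>]] g.form_zero [OF sf [OF \<zeta>]] g.lin_zero [OF \<omega>_left])
    finally show ?thesis .
  qed
  have 3: "contr s l (\<lambda>\<alpha> \<beta> \<gamma>. \<phi> (s_map l m \<alpha>) (s_map l m \<beta>) (s_map l m \<gamma>)) p \<alpha> = fst r"
    unfolding contr_def
  proof (rule the_equality)
    show "v' = fst r" if v': "v' \<in> l \<and> (\<forall>\<zeta>\<in>W. \<zeta> v' = \<phi> (s_map l m p) (s_map l m \<alpha>) (s_map l m \<zeta>))" for v'
    proof (rule g.forms_eqI)
      fix \<xi> assume "\<xi> \<in> g.forms"
      then have "restr l \<xi> v' = restr l \<xi> (fst r)"
        using v' key restr_l by simp
      then show "\<xi> v' = \<xi> (fst r)"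
        using v' r by (simp add: restr_def)
    qed
  qed (use r key in blast)
  have 4: "j (snd r) y = p (br z y)" if y: "y \<in> l" for y
  proof -
    have "j (snd r) y = kap r (y, 0)"
      by (simp add: kap_def j_zero)
    also have "\<dots> = s_map l m p (br z y)"
      unfolding r_eq by (simp add: bracket_simps \<omega>_l [OF y] s [OF p] s [OF \<alpha>] sf [OF p] sf [OF \<alpha>]
          g.form_zero [OF sf [OF p]] g.form_zero [OF sf [OF \<alpha>]])
    finally show ?thesis
      using br_ll [OF z y] by (simp add: s_map_def)
  qed
  show "Al p v = Rl (Bd (\<sigma> p) (Tl v))"
    unfolding r_def [symmetric]
    unfolding Rl_def v_eq l_double_bracket_def double_bracket_def Let_def fst_conv snd_conv 3
    using r by (simp add: br_zero ad_star_def restr_def fun_eq_iff 4 W_at_0 [OF \<alpha>])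
qed

lemma Al_pow:
  assumes p: "p \<in> W" and v: "v \<in> Vl"
  shows "(Al p ^^ n) v \<in> Vl \<and> Tl ((Al p ^^ n) v) = (Bd (\<sigma> p) ^^ n) (Tl v)"
proof (induction n)
  case (Suc n)
  then have IH: "(Al p ^^ n) v \<in> Vl" "Tl ((Al p ^^ n) v) = (Bd (\<sigma> p) ^^ n) (Tl v)"
    by simp_all
  then show ?case
    unfolding funpow.simps o_def Al_eq(2) [OF p IH(1)] Tl_Rl [OF Al_eq(1) [OF p IH(1)]] by (simp add: Rl_mem)
qed (simp add: v del: mem_Times_iff)

lemma form_Rl:
  assumes \<Xi>: "\<Xi> \<in> dual (dscale s) Vl"
  shows "(\<lambda>u. \<Xi> (Rl u)) \<in> d.forms"
  unfolding dual_UNIV [of sd] lin_on_UNIV mem_Collect_eq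
  by (simp only: Rl_add Rl_scale dual_add [OF \<Xi> Rl_mem Rl_mem] dual_scale [OF \<Xi> Rl_mem]) simp

lemma l_sums:
  assumes p: "p \<in> W" and v: "v \<in> Vl" and \<Xi>: "\<Xi> \<in> dual (dscale s) Vl" and f: "entire f"
  shows "(\<lambda>n. fps_nth (rfps f) n * \<Xi> ((Al p ^^ n) v)) sums \<Xi> (Rl (d.fs f (\<sigma> p) (Tl v)))"
proof -
  have "\<Xi> ((Al p ^^ n) v) = \<Xi> (Rl ((Bd (\<sigma> p) ^^ n) (Tl v)))" for n
    using Al_pow [OF p v, of n] Rl_Tl by metis
  then show ?thesis
    unfolding d.fs_def using d.ps_sums [OF entire_rfps [OF f] d.B_right form_Rl [OF \<Xi>], of "\<sigma> p" "Tl v"] by simp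
qed

lemma Al_context:
  assumes p: "p \<in> W"
  obtains B where "Modules.module.subspace (dscale s) Vl" "finite B" "Vl \<subseteq> Modules.module.span (dscale s) B"
    "lin_on (dscale s) (dscale s) Vl (Al p)" "Al p ` Vl \<subseteq> Vl"
proof
  interpret V: Vector_Spaces.vector_space "dscale s"
    by (rule vs_dscale)
  show "V.subspace Vl"
    unfolding V.subspace_def using Rl_mem [of 0] Vl_add Vl_scale by (simp only: Rl_zero) blast
  let ?B = "(\<lambda>i. Rl (d.bas i)) ` {..<d.dm}"
  show "finite ?B"
    by simp
  show "Vl \<subseteq> V.span ?B"
  proof
    fix v assume v: "v \<in> Vl"
    have sum: "Rl (\<Sum>i\<in>I. f i) = (\<Sum>i\<in>I. Rl (f i))" for I :: "nat set" and f
      by (induction I rule: infinite_finite_induct) (simp_all add: Rl_zero Rl_add)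
    have "v = Rl (\<Sum>i<d.dm. sd (d.cof i (Tl v)) (d.bas i))"
      unfolding d.basis_facts(1) [symmetric] by (rule Rl_Tl [OF v, symmetric])
    also have "\<dots> \<in> V.span ?B"
      unfolding sum Rl_scale by (intro V.span_sum V.span_scale V.span_base) simp
    finally show "v \<in> V.span ?B" .
  qed
  show "lin_on (dscale s) (dscale s) Vl (Al p)"
    unfolding lin_on_def
  proof (intro conjI ballI allI)
    fix x y assume xy: "x \<in> Vl" "y \<in> Vl"
    show "Al p (x + y) = Al p x + Al p y"
      unfolding Al_eq(2) [OF p xy(1)] Al_eq(2) [OF p xy(2)] Al_eq(2) [OF p Vl_add [OF xy]] Tl_add d.B_add Rl_add ..
  next
    fix x c assume x: "x \<in> Vl"
    show "Al p (dscale s c x) = dscale s c (Al p x)"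
      unfolding Al_eq(2) [OF p x] Al_eq(2) [OF p Vl_scale [OF x]] Tl_scale d.B_scale Rl_scale ..
  qed
  show "Al p ` Vl \<subseteq> Vl"
  proof (rule image_subsetI)
    show "Al p v \<in> Vl" if "v \<in> Vl" for v
      unfolding Al_eq(2) [OF p that] by (rule Rl_mem)
  qed
qed

definition C1 :: "('g \<Rightarrow> 'k) \<Rightarrow> bool" where "C1 p \<longleftrightarrow> (\<forall>x\<in>D0. d.fs sS (\<sigma> p) x = 0 \<longrightarrow> x = 0)"

text \<open>\<open>Sp_sinh\<close> turns the spectral condition into injectivity of sinh a/a on the
  double of l, which \<open>Tl\<close> and \<open>Rl\<close> carry over to
  \<open>D0\<close>.\<close>

lemma Sp_iff_C1:
  assumes p: "p \<in> W"
  shows "Sp (dscale s) Vl (Al p) \<inter> {\<i> * complex_of_real pi * of_int k | k::int. k \<noteq> 0} = {} \<longleftrightarrow> C1 p"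
proof -
  have eq: "(\<forall>\<Xi>\<in>dual (dscale s) Vl. (\<lambda>n. fps_nth (rfps sS) n * \<Xi> ((Al p ^^ n) v)) sums 0) \<longleftrightarrow> d.fs sS (\<sigma> p) (Tl v) = 0"
    if v: "v \<in> Vl" for v
  proof
    let ?x = "d.fs sS (\<sigma> p) (Tl v)"
    assume h: "\<forall>\<Xi>\<in>dual (dscale s) Vl. (\<lambda>n. fps_nth (rfps sS) n * \<Xi> ((Al p ^^ n) v)) sums 0"
    show "?x = 0"
    proof (rule d.forms_eqI)
      fix \<psi> assume \<psi>: "\<psi> \<in> d.forms"
      let ?\<Xi> = "restr Vl (\<lambda>w. \<psi> (Tl w))"
      have \<Xi>: "?\<Xi> \<in> dual (dscale s) Vl"
        by (rule restr_dualI [OF Vl_add Vl_scale]) (simp_all only: Tl_add Tl_scale d.form_add [OF \<psi>] d.form_scale [OF \<psi>])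
      have "?\<Xi> (Rl ?x) = 0"
        by (rule sums_unique2 [OF l_sums [OF p v \<Xi> entire_series(6)] h [THEN bspec, OF \<Xi>]])
      then show "\<psi> ?x = \<psi> 0"
        unfolding restr_def using Rl_mem Tl_Rl [OF fs_D0 [OF entire_series(6) p Tl_D0 [OF v]]] by (simp add: d.form_zero [OF \<psi>])
    qed
  next
    assume h: "d.fs sS (\<sigma> p) (Tl v) = 0"
    show "\<forall>\<Xi>\<in>dual (dscale s) Vl. (\<lambda>n. fps_nth (rfps sS) n * \<Xi> ((Al p ^^ n) v)) sums 0"
    proof
      fix \<Xi> assume \<Xi>: "\<Xi> \<in> dual (dscale s) Vl"
      have "\<Xi> (Rl 0) = 0"
        by (rule d.form_zero [OF form_Rl [OF \<Xi>]])
      then show "(\<lambda>n. fps_nth (rfps sS) n * \<Xi> ((Al p ^^ n) v)) sums 0"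
        using l_sums [OF p v \<Xi> entire_series(6)] unfolding h by simp
    qed
  qed
  obtain B where B: "Modules.module.subspace (dscale s) Vl" "finite B" "Vl \<subseteq> Modules.module.span (dscale s) B"
    "lin_on (dscale s) (dscale s) Vl (Al p)" "Al p ` Vl \<subseteq> Vl"
    by (rule Al_context [OF p])
  have "(\<forall>v\<in>Vl. d.fs sS (\<sigma> p) (Tl v) = 0 \<longrightarrow> v = 0) \<longleftrightarrow> C1 p"
    unfolding C1_def
  proof (intro iffI ballI impI)
    fix x assume h: "\<forall>v\<in>Vl. d.fs sS (\<sigma> p) (Tl v) = 0 \<longrightarrow> v = 0" "x \<in> D0" "d.fs sS (\<sigma> p) x = 0"
    have "Rl x = 0"
      by (rule h(1) [THEN bspec, THEN mp]) (simp_all only: Rl_mem Tl_Rl [OF h(2)] h(3))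
    then have "Tl (Rl x) = Tl 0"
      by (rule arg_cong)
    then show "x = 0"
      unfolding Tl_Rl [OF h(2)] Tl_zero .
  next
    fix v assume h: "\<forall>x\<in>D0. d.fs sS (\<sigma> p) x = 0 \<longrightarrow> x = 0" "v \<in> Vl" "d.fs sS (\<sigma> p) (Tl v) = 0"
    have "Tl v = 0"
      by (rule h(1) [THEN bspec, THEN mp, OF Tl_D0 [OF h(2)] h(3)])
    then have "Rl (Tl v) = Rl 0"
      by (rule arg_cong)
    then show "v = 0"
      unfolding Rl_Tl [OF h(2)] Rl_zero .
  qed
  then show ?thesis
    unfolding Sp_sinh [OF vs_dscale B] using eq by (simp cong: ball_cong)
qed

text \<open>
  \<open>A0 p\<close> extends \<open>sinh a/a\<close> from \<open>l \<oplus> l\<^sup>*\<close> by the identity on \<open>m \<oplus> l\<^sup>\<bottom>\<close>, so that its invertibility can be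
  read off a determinant on the whole double.
\<close>

definition "P0 u = Tl (Rl u)"
definition "A0 p u = d.fs sS (\<sigma> p) (P0 u) + (u - P0 u)"

lemma P0_add: "P0 (u + v) = P0 u + P0 v" and P0_scale: "P0 (sd c u) = sd c (P0 u)"
  by (simp_all only: P0_def Rl_add Tl_add Rl_scale Tl_scale)

lemma lin_P0: "d.lin P0"
  unfolding lin_on_UNIV using P0_add P0_scale by blast

lemma P0_D0: "P0 u \<in> D0" and P0_id: "u \<in> D0 \<Longrightarrow> P0 u = u"
  by (simp_all only: P0_def Tl_D0 [OF Rl_mem] Tl_Rl)

lemma lin_A0: "d.lin (A0 p)"
proof -
  have "d.lin (\<lambda>u. u)"
    by (simp add: lin_on_UNIV)
  then show ?thesis
    unfolding A0_def [abs_def] by (intro d.lin_plus d.lin_minus d.lin_comp [OF d.lin_fs lin_P0] lin_P0)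
qed

lemma P0_A0: "p \<in> W \<Longrightarrow> P0 (A0 p u) = d.fs sS (\<sigma> p) (P0 u)"
  unfolding A0_def d.lin_add [OF lin_P0] d.lin_diff [OF lin_P0]
  by (simp add: P0_id [OF P0_D0] P0_id [OF fs_D0 [OF entire_series(6) _ P0_D0]])

lemma A0_injective_iff:
  assumes p: "p \<in> W"
  shows "(\<forall>u. A0 p u = 0 \<longrightarrow> u = 0) \<longleftrightarrow> C1 p"
proof
  assume h: "\<forall>u. A0 p u = 0 \<longrightarrow> u = 0"
  show "C1 p"
    unfolding C1_def
  proof (intro ballI impI)
    fix x assume x: "x \<in> D0" "d.fs sS (\<sigma> p) x = 0"
    have "A0 p x = 0"
      by (simp add: A0_def P0_id [OF x(1)] x(2))
    then show "x = 0"
      by (rule h [THEN spec, THEN mp])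
  qed
next
  assume h: "C1 p"
  show "\<forall>u. A0 p u = 0 \<longrightarrow> u = 0"
  proof (intro allI impI)
    fix u assume u: "A0 p u = 0"
    then have "d.fs sS (\<sigma> p) (P0 u) = 0"
      using P0_A0 [OF p, of u] d.lin_zero [OF lin_P0] by simp
    then have "P0 u = 0"
      using h P0_D0 by (simp add: C1_def)
    then show "u = 0"
      using u by (simp add: A0_def d.fs_zero)
  qed
qed

text \<open>Injectivity of \<open>A0\<close> on the whole double gives surjectivity by dimension;
  parity then allows the preimage to be taken in P.\<close>

lemma C1_solve:
  assumes p: "p \<in> W" and c: "C1 p" and \<beta>: "\<beta> \<in> Ps"
  shows "\<exists>x\<in>Ps. d.fs sS (\<sigma> p) x = \<beta>"
proof -
  have inj: "\<forall>u. A0 p u = 0 \<longrightarrow> u = 0"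
    unfolding A0_injective_iff [OF p] by (rule c)
  have "\<exists>u. A0 p u = \<beta>"
    by (rule d.lin_inj_imp_surj [OF lin_A0 inj [rule_format]])
  then obtain u where u: "A0 p u = \<beta>"
    by (elim exE)
  have "\<beta> \<in> D0"
    using \<beta> g.subspace_0 [OF l_subspace] by (auto simp: Ps_def D0_def)
  then have \<beta>_eq: "d.fs sS (\<sigma> p) (P0 u) = \<beta>"
    using P0_A0 [OF p, of u] u P0_id by simp
  have x: "(fst (P0 u), 0) \<in> Ls" "(0, snd (P0 u)) \<in> Ps"
    using D0_split [OF P0_D0] by simp_all
  define a where "a = d.fs sS (\<sigma> p) (fst (P0 u), 0)"
  define b where "b = d.fs sS (\<sigma> p) (0, snd (P0 u))"
  have ab: "a \<in> Ls" "b \<in> Ps"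
    unfolding a_def b_def using d.sS_L [OF \<sigma>_P [OF p] x(1)] d.sS_P [OF \<sigma>_P [OF p] x(2)] by simp_all
  have sum: "a + b = \<beta>"
    unfolding a_def b_def d.fs_add' [symmetric] pair_split [symmetric] by (rule \<beta>_eq)
  \<comment> \<open>The even series sinh a/a preserves L and P. As \<beta> has no part in L, the
    image a of the L part vanishes, and the P part alone is a preimage.\<close>
  then have "fst a + fst b = fst \<beta>"
    by auto
  then have "a = 0"
    using ab \<beta> by (auto simp: Ls_def Ps_def zero_prod_def)
  then have "b = \<beta>"
    using sum by simp
  then show ?thesis
    unfolding b_def by (intro bexI [OF _ x(2)])
qed

text \<open>Both spectral conditions become injectivity of operators with smooth coefficients, so
  openness of U and smoothness of inverses follow from determinants.\<close>

lemma U_iff: "p \<in> U_can s br \<omega> \<phi> l m \<longleftrightarrow> p \<in> W \<and> (\<forall>u. A0 p u = 0 \<longrightarrow> u = 0) \<and> (\<forall>x. A2 p x = 0 \<longrightarrow> x = 0)"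
proof (cases "p \<in> W")
  case True
  then show ?thesis
    unfolding U_can_def mem_Collect_eq A0_injective_iff [OF True] Sp_iff_C1 [OF True] zero_notin_Sp_iff [OF True] by blast
qed (simp add: U_can_def)

lemma smooth_A0: "d.smooth_on W U (\<lambda>p. A0 p v)"
  unfolding A0_def by (intro d.smooth_add smooth_fs entire_series d.smooth_const)

lemma smooth_A2: "g.smooth_on W U (\<lambda>p. A2 p x)"
  unfolding A2_def by (intro smooth_fst smooth_fs entire_series d.smooth_const)

lemma open_U: "openin (top_of_set W) (U_can s br \<omega> \<phi> l m)"
proof -
  have "openin (top_of_set W) ({p \<in> W. \<forall>u. A0 p u = 0 \<longrightarrow> u = 0} \<inter> {p \<in> W. \<forall>x. A2 p x = 0 \<longrightarrow> x = 0})"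
    by (intro openin_Int d.open_injective g.open_injective lin_A0 lin_A2
      Ck_on_continuous [OF d.smooth_onD [OF smooth_A0]] Ck_on_continuous [OF g.smooth_onD [OF smooth_A2]])
  also have "{p \<in> W. \<forall>u. A0 p u = 0 \<longrightarrow> u = 0} \<inter> {p \<in> W. \<forall>x. A2 p x = 0 \<longrightarrow> x = 0} = U_can s br \<omega> \<phi> l m"
    by (auto simp: U_iff)
  finally show ?thesis .
qed

lemma W_open_U: "W_open W (U_can s br \<omega> \<phi> l m)"
  by (rule W_openI [OF open_U W_line])

lemma zero_in_U: "0 \<in> U_can s br \<omega> \<phi> l m"
proof -
  have \<sigma>: "\<sigma> 0 = 0"
    by (simp add: \<sigma>_def s_map_def jinv_def zero_prod_def)
  have "d.fs sS (\<sigma> 0) x = x" "d.em (\<sigma> 0) x = x" for x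
    unfolding \<sigma> d.fs_zero_left [OF entire_series(6)] d.fs_zero_left [OF entire_series(2)] by (simp_all add: sS_def sEm_def)
  then show ?thesis
    unfolding U_iff by (simp add: A0_def A2_def dual_closed)
qed

end

section \<open>Invariance of U and the properties of the l-matrix on U\<close>

context compatible_quasi_bialgebra
begin

abbreviation "U \<equiv> U_can s br \<omega> \<phi> l m"
abbreviation "lc \<equiv> l_can s br \<omega> \<phi> l m"

lemma U_W: "p \<in> U \<Longrightarrow> p \<in> W" and U_A0: "p \<in> U \<Longrightarrow> A0 p u = 0 \<Longrightarrow> u = 0"
  and U_A2: "p \<in> U \<Longrightarrow> A2 p x = 0 \<Longrightarrow> x = 0"
  by (simp_all only: U_iff)

lemma U_C1: "p \<in> U \<Longrightarrow> C1 p"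
proof -
  assume p: "p \<in> U"
  show "C1 p"
    by (rule A0_injective_iff [OF U_W [OF p], THEN iffD1], intro allI impI, rule U_A0 [OF p])
qed

text \<open>Since \<omega> vanishes on l, ad z on g is the restriction of ad (z, 0) to g x 0, and so
  are the exponentials.\<close>

lemma exp_br:
  assumes z: "z \<in> l"
  shows "exp_op s UNIV (br z) y = fst (d.e (z, 0) (y, 0))"
  unfolding exp_op_def
proof (rule the_equality)
  have B: "Bd (z, 0) (v, 0) = (br z v, 0)" for v
  proof -
    have "kap (Bd (z, 0) (v, 0) - (br z v, 0)) w = 0" for w
      unfolding d.\<kappa>_diff by (cases w) (simp add: bracket_simps, simp add: kap_def j_zero)
    then have "Bd (z, 0) (v, 0) - (br z v, 0) = 0"
      by (rule d.nondegenerate)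
    then show ?thesis
      by simp
  qed
  have pow: "(Bd (z, 0) ^^ n) (y, 0) = ((br z ^^ n) y, 0)" for n
    by (induction n) (simp_all add: B)
  have sums: "(\<lambda>n. \<xi> ((br z ^^ n) y) / fact n) sums \<xi> (fst (d.e (z, 0) (y, 0)))" if \<xi>: "\<xi> \<in> g.forms" for \<xi>
    using d.fs_sums [OF entire_series(1) form_fst [OF \<xi>], of "(z, 0)" "(y, 0)"] by (simp add: pow sE_def)
  then show "fst (d.e (z, 0) (y, 0)) \<in> UNIV \<and> (\<forall>\<xi>\<in>g.forms. (\<lambda>n. \<xi> ((br z ^^ n) y) / fact n) sums \<xi> (fst (d.e (z, 0) (y, 0))))"
    by simp
  fix w assume w: "w \<in> UNIV \<and> (\<forall>\<xi>\<in>g.forms. (\<lambda>n. \<xi> ((br z ^^ n) y) / fact n) sums \<xi> w)"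
  show "w = fst (d.e (z, 0) (y, 0))"
  proof (rule g.forms_eqI)
    show "\<xi> w = \<xi> (fst (d.e (z, 0) (y, 0)))" if "\<xi> \<in> g.forms" for \<xi>
      by (rule sums_unique2 [OF w [THEN conjunct2, THEN bspec, OF that] sums [OF that]])
  qed
qed

lemma Ls_pair: "z \<in> l \<Longrightarrow> (z, 0) \<in> Ls"
  by (simp add: Ls_def)

lemma exp_br_l:
  assumes z: "z \<in> l" and y: "y \<in> l"
  shows "exp_op s UNIV (br z) y \<in> l" "d.e (z, 0) (y, 0) = (exp_op s UNIV (br z) y, 0)"
  using d.fs_L(1) [OF entire_series(1) Ls_pair [OF z] Ls_pair [OF y]]
  by (auto simp: exp_br [OF z] Ls_def)

lemma Ad_L_l: "g \<in> Ad_L s br l \<Longrightarrow> y \<in> l \<Longrightarrow> g y \<in> l"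
  by (induction arbitrary: y rule: Ad_L.induct) (simp_all add: exp_br_l(1))

text \<open>The coadjoint action is a transpose, and under the invariant pairing the transpose of
  e^(ad z) is e^(-ad z).\<close>

lemma \<sigma>_Ad:
  assumes z: "z \<in> l" and p: "p \<in> W"
  defines "q \<equiv> restr l (\<lambda>y. p (exp_op s UNIV (br z) y))"
  shows "q \<in> W" "\<sigma> q = d.em (z, 0) (\<sigma> p)"
proof -
  have form: "(\<lambda>y. s_map l m p (fst (d.e (z, 0) (y, 0)))) \<in> g.forms"
    by (rule form_left [OF d.form_comp [OF form_fst [OF annih_form [OF s_map_annih [OF p]]] d.lin_fs]])
  have q: "q = restr l (\<lambda>y. s_map l m p (fst (d.e (z, 0) (y, 0))))"
    unfolding q_def exp_br [OF z] using exp_br_l(1) [OF z] by (simp add: restr_def fun_eq_iff s_map_def exp_br [OF z])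
  show qW: "q \<in> W"
    unfolding q by (rule restr_l [OF form])
  have em: "d.em (z, 0) (\<sigma> p) \<in> Ps"
    by (rule d.fs_L(3) [OF entire_series(2) Ls_pair [OF z] \<sigma>_P [OF p]])
  define v where "v = d.em (z, 0) (\<sigma> p)"
  have v: "fst v = 0" "j (snd v) \<in> annih s m"
    using em by (auto simp: Ps_def v_def)
  have "j (snd v) y = q y" if y: "y \<in> l" for y
  proof -
    have "j (snd v) y = kap v (y, 0)"
      by (simp add: kap_def j_zero)
    also have "\<dots> = kap (\<sigma> p) (d.e (z, 0) (y, 0))"
      unfolding v_def by (rule d.\<kappa>_e(2))
    also have "\<dots> = s_map l m p (exp_op s UNIV (br z) y)"
      unfolding exp_br_l(2) [OF z y] by (simp add: kap_def \<sigma>_def j_zero j_jinv [OF annih_form [OF s_map_annih [OF p]]])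
    also have "\<dots> = q y"
      using y exp_br_l(1) [OF z y] by (simp add: q_def restr_def s_map_def)
    finally show ?thesis .
  qed
  then have "restr l (j (snd v)) = q"
    using qW by (auto simp: restr_def fun_eq_iff dual_def)
  then have "\<sigma> q = v"
    using \<sigma>_restr [OF em] by (simp add: v_def)
  then show "\<sigma> q = d.em (z, 0) (\<sigma> p)"
    by (simp add: v_def)
qed

lemma e_D0: "z \<in> l \<Longrightarrow> x \<in> D0 \<Longrightarrow> d.e (z, 0) x \<in> D0"
proof -
  assume z: "z \<in> l" and x: "x \<in> D0"
  have "d.e (z, 0) (fst x, 0) \<in> Ls" "d.e (z, 0) (0, snd x) \<in> Ps"
    using d.fs_L(1,3) [OF entire_series(1) Ls_pair [OF z]] D0_split [OF x] by simp_all
  then have "d.e (z, 0) (fst x, 0) + d.e (z, 0) (0, snd x) \<in> D0"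
    by (auto simp: Ls_def Ps_def D0_def)
  then show ?thesis
    unfolding d.fs_add' [symmetric] pair_split [symmetric] .
qed

text \<open>Series in ad z with z in L preserve the four summands, hence g = L + M and its dual P +
  Q.\<close>

lemma fst_zero_iff_fs_L:
  assumes z: "z \<in> l" and f: "entire f"
  shows "snd x = 0 \<Longrightarrow> snd (d.fs f (z, 0) x) = 0" "fst x = 0 \<Longrightarrow> fst (d.fs f (z, 0) x) = 0"
proof -
  note fs = d.fs_L [OF f Ls_pair [OF z]]
  show "snd (d.fs f (z, 0) x) = 0" if "snd x = 0"
  proof -
    have x: "x = (pr (fst x), 0) + (fst x - pr (fst x), 0)"
      by (rule prod_eqI) (simp_all add: that)
    have "d.fs f (z, 0) (pr (fst x), 0) \<in> Ls" "d.fs f (z, 0) (fst x - pr (fst x), 0) \<in> Ms"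
      by (rule fs(1), simp add: Ls_def) (rule fs(2), simp add: Ms_def)
    then show ?thesis
      by (subst x) (auto simp: d.fs_add' Ls_def Ms_def simp del: add_Pair)
  qed
  show "fst (d.fs f (z, 0) x) = 0" if "fst x = 0"
  proof -
    let ?a = "jinv (s_map l m (restr l (j (snd x))))" and ?b = "jinv (j (snd x) - s_map l m (restr l (j (snd x))))"
    have x: "x = (0, ?a) + (0, ?b)"
      by (rule prod_eqI) (simp_all add: that jinv_add [symmetric] jinv_j)
    have "d.fs f (z, 0) (0, ?a) \<in> Ps" "d.fs f (z, 0) (0, ?b) \<in> Qs"
      by (rule fs(3), simp add: Ps_def jinv_annih s_map_annih restr_l) (rule fs(4), simp add: Qs_def jinv_annih diff_s_map_annih)
    then show ?thesis
      by (subst x) (auto simp: d.fs_add' Ps_def Qs_def simp del: add_Pair)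
  qed
qed

text \<open>The operators at the new point are conjugate to those at p by e^(ad z), which preserves
  \<open>D0\<close> for the first condition and both g and its dual for the second.\<close>

lemma U_Ad_step:
  assumes z: "z \<in> l" and p: "p \<in> U"
  shows "restr l (\<lambda>y. p (exp_op s UNIV (br z) y)) \<in> U"
proof -
  let ?q = "restr l (\<lambda>y. p (exp_op s UNIV (br z) y))"
  let ?z = "(z, 0 :: 'g)"
  note q = \<sigma>_Ad [OF z U_W [OF p]]
  have "C1 ?q"
    unfolding C1_def q(2)
  proof (intro ballI impI)
    fix x assume x: "x \<in> D0" "d.fs sS (d.em ?z (\<sigma> p)) x = 0"
    have "d.em ?z (d.fs sS (\<sigma> p) (d.e ?z x)) = 0"
      using x(2) d.fs_conj [OF entire_series(6), of ?z "\<sigma> p" "d.e ?z x"] by simp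
    then have "d.e ?z (d.em ?z (d.fs sS (\<sigma> p) (d.e ?z x))) = d.e ?z 0"
      by simp
    then have "d.fs sS (\<sigma> p) (d.e ?z x) = 0"
      unfolding d.e_em d.fs_zero .
    then have "d.e ?z x = 0"
      using U_C1 [OF p] e_D0 [OF z x(1)] by (simp add: C1_def)
    then have "d.em ?z (d.e ?z x) = d.em ?z 0"
      by simp
    then show "x = 0"
      unfolding d.em_e d.fs_zero .
  qed
  moreover have "x = 0" if x: "A2 ?q x = 0" for x
  proof -
    define v where "v = d.e ?z (x, 0)"
    have v: "v = (fst v, 0)"
      using fst_zero_iff_fs_L(1) [OF z entire_series(1), of "(x, 0)"] by (intro prod_eqI) (simp_all add: v_def)
    have "fst (d.em ?z (d.em (\<sigma> p) v)) = 0"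
      using x d.fs_conj [OF entire_series(2), of ?z "\<sigma> p" v] by (simp add: A2_def q(2) v_def)
    then have "fst (d.e ?z (d.em ?z (d.em (\<sigma> p) v))) = 0"
      by (rule fst_zero_iff_fs_L(2) [OF z entire_series(1)])
    then have "fst (d.em (\<sigma> p) v) = 0"
      unfolding d.e_em .
    then have "A2 p (fst v) = 0"
      unfolding A2_def v [symmetric] .
    then have "fst v = 0"
      by (rule U_A2 [OF p])
    then have "v = 0"
      using v by (simp add: zero_prod_def)
    then have "d.em ?z v = d.em ?z 0"
      by simp
    then have "(x, 0) = (0 :: 'g \<times> 'g)"
      unfolding v_def d.em_e d.fs_zero .
    then show "x = 0"
      by (simp add: zero_prod_def)
  qed
  ultimately show ?thesis
    unfolding U_iff A0_injective_iff [OF q(1)] using q(1) by simp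
qed

lemma Ad_star_invariant_U: "Ad_star_invariant s br l U"
proof -
  have "\<forall>p\<in>U. restr l (\<lambda>y. p (g y)) \<in> U" if "g \<in> Ad_L s br l" for g
    using that
  proof (induction rule: Ad_L.induct)
    case Ad_L_id
    have "restr l p = p" if "p \<in> W" for p
      using that by (auto simp: restr_def dual_def)
    then show ?case
      using U_W by simp
  next
    case (Ad_L_step g z)
    show ?case
    proof
      fix p assume p: "p \<in> U"
      \<comment> \<open>Transposition reverses composition: the exponential moves p first, and the
        hypothesis for g is applied to the resulting point of U.\<close>
      have "restr l (\<lambda>y. p ((exp_op s UNIV (br z) \<circ> g) y)) = restr l (\<lambda>y. restr l (\<lambda>y. p (exp_op s UNIV (br z) y)) (g y))"
        using Ad_L_l [OF Ad_L_step.hyps(1)] by (simp add: restr_def fun_eq_iff)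
      also have "\<dots> \<in> U"
        by (rule Ad_L_step.IH [THEN bspec, OF U_Ad_step [OF Ad_L_step.hyps(2) p]])
      finally show "restr l (\<lambda>y. p ((exp_op s UNIV (br z) \<circ> g) y)) \<in> U" .
    qed
  qed
  then show ?thesis
    by (simp add: Ad_star_invariant_def)
qed

text \<open>\<open>r\<close> and \<open>\<tau>\<close> are the two parts of the l-matrix as maps of
  g x g. Their first argument is \<open>\<sigma> p\<close>, from which p is recovered by
  \<open>restr_\<sigma>\<close>.\<close>

definition r :: "'g \<times> 'g \<Rightarrow> 'g \<times> 'g \<Rightarrow> 'g \<times> 'g" where
  "r q \<beta> = (r_AM s br \<phi> l m (restr l (j (snd q))) (restr l (j (snd \<beta>))), 0)"

definition \<tau> :: "'g \<times> 'g \<Rightarrow> 'g \<times> 'g \<Rightarrow> 'g \<times> 'g" where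
  "\<tau> q \<eta> = (- inv_into UNIV (\<lambda>x. pAd' (restr l (j (snd q))) (x, 0)) (pAd' (restr l (j (snd q))) (0, j (snd \<eta>))), 0)"

text \<open>\<open>hol_calc_F_AM\<close> with u = x, v = S x and w = G x, transported to the double
  of l; by parity v has only a form component and w only a component in l.\<close>

lemma r_sS:
  assumes p: "p \<in> U" and x: "x \<in> Ps"
  shows "r (\<sigma> p) (d.fs sS (\<sigma> p) x) = d.fs sG (\<sigma> p) x"
proof -
  let ?S = "d.fs sS (\<sigma> p) x" and ?G = "d.fs sG (\<sigma> p) x"
  note pW = U_W [OF p]
  have S: "?S \<in> Ps" and G: "?G \<in> Ls"
    using d.sS_P [OF \<sigma>_P [OF pW] x] d.sG_P [OF \<sigma>_P [OF pW] x] by simp_all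
  have xD: "x \<in> D0"
    using x g.subspace_0 [OF l_subspace] by (auto simp: Ps_def D0_def)
  have Rl_S: "Rl ?S = (0, restr l (j (snd ?S)))"
    using S g.lin_zero [OF lin_pr] by (auto simp: Rl_def Ps_def)
  have Rl_G: "Rl ?G = (fst ?G, 0)"
    using G by (auto simp: Rl_def Ls_def j_zero restr_def fun_eq_iff)
  obtain B where B: "Modules.module.subspace (dscale s) Vl" "finite B" "Vl \<subseteq> Modules.module.span (dscale s) B"
    "lin_on (dscale s) (dscale s) Vl (Al p)" "Al p ` Vl \<subseteq> Vl"
    by (rule Al_context [OF pW])
  have sums: "(\<lambda>n. fps_nth (rfps f) n * \<Xi> ((Al p ^^ n) (Rl x))) sums \<Xi> (Rl (d.fs f (\<sigma> p) x))"
    if "entire f" "\<Xi> \<in> dual (dscale s) Vl" for f \<Xi>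
    using l_sums [OF pW Rl_mem that(2,1), of x] unfolding Tl_Rl [OF xD] .
  have "hol_calc (dscale s) Vl F_AM (Al p) (Rl ?S) = Rl ?G"
    by (rule hol_calc_F_AM [OF vs_dscale B _ Rl_mem Rl_mem Rl_mem sums [OF entire_series(6)] sums [OF entire_series(7)]])
      (simp_all add: Sp_iff_C1 [OF pW] U_C1 [OF p])
  then have "r_AM s br \<phi> l m p (restr l (j (snd ?S))) = fst ?G"
    unfolding r_AM_def Rl_S Rl_G by simp
  then show ?thesis
    using G unfolding r_def restr_\<sigma> [OF pW] by (auto simp: Ls_def)
qed

lemma regR: "p \<in> U \<Longrightarrow> d.regR r (\<sigma> p)"
  unfolding d.regR_def using C1_solve [OF U_W U_C1] r_sS by simp

lemma A2_bij:
  assumes p: "p \<in> U"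
  shows "A2 p (inv_into UNIV (\<lambda>x. pAd' p (x, 0)) y) = y"
proof -
  have "\<exists>x. A2 p x = y"
    by (rule g.lin_inj_imp_surj [OF lin_A2 U_A2 [OF p]])
  then have "y \<in> range (A2 p)"
    by auto
  then show ?thesis
    unfolding pAd_A2 [OF U_W [OF p]] by (rule f_inv_into_f)
qed

lemma A2_\<tau>:
  assumes p: "p \<in> U"
  shows "A2 p (fst (\<tau> (\<sigma> p) \<eta>)) = - fst (d.em (\<sigma> p) (0, snd \<eta>))"
  unfolding \<tau>_def restr_\<sigma> [OF U_W [OF p]] fst_conv g.lin_neg [OF lin_A2] A2_bij [OF p]
    pAd_eq [OF U_W [OF p] j_form] jinv_j ..

lemma \<tau>_pair: "\<tau> q \<eta> = (fst (\<tau> q \<eta>), 0)" and r_pair: "r q \<beta> = (fst (r q \<beta>), 0)"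
  by (simp_all add: \<tau>_def r_def)

lemma fst_em_\<tau>: "p \<in> U \<Longrightarrow> \<eta> \<in> Qs \<Longrightarrow> fst (d.em (\<sigma> p) (\<eta> + \<tau> (\<sigma> p) \<eta>)) = 0"
proof -
  assume p: "p \<in> U" and \<eta>: "\<eta> \<in> Qs"
  have e: "\<eta> = (0, snd \<eta>)"
    using \<eta> by (auto simp: Qs_def)
  have "fst (d.em (\<sigma> p) (0, snd \<eta>)) + A2 p (fst (\<tau> (\<sigma> p) \<eta>)) = 0"
    unfolding A2_\<tau> [OF p] by simp
  then show ?thesis
    unfolding d.fs_add' fst_add A2_def \<tau>_pair [symmetric] e [symmetric] .
qed

text \<open>Vanishing of the g-component of e^-a (\<eta> + \<tau> \<eta>) is the definition of
  \<tau>. Since e^-a preserves both L + P and M + Q, the parts of \<tau> \<eta> in l and in m can be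
  separated.\<close>

lemma regT:
  assumes p: "p \<in> U"
  shows "d.regT \<tau> (\<sigma> p)"
  unfolding d.regT_def
proof (intro conjI ballI impI)
  note pW = U_W [OF p]
  fix \<eta> assume \<eta>: "\<eta> \<in> Qs"
  define x where "x = fst (\<tau> (\<sigma> p) \<eta>)"
  have \<tau>: "\<tau> (\<sigma> p) \<eta> = (x, 0)"
    unfolding x_def by (rule \<tau>_pair)
  \<comment> \<open>The two images have g-components in m and in l with sum zero, so both vanish;
    injectivity of \<open>A2\<close> then kills the l part of x.\<close>
  have 1: "(x - pr x, snd \<eta>) \<in> D1" and 0: "(pr x, 0) \<in> D0"
    using \<eta> by (auto simp: D1_def D0_def Qs_def j_zero annih_def zero_form)
  have e0: "d.em (\<sigma> p) (pr x, 0) \<in> D0" and e1: "d.em (\<sigma> p) (x - pr x, snd \<eta>) \<in> D1"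
    by (rule fs_D0 [OF entire_series(2) pW 0] fs_D1 [OF entire_series(2) pW 1])+
  have "(x - pr x, snd \<eta>) + (pr x, 0) = \<eta> + \<tau> (\<sigma> p) \<eta>"
    using \<eta> by (auto simp: \<tau> Qs_def)
  then have sum: "fst (d.em (\<sigma> p) (x - pr x, snd \<eta>)) + fst (d.em (\<sigma> p) (pr x, 0)) = 0"
    unfolding fst_add [symmetric] d.fs_add' [symmetric] using fst_em_\<tau> [OF p \<eta>] by simp
  then have "fst (d.em (\<sigma> p) (pr x, 0)) = - fst (d.em (\<sigma> p) (x - pr x, snd \<eta>))"
    by (simp add: eq_neg_iff_add_eq_0 add.commute)
  moreover have "- fst (d.em (\<sigma> p) (x - pr x, snd \<eta>)) \<in> m"
    using e1 by (intro g.subspace_neg [OF m_subspace]) (simp add: D1_def mem_Times_iff)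
  ultimately have "fst (d.em (\<sigma> p) (pr x, 0)) \<in> l \<inter> m"
    using e0 by (simp add: D0_def mem_Times_iff)
  then have "A2 p (pr x) = 0"
    unfolding lm_disjoint A2_def by simp
  then have x0: "pr x = 0"
    by (rule U_A2 [OF p])
  then have "x \<in> m"
    using pr_m [of x] by simp
  then show "\<tau> (\<sigma> p) \<eta> \<in> Ms"
    by (simp add: \<tau> Ms_def)
  have "\<eta> + \<tau> (\<sigma> p) \<eta> = (x - pr x, snd \<eta>)"
    using \<eta> by (auto simp: \<tau> Qs_def x0)
  then have "d.em (\<sigma> p) (\<eta> + \<tau> (\<sigma> p) \<eta>) \<in> D1"
    using e1 by simp
  then show "d.em (\<sigma> p) (\<eta> + \<tau> (\<sigma> p) \<eta>) \<in> Qs"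
    using fst_em_\<tau> [OF p \<eta>] by (simp add: D1_def Qs_def mem_Times_iff)
next
  fix x assume x: "x \<in> Ms" "d.em (\<sigma> p) x \<in> Qs"
  then have "x = (fst x, 0)"
    by (auto simp: Ms_def)
  moreover from this have "A2 p (fst x) = 0"
    using x(2) unfolding A2_def by (auto simp: Qs_def)
  then have "fst x = 0"
    by (rule U_A2 [OF p])
  ultimately show "x = 0"
    by (simp add: zero_prod_def)
qed

text \<open>Preimages under the linear operator sinh a/a can be combined, and on them r is the
  linear operator G.\<close>

lemma r_linear:
  assumes p: "p \<in> U" and \<beta>: "\<beta> \<in> Ps" "\<beta>' \<in> Ps"
  shows "r (\<sigma> p) (\<beta> + sd c \<beta>') = r (\<sigma> p) \<beta> + sd c (r (\<sigma> p) \<beta>')"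
proof -
  obtain b b' where b: "b \<in> Ps" "d.fs sS (\<sigma> p) b = \<beta>" "b' \<in> Ps" "d.fs sS (\<sigma> p) b' = \<beta>'"
    using C1_solve [OF U_W [OF p] U_C1 [OF p] \<beta>(1)] C1_solve [OF U_W [OF p] U_C1 [OF p] \<beta>(2)] by (elim bexE)
  have "d.fs sS (\<sigma> p) (b + sd c b') = \<beta> + sd c \<beta>'"
    by (simp add: d.fs_add' d.fs_scale b)
  then have "r (\<sigma> p) (\<beta> + sd c \<beta>') = d.fs sG (\<sigma> p) (b + sd c b')"
    using r_sS [OF p d.P_line [OF b(1,3)], of c] by simp
  also have "\<dots> = r (\<sigma> p) \<beta> + sd c (r (\<sigma> p) \<beta>')"
    using r_sS [OF p b(1)] r_sS [OF p b(3)] by (simp add: d.fs_add' d.fs_scale b)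
  finally show ?thesis .
qed

lemma \<tau>_linear:
  assumes p: "p \<in> U"
  shows "\<tau> (\<sigma> p) (\<eta> + sd c \<eta>') = \<tau> (\<sigma> p) \<eta> + sd c (\<tau> (\<sigma> p) \<eta>')"
proof -
  let ?t = "\<lambda>\<eta>. fst (\<tau> (\<sigma> p) \<eta>)"
  have "(0, snd (\<eta> + sd c \<eta>')) = (0, snd \<eta>) + sd c (0, snd \<eta>')"
    by (simp add: sd_def)
  then have "A2 p (?t (\<eta> + sd c \<eta>')) = A2 p (?t \<eta>) + s c (A2 p (?t \<eta>'))"
    unfolding A2_\<tau> [OF p] by (simp only: d.fs_add' d.fs_scale) (simp add: sd_def g.scale_minus_right)
  then have "A2 p (?t (\<eta> + sd c \<eta>') - (?t \<eta> + s c (?t \<eta>'))) = 0"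
    by (simp add: g.lin_diff [OF lin_A2] g.lin_add [OF lin_A2] g.lin_scale [OF lin_A2])
  then have "?t (\<eta> + sd c \<eta>') - (?t \<eta> + s c (?t \<eta>')) = 0"
    by (rule U_A2 [OF p])
  then show ?thesis
    by (intro prod_eqI) (simp_all add: sd_def \<tau>_def)
qed

section \<open>The l-matrix as the sum of its parts on P and on Q\<close>

definition Pc :: "('g \<Rightarrow> 'k) \<Rightarrow> 'g \<times> 'g" where "Pc \<xi> = \<sigma> (restr l \<xi>)"
definition Qc :: "('g \<Rightarrow> 'k) \<Rightarrow> 'g \<times> 'g" where "Qc \<xi> = (0, jinv (\<xi> - s_map l m (restr l \<xi>)))"

lemma Pc_P: "\<xi> \<in> g.forms \<Longrightarrow> Pc \<xi> \<in> Ps" and Qc_Q: "\<xi> \<in> g.forms \<Longrightarrow> Qc \<xi> \<in> Qs"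
  by (simp_all add: Pc_def \<sigma>_P restr_l Qc_def Qs_def jinv_annih diff_s_map_annih)

lemma Pc_Qc: "Pc \<xi> + Qc \<xi> = (0, jinv \<xi>)"
  by (simp add: Pc_def Qc_def \<sigma>_def jinv_add [symmetric])

lemma lc_eq:
  assumes p: "p \<in> U" and \<xi>: "\<xi> \<in> g.forms"
  shows "lc p \<xi> = fst (r (\<sigma> p) (Pc \<xi>)) + fst (\<tau> (\<sigma> p) (Qc \<xi>))"
  unfolding l_can_def Let_def r_def \<tau>_def fst_conv restr_\<sigma> [OF U_W [OF p]] Pc_def restr_\<sigma> [OF restr_l [OF \<xi>]]
  by (simp add: Qc_def j_jinv [OF annih_form [OF diff_s_map_annih [OF \<xi>]]])

lemma lc_pair:
  assumes "p \<in> U" "\<xi> \<in> g.forms"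
  shows "(lc p \<xi>, 0) = r (\<sigma> p) (Pc \<xi>) + \<tau> (\<sigma> p) (Qc \<xi>)"
  unfolding lc_eq [OF assms] by (rule prod_eqI) (simp_all add: r_def \<tau>_def)

text \<open>Q is invisible on l, so the restriction to l determines the P part, and the Q part is
  the difference.\<close>

lemma PQ_unique:
  assumes "\<beta> \<in> Ps" "\<eta> \<in> Qs" "\<beta> + \<eta> = (0, jinv \<xi>)" and \<xi>: "\<xi> \<in> g.forms"
  shows "Pc \<xi> = \<beta>" "Qc \<xi> = \<eta>"
proof -
  have "j (snd \<beta> + snd \<eta>) = \<xi>"
    using assms(3) j_jinv [OF \<xi>] by (auto simp: prod_eq_iff)
  then have *: "j (snd \<beta>) x + j (snd \<eta>) x = \<xi> x" for x
    unfolding j_add by auto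
  have "restr l \<xi> = restr l (j (snd \<beta>))"
  proof (rule ext)
    have \<eta>: "j (snd \<eta>) x = 0" if "x \<in> l" for x
      using assms(2) that annih_zero by (auto simp: Qs_def)
    show "restr l \<xi> x = restr l (j (snd \<beta>)) x" for x
      using * [of x] \<eta> [of x] by (cases "x \<in> l") (simp_all add: restr_def)
  qed
  then show "Pc \<xi> = \<beta>"
    unfolding Pc_def using \<sigma>_restr [OF assms(1)] by simp
  then have "\<beta> + Qc \<xi> = \<beta> + \<eta>"
    using Pc_Qc [of \<xi>] assms(3) by simp
  then show "Qc \<xi> = \<eta>"
    by simp
qed

lemma PQ_linear:
  assumes "\<xi> \<in> g.forms" "\<eta> \<in> g.forms"
  shows "Pc (\<xi> + fscale c \<eta>) = Pc \<xi> + sd c (Pc \<eta>)" "Qc (\<xi> + fscale c \<eta>) = Qc \<xi> + sd c (Qc \<eta>)"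
proof -
  have "(Pc \<xi> + sd c (Pc \<eta>)) + (Qc \<xi> + sd c (Qc \<eta>)) = (Pc \<xi> + Qc \<xi>) + sd c (Pc \<eta> + Qc \<eta>)"
    by (simp add: d.scale_right_distrib)
  also have "\<dots> = (0, jinv (\<xi> + fscale c \<eta>))"
    unfolding Pc_Qc by (simp add: sd_def jinv_add jinv_fscale)
  finally have sum: "(Pc \<xi> + sd c (Pc \<eta>)) + (Qc \<xi> + sd c (Qc \<eta>)) = (0, jinv (\<xi> + fscale c \<eta>))" .
  have P: "Pc \<xi> + sd c (Pc \<eta>) \<in> Ps" and Q: "Qc \<xi> + sd c (Qc \<eta>) \<in> Qs"
    using assms by (simp_all add: d.subspaces Pc_P Qc_Q)
  show "Pc (\<xi> + fscale c \<eta>) = Pc \<xi> + sd c (Pc \<eta>)" "Qc (\<xi> + fscale c \<eta>) = Qc \<xi> + sd c (Qc \<eta>)"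
    by (rule PQ_unique [OF P Q sum], intro dual_closed assms)+
qed

lemma lc_linear:
  assumes p: "p \<in> U" and \<xi>: "\<xi> \<in> g.forms" "\<eta> \<in> g.forms"
  shows "lc p (\<xi> + fscale c \<eta>) = lc p \<xi> + s c (lc p \<eta>)"
proof -
  have "\<xi> + fscale c \<eta> \<in> g.forms"
    using \<xi> by (intro dual_closed)
  from lc_pair [OF p this]
  have "(lc p (\<xi> + fscale c \<eta>), 0) = (lc p \<xi>, 0) + sd c (lc p \<eta>, 0)"
    unfolding lc_pair [OF p \<xi>(1)] lc_pair [OF p \<xi>(2)] PQ_linear [OF \<xi>] r_linear [OF p Pc_P [OF \<xi>(1)] Pc_P [OF \<xi>(2)]]
      \<tau>_linear [OF p] by (simp add: d.scale_right_distrib)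
  then show ?thesis
    by (simp add: sd_def)
qed

lemma kap_lc:
  assumes p: "p \<in> U" and \<xi>: "\<xi> \<in> g.forms" "\<eta> \<in> g.forms"
  shows "\<eta> (lc p \<xi>) = kap (r (\<sigma> p) (Pc \<xi>)) (Pc \<eta>) + kap (\<tau> (\<sigma> p) (Qc \<xi>)) (Qc \<eta>)"
proof -
  have r: "r (\<sigma> p) (Pc \<xi>) \<in> Ls"
    by (rule d.regR_facts(1) [OF regR [OF p] \<sigma>_P [OF U_W [OF p]] Pc_P [OF \<xi>(1)]])
  have t: "\<tau> (\<sigma> p) (Qc \<xi>) \<in> Ms"
    using regT [OF p] Qc_Q [OF \<xi>(1)] by (simp add: d.regT_def)
  have "\<eta> (lc p \<xi>) = kap (lc p \<xi>, 0) (0, jinv \<eta>)"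
    by (simp add: kap_def j_jinv [OF \<xi>(2)] j_zero)
  also have "\<dots> = kap (r (\<sigma> p) (Pc \<xi>) + \<tau> (\<sigma> p) (Qc \<xi>)) (Pc \<eta> + Qc \<eta>)"
    unfolding lc_pair [OF p \<xi>(1)] Pc_Qc ..
  also have "\<dots> = kap (r (\<sigma> p) (Pc \<xi>)) (Pc \<eta>) + kap (\<tau> (\<sigma> p) (Qc \<xi>)) (Qc \<eta>)"
    by (simp add: d.\<kappa>_add d.orth(3) [OF r Qc_Q [OF \<xi>(2)]] d.orth(6) [OF t Pc_P [OF \<xi>(2)]])
  finally show ?thesis .
qed

lemma lc_skew_maps: "p \<in> U \<Longrightarrow> lc p \<in> skew_maps s UNIV"
proof -
  assume p: "p \<in> U"
  have "lc p (\<xi> + \<eta>) = lc p \<xi> + lc p \<eta>" if "\<xi> \<in> g.forms" "\<eta> \<in> g.forms" for \<xi> \<eta>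
    using lc_linear [OF p that, of 1] by (simp add: fscale_def)
  moreover have "lc p (fscale c \<eta>) = s c (lc p \<eta>)" if "\<eta> \<in> g.forms" for c \<eta>
  proof -
    have z: "(0 :: 'g \<Rightarrow> 'k) \<in> g.forms"
      by (rule dual_closed(3))
    have "fscale 1 0 = (0 :: 'g \<Rightarrow> 'k)"
      by (rule ext) (simp add: fscale_def)
    then have "lc p 0 = 0"
      using lc_linear [OF p z z, of 1] by simp
    then show ?thesis
      using lc_linear [OF p z that, of c] by simp
  qed
  moreover have "\<eta> (lc p \<xi>) = - \<xi> (lc p \<eta>)" if \<xi>: "\<xi> \<in> g.forms" "\<eta> \<in> g.forms" for \<xi> \<eta>
  proof -
    have "kap (r (\<sigma> p) (Pc \<xi>)) (Pc \<eta>) = - kap (r (\<sigma> p) (Pc \<eta>)) (Pc \<xi>)"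
      using d.regR_facts(4) [OF regR [OF p] \<sigma>_P [OF U_W [OF p]] Pc_P [OF \<xi>(1)] Pc_P [OF \<xi>(2)]]
      by (simp add: d.\<kappa>_sym [of "Pc \<xi>"])
    moreover have "kap (\<tau> (\<sigma> p) (Qc \<xi>)) (Qc \<eta>) = - kap (\<tau> (\<sigma> p) (Qc \<eta>)) (Qc \<xi>)"
      using d.\<tau>_skew [OF regT [OF p] Qc_Q [OF \<xi>(1)] Qc_Q [OF \<xi>(2)]]
      by (simp add: d.\<kappa>_sym [of "Qc \<xi>"])
    ultimately show ?thesis
      unfolding kap_lc [OF p \<xi>] kap_lc [OF p \<xi>(2,1)] by simp
  qed
  ultimately show ?thesis
    unfolding skew_maps_def lin_on_def mem_Collect_eq by (intro conjI ballI allI subset_UNIV)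
qed

lemma g_smooth_cong:
  assumes "\<And>p. p \<in> U \<Longrightarrow> f p = h p" "g.smooth_on W U f"
  shows "g.smooth_on W U h"
  unfolding g.smooth_on_def
proof (intro ballI allI)
  fix \<xi> k assume \<xi>: "\<xi> \<in> g.forms"
  show "Ck_on k W U (\<lambda>p. \<xi> (h p))"
    by (rule Ck_on_cong_open [OF W_open_U _ g.smooth_onD [OF assms(2) \<xi>]]) (simp add: assms(1))
qed

text \<open>Smoothness is taken from r = G x with S x = \<beta>, where x depends smoothly on p by
  Cramer's rule; the residues defining r are not differentiated.\<close>

lemma smooth_r:
  assumes \<beta>: "\<beta> \<in> Ps"
  shows "g.smooth_on W U (\<lambda>p. fst (r (\<sigma> p) \<beta>))"
proof -
  define x where "x p = (SOME x. x \<in> Ps \<and> d.fs sS (\<sigma> p) x = \<beta>)" for p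
  have x: "x p \<in> Ps" "d.fs sS (\<sigma> p) (x p) = \<beta>" if "p \<in> U" for p
  proof -
    have "\<exists>x. x \<in> Ps \<and> d.fs sS (\<sigma> p) x = \<beta>"
      using C1_solve [OF U_W [OF that] U_C1 [OF that] \<beta>] by (elim bexE) (intro exI conjI)
    then have "x p \<in> Ps \<and> d.fs sS (\<sigma> p) (x p) = \<beta>"
      unfolding x_def by (rule someI_ex)
    then show "x p \<in> Ps" "d.fs sS (\<sigma> p) (x p) = \<beta>"
      by simp_all
  qed
  have sx: "d.smooth_on W U x"
  \<comment> \<open>The pointwise choice of x is harmless: on U the operator \<open>A0 p\<close> is
    injective, so x is its unique solution.\<close>
  proof (rule d.smooth_inverse [where A = A0 and b = "\<lambda>_. \<beta>", OF W_open_U lin_A0 _ smooth_A0 d.smooth_const])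
    show "v = 0" if "p \<in> U" "A0 p v = 0" for p v
      by (rule U_A0 [OF that])
    show "A0 p (x p) = \<beta>" if "p \<in> U" for p
    proof -
      have "x p \<in> D0"
        using x(1) [OF that] g.subspace_0 [OF l_subspace] by (auto simp: Ps_def D0_def)
      then show ?thesis
        by (simp add: A0_def P0_id x(2) [OF that])
    qed
  qed
  show ?thesis
  proof (rule g_smooth_cong [OF _ smooth_fst [OF smooth_fs [OF entire_series(7) sx]]])
    show "fst (d.fs sG (\<sigma> p) (x p)) = fst (r (\<sigma> p) \<beta>)" if "p \<in> U" for p
      using r_sS [OF that x(1) [OF that]] unfolding x(2) [OF that] by simp
  qed
qed

lemma smooth_\<tau>: "g.smooth_on W U (\<lambda>p. fst (\<tau> (\<sigma> p) \<eta>))"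
proof (rule g.smooth_inverse [where A = A2, OF W_open_U lin_A2 _ smooth_A2])
  show "v = 0" if "p \<in> U" "A2 p v = 0" for p v
    by (rule U_A2 [OF that])
  show "A2 p (fst (\<tau> (\<sigma> p) \<eta>)) = fst (d.em (\<sigma> p) (0, - snd \<eta>))" if "p \<in> U" for p
  proof -
    have "(0 :: 'g, - snd \<eta>) = - (0, snd \<eta>)"
      by simp
    then show ?thesis
      unfolding A2_\<tau> [OF that] by (simp only: d.fs_neg fst_uminus)
  qed
  show "g.smooth_on W U (\<lambda>p. fst (d.em (\<sigma> p) (0, - snd \<eta>)))"
    by (intro smooth_fst smooth_fs entire_series d.smooth_const)
qed

lemma smooth_lc: "smooth_op s l U lc"
  unfolding smooth_op_def
proof (intro ballI allI)
  fix \<xi> \<zeta> k assume \<xi>: "\<xi> \<in> g.forms" "\<zeta> \<in> g.forms"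
  have "g.smooth_on W U (\<lambda>p. fst (r (\<sigma> p) (Pc \<xi>)) + fst (\<tau> (\<sigma> p) (Qc \<xi>)))"
    by (intro g.smooth_add smooth_r smooth_\<tau> Pc_P \<xi>)
  then have "g.smooth_on W U (\<lambda>p. lc p \<xi>)"
    by (rule g_smooth_cong [rotated]) (simp add: lc_eq \<xi>)
  then show "Ck_on k W U (\<lambda>p. \<zeta> (lc p \<xi>))"
    by (rule g.smooth_onD [OF _ \<xi>(2)])
qed

lemma U_line: "p \<in> U \<Longrightarrow> \<alpha> \<in> W \<Longrightarrow> \<forall>\<^sub>F t in nhds 0. p + fscale t \<alpha> \<in> U"
  using W_open_U by (simp add: W_open_def)

lemma reg_line:
  assumes "p \<in> U" "\<delta> \<in> Ps"
  shows "\<forall>\<^sub>F t in nhds 0. d.regR r (\<sigma> p + sd t \<delta>)" "\<forall>\<^sub>F t in nhds 0. d.regT \<tau> (\<sigma> p + sd t \<delta>)"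
proof -
  have \<delta>: "restr l (j (snd \<delta>)) \<in> W"
    by (rule restr_l [OF j_form])
  have eq: "\<sigma> p + sd t \<delta> = \<sigma> (p + fscale t (restr l (j (snd \<delta>))))" for t
    unfolding \<sigma>_line \<sigma>_restr [OF assms(2)] ..
  show "\<forall>\<^sub>F t in nhds 0. d.regR r (\<sigma> p + sd t \<delta>)" "\<forall>\<^sub>F t in nhds 0. d.regT \<tau> (\<sigma> p + sd t \<delta>)"
    unfolding eq by (rule eventually_mono [OF U_line [OF assms(1) \<delta>]], rule regR regT, assumption)+
qed

lemma vder_left: "g.vder F F' \<Longrightarrow> d.vder (\<lambda>t. (F t, 0)) (F', 0)"
  unfolding g.vder_def d.vder_def by (intro ballI) (drule bspec [OF _ form_left])

text \<open>Smoothness provides the derivatives of both parts, and uniqueness of derivatives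
  evaluates the definite description in \<open>d_op\<close> as their sum.\<close>

lemma derivatives:
  assumes p: "p \<in> U" and \<alpha>: "\<alpha> \<in> W" and \<eta>: "\<eta> \<in> g.forms"
  obtains a b where "d.vder (\<lambda>t. r (\<sigma> p + sd t (\<sigma> \<alpha>)) (Pc \<eta>)) (a, 0)"
    "d.vder (\<lambda>t. \<tau> (\<sigma> p + sd t (\<sigma> \<alpha>)) (Qc \<eta>)) (b, 0)" "d_op s lc p \<alpha> \<eta> = a + b"
proof -
  obtain a where a: "g.vder (\<lambda>t. fst (r (\<sigma> (p + fscale t \<alpha>)) (Pc \<eta>))) a"
    using g.smooth_vder [OF smooth_r [OF Pc_P [OF \<eta>]] p \<alpha>] by (elim exE)
  obtain b where b: "g.vder (\<lambda>t. fst (\<tau> (\<sigma> (p + fscale t \<alpha>)) (Qc \<eta>))) b"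
    using g.smooth_vder [OF smooth_\<tau> [of "Qc \<eta>"] p \<alpha>] by (elim exE)
  have ab: "g.vder (\<lambda>t. lc (p + fscale t \<alpha>) \<eta>) (a + b)"
    by (rule g.vder_transform [OF g.vder_add [OF a b]])
      (rule eventually_mono [OF U_line [OF p \<alpha>]], simp add: lc_eq \<eta>)
  have "d_op s lc p \<alpha> \<eta> = a + b"
    unfolding d_op_def g.vder_def [symmetric]
    by (rule the_equality [where P = "g.vder (\<lambda>t. lc (p + fscale t \<alpha>) \<eta>)", OF ab]) (rule g.vder_unique [OF _ ab])
  then show ?thesis
    using that [of a b] vder_left [OF a] vder_left [OF b] unfolding r_pair [symmetric] \<tau>_pair [symmetric] \<sigma>_line by simp
qed

text \<open>The vectors (lc p \<xi>, \<xi>) of the graph are the arguments of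
  \<open>dynamical_equation\<close>. Expanding their triple product by \<open>kap_Bd\<close> yields
  the required terms, up to the skewness of \<omega> and of the bracket.\<close>

lemma dynamical:
  assumes p: "p \<in> U" and \<xi>: "\<xi> \<in> g.forms" and \<eta>: "\<eta> \<in> g.forms" and \<zeta>: "\<zeta> \<in> g.forms"
  shows "(\<zeta> (d_op s lc p (restr l \<xi>) \<eta>) - \<zeta> (br (lc p \<xi>) (lc p \<eta>)) - \<zeta> (\<omega> (lc p \<xi>) \<eta>))
    + (\<xi> (d_op s lc p (restr l \<eta>) \<zeta>) - \<xi> (br (lc p \<eta>) (lc p \<zeta>)) - \<xi> (\<omega> (lc p \<eta>) \<zeta>))
    + (\<eta> (d_op s lc p (restr l \<zeta>) \<xi>) - \<eta> (br (lc p \<zeta>) (lc p \<xi>)) - \<eta> (\<omega> (lc p \<zeta>) \<xi>)) = \<phi> \<xi> \<eta> \<zeta>"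
proof -
  let ?q = "\<sigma> p"
  obtain a1 b1 where 1: "d.vder (\<lambda>t. r (?q + sd t (Pc \<xi>)) (Pc \<eta>)) (a1, 0)"
    "d.vder (\<lambda>t. \<tau> (?q + sd t (Pc \<xi>)) (Qc \<eta>)) (b1, 0)" "d_op s lc p (restr l \<xi>) \<eta> = a1 + b1"
    by (rule derivatives [OF p restr_l [OF \<xi>] \<eta>, folded Pc_def])
  obtain a2 b2 where 2: "d.vder (\<lambda>t. r (?q + sd t (Pc \<eta>)) (Pc \<zeta>)) (a2, 0)"
    "d.vder (\<lambda>t. \<tau> (?q + sd t (Pc \<eta>)) (Qc \<zeta>)) (b2, 0)" "d_op s lc p (restr l \<eta>) \<zeta> = a2 + b2"
    by (rule derivatives [OF p restr_l [OF \<eta>] \<zeta>, folded Pc_def])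
  obtain a3 b3 where 3: "d.vder (\<lambda>t. r (?q + sd t (Pc \<zeta>)) (Pc \<xi>)) (a3, 0)"
    "d.vder (\<lambda>t. \<tau> (?q + sd t (Pc \<zeta>)) (Qc \<xi>)) (b3, 0)" "d_op s lc p (restr l \<zeta>) \<xi> = a3 + b3"
    by (rule derivatives [OF p restr_l [OF \<zeta>] \<xi>, folded Pc_def])
  have u: "(Pc \<theta> + r ?q (Pc \<theta>)) + (Qc \<theta> + \<tau> ?q (Qc \<theta>)) = (lc p \<theta>, jinv \<theta>)" if "\<theta> \<in> g.forms" for \<theta>
  proof -
    have "(Pc \<theta> + r ?q (Pc \<theta>)) + (Qc \<theta> + \<tau> ?q (Qc \<theta>)) = (Pc \<theta> + Qc \<theta>) + (r ?q (Pc \<theta>) + \<tau> ?q (Qc \<theta>))"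
      by (simp add: algebra_simps)
    then show ?thesis
      unfolding Pc_Qc lc_pair [OF p that, symmetric] by simp
  qed
  have k: "kap ((a, 0) + (b, 0)) (Pc \<theta> + Qc \<theta>) = \<theta> (a + b)" if "\<theta> \<in> g.forms" for \<theta> a b
    unfolding Pc_Qc by (simp add: kap_def j_zero j_jinv [OF that])
  have "\<zeta> (a1 + b1) + \<xi> (a2 + b2) + \<eta> (a3 + b3)
      = kap (Bd (lc p \<xi>, jinv \<xi>) (lc p \<eta>, jinv \<eta>)) (lc p \<zeta>, jinv \<zeta>)"
    using d.dynamical_equation [OF \<sigma>_P [OF U_W [OF p]] Pc_P [OF \<xi>] Pc_P [OF \<eta>] Pc_P [OF \<zeta>] Qc_Q [OF \<xi>] Qc_Q [OF \<eta>] Qc_Q [OF \<zeta>]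
      reg_line [OF p] 1(1) 2(1) 3(1) 1(2) 2(2) 3(2)]
    unfolding u [OF \<xi>] u [OF \<eta>] u [OF \<zeta>] k [OF \<xi>] k [OF \<eta>] k [OF \<zeta>] .
  also have "\<dots> = \<zeta> (br (lc p \<xi>) (lc p \<eta>)) + \<zeta> (\<omega> (lc p \<xi>) \<eta>) - \<zeta> (\<omega> (lc p \<eta>) \<xi>) + \<phi> \<xi> \<eta> \<zeta>
    - \<eta> (br (lc p \<xi>) (lc p \<zeta>)) + \<xi> (br (lc p \<eta>) (lc p \<zeta>)) + \<eta> (\<omega> (lc p \<zeta>) \<xi>)"
    unfolding kap_Bd j_jinv [OF \<xi>] j_jinv [OF \<eta>] j_jinv [OF \<zeta>] ..
  finally have main: "\<zeta> (a1 + b1) + \<xi> (a2 + b2) + \<eta> (a3 + b3)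
    = \<zeta> (br (lc p \<xi>) (lc p \<eta>)) + \<zeta> (\<omega> (lc p \<xi>) \<eta>) - \<zeta> (\<omega> (lc p \<eta>) \<xi>) + \<phi> \<xi> \<eta> \<zeta>
    - \<eta> (br (lc p \<xi>) (lc p \<zeta>)) + \<xi> (br (lc p \<eta>) (lc p \<zeta>)) + \<eta> (\<omega> (lc p \<zeta>) \<xi>)" .
  have "\<zeta> (\<omega> (lc p \<eta>) \<xi>) = - \<xi> (\<omega> (lc p \<eta>) \<zeta>)"
    by (rule \<omega>_skew [OF \<xi> \<zeta>])
  moreover have "\<eta> (br (lc p \<xi>) (lc p \<zeta>)) = - \<eta> (br (lc p \<zeta>) (lc p \<xi>))"
    by (subst br_anti) (rule g.form_neg [OF \<eta>])
  ultimately have main': "\<zeta> (a1 + b1) + \<xi> (a2 + b2) + \<eta> (a3 + b3)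
    = \<zeta> (br (lc p \<xi>) (lc p \<eta>)) + \<zeta> (\<omega> (lc p \<xi>) \<eta>) + \<xi> (\<omega> (lc p \<eta>) \<zeta>) + \<phi> \<xi> \<eta> \<zeta>
    + \<eta> (br (lc p \<zeta>) (lc p \<xi>)) + \<xi> (br (lc p \<eta>) (lc p \<zeta>)) + \<eta> (\<omega> (lc p \<zeta>) \<xi>)"
    using main by simp
  have arith: "(X - A - D) + (Y - B - E) + (Z - C - F) = f" if "X + Y + Z = A + D + E + f + C + B + F"
    for X Y Z A B C D E F f :: 'k
  proof -
    have "(X - A - D) + (Y - B - E) + (Z - C - F) = (X + Y + Z) - (A + D + E + C + B + F)"
      by (simp add: algebra_simps)
    also have "\<dots> = f"
      unfolding that by (simp add: algebra_simps)
    finally show ?thesis .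
  qed
  show ?thesis
    unfolding 1(3) 2(3) 3(3) by (rule arith [OF main'])
qed

lemma B_Ls:
  assumes z: "z \<in> l"
  shows "fst (Bd (z, 0) (x, y)) = br z x" "Bd (z, 0) (0, y) = (0, jinv (- ad_star UNIV br z (j y)))"
proof -
  have f: "ad_star UNIV br z (j y) \<in> g.forms"
    unfolding dual_UNIV lin_on_UNIV mem_Collect_eq ad_star_def restr_def
    by (simp add: br_add br_scale g.form_add [OF j_form] g.form_scale [OF j_form])
  have nf: "- ad_star UNIV br z (j y) \<in> g.forms"
    using dual_closed(2) [OF f, of "- 1"] by (simp add: fscale_def fun_Compl_def)
  show "fst (Bd (z, 0) (x, y)) = br z x"
  proof (rule g.forms_eqI)
    fix \<xi> assume \<xi>: "\<xi> \<in> g.forms"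
    have "\<xi> (fst (Bd (z, 0) (x, y))) = kap (Bd (z, 0) (x, y)) (0, jinv \<xi>)"
      by (simp add: kap_def j_jinv [OF \<xi>] g.form_zero [OF j_form])
    then show "\<xi> (fst (Bd (z, 0) (x, y))) = \<xi> (br z x)"
      by (simp add: bracket_simps \<omega>_l [OF z] j_jinv [OF \<xi>] \<xi> g.form_zero [OF \<xi>])
  qed
  have "kap (Bd (z, 0) (0, y) - (0, jinv (- ad_star UNIV br z (j y)))) w = 0" for w
  proof -
    have "kap (Bd (z, 0) (0, y)) w = - j y (br z (fst w))"
      by (cases w) (simp add: bracket_simps \<omega>_l [OF z])
    moreover have "kap (0, jinv (- ad_star UNIV br z (j y))) w = - j y (br z (fst w))"
      by (simp add: kap_def j_jinv [OF nf] g.form_zero [OF j_form]) (simp add: ad_star_def restr_def)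
    ultimately show ?thesis
      unfolding d.\<kappa>_diff by simp
  qed
  then have "Bd (z, 0) (0, y) - (0, jinv (- ad_star UNIV br z (j y))) = 0"
    by (rule d.nondegenerate)
  then show "Bd (z, 0) (0, y) = (0, jinv (- ad_star UNIV br z (j y)))"
    by simp
qed

text \<open>The sum of the equivariance of both parts; the term with \<omega> vanishes since z lies
  in l.\<close>

lemma equivariant:
  assumes p: "p \<in> U" and z: "z \<in> l" and \<xi>: "\<xi> \<in> g.forms"
  shows "d_op s lc p (ad_star l br z p) \<xi> + \<omega> z \<xi> + br z (lc p \<xi>) + lc p (ad_star UNIV br z \<xi>) = 0"
proof -
  let ?q = "\<sigma> p" and ?z = "(z, 0 :: 'g)"
  note pW = U_W [OF p]
  have sp: "s_map l m p \<in> g.forms"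
    by (rule annih_form [OF s_map_annih [OF pW]])
  have ad: "ad_star UNIV br z \<theta> \<in> g.forms" if \<theta>: "\<theta> \<in> g.forms" for \<theta>
    unfolding dual_UNIV lin_on_UNIV mem_Collect_eq ad_star_def restr_def
    by (simp add: br_add br_scale g.form_add [OF \<theta>] g.form_scale [OF \<theta>])
  have ad_eq: "ad_star l br z p = restr l (ad_star UNIV br z (s_map l m p))"
    using br_ll [OF z] by (simp add: ad_star_def restr_def fun_eq_iff s_map_def)
  have \<alpha>: "ad_star l br z p \<in> W"
    unfolding ad_eq by (rule restr_l [OF ad [OF sp]])
  have neg: "jinv (- \<theta>) = - jinv \<theta>" for \<theta> :: "'g \<Rightarrow> 'k"
    by (simp add: jinv_def sum_negf)
  have B: "Bd ?z (0, jinv \<theta>) = - (0, jinv (ad_star UNIV br z \<theta>))" if "\<theta> \<in> g.forms" for \<theta>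
    unfolding B_Ls(2) [OF z] j_jinv [OF that] neg by simp
  \<comment> \<open>\<open>ad_star\<close> is the transpose without sign while the bracket of the
    double contains its negative, so the direction of differentiation is -[z, \<sigma> p].\<close>
  have Bq: "- Bd ?z ?q = \<sigma> (ad_star l br z p)"
  proof -
    have "- Bd ?z ?q = (0, jinv (ad_star UNIV br z (s_map l m p)))"
      unfolding \<sigma>_def B [OF sp] by simp
    moreover have "- Bd ?z ?q \<in> Ps"
      by (rule d.subspaces(9) [OF d.LP [OF Ls_pair [OF z] \<sigma>_P [OF pW]]])
    ultimately show ?thesis
      using \<sigma>_restr [of "- Bd ?z ?q"] j_jinv [OF ad [OF sp]] by (simp add: ad_eq)
  qed
  obtain a b where ab: "d.vder (\<lambda>t. r (?q + sd t (- Bd ?z ?q)) (Pc \<xi>)) (a, 0)"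
    "d.vder (\<lambda>t. \<tau> (?q + sd t (- Bd ?z ?q)) (Qc \<xi>)) (b, 0)" "d_op s lc p (ad_star l br z p) \<xi> = a + b"
    by (rule derivatives [OF p \<alpha> \<xi>, folded Bq])
  have P: "- Bd ?z ?q \<in> Ps"
    unfolding Bq by (rule \<sigma>_P [OF \<alpha>])
  have BP: "Bd ?z (Pc \<xi>) \<in> Ps" and BQ: "Bd ?z (Qc \<xi>) \<in> Qs"
    by (rule d.LP [OF Ls_pair [OF z] Pc_P [OF \<xi>]] d.LQ [OF Ls_pair [OF z] Qc_Q [OF \<xi>]])+
  have "(- Bd ?z (Pc \<xi>)) + (- Bd ?z (Qc \<xi>)) = - Bd ?z (Pc \<xi> + Qc \<xi>)"
    by (simp add: d.B_add)
  also have "\<dots> = (0, jinv (ad_star UNIV br z \<xi>))"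
    unfolding Pc_Qc B [OF \<xi>] by simp
  finally have "Pc (ad_star UNIV br z \<xi>) = - Bd ?z (Pc \<xi>)" "Qc (ad_star UNIV br z \<xi>) = - Bd ?z (Qc \<xi>)"
    using PQ_unique [OF d.subspaces(9) [OF BP] d.subspaces(12) [OF BQ] _ ad [OF \<xi>]] by simp_all
  note PQ = this
  have neg1: "- u = 0 + sd (- 1) u" for u
    by (rule prod_eqI) (simp_all add: sd_def)
  have zero: "0 \<in> Ps"
    using d.subspaces(8) [OF BP, of 0] by simp
  have r0: "r ?q 0 = 0" and \<tau>0: "\<tau> ?q 0 = 0"
    using r_linear [OF p zero zero, of 1] \<tau>_linear [OF p, of 0 1 0] by simp_all
  have "r ?q (- Bd ?z (Pc \<xi>)) = - r ?q (Bd ?z (Pc \<xi>))"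
    unfolding neg1 [of "Bd ?z (Pc \<xi>)"] r_linear [OF p zero BP] r0 by (simp add: neg1 [symmetric])
  moreover have "\<tau> ?q (- Bd ?z (Qc \<xi>)) = - \<tau> ?q (Bd ?z (Qc \<xi>))"
    unfolding neg1 [of "Bd ?z (Qc \<xi>)"] \<tau>_linear [OF p] \<tau>0 by (simp add: neg1 [symmetric])
  ultimately have "(lc p (ad_star UNIV br z \<xi>), 0) = - (r ?q (Bd ?z (Pc \<xi>)) + \<tau> ?q (Bd ?z (Qc \<xi>)))"
    unfolding lc_pair [OF p ad [OF \<xi>]] PQ by simp
  also have "\<dots> = - (((a, 0) + Bd ?z (r ?q (Pc \<xi>))) + ((b, 0) + Bd ?z (\<tau> ?q (Qc \<xi>))))"
    using d.equivariance_r [OF Ls_pair [OF z] \<sigma>_P [OF pW] Pc_P [OF \<xi>] reg_line(1) [OF p P] ab(1)]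
      d.equivariance_\<tau> [OF Ls_pair [OF z] \<sigma>_P [OF pW] Qc_Q [OF \<xi>] reg_line(2) [OF p P] ab(2)] by simp
  also have "\<dots> = - ((a + b, 0) + Bd ?z (lc p \<xi>, 0))"
    unfolding lc_pair [OF p \<xi>] d.B_add by (simp add: algebra_simps)
  finally have "fst (lc p (ad_star UNIV br z \<xi>), 0 :: 'g) = fst (- ((a + b, 0) + Bd ?z (lc p \<xi>, 0)))"
    by (rule arg_cong)
  then have "lc p (ad_star UNIV br z \<xi>) = - ((a + b) + br z (lc p \<xi>))"
    by (simp add: B_Ls(1) [OF z])
  then show ?thesis
    unfolding ab(3) \<omega>_l [OF z \<xi>] by simp
qed

lemma dynamical_lc: "dynamical_l_matrix s br \<omega> \<phi> l U lc"
  unfolding dynamical_l_matrix_def Let_def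
  by (intro conjI ballI open_U Ad_star_invariant_U lc_skew_maps smooth_lc dynamical equivariant)

text \<open>A form vanishing on m has no Q part and one vanishing on l has no P part; r takes values
  in L and \<tau> in M.\<close>

lemma lc_compatible:
  assumes p: "p \<in> U"
  shows "\<xi> \<in> annih s m \<Longrightarrow> lc p \<xi> \<in> l" "\<xi> \<in> annih s l \<Longrightarrow> lc p \<xi> \<in> m"
proof -
  have zP: "0 \<in> Ps" and zQ: "0 \<in> Qs"
    by (simp_all add: Ps_def Qs_def zero_prod_def j_zero annih_def zero_form)
  have r0: "r (\<sigma> p) 0 = 0" and \<tau>0: "\<tau> (\<sigma> p) 0 = 0"
    using r_linear [OF p zP zP, of 1] \<tau>_linear [OF p, of 0 1 0] by simp_all
  show "lc p \<xi> \<in> l" if \<xi>: "\<xi> \<in> annih s m"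
  proof -
    have P: "(0, jinv \<xi>) \<in> Ps"
      by (simp add: Ps_def jinv_annih \<xi>)
    have eq: "Pc \<xi> = (0, jinv \<xi>)" "Qc \<xi> = 0"
      by (rule PQ_unique [OF P zQ _ annih_form [OF \<xi>]], simp)+
    have "r (\<sigma> p) (0, jinv \<xi>) \<in> Ls"
      by (rule d.regR_facts(1) [OF regR [OF p] \<sigma>_P [OF U_W [OF p]] P])
    then show ?thesis
      unfolding lc_eq [OF p annih_form [OF \<xi>]] eq \<tau>0 by (auto simp: Ls_def)
  qed
  show "lc p \<xi> \<in> m" if \<xi>: "\<xi> \<in> annih s l"
  proof -
    have Q: "(0, jinv \<xi>) \<in> Qs"
      by (simp add: Qs_def jinv_annih \<xi>)
    have eq: "Pc \<xi> = 0" "Qc \<xi> = (0, jinv \<xi>)"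
      by (rule PQ_unique [OF zP Q _ annih_form [OF \<xi>]], simp)+
    have "\<tau> (\<sigma> p) (0, jinv \<xi>) \<in> Ms"
      using regT [OF p] Q by (simp add: d.regT_def)
    then show ?thesis
      unfolding lc_eq [OF p annih_form [OF \<xi>]] eq r0 by (auto simp: Ms_def)
  qed
qed

text \<open>At p = 0 the series reduce to their constant terms: S and e^-a become the identity, and
  the odd G becomes zero.\<close>

lemma lc_zero:
  assumes \<xi>: "\<xi> \<in> g.forms"
  shows "lc 0 \<xi> = 0"
proof -
  have \<sigma>: "\<sigma> 0 = 0"
    by (simp add: \<sigma>_def s_map_def jinv_def zero_prod_def)
  note U0 = zero_in_U
  have "r (\<sigma> 0) (Pc \<xi>) = 0"
    using r_sS [OF U0 Pc_P [OF \<xi>]]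
    unfolding \<sigma> d.fs_zero_left [OF entire_series(6)] d.fs_zero_left [OF entire_series(7)] by (simp add: sS_def sG_def)
  moreover have "\<tau> (\<sigma> 0) (Qc \<xi>) = 0"
  proof -
    have "fst (d.em (\<sigma> 0) (Qc \<xi> + \<tau> (\<sigma> 0) (Qc \<xi>))) = 0"
      by (rule fst_em_\<tau> [OF U0 Qc_Q [OF \<xi>]])
    then have "fst (\<tau> (\<sigma> 0) (Qc \<xi>)) = 0"
      unfolding \<sigma> d.fs_zero_left [OF entire_series(2)] by (simp add: sEm_def Qc_def)
    then show ?thesis
      by (intro prod_eqI) (simp_all add: \<tau>_def)
  qed
  ultimately show ?thesis
    unfolding lc_eq [OF U0 \<xi>] by simp
qed

end

theorem theorem6p1:
  fixes s :: "'k::rc_field \<Rightarrow> 'g::ab_group_add \<Rightarrow> 'g"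
    and br :: "'g \<Rightarrow> 'g \<Rightarrow> 'g"
    and \<omega> :: "'g \<Rightarrow> ('g \<Rightarrow> 'k) \<Rightarrow> 'g"
    and \<phi> :: "('g \<Rightarrow> 'k) \<Rightarrow> ('g \<Rightarrow> 'k) \<Rightarrow> ('g \<Rightarrow> 'k) \<Rightarrow> 'k"
    and l m :: "'g set"
  assumes "fin_dim s"
    and "lie_quasi_bialgebra s UNIV br \<omega> \<phi>"
    and "reductive_decomposition s br l m"
    and "canonically_compatible s \<omega> \<phi> l m"
  shows "0 \<in> U_can s br \<omega> \<phi> l m
    \<and> dynamical_l_matrix s br \<omega> \<phi> l (U_can s br \<omega> \<phi> l m) (l_can s br \<omega> \<phi> l m)
    \<and> (\<forall>\<xi>\<in>dual s UNIV. l_can s br \<omega> \<phi> l m 0 \<xi> = 0)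
    \<and> (\<forall>p\<in>U_can s br \<omega> \<phi> l m.
          l_can s br \<omega> \<phi> l m p ` annih s m \<subseteq> l \<and> l_can s br \<omega> \<phi> l m p ` annih s l \<subseteq> m)"
proof -
  interpret compatible_quasi_bialgebra s br \<omega> \<phi> l m
    by (rule compatible_quasi_bialgebra.intro) (rule assms)+
  show ?thesis
    by (intro conjI ballI zero_in_U dynamical_lc lc_zero image_subsetI lc_compatible)
qed

end
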